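(* Let $n\ge 2$ and let $\mathcal{PB}_n$ be the partial Brauer monoid of degree $n$. (i) The ideals of $\mathcal{PB}_n$ are exactly the sets $I_q=\{\alpha\in\mathcal{PB}_n:\operatorname{rank}(\alpha)\le q\}$ for $q=0,\dots,n$, yielding the Rees congruences $R_q=R_{I_q}$. (ii) The proper IN-pairs $(I,M)$ of $\mathcal{PB}_n$ with $M\le\overline{\mathcal S}_q$ for some $q$ are exactly the pairs $(I_{q-1},\overline N)$, for $q=2,\dots,n$ and $N$ a non-trivial normal subgroup of $\mathcal S_q$, yielding the congruences $R_N=R_{I_{q-1},\overline N}$. (iii) The retractable IN-pairs $(I,M)$ of $\mathcal{PB}_n$ with $M\le\overline{\mathcal S}_q$ for some $q$ are exactly $\mathscr C_0=(I_0,\{\overline{\mathrm{id}}_1\})$, $\mathscr C_1=(I_1,\{\overline{\mathrm{id}}_2\})$ and $\mathscr C_{\mathcal S_2}=(I_1,\overline{\mathcal S}_2)$, yielding the congruences $\lambda_0,\rho_0,\mu_0$ (from $\mathscr C_0$), $\lambda_1,\rho_1,\mu_1$ (from $\mathscr C_1$) and $\lambda_{\mathcal S_2},\rho_{\mathcal S_2},\mu_{\mathcal S_2}$ (from $\mathscr C_{\mathcal S_2}$). (iv) The congruences $R_q$ ($0\le q\le n$), $R_N$ ($\{\mathrm{id}_q\}\ne N\trianglelefteq\mathcal S_q$, $2\le q\le n$), $\lambda_0,\rho_0,\mu_0,\lambda_1,\rho_1,\mu_1,\lambda_{\mathcal S_2},\rho_{\mathcal S_2},\mu_{\mathcal S_2}$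 are pairwise distinct, and they are all the congruences of $\mathcal{PB}_n$. (v) The $*$-congruences of $\mathcal{PB}_n$ are precisely the congruences listed in (iv) other than $\lambda_0,\lambda_1,\lambda_{\mathcal S_2},\rho_0,\rho_1,\rho_{\mathcal S_2}$. (vi) The order (inclusion) on $\operatorname{Cong}(\mathcal{PB}_n)$ is as follows. The twelve congruences $\xi_i$ with $\xi\in\{\mu,\lambda,\rho,R\}$ and $i\in\{0,1,\mathcal S_2\}$ form the direct product of the four-element diamond $\mu<\lambda,\rho<R$ (with $\lambda,\rho$ incomparable) and the three-element chain $0<1<\mathcal S_2$ (that is, $\xi_i\subseteq\zeta_j$ iff $\xi\le\zeta$ in the diamond and $i\le j$ in the chain), with bottom element $\mu_0=\Delta$ and top element $R_{\mathcal S_2}$. The remaining congruences all contain $R_{\mathcal S_2}$ and form the chain $$R_{\mathcal S_2}\subsetneq R_2\subsetneq R_{\mathcal A_3}\subsetneq R_{\mathcal S_3}\subsetneq R_3\subsetneq R_K\subsetneq R_{\mathcal A_4}\subsetneq R_{\mathcal S_4}\subsetneq R_4\subsetneq R_{\mathcal A_5}\subsetneq R_{\mathcal S_5}\subsetneq R_5\subsetneq\cdots\subsetneq R_{\mathcal S_n}\subsetneq R_n=\nabla$$ (truncated at $R_n$), where $K$ is the Klein 4-group in $\mathcal S_4$. The lattice $\operatorname{Cong}^*(\mathcal{PB}_n)$ of $*$-congruences is the restriction of this order to the congruences in (v): the product of the chain $\mu<R$ with the chain $0<1<\mathcal S_2$, followed by the same chain above $R_{\mathcal S_2}$.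
   Context: **Partial Brauer monoid.** Let $\mathbf n=\{1,\dots,n\}$, $\mathbf n'=\{1',\dots,n'\}$. The partition monoid $\mathcal P_n$ is the set of all set partitions of $\mathbf n\cup\mathbf n'$. To form $\alpha\beta$: rename each lower point $i'$ of $\alpha$ to $i''$ and each upper point $i$ of $\beta$ to $i''$, and consider the graph on $\mathbf n\cup\mathbf n''\cup\mathbf n'$ whose edges join points lying in a common block of (renamed) $\alpha$ or of (renamed) $\beta$; two points of $\mathbf n\cup\mathbf n'$ lie in the same block of $\alpha\beta$ iff they are connected by a path in this graph. $\mathcal{PB}_n$ is the submonoid of all $\alpha\in\mathcal P_n$ all of whose blocks have size at most $2$. A block is a transversal if it meets both $\mathbf n$ and $\mathbf n'$; $\operatorname{rank}(\alpha)$ is the number of transversals of $\alpha$. The involution $\alpha\mapsto\alpha^*$ interchanges $i$ and $i'$ for every $i$; a $*$-congruence is a congruence $\xi$ such that $(\alpha,\beta)\in\xi$ implies $(\alpha^*,\beta^* )\in\xi$. The $\mathscr J$-classes of $\mathcal{PB}_n$ are $J_q=\{\alpha:\operatorname{rank}(\alpha)=q\}$, $0\le q\le n$. $\mathcal S_q$, $\mathcal A_q$ are the symmetric and alternating groups of degree $q$. For $\sigma\in\mathcal S_q$, $\overline\sigma\in J_q$ has transversals $\{i,(i\sigma)'\}$ ($1\le i\le q$) and all other blocks singletons; for $N\subseteq\mathcal S_q$, $\overline N=\{\overline\sigma:\sigma\in N\}$. Then $\overline{\mathcal S}_q$ is a maximal subgroup contained in $J_q$. **General constructions**, for a finite semigroup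 $S$ with minimal ideal $M$. $S^1$ is $S$ with an identity adjoined if necessary; $\mathscr R,\mathscr L,\mathscr H,\mathscr J$ are Green's relations; the $\mathscr J$-classes are ordered by $J_a\le J_b$ iff $a\in S^1bS^1$. $\Delta=\{(a,a):a\in S\}$, $\nabla=S\times S$. Ideals are non-empty. The Rees congruence of an ideal $I$ is $R_I=\Delta\cup(I\times I)$. An ideal $I$ is retractable if there is a homomorphism $f:I\to M$ (a retraction) with $xf=x$ for all $x\in M$; such $f$ is then unique. An IN-pair is a pair $(I,N)$ where $I$ is an ideal and $N$ is a normal subgroup of a maximal subgroup of $S$ contained in some regular $\mathscr J$-class $J$ that is minimal among the $\mathscr J$-classes contained in $S\setminus I$; it is proper if $|N|\ge2$. Put $\nu_N=\{(sxt,syt)\in J\times J: x,y\in N,\ s,t\in S^1\}$ and $R_{I,N}=\Delta\cup\nu_N\cup(I\times I)$. The IN-pair is retractable if $I$ is retractable and $|xN|=|Nx|=1$ for all $x\in M$; then, with $f:I\to M$ the retraction, $\lambda_{I,N}=\Delta\cup\nu_N\cup\{(x,y)\in I\times I:xf\mathrel{\mathscr L}yf\}$, $\rho_{I,N}=\Delta\cup\nu_N\cup\{(x,y)\in I\times I:xf\mathrel{\mathscr R}yf\}$, $\mu_{I,N}=\Delta\cup\nu_N\cup\{(x,y)\in I\times I:xf\mathrel{\mathscr H}yf\}$. **Abbreviations.** $\lambda_0=\lambda_{\mathscr C_0}$, $\lambda_1=\lambda_{\mathscr C_1}$, $\lambda_{\mathcal S_2}=\lambda_{\mathscr C_{\mathcal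 S_2}}$, and similarly for $\rho,\mu$. $R_{\mathcal S_2}$ is the congruence $R_N$ with $N=\mathcal S_2$. *)

theory Defs
  imports "HOL-Algebra.Sym_Groups" "HOL-Library.Disjoint_Sets"
begin

section \<open>Congruences of a finite monoid\<close>

text \<open>
  Only the fields \<^const>\<open>carrier\<close> and \<^const>\<open>mult\<close> of the structure \<open>S\<close> are used. The constructions
  are applied to a structure with an identity element, so \<open>S\<^sup>1\<close> is \<^term>\<open>carrier S\<close>.
\<close>

definition sgp_ideal :: "('a, 'b) monoid_scheme \<Rightarrow> 'a set \<Rightarrow> bool" where
  "sgp_ideal S I \<longleftrightarrow> I \<noteq> {} \<and> I \<subseteq> carrier S \<and>
     (\<forall>x\<in>I. \<forall>s\<in>carrier S. s \<otimes>\<^bsub>S\<^esub> x \<in> I \<and> x \<otimes>\<^bsub>S\<^esub> s \<in> I)"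

text \<open>In a finite semigroup the intersection of all ideals is itself an ideal.\<close>
definition min_ideal :: "('a, 'b) monoid_scheme \<Rightarrow> 'a set" where
  "min_ideal S = \<Inter>{I. sgp_ideal S I}"

definition congruence :: "('a, 'b) monoid_scheme \<Rightarrow> ('a \<times> 'a) set \<Rightarrow> bool" where
  "congruence S \<theta> \<longleftrightarrow> equiv (carrier S) \<theta> \<and>
     (\<forall>(x, y)\<in>\<theta>. \<forall>z\<in>carrier S.
        (z \<otimes>\<^bsub>S\<^esub> x, z \<otimes>\<^bsub>S\<^esub> y) \<in> \<theta> \<and> (x \<otimes>\<^bsub>S\<^esub> z, y \<otimes>\<^bsub>S\<^esub> z) \<in> \<theta>)"

definition Cong :: "('a, 'b) monoid_scheme \<Rightarrow> ('a \<times> 'a) set set" where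
  "Cong S = {\<theta>. congruence S \<theta>}"

definition Delta :: "('a, 'b) monoid_scheme \<Rightarrow> ('a \<times> 'a) set" where
  "Delta S = Id_on (carrier S)"

definition Nabla :: "('a, 'b) monoid_scheme \<Rightarrow> ('a \<times> 'a) set" where
  "Nabla S = carrier S \<times> carrier S"

definition left_principal :: "('a, 'b) monoid_scheme \<Rightarrow> 'a \<Rightarrow> 'a set" where
  "left_principal S x = {s \<otimes>\<^bsub>S\<^esub> x | s. s \<in> carrier S}"

definition right_principal :: "('a, 'b) monoid_scheme \<Rightarrow> 'a \<Rightarrow> 'a set" where
  "right_principal S x = {x \<otimes>\<^bsub>S\<^esub> t | t. t \<in> carrier S}"

definition principal :: "('a, 'b) monoid_scheme \<Rightarrow> 'a \<Rightarrow> 'a set" where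
  "principal S x = {s \<otimes>\<^bsub>S\<^esub> x \<otimes>\<^bsub>S\<^esub> t | s t. s \<in> carrier S \<and> t \<in> carrier S}"

definition GreenL :: "('a, 'b) monoid_scheme \<Rightarrow> ('a \<times> 'a) set" where
  "GreenL S = {(x, y) \<in> carrier S \<times> carrier S. left_principal S x = left_principal S y}"

definition GreenR :: "('a, 'b) monoid_scheme \<Rightarrow> ('a \<times> 'a) set" where
  "GreenR S = {(x, y) \<in> carrier S \<times> carrier S. right_principal S x = right_principal S y}"

definition GreenH :: "('a, 'b) monoid_scheme \<Rightarrow> ('a \<times> 'a) set" where
  "GreenH S = GreenL S \<inter> GreenR S"

definition GreenJ :: "('a, 'b) monoid_scheme \<Rightarrow> ('a \<times> 'a) set" where
  "GreenJ S = {(x, y) \<in> carrier S \<times> carrier S. principal S x = principal S y}"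

definition J_classes :: "('a, 'b) monoid_scheme \<Rightarrow> 'a set set" where
  "J_classes S = carrier S // GreenJ S"

definition J_le :: "('a, 'b) monoid_scheme \<Rightarrow> 'a set \<Rightarrow> 'a set \<Rightarrow> bool" where
  "J_le S A B \<longleftrightarrow> (\<exists>a\<in>A. \<exists>b\<in>B. a \<in> principal S b)"

definition regular_class :: "('a, 'b) monoid_scheme \<Rightarrow> 'a set \<Rightarrow> bool" where
  "regular_class S J \<longleftrightarrow> (\<forall>x\<in>J. \<exists>y\<in>carrier S. x \<otimes>\<^bsub>S\<^esub> y \<otimes>\<^bsub>S\<^esub> x = x)"

definition minimal_J_outside :: "('a, 'b) monoid_scheme \<Rightarrow> 'a set \<Rightarrow> 'a set \<Rightarrow> bool" where
  "minimal_J_outside S I J \<longleftrightarrow> J \<in> J_classes S \<and> J \<subseteq> carrier S - I \<and>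
     (\<forall>J'\<in>J_classes S. J' \<subseteq> carrier S - I \<and> J_le S J' J \<longrightarrow> J' = J)"

text \<open>
  The identity \<open>e\<close> of a subgroup of \<open>S\<close> is in general not that of \<open>S\<close>; it is determined
  by the carrier of the subgroup.
\<close>
definition group_at :: "('a, 'b) monoid_scheme \<Rightarrow> 'a set \<Rightarrow> 'a \<Rightarrow> ('a, 'b) monoid_scheme" where
  "group_at S G e = S\<lparr>carrier := G, one := e\<rparr>"

definition subgroup_of_sgp :: "('a, 'b) monoid_scheme \<Rightarrow> 'a set \<Rightarrow> bool" where
  "subgroup_of_sgp S G \<longleftrightarrow> G \<subseteq> carrier S \<and> (\<exists>e. group (group_at S G e))"

definition maximal_subgroup :: "('a, 'b) monoid_scheme \<Rightarrow> 'a set \<Rightarrow> bool" where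
  "maximal_subgroup S G \<longleftrightarrow> subgroup_of_sgp S G \<and>
     (\<forall>H. subgroup_of_sgp S H \<and> G \<subseteq> H \<longrightarrow> H = G)"

definition IN_pair :: "('a, 'b) monoid_scheme \<Rightarrow> 'a set \<Rightarrow> 'a set \<Rightarrow> bool" where
  "IN_pair S I N \<longleftrightarrow> sgp_ideal S I \<and>
     (\<exists>J G e. minimal_J_outside S I J \<and> regular_class S J \<and>
        maximal_subgroup S G \<and> G \<subseteq> J \<and> N \<lhd> group_at S G e)"

definition proper_IN_pair :: "('a, 'b) monoid_scheme \<Rightarrow> 'a set \<Rightarrow> 'a set \<Rightarrow> bool" where
  "proper_IN_pair S I N \<longleftrightarrow> IN_pair S I N \<and> card N \<ge> 2"

definition is_retraction :: "('a, 'b) monoid_scheme \<Rightarrow> 'a set \<Rightarrow> ('a \<Rightarrow> 'a) \<Rightarrow> bool" where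
  "is_retraction S I f \<longleftrightarrow> f \<in> hom (S\<lparr>carrier := I\<rparr>) (S\<lparr>carrier := min_ideal S\<rparr>) \<and>
     (\<forall>x\<in>min_ideal S. f x = x)"

definition retractable_ideal :: "('a, 'b) monoid_scheme \<Rightarrow> 'a set \<Rightarrow> bool" where
  "retractable_ideal S I \<longleftrightarrow> sgp_ideal S I \<and> (\<exists>f. is_retraction S I f)"

definition retractable_IN_pair :: "('a, 'b) monoid_scheme \<Rightarrow> 'a set \<Rightarrow> 'a set \<Rightarrow> bool" where
  "retractable_IN_pair S I N \<longleftrightarrow> IN_pair S I N \<and> retractable_ideal S I \<and>
     (\<forall>x\<in>min_ideal S. card (x <#\<^bsub>S\<^esub> N) = 1 \<and> card (N #>\<^bsub>S\<^esub> x) = 1)"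

text \<open>A retraction is unique on \<open>I\<close>; its values elsewhere are never used.\<close>
definition retraction :: "('a, 'b) monoid_scheme \<Rightarrow> 'a set \<Rightarrow> 'a \<Rightarrow> 'a" where
  "retraction S I = (SOME f. is_retraction S I f)"

definition Rees :: "('a, 'b) monoid_scheme \<Rightarrow> 'a set \<Rightarrow> ('a \<times> 'a) set" where
  "Rees S I = Delta S \<union> I \<times> I"

text \<open>
  \<^term>\<open>GreenJ S `` N\<close> is the \<open>\<J>\<close>-class containing \<open>N\<close> whenever \<open>N\<close> is non-empty and contained in a
  single \<open>\<J>\<close>-class.
\<close>
definition nu :: "('a, 'b) monoid_scheme \<Rightarrow> 'a set \<Rightarrow> ('a \<times> 'a) set" where
  "nu S N = {(s \<otimes>\<^bsub>S\<^esub> x \<otimes>\<^bsub>S\<^esub> t, s \<otimes>\<^bsub>S\<^esub> y \<otimes>\<^bsub>S\<^esub> t) | s t x y.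
               x \<in> N \<and> y \<in> N \<and> s \<in> carrier S \<and> t \<in> carrier S}
            \<inter> (GreenJ S `` N) \<times> (GreenJ S `` N)"

definition R_IN :: "('a, 'b) monoid_scheme \<Rightarrow> 'a set \<Rightarrow> 'a set \<Rightarrow> ('a \<times> 'a) set" where
  "R_IN S I N = Delta S \<union> nu S N \<union> I \<times> I"

definition lambda_IN :: "('a, 'b) monoid_scheme \<Rightarrow> 'a set \<Rightarrow> 'a set \<Rightarrow> ('a \<times> 'a) set" where
  "lambda_IN S I N = Delta S \<union> nu S N \<union>
     {(x, y) \<in> I \<times> I. (retraction S I x, retraction S I y) \<in> GreenL S}"

definition rho_IN :: "('a, 'b) monoid_scheme \<Rightarrow> 'a set \<Rightarrow> 'a set \<Rightarrow> ('a \<times> 'a) set" where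
  "rho_IN S I N = Delta S \<union> nu S N \<union>
     {(x, y) \<in> I \<times> I. (retraction S I x, retraction S I y) \<in> GreenR S}"

definition mu_IN :: "('a, 'b) monoid_scheme \<Rightarrow> 'a set \<Rightarrow> 'a set \<Rightarrow> ('a \<times> 'a) set" where
  "mu_IN S I N = Delta S \<union> nu S N \<union>
     {(x, y) \<in> I \<times> I. (retraction S I x, retraction S I y) \<in> GreenH S}"


section \<open>The partial Brauer monoid\<close>

text \<open>
  \<open>Up i\<close> is the upper point \<open>i\<close> and \<open>Dn i\<close> the lower point \<open>i'\<close>. The middle points \<open>Mid i\<close>
  (that is, \<open>i''\<close>) occur only while a product is being formed.
\<close>
datatype vertex = Up nat | Mid nat | Dn nat

definition points :: "nat \<Rightarrow> vertex set" where
  "points n = Up ` {1..n} \<union> Dn ` {1..n}"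

fun lower_to_mid :: "vertex \<Rightarrow> vertex" where
  "lower_to_mid (Dn i) = Mid i"
| "lower_to_mid (Up i) = Up i"
| "lower_to_mid (Mid i) = Mid i"

fun upper_to_mid :: "vertex \<Rightarrow> vertex" where
  "upper_to_mid (Up i) = Mid i"
| "upper_to_mid (Dn i) = Dn i"
| "upper_to_mid (Mid i) = Mid i"

definition product_edges :: "vertex set set \<Rightarrow> vertex set set \<Rightarrow> (vertex \<times> vertex) set" where
  "product_edges \<alpha> \<beta> =
     {(u, v). \<exists>B \<in> (`) lower_to_mid ` \<alpha> \<union> (`) upper_to_mid ` \<beta>. u \<in> B \<and> v \<in> B}"

definition part_mult :: "nat \<Rightarrow> vertex set set \<Rightarrow> vertex set set \<Rightarrow> vertex set set" where
  "part_mult n \<alpha> \<beta> = points n // Restr ((product_edges \<alpha> \<beta>)\<^sup>*) (points n)"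

definition partition_monoid :: "nat \<Rightarrow> vertex set set monoid" where
  "partition_monoid n =
     \<lparr>carrier = {\<alpha>. partition_on (points n) \<alpha>},
      mult = part_mult n,
      one = {{Up i, Dn i} | i. i \<in> {1..n}}\<rparr>"

definition PB :: "nat \<Rightarrow> vertex set set monoid" where
  "PB n = (partition_monoid n)
     \<lparr>carrier := {\<alpha> \<in> carrier (partition_monoid n). \<forall>B\<in>\<alpha>. card B \<le> 2}\<rparr>"

definition rank :: "vertex set set \<Rightarrow> nat" where
  "rank \<alpha> = card {B \<in> \<alpha>. (\<exists>i. Up i \<in> B) \<and> (\<exists>j. Dn j \<in> B)}"

fun flip :: "vertex \<Rightarrow> vertex" where
  "flip (Up i) = Dn i"
| "flip (Dn i) = Up i"
| "flip (Mid i) = Mid i"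

definition star :: "vertex set set \<Rightarrow> vertex set set" where
  "star \<alpha> = (`) flip ` \<alpha>"

definition Cong_star :: "nat \<Rightarrow> (vertex set set \<times> vertex set set) set set" where
  "Cong_star n = {\<theta> \<in> Cong (PB n). \<forall>(\<alpha>, \<beta>)\<in>\<theta>. (star \<alpha>, star \<beta>) \<in> \<theta>}"

definition I_rank :: "nat \<Rightarrow> nat \<Rightarrow> vertex set set set" where
  "I_rank n q = {\<alpha> \<in> carrier (PB n). rank \<alpha> \<le> q}"

definition bar :: "nat \<Rightarrow> nat \<Rightarrow> (nat \<Rightarrow> nat) \<Rightarrow> vertex set set" where
  "bar n q \<sigma> = {{Up i, Dn (\<sigma> i)} | i. i \<in> {1..q}} \<union>
     {{Up i} | i. i \<in> {q+1..n}} \<union> {{Dn i} | i. i \<in> {q+1..n}}"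

definition bar_sym :: "nat \<Rightarrow> nat \<Rightarrow> vertex set set monoid" where
  "bar_sym n q = group_at (PB n) (bar n q ` carrier (sym_group q)) (bar n q id)"

definition klein4 :: "(nat \<Rightarrow> nat) set" where
  "klein4 = {id, transpose 1 2 \<circ> transpose 3 4, transpose 1 3 \<circ> transpose 2 4,
             transpose 1 4 \<circ> transpose 2 3}"


section \<open>The named congruences\<close>

type_synonym pb_rel = "(vertex set set \<times> vertex set set) set"

definition Rq :: "nat \<Rightarrow> nat \<Rightarrow> pb_rel" where
  "Rq n q = Rees (PB n) (I_rank n q)"

text \<open>The degree \<open>q\<close> is an explicit argument, since \<open>N\<close> is a set of functions on \<^typ>\<open>nat\<close>.\<close>
definition RN :: "nat \<Rightarrow> nat \<Rightarrow> (nat \<Rightarrow> nat) set \<Rightarrow> pb_rel" where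
  "RN n q N = R_IN (PB n) (I_rank n (q - 1)) (bar n q ` N)"

datatype idx = Zero | One | STwo

fun C_pair :: "nat \<Rightarrow> idx \<Rightarrow> vertex set set set \<times> vertex set set set" where
  "C_pair n Zero = (I_rank n 0, {bar n 1 id})"
| "C_pair n One  = (I_rank n 1, {bar n 2 id})"
| "C_pair n STwo = (I_rank n 1, bar n 2 ` carrier (sym_group 2))"

definition lam :: "nat \<Rightarrow> idx \<Rightarrow> pb_rel" where
  "lam n i = (case C_pair n i of (I, N) \<Rightarrow> lambda_IN (PB n) I N)"

definition rho :: "nat \<Rightarrow> idx \<Rightarrow> pb_rel" where
  "rho n i = (case C_pair n i of (I, N) \<Rightarrow> rho_IN (PB n) I N)"

definition mu :: "nat \<Rightarrow> idx \<Rightarrow> pb_rel" where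
  "mu n i = (case C_pair n i of (I, N) \<Rightarrow> mu_IN (PB n) I N)"

text \<open>Labels for the entries of the list of congruences, used to express that they are pairwise
  distinct.\<close>
datatype cong_label =
    LRq nat | LRN nat "(nat \<Rightarrow> nat) set" | LLam idx | LRho idx | LMu idx

fun cong_of :: "nat \<Rightarrow> cong_label \<Rightarrow> pb_rel" where
  "cong_of n (LRq q) = Rq n q"
| "cong_of n (LRN q N) = RN n q N"
| "cong_of n (LLam i) = lam n i"
| "cong_of n (LRho i) = rho n i"
| "cong_of n (LMu i) = mu n i"

definition cong_labels :: "nat \<Rightarrow> cong_label set" where
  "cong_labels n = {LRq q | q. q \<le> n} \<union>
     {LRN q N | q N. 2 \<le> q \<and> q \<le> n \<and> N \<lhd> sym_group q \<and> N \<noteq> {id}} \<union>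
     range LLam \<union> range LRho \<union> range LMu"

datatype diamond = DMu | DLam | DRho | DR

definition diamond_le :: "diamond \<Rightarrow> diamond \<Rightarrow> bool" where
  "diamond_le d e \<longleftrightarrow> d = e \<or> d = DMu \<or> e = DR"

definition idx_le :: "idx \<Rightarrow> idx \<Rightarrow> bool" where
  "idx_le i j \<longleftrightarrow> i = j \<or> i = Zero \<or> j = STwo"

fun xi :: "nat \<Rightarrow> diamond \<Rightarrow> idx \<Rightarrow> pb_rel" where
  "xi n DMu i = mu n i"
| "xi n DLam i = lam n i"
| "xi n DRho i = rho n i"
| "xi n DR Zero = Rq n 0"
| "xi n DR One = Rq n 1"
| "xi n DR STwo = RN n 2 (carrier (sym_group 2))"

definition chain_block :: "nat \<Rightarrow> nat \<Rightarrow> pb_rel list" where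
  "chain_block n q = (if q = 4 then [RN n 4 klein4] else []) @
     [RN n q (carrier (alt_group q)), RN n q (carrier (sym_group q)), Rq n q]"

text \<open>The part of the chain strictly above \<open>R\<^bsub>S\<^sub>2\<^esub>\<close>, in increasing order.\<close>
definition upper_chain :: "nat \<Rightarrow> pb_rel list" where
  "upper_chain n = Rq n 2 # concat (map (chain_block n) [3..<n+1])"

end

theory Submission
  imports Defs
begin

text \<open>
  Write \<open>e\<^sub>q\<close> for the bar of \<open>id\<^sub>q\<close> and \<open>\<omega> = e\<^sub>0\<close>. If a congruence relates two elements that are not
  \<open>\<H>\<close>-related, the larger rank being \<open>q \<ge> 1\<close>, then suitable multiples relate \<open>e\<^sub>q\<close> to an element of
  smaller rank, and descent on the rank relates \<open>e\<^sub>q\<close> to \<open>\<omega>\<close>. Two distinct \<open>\<H>\<close>-related elements of rank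
  \<open>q\<close> relate \<open>e\<^sub>q\<^sub>-\<^sub>1\<close> to \<open>\<omega>\<close> in the same way. For \<open>q \<ge> 2\<close> this collapses all elements of rank at most
  \<open>q\<close>, because \<open>e\<^sub>q\<close> fixes the hook \<open>{1, 2}\<close> and \<open>\<omega>\<close> does not. On elements of rank at most 1 the halves
  \<open>x\<omega>\<close> and \<open>\<omega>x\<close> survive; remembering both, one or none of them gives \<open>\<mu>\<close>, \<open>\<lambda>\<close> and \<open>\<rho>\<close>, and \<open>R\<close>. In the
  rank just above the collapsed ideal a congruence is determined by a normal subgroup of a symmetric group.
\<close>

section \<open>Connected components of product graphs\<close>

text \<open>Products are defined by paths of arbitrary length. Only closure and associativity treat
  such paths in general; elsewhere a diagram is an involution on points, and the multipliers are
  chosen so that the paths to be traced have at most four edges. Statements about lower halves come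
  from upper ones by reflection. The threshold 2 has two sources. An element of rank at most 1
  offers a single transversal, so a rank-zero factor cannot join two of its ends to a new hook, and
  halves behave multiplicatively; with two transversals a hook can be pulled through. Moreover,
  cutting a rank-zero element down to {1, 2} leaves there a hook or two singletons, and the
  transposition fixes both, so identifying the permutations of {1, 2} still respects halves. A
  congruence other than the total one thus has a level \<open>q\<close>, a normal subgroup and two
  flags. Levels 1 and 2 carry three choices of level and group and four of flags, which gives the
  product of chain and diamond; from level 3 on both flags are off. Each parameter is visible in
  whether particular test pairs are related, so comparing congruences is comparing
  parameters.\<close>

text \<open>The graph \<open>E\<close> may be replaced by its connectivity on the interface
  \<open>X\<close> before \<open>F\<close> is attached: a path alternates between
  \<open>E\<close>-segments and \<open>F\<close>-edges, and every maximal \<open>E\<close>-segment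
  starts and ends in \<open>X\<close>. Associativity uses this once for each bracketing.\<close>

lemma rtrancl_glue:
  assumes "Field E \<subseteq> X'" "Field F \<subseteq> X''" "Y \<inter> X' \<subseteq> X" "X'' \<inter> X' \<subseteq> X"
  shows "Restr ((Restr (E\<^sup>*) X \<union> F)\<^sup>*) Y = Restr ((E \<union> F)\<^sup>*) Y"
proof
  have Y: "Y \<inter> Field E \<subseteq> X" and F: "Field F \<inter> Field E \<subseteq> X"
    using assms by blast+
  let ?N = "Restr (E\<^sup>*) X \<union> F"
  have "E\<^sup>* \<subseteq> (E \<union> F)\<^sup>*"
    by (simp add: rtrancl_mono)
  then have "?N\<^sup>* \<subseteq> (E \<union> F)\<^sup>*"
    by (intro rtrancl_subset_rtrancl) auto
  then show "Restr (?N\<^sup>*) Y \<subseteq> Restr ((E \<union> F)\<^sup>*) Y" by auto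
  show "Restr ((E \<union> F)\<^sup>*) Y \<subseteq> Restr (?N\<^sup>*) Y"
  proof (rule subrelI)
    fix y z assume "(y, z) \<in> Restr ((E \<union> F)\<^sup>*) Y"
    then have yz: "(y, z) \<in> (E \<union> F)\<^sup>*" "y \<in> Y" "z \<in> Y" by auto
    have fE: "b \<in> Field E" if "(a, b) \<in> E\<^sup>*" "a \<noteq> b" for a b
      using that by (metis FieldI2 rtranclE)
    \<comment> \<open>The invariant leaves the current \<open>E\<close>-segment open,
      \<open>x\<close> being the point where it was entered; it is closed only when an
      \<open>F\<close>-edge follows. The second disjunct covers points that \<open>E\<close> does
      not touch.\<close>
    from yz(1) have "\<exists>x. (y, x) \<in> ?N\<^sup>* \<and> (x, z) \<in> E\<^sup>* \<and> (x \<in> X \<or> x = z \<and> z \<notin> Field E)"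
    proof induction
      case base
      then show ?case using Y yz(2) by blast
    next
      case (step z w)
      then obtain x where x: "(y, x) \<in> ?N\<^sup>*" "(x, z) \<in> E\<^sup>*" "x \<in> X \<or> x = z \<and> z \<notin> Field E"
        by blast
      show ?case
      proof (cases "(z, w) \<in> E")
        case True
        then have "x \<in> X" using x(3) by (meson FieldI1)
        then show ?thesis using x True by (meson rtrancl.rtrancl_into_rtrancl)
      next
        case False
        then have zw: "(z, w) \<in> F" using step.hyps by blast
        have "(y, z) \<in> ?N\<^sup>*"
        proof (cases "x = z")
          case False
          then have "x \<in> X" "z \<in> X" using x fE F zw by (auto intro: FieldI1)
          then show ?thesis using x by (meson IntI SigmaI UnI1 rtrancl.rtrancl_into_rtrancl)
        qed (use x in simp)
        then have "(y, w) \<in> ?N\<^sup>*" using zw by (meson UnI2 rtrancl.rtrancl_into_rtrancl)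
        moreover have "w \<in> X \<or> w \<notin> Field E" using zw F by (auto intro: FieldI2)
        ultimately show ?thesis by blast
      qed
    qed
    then obtain x where x: "(y, x) \<in> ?N\<^sup>*" "(x, z) \<in> E\<^sup>*" "x \<in> X \<or> x = z" by blast
    have "(y, z) \<in> ?N\<^sup>*"
    proof (cases "x = z")
      case False
      then have "x \<in> X" "z \<in> X" using x fE Y yz(3) by auto
      then show ?thesis using x by (meson IntI SigmaI UnI1 rtrancl.rtrancl_into_rtrancl)
    qed (use x in simp)
    then show "(y, z) \<in> Restr (?N\<^sup>*) Y" using yz by blast
  qed
qed

lemma rtrancl_map_prod:
  assumes "inj h"
  shows "(h x, h y) \<in> (map_prod h h ` R)\<^sup>* \<longleftrightarrow> (x, y) \<in> R\<^sup>*"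
proof
  have "\<exists>z. w = h z \<and> (x, z) \<in> R\<^sup>*" if "(h x, w) \<in> (map_prod h h ` R)\<^sup>*" for w
    using that
  proof induction
    case (step v w)
    then obtain z z' where "v = h z" "(x, z) \<in> R\<^sup>*" "(z, z') \<in> R" "w = h z'"
      using assms by (auto dest!: injD)
    then show ?case using assms by (metis injD rtrancl.rtrancl_into_rtrancl)
  qed auto
  then show "(h x, h y) \<in> (map_prod h h ` R)\<^sup>* \<Longrightarrow> (x, y) \<in> R\<^sup>*"
    using assms by (metis injD)
  show "(x, y) \<in> R\<^sup>* \<Longrightarrow> (h x, h y) \<in> (map_prod h h ` R)\<^sup>*"
  proof (induction rule: rtrancl_induct)
    case (step y z)
    then show ?case by (metis (no_types, lifting) image_eqI map_prod_simp rtrancl.simps)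
  qed auto
qed

definition letter :: "('a \<Rightarrow> 'a) \<Rightarrow> ('a \<Rightarrow> 'a) \<Rightarrow> nat \<Rightarrow> 'a \<Rightarrow> 'a" where
  "letter a b k = (if even k then a else b)"

primrec walk :: "('a \<Rightarrow> 'a) \<Rightarrow> ('a \<Rightarrow> 'a) \<Rightarrow> 'a \<Rightarrow> nat \<Rightarrow> 'a" where
  "walk a b u 0 = u"
| "walk a b u (Suc k) = letter a b k (walk a b u k)"

text \<open>
  A walk that applies two involutions alternately and starts at a fixed point of the second one
  runs through the whole connected component of its starting point. As soon as it stands still for
  one step it retraces itself, so it meets at most one other fixed point of an involution.
\<close>
lemma fixed_points_of_component:
  assumes a: "\<And>x. a (a x) = x" and b: "\<And>x. b (b x) = x" and u: "b u = u"
    and conn: "(u, v) \<in> ({(x, a x) |x. True} \<union> {(x, b x) |x. True})\<^sup>*"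
      "(u, w) \<in> ({(x, a x) |x. True} \<union> {(x, b x) |x. True})\<^sup>*"
    and fixed: "a v = v \<or> b v = v" "a w = w \<or> b w = w"
    and ne: "v \<noteq> u" "w \<noteq> u"
  shows "v = w"
proof -
  let ?x = "walk a b u"
  have letter: "letter a b k (letter a b k x) = x" for k x
    by (simp add: letter_def a b)
  have ex: "\<exists>k. z = ?x k" if "(u, z) \<in> ({(x, a x) |x. True} \<union> {(x, b x) |x. True})\<^sup>*" for z
    using that
  proof induction
    case base
    show ?case by (rule exI[of _ 0]) simp
  next
    case (step y z)
    then obtain k where k: "y = ?x k" by blast
    have "letter a b k y = ?x (Suc k)" by (simp add: k)
    moreover have "\<exists>j. letter a b (Suc k) y = ?x j"
    proof (cases k)
      case 0
      then have "letter a b (Suc k) y = ?x 0" using k u by (simp add: letter_def)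
      then show ?thesis by blast
    next
      case (Suc j)
      have "letter a b (Suc k) = letter a b j" by (simp add: Suc letter_def)
      then have "letter a b (Suc k) y = ?x j" using k Suc by (simp add: letter)
      then show ?thesis by blast
    qed
    moreover have "z = letter a b k y \<or> z = letter a b (Suc k) y"
      using step.hyps by (auto simp: letter_def)
    ultimately show ?case by metis
  qed
  \<comment> \<open>At the first visit to \<open>z\<close> the letter just applied has moved the
    walk, so it does not fix \<open>z\<close>. The letter fixing \<open>z\<close> is therefore the
    next one, and the walk stands still.\<close>
  have stop: "\<exists>k. ?x k = z \<and> ?x (Suc k) = z \<and> (\<forall>l<k. ?x l \<noteq> z)"
    if z: "(u, z) \<in> ({(x, a x) |x. True} \<union> {(x, b x) |x. True})\<^sup>*" "a z = z \<or> b z = z" "z \<noteq> u" for z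
  proof -
    define k where "k = (LEAST k. ?x k = z)"
    have k: "?x k = z" "\<forall>l<k. ?x l \<noteq> z"
      unfolding k_def using ex[OF z(1)] LeastI[of "\<lambda>k. ?x k = z"] not_less_Least by auto
    then obtain j where j: "k = Suc j" using z(3) by (cases k) auto
    have "letter a b j z \<noteq> z" using k(2) j letter k(1)
      by (metis lessI walk.simps(2))
    then have "letter a b k z = z" using z(2) by (auto simp: letter_def j)
    then show ?thesis using k by auto
  qed
  \<comment> \<open>After standing still at time \<open>k\<close> the walk is back at
    \<open>u\<close> at time 2k + 1. The next letter is then \<open>b\<close>, which fixes
    \<open>u\<close>, so from time 2k + 2 on the walk repeats itself with the same parity. Nothing
    is met for the first time after \<open>k\<close>.\<close>
  have lt: False if k: "?x k = z" "?x (Suc k) = z" and l: "?x l = z'" "\<forall>l'<l. ?x l' \<noteq> z'" "k < l"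
    for k l z z'
  proof -
    have retrace: "?x (k + 1 + j) = ?x (k - j)" if "j \<le> k" for j
      using that
    proof (induction j)
      case (Suc j)
      have *: "letter a b (k + 1 + j) = letter a b (k - Suc j)"
        unfolding letter_def using Suc(2) by (auto simp: even_diff_nat)
      have "?x (k - j) = letter a b (k - Suc j) (?x (k - Suc j))"
        using Suc(2) by (metis Suc_diff_Suc Suc_le_lessD walk.simps(2))
      then show ?case using Suc * by (simp add: letter)
    qed (use k in simp)
    have again: "?x (2 * k + 2 + j) = ?x j" for j
    proof (induction j)
      case 0
      have "?x (2 * k + 1) = u" using retrace[of k] by (simp add: mult_2)
      then show ?case using u by (simp add: letter_def)
    next
      case (Suc j)
      then show ?case by (simp add: letter_def)
    qed
    have "\<exists>l'\<le>k. ?x l' = ?x l"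
    proof (induction l rule: less_induct)
      case (less l)
      consider "l \<le> k" | "k + 1 \<le> l" "l < 2 * k + 2" | "2 * k + 2 \<le> l" by linarith
      then show ?case
      proof cases
        case 2
        then show ?thesis using retrace[of "l - (k + 1)"]
          by (intro exI[of _ "k - (l - (k + 1))"]) auto
      next
        case 3
        then have "?x (l - (2 * k + 2)) = ?x l"
          using again[of "l - (2 * k + 2)"] le_add_diff_inverse[of "2 * k + 2" l] by metis
        then show ?thesis using less[of "l - (2 * k + 2)"] 3 by auto
      qed auto
    qed
    then show False using l by (metis le_less_trans)
  qed
  obtain k where k: "?x k = v" "?x (Suc k) = v" "\<forall>l<k. ?x l \<noteq> v"
    using stop conn fixed ne by blast
  obtain l where l: "?x l = w" "?x (Suc l) = w" "\<forall>j<l. ?x j \<noteq> w"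
    using stop conn fixed ne by blast
  show ?thesis
    using lt[OF k(1,2) l(1,3)] lt[OF l(1,2) k(1,3)] k(1) l(1)
    by (metis linorder_neqE_nat)
qed

section \<open>Partial Brauer diagrams as pairings\<close>

text \<open>A singleton block is {u, u}, so singletons are the fixed points. The default value makes
  the map the identity off the diagram, hence an involution on the whole type without side
  conditions.\<close>

definition mate :: "vertex set set \<Rightarrow> vertex \<Rightarrow> vertex" where
  "mate \<alpha> u = (if \<exists>v. {u, v} \<in> \<alpha> then THE v. {u, v} \<in> \<alpha> else u)"

definition pairing :: "nat \<Rightarrow> (vertex \<Rightarrow> vertex) \<Rightarrow> bool" where
  "pairing n f \<longleftrightarrow> (\<forall>u\<in>points n. f u \<in> points n \<and> f (f u) = u)"

definition pairs :: "nat \<Rightarrow> (vertex \<Rightarrow> vertex) \<Rightarrow> vertex set set" where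
  "pairs n f = (\<lambda>u. {u, f u}) ` points n"

definition same_block :: "vertex set set \<Rightarrow> (vertex \<times> vertex) set" where
  "same_block \<alpha> = {(u, v). \<exists>B\<in>\<alpha>. u \<in> B \<and> v \<in> B}"

abbreviation PBc :: "nat \<Rightarrow> vertex set set set" where
  "PBc n \<equiv> carrier (PB n)"

lemma Up_points [simp]: "Up i \<in> points n \<longleftrightarrow> 1 \<le> i \<and> i \<le> n"
  and Dn_points [simp]: "Dn i \<in> points n \<longleftrightarrow> 1 \<le> i \<and> i \<le> n"
  and Mid_points [simp]: "Mid i \<notin> points n"
  by (auto simp: points_def)

lemma finite_points [simp]: "finite (points n)"
  by (simp add: points_def)

lemma PB_carrier: "\<alpha> \<in> PBc n \<longleftrightarrow> partition_on (points n) \<alpha> \<and> (\<forall>B\<in>\<alpha>. card B \<le> 2)"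
  by (simp add: PB_def partition_monoid_def)

lemma PB_mult: "\<alpha> \<otimes>\<^bsub>PB n\<^esub> \<beta> = part_mult n \<alpha> \<beta>"
  by (simp add: PB_def partition_monoid_def)

lemma same_blockI: "\<lbrakk>B \<in> \<alpha>; u \<in> B; v \<in> B\<rbrakk> \<Longrightarrow> (u, v) \<in> same_block \<alpha>"
  by (auto simp: same_block_def)

lemma block_unique:
  "\<lbrakk>partition_on A \<alpha>; B \<in> \<alpha>; C \<in> \<alpha>; u \<in> B; u \<in> C\<rbrakk> \<Longrightarrow> B = C"
  by (auto simp: partition_on_def disjoint_def)

lemma block_pair:
  assumes "\<alpha> \<in> PBc n" "B \<in> \<alpha>" "u \<in> B"
  shows "\<exists>v. B = {u, v}"
proof -
  have "card B \<le> 2" "B \<subseteq> points n"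
    using assms by (auto simp: PB_carrier partition_on_def)
  then have fin: "finite B" by (meson finite_points finite_subset)
  have "card (B - {u}) \<le> 1" using \<open>card B \<le> 2\<close> assms(3) fin by simp
  then have "B - {u} = {} \<or> (\<exists>v. B - {u} = {v})"
    using fin by (metis card_1_singletonE card_0_eq finite_Diff le_Suc_eq le_zero_eq One_nat_def)
  then show ?thesis
    using assms(3) by (metis insert_Diff insert_absorb2 insert_absorb insert_commute)
qed

lemma mate_eqI:
  assumes "\<alpha> \<in> PBc n" "{u, v} \<in> \<alpha>"
  shows "mate \<alpha> u = v"
proof -
  have "w = v" if "{u, w} \<in> \<alpha>" for w
  proof -
    have "{u, v} = {u, w}"
      using block_unique[of "points n" \<alpha> "{u, v}" "{u, w}" u] assms that by (auto simp: PB_carrier)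
    then show ?thesis by (auto simp: doubleton_eq_iff)
  qed
  then have "(THE v. {u, v} \<in> \<alpha>) = v" using assms(2) by (intro the_equality)
  then show ?thesis using assms(2) by (auto simp: mate_def)
qed

lemma mate_block:
  assumes "\<alpha> \<in> PBc n" "u \<in> points n"
  shows "{u, mate \<alpha> u} \<in> \<alpha>"
proof -
  obtain B where B: "B \<in> \<alpha>" "u \<in> B" using assms by (auto simp: PB_carrier partition_on_def)
  then obtain v where "B = {u, v}" using block_pair assms by blast
  then show ?thesis using B mate_eqI[OF assms(1)] by metis
qed

lemma mate_outside:
  assumes "\<alpha> \<in> PBc n" "u \<notin> points n"
  shows "mate \<alpha> u = u"
proof -
  have "{u, v} \<notin> \<alpha>" for v using assms by (auto simp: PB_carrier partition_on_def)
  then show ?thesis by (simp add: mate_def)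
qed

lemma mate_points [simp]:
  assumes "\<alpha> \<in> PBc n"
  shows "mate \<alpha> u \<in> points n \<longleftrightarrow> u \<in> points n"
  using mate_block[OF assms] mate_outside[OF assms] assms
  by (cases "u \<in> points n") (auto simp: PB_carrier partition_on_def)

lemma mate_mate [simp]:
  assumes "\<alpha> \<in> PBc n"
  shows "mate \<alpha> (mate \<alpha> u) = u"
proof (cases "u \<in> points n")
  case True
  then show ?thesis using mate_block[OF assms True] mate_eqI[OF assms] by (metis insert_commute)
qed (use mate_outside assms in simp)

lemma mate_sym:
  assumes "\<alpha> \<in> PBc n"
  shows "mate \<alpha> u = v \<longleftrightarrow> mate \<alpha> v = u"
  using assms mate_mate by metis

lemma PB_eq_pairs:
  assumes "\<alpha> \<in> PBc n"
  shows "\<alpha> = pairs n (mate \<alpha>)"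
proof
  show "pairs n (mate \<alpha>) \<subseteq> \<alpha>" using mate_block[OF assms] by (auto simp: pairs_def)
  show "\<alpha> \<subseteq> pairs n (mate \<alpha>)"
  proof
    fix B assume B: "B \<in> \<alpha>"
    then have "B \<noteq> {}" "B \<subseteq> points n" using assms by (auto simp: PB_carrier partition_on_def)
    then obtain u where u: "u \<in> B" "u \<in> points n" by blast
    then obtain v where "B = {u, v}" using block_pair assms B by blast
    then show "B \<in> pairs n (mate \<alpha>)" using B u mate_eqI[OF assms] by (auto simp: pairs_def)
  qed
qed

lemma PB_eqI:
  assumes "\<alpha> \<in> PBc n" "\<beta> \<in> PBc n" "\<And>u. u \<in> points n \<Longrightarrow> mate \<alpha> u = mate \<beta> u"
  shows "\<alpha> = \<beta>"
proof -
  have "pairs n (mate \<alpha>) = pairs n (mate \<beta>)" using assms(3) by (auto simp: pairs_def)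
  then show ?thesis using PB_eq_pairs assms(1,2) by metis
qed

lemma PB_eqI_UpDn:
  assumes "\<alpha> \<in> PBc n" "\<beta> \<in> PBc n"
    and "\<And>i. 1 \<le> i \<Longrightarrow> i \<le> n \<Longrightarrow> mate \<alpha> (Up i) = mate \<beta> (Up i)"
    and "\<And>i. 1 \<le> i \<Longrightarrow> i \<le> n \<Longrightarrow> mate \<alpha> (Dn i) = mate \<beta> (Dn i)"
  shows "\<alpha> = \<beta>"
  by (rule PB_eqI[OF assms(1,2)]) (auto simp: points_def assms)

lemma pairs_PB:
  assumes "pairing n f"
  shows "pairs n f \<in> PBc n"
proof -
  have "partition_on (points n) (pairs n f)"
  proof (rule partition_onI)
    fix p q assume "p \<in> pairs n f" "q \<in> pairs n f" "p \<noteq> q"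
    then obtain u v where "p = {u, f u}" "q = {v, f v}" "u \<in> points n" "v \<in> points n"
      by (auto simp: pairs_def)
    then show "disjnt p q"
      using assms \<open>p \<noteq> q\<close> unfolding pairing_def disjnt_iff
      by (metis doubleton_eq_iff insert_iff singletonD)
  qed (use assms in \<open>auto simp: pairs_def pairing_def\<close>)
  then show ?thesis by (auto simp: PB_carrier pairs_def card_insert_if)
qed

lemma mate_pairs:
  assumes "pairing n f" "u \<in> points n"
  shows "mate (pairs n f) u = f u"
  using mate_eqI[OF pairs_PB[OF assms(1)]] assms(2) by (simp add: pairs_def)

lemma same_block_iff:
  assumes "\<alpha> \<in> PBc n"
  shows "(u, v) \<in> same_block \<alpha> \<longleftrightarrow> u \<in> points n \<and> (v = u \<or> v = mate \<alpha> u)"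
proof
  assume "(u, v) \<in> same_block \<alpha>"
  then obtain B where B: "B \<in> \<alpha>" "u \<in> B" "v \<in> B" by (auto simp: same_block_def)
  then obtain w where "B = {u, w}" using block_pair assms by blast
  then show "u \<in> points n \<and> (v = u \<or> v = mate \<alpha> u)"
    using B mate_eqI[OF assms] assms by (auto simp: PB_carrier partition_on_def)
next
  assume "u \<in> points n \<and> (v = u \<or> v = mate \<alpha> u)"
  then show "(u, v) \<in> same_block \<alpha>"
    using mate_block[OF assms, of u] by (auto simp: same_block_def)
qed

lemma partition_eq_iff:
  assumes "partition_on A \<alpha>" "partition_on A \<beta>"
  shows "\<alpha> = \<beta> \<longleftrightarrow> same_block \<alpha> = same_block \<beta>"
proof
  assume eq: "same_block \<alpha> = same_block \<beta>"
  have "A // same_block \<alpha> = \<alpha>" "A // same_block \<beta> = \<beta>"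
    unfolding same_block_def
    by (rule partition_on_eq_quotient[OF assms(1)], rule partition_on_eq_quotient[OF assms(2)])
  then show "\<alpha> = \<beta>" unfolding eq by (rule trans[OF sym])
qed simp

section \<open>Components of the product graph and closure of the product\<close>

lemma equiv_conn: "equiv (points n) (Restr ((product_edges \<alpha> \<beta>)\<^sup>*) (points n))"
proof -
  have "sym (product_edges \<alpha> \<beta>)" by (auto simp: sym_def product_edges_def)
  then have "sym ((product_edges \<alpha> \<beta>)\<^sup>*)" by (rule sym_rtrancl)
  then show ?thesis
    by (auto intro!: equivI simp: refl_on_def sym_def trans_def)
qed

lemma part_mult_partition: "partition_on (points n) (part_mult n \<alpha> \<beta>)"
  unfolding part_mult_def by (rule partition_on_quotient[OF equiv_conn])

lemma same_block_part_mult: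
  "same_block (part_mult n \<alpha> \<beta>) = Restr ((product_edges \<alpha> \<beta>)\<^sup>*) (points n)"
  (is "_ = ?R")
proof -
  have "(u, v) \<in> same_block (part_mult n \<alpha> \<beta>) \<longleftrightarrow> (u, v) \<in> ?R" for u v
  proof
    assume "(u, v) \<in> same_block (part_mult n \<alpha> \<beta>)"
    then show "(u, v) \<in> ?R"
      unfolding same_block_def part_mult_def
      using quotient_eq_iff[OF equiv_conn[of n \<alpha> \<beta>]] in_quotient_imp_subset[OF equiv_conn[of n \<alpha> \<beta>]]
      by blast
  next
    assume uv: "(u, v) \<in> ?R"
    have "?R `` {u} \<in> part_mult n \<alpha> \<beta>" using uv unfolding part_mult_def by (intro quotientI) blast
    moreover have "u \<in> ?R `` {u}" "v \<in> ?R `` {u}" using uv by blast+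
    ultimately show "(u, v) \<in> same_block (part_mult n \<alpha> \<beta>)" by (rule same_blockI)
  qed
  then show ?thesis by (intro equalityI subrelI) simp_all
qed

text \<open>The involution of the upper factor, transported to the three rows; it fixes the row that
  the factor does not meet. Thus every outer point is fixed by one of the two step maps, which is
  what the walk argument requires.\<close>

fun upper_step :: "vertex set set \<Rightarrow> vertex \<Rightarrow> vertex" where
  "upper_step \<alpha> (Up i) = lower_to_mid (mate \<alpha> (Up i))"
| "upper_step \<alpha> (Mid i) = lower_to_mid (mate \<alpha> (Dn i))"
| "upper_step \<alpha> (Dn i) = Dn i"

fun lower_step :: "vertex set set \<Rightarrow> vertex \<Rightarrow> vertex" where
  "lower_step \<beta> (Dn i) = upper_to_mid (mate \<beta> (Dn i))"
| "lower_step \<beta> (Mid i) = upper_to_mid (mate \<beta> (Up i))"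
| "lower_step \<beta> (Up i) = Up i"

lemma mate_UpDn_not_Mid:
  assumes "\<alpha> \<in> PBc n"
  shows "mate \<alpha> (Up i) \<noteq> Mid j" "mate \<alpha> (Dn i) \<noteq> Mid j"
  using mate_outside[OF assms, of "Mid j"] mate_sym[OF assms] by (metis Mid_points vertex.distinct)+

lemma upper_step_invol:
  assumes "\<alpha> \<in> PBc n"
  shows "upper_step \<alpha> (upper_step \<alpha> x) = x"
proof -
  have "upper_step \<alpha> (lower_to_mid u) = lower_to_mid (mate \<alpha> u)" if "\<forall>i. u \<noteq> Mid i" for u
    using that by (cases u) auto
  then show ?thesis using mate_UpDn_not_Mid[OF assms] mate_mate[OF assms]
    by (cases x) auto
qed

lemma lower_step_invol:
  assumes "\<alpha> \<in> PBc n"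
  shows "lower_step \<alpha> (lower_step \<alpha> x) = x"
proof -
  have "lower_step \<alpha> (upper_to_mid u) = upper_to_mid (mate \<alpha> u)" if "\<forall>i. u \<noteq> Mid i" for u
    using that by (cases u) auto
  then show ?thesis using mate_UpDn_not_Mid[OF assms] mate_mate[OF assms]
    by (cases x) auto
qed

definition steps :: "vertex set set \<Rightarrow> vertex set set \<Rightarrow> (vertex \<times> vertex) set" where
  "steps \<alpha> \<beta> = {(x, upper_step \<alpha> x) |x. True} \<union> {(x, lower_step \<beta> x) |x. True}"

lemma steps_upper: "(x, upper_step \<alpha> x) \<in> (steps \<alpha> \<beta>)\<^sup>*"
  and steps_lower: "(x, lower_step \<beta> x) \<in> (steps \<alpha> \<beta>)\<^sup>*"
  by (auto simp: steps_def)

lemma product_edges_eq: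
  "product_edges \<alpha> \<beta> =
    map_prod lower_to_mid lower_to_mid ` same_block \<alpha> \<union> map_prod upper_to_mid upper_to_mid ` same_block \<beta>"
proof (intro equalityI subrelI)
  fix u v assume "(u, v) \<in> product_edges \<alpha> \<beta>"
  then consider B where "B \<in> \<alpha>" "u \<in> lower_to_mid ` B" "v \<in> lower_to_mid ` B"
    | B where "B \<in> \<beta>" "u \<in> upper_to_mid ` B" "v \<in> upper_to_mid ` B"
    by (auto simp: product_edges_def)
  then show "(u, v) \<in> map_prod lower_to_mid lower_to_mid ` same_block \<alpha> \<union>
      map_prod upper_to_mid upper_to_mid ` same_block \<beta>"
    by cases (auto intro!: map_prod_imageI same_blockI)
qed (auto simp: product_edges_def same_block_def)

text \<open>The two relations themselves differ, since \<open>steps\<close> also has loops at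
  vertices outside the diagram; only the reflexive transitive closures agree.\<close>

lemma product_edges_rtrancl:
  assumes \<alpha>: "\<alpha> \<in> PBc n" and \<beta>: "\<beta> \<in> PBc n"
  shows "(product_edges \<alpha> \<beta>)\<^sup>* = (steps \<alpha> \<beta>)\<^sup>*"
proof -
  have up: "(lower_to_mid u, lower_to_mid v) \<in> (steps \<alpha> \<beta>)\<^sup>*" if "(u, v) \<in> same_block \<alpha>" for u v
  proof -
    have uv: "u \<in> points n" "v = u \<or> v = mate \<alpha> u" using that same_block_iff[OF \<alpha>] by auto
    then have "lower_to_mid v = lower_to_mid u \<or> lower_to_mid v = upper_step \<alpha> (lower_to_mid u)"
      by (auto simp: points_def)
    then show ?thesis using steps_upper by (metis rtrancl.rtrancl_refl)
  qed
  have low: "(upper_to_mid u, upper_to_mid v) \<in> (steps \<alpha> \<beta>)\<^sup>*" if "(u, v) \<in> same_block \<beta>" for u v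
  proof -
    have uv: "u \<in> points n" "v = u \<or> v = mate \<beta> u" using that same_block_iff[OF \<beta>] by auto
    then have "upper_to_mid v = upper_to_mid u \<or> upper_to_mid v = lower_step \<beta> (upper_to_mid u)"
      by (auto simp: points_def)
    then show ?thesis using steps_lower by (metis rtrancl.rtrancl_refl)
  qed
  have "product_edges \<alpha> \<beta> \<subseteq> (steps \<alpha> \<beta>)\<^sup>*"
    unfolding product_edges_eq using up low by auto
  moreover have "steps \<alpha> \<beta> \<subseteq> (product_edges \<alpha> \<beta>)\<^sup>*"
  proof -
    have "(x, upper_step \<alpha> x) \<in> (product_edges \<alpha> \<beta>)\<^sup>*" for x
    proof (cases "x = upper_step \<alpha> x")
      case False
      define u where "u = (case x of Mid i \<Rightarrow> Dn i | _ \<Rightarrow> x)"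
      have u: "lower_to_mid u = x" "upper_step \<alpha> x = lower_to_mid (mate \<alpha> u)"
        using False by (auto simp: u_def split: vertex.splits)
      then have "u \<in> points n" using False mate_outside[OF \<alpha>] by metis
      then have "(u, mate \<alpha> u) \<in> same_block \<alpha>" by (simp add: same_block_iff[OF \<alpha>])
      then have "(x, upper_step \<alpha> x) \<in> product_edges \<alpha> \<beta>"
        unfolding product_edges_eq using u by (metis UnI1 map_prod_imageI)
      then show ?thesis by blast
    qed simp
    moreover have "(x, lower_step \<beta> x) \<in> (product_edges \<alpha> \<beta>)\<^sup>*" for x
    proof (cases "x = lower_step \<beta> x")
      case False
      define u where "u = (case x of Mid i \<Rightarrow> Up i | _ \<Rightarrow> x)"
      have u: "upper_to_mid u = x" "lower_step \<beta> x = upper_to_mid (mate \<beta> u)"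
        using False by (auto simp: u_def split: vertex.splits)
      then have "u \<in> points n" using False mate_outside[OF \<beta>] by metis
      then have "(u, mate \<beta> u) \<in> same_block \<beta>" by (simp add: same_block_iff[OF \<beta>])
      then have "(x, lower_step \<beta> x) \<in> product_edges \<alpha> \<beta>"
        unfolding product_edges_eq using u by (metis UnI2 map_prod_imageI)
      then show ?thesis by blast
    qed simp
    ultimately show ?thesis by (auto simp: steps_def)
  qed
  ultimately show ?thesis
    by (intro subset_antisym rtrancl_subset_rtrancl)
qed

text \<open>A block with three points would be a component with three outer points. Each is fixed by
  one of the two step maps, and the walk from the first meets at most one further fixed point. An
  upper point is fixed by \<open>lower_step\<close> and a lower one by \<open>upper_step\<close>, so
  the two involutions change roles with the row of the starting point.\<close>

lemma part_mult_closed: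
  assumes \<alpha>: "\<alpha> \<in> PBc n" and \<beta>: "\<beta> \<in> PBc n"
  shows "part_mult n \<alpha> \<beta> \<in> PBc n"
proof -
  have two: "v = w" if "u \<in> points n" "v \<in> points n" "w \<in> points n" "(u, v) \<in> (steps \<alpha> \<beta>)\<^sup>*" "(u, w) \<in> (steps \<alpha> \<beta>)\<^sup>*" "v \<noteq> u" "w \<noteq> u"
    for u v w
  proof -
    have fixed: "upper_step \<alpha> x = x \<or> lower_step \<beta> x = x" if "x \<in> points n" for x
      using that by (cases x) simp_all
    show ?thesis
    proof (cases "lower_step \<beta> u = u")
      case True
      show ?thesis
        using fixed_points_of_component[OF upper_step_invol[OF \<alpha>] lower_step_invol[OF \<beta>] True that(4,5)[unfolded steps_def]
            fixed[OF that(2)] fixed[OF that(3)] that(6,7)] .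
    next
      case False
      then have u: "upper_step \<alpha> u = u" using fixed that(1) by blast
      have swap: "upper_step \<alpha> x = x \<or> lower_step \<beta> x = x \<Longrightarrow> lower_step \<beta> x = x \<or> upper_step \<alpha> x = x" for x
        by blast
      show ?thesis
        using fixed_points_of_component[OF lower_step_invol[OF \<beta>] upper_step_invol[OF \<alpha>] u _ _
            swap[OF fixed[OF that(2)]] swap[OF fixed[OF that(3)]] that(6,7)] that(4,5)[unfolded steps_def]
        by (simp only: Un_commute)
    qed
  qed
  have "card B \<le> 2" if B: "B \<in> part_mult n \<alpha> \<beta>" for B
  proof (rule ccontr)
    assume "\<not> card B \<le> 2"
    then obtain C where "C \<subseteq> B" "card C = 3"
      by (metis not_less_eq_eq numeral_2_eq_2 numeral_3_eq_3 obtain_subset_with_card_n)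
    moreover then obtain u v w where "C = {u, v, w}" "u \<noteq> v" "v \<noteq> w" "u \<noteq> w"
      by (metis card_3_iff)
    ultimately have uvw: "u \<in> B" "v \<in> B" "w \<in> B" "v \<noteq> u" "w \<noteq> u" "v \<noteq> w" by auto
    then have blk: "(u, v) \<in> same_block (part_mult n \<alpha> \<beta>)" "(u, w) \<in> same_block (part_mult n \<alpha> \<beta>)"
      using B by (auto simp: same_block_def)
    then show False
      using blk two[of u v w] uvw(4-6)
      unfolding same_block_part_mult product_edges_rtrancl[OF \<alpha> \<beta>] by blast
  qed
  then show ?thesis using part_mult_partition by (simp add: PB_carrier)
qed

lemma mult_closed [simp]: "\<alpha> \<in> PBc n \<Longrightarrow> \<beta> \<in> PBc n \<Longrightarrow> \<alpha> \<otimes>\<^bsub>PB n\<^esub> \<beta> \<in> PBc n"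
  by (simp add: PB_mult part_mult_closed)

text \<open>A set closed under both steps contains the component of \<open>u\<close>, so its outer
  points are the only candidates for the partner. The path to \<open>v\<close> shows that
  \<open>u\<close> is not left single when \<open>v\<close> differs from it; \<open>v\<close> may
  also be \<open>u\<close> itself.\<close>

lemma mate_multI:
  assumes \<alpha>: "\<alpha> \<in> PBc n" and \<beta>: "\<beta> \<in> PBc n" and uv: "u \<in> points n" "v \<in> points n"
    and closed: "\<And>x. x \<in> X \<Longrightarrow> upper_step \<alpha> x \<in> X \<and> lower_step \<beta> x \<in> X"
    and X: "u \<in> X" "X \<inter> points n \<subseteq> {u, v}"
    and conn: "(u, v) \<in> (steps \<alpha> \<beta>)\<^sup>*"
  shows "mate (\<alpha> \<otimes>\<^bsub>PB n\<^esub> \<beta>) u = v"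
proof -
  have X': "w \<in> X" if "(u, w) \<in> (steps \<alpha> \<beta>)\<^sup>*" for w
    using that
  proof (induction rule: rtrancl_induct)
    case (step x y)
    then show ?case using closed[of x] by (auto simp: steps_def)
  qed (rule X(1))
  have blk: "(x, y) \<in> (steps \<alpha> \<beta>)\<^sup>* \<longleftrightarrow> y = x \<or> y = mate (\<alpha> \<otimes>\<^bsub>PB n\<^esub> \<beta>) x"
    if "x \<in> points n" "y \<in> points n" for x y
    using same_block_part_mult[of n \<alpha> \<beta>] same_block_iff[OF part_mult_closed[OF \<alpha> \<beta>]] that
    unfolding product_edges_rtrancl[OF \<alpha> \<beta>] PB_mult by blast
  let ?w = "mate (\<alpha> \<otimes>\<^bsub>PB n\<^esub> \<beta>) u"
  have w: "?w \<in> points n" using uv \<alpha> \<beta> by simp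
  then have "?w \<in> {u, v}" using blk[OF uv(1) w] X' X by blast
  moreover have "v = u \<or> v = ?w" using blk[OF uv] conn by blast
  ultimately show ?thesis by auto
qed

section \<open>The product\<close>

lemma mate_moved_points:
  assumes "\<alpha> \<in> PBc n" "mate \<alpha> u = v" "u \<noteq> v"
  shows "u \<in> points n" "v \<in> points n"
  using assms mate_outside mate_points by metis+

text \<open>This rule and the next four list the path shapes that are followed explicitly: staying
  above, passing through, turning back, ending in the middle row, and zigzagging. The set
  \<open>X\<close> in each proof is the vertex set of the path.\<close>

lemma mate_mult_Up_Up:
  assumes \<alpha>: "\<alpha> \<in> PBc n" and \<beta>: "\<beta> \<in> PBc n" and "mate \<alpha> (Up i) = Up j"
  shows "mate (\<alpha> \<otimes>\<^bsub>PB n\<^esub> \<beta>) (Up i) = Up j"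
proof (cases "Up i \<in> points n")
  case True
  have *: "mate \<alpha> (Up j) = Up i" using assms(3) mate_sym[OF \<alpha>] by blast
  have "Up j \<in> points n" using True assms(3) mate_points[OF \<alpha>] by metis
  moreover have "(Up i, Up j) \<in> (steps \<alpha> \<beta>)\<^sup>*"
    using steps_upper[of "Up i" \<alpha> \<beta>] assms(3) by simp
  ultimately show ?thesis
    using True * assms(3) by (intro mate_multI[OF \<alpha> \<beta>, where X = "{Up i, Up j}"]) auto
next
  case False
  then show ?thesis using mate_outside[OF \<alpha> False] mate_outside[OF mult_closed[OF \<alpha> \<beta>] False] assms(3) by simp
qed

lemma mate_mult_Up_Dn:
  assumes \<alpha>: "\<alpha> \<in> PBc n" and \<beta>: "\<beta> \<in> PBc n"
    and s: "mate \<alpha> (Up i) = Dn m" "mate \<beta> (Up m) = Dn j"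
  shows "mate (\<alpha> \<otimes>\<^bsub>PB n\<^esub> \<beta>) (Up i) = Dn j"
proof -
  have *: "mate \<alpha> (Dn m) = Up i" "mate \<beta> (Dn j) = Up m"
    using s mate_sym[OF \<alpha>] mate_sym[OF \<beta>] by blast+
  have p: "Up i \<in> points n" "Dn j \<in> points n"
    using mate_moved_points[OF \<alpha> s(1)] mate_moved_points[OF \<beta> s(2)] by blast+
  have "(Up i, Mid m) \<in> (steps \<alpha> \<beta>)\<^sup>*" "(Mid m, Dn j) \<in> (steps \<alpha> \<beta>)\<^sup>*"
    using steps_upper[of "Up i" \<alpha> \<beta>] steps_lower[of "Mid m" \<beta> \<alpha>] s by simp_all
  then have "(Up i, Dn j) \<in> (steps \<alpha> \<beta>)\<^sup>*" by (rule rtrancl_trans)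
  then show ?thesis
    using p * s by (intro mate_multI[OF \<alpha> \<beta>, where X = "{Up i, Mid m, Dn j}"]) auto
qed

lemma mate_mult_Up_turn:
  assumes \<alpha>: "\<alpha> \<in> PBc n" and \<beta>: "\<beta> \<in> PBc n"
    and s: "mate \<alpha> (Up i) = Dn m" "mate \<beta> (Up m) = Up m'" "mate \<alpha> (Dn m') = Up j"
  shows "mate (\<alpha> \<otimes>\<^bsub>PB n\<^esub> \<beta>) (Up i) = Up j"
proof -
  have *: "mate \<alpha> (Dn m) = Up i" "mate \<beta> (Up m') = Up m" "mate \<alpha> (Up j) = Dn m'"
    using s mate_sym[OF \<alpha>] mate_sym[OF \<beta>] by blast+
  have p: "Up i \<in> points n" "Up j \<in> points n"
    using mate_moved_points[OF \<alpha> s(1)] mate_moved_points[OF \<alpha> s(3)] by blast+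
  have "(Up i, Mid m) \<in> (steps \<alpha> \<beta>)\<^sup>*" "(Mid m, Mid m') \<in> (steps \<alpha> \<beta>)\<^sup>*" "(Mid m', Up j) \<in> (steps \<alpha> \<beta>)\<^sup>*"
    using steps_upper[of "Up i" \<alpha> \<beta>] steps_lower[of "Mid m" \<beta> \<alpha>] steps_upper[of "Mid m'" \<alpha> \<beta>] s by simp_all
  then have "(Up i, Up j) \<in> (steps \<alpha> \<beta>)\<^sup>*" by (meson rtrancl_trans)
  then show ?thesis
    using p * s by (intro mate_multI[OF \<alpha> \<beta>, where X = "{Up i, Mid m, Mid m', Up j}"]) auto
qed

lemma mate_mult_Up_stuck:
  assumes \<alpha>: "\<alpha> \<in> PBc n" and \<beta>: "\<beta> \<in> PBc n"
    and s: "mate \<alpha> (Up i) = Dn m" "mate \<beta> (Up m) = Up m'" "mate \<alpha> (Dn m') = Dn m'"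
  shows "mate (\<alpha> \<otimes>\<^bsub>PB n\<^esub> \<beta>) (Up i) = Up i"
proof -
  have *: "mate \<alpha> (Dn m) = Up i" "mate \<beta> (Up m') = Up m"
    using s mate_sym[OF \<alpha>] mate_sym[OF \<beta>] by blast+
  have p: "Up i \<in> points n"
    using mate_moved_points[OF \<alpha> s(1)] by blast
  show ?thesis
    using p * s by (intro mate_multI[OF \<alpha> \<beta>, where X = "{Up i, Mid m, Mid m'}"]) auto
qed

text \<open>This is how a transversal can use an upper hook of the second factor. It makes hooks
  detectable by ranks in \<open>upper_separation\<close>.\<close>

lemma mate_mult_Up_zigzag:
  assumes \<alpha>: "\<alpha> \<in> PBc n" and \<beta>: "\<beta> \<in> PBc n"
    and s: "mate \<alpha> (Up i) = Dn m" "mate \<beta> (Up m) = Up m'" "mate \<alpha> (Dn m') = Dn m''" "mate \<beta> (Up m'') = Dn j"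
  shows "mate (\<alpha> \<otimes>\<^bsub>PB n\<^esub> \<beta>) (Up i) = Dn j"
proof -
  have *: "mate \<alpha> (Dn m) = Up i" "mate \<beta> (Up m') = Up m" "mate \<alpha> (Dn m'') = Dn m'" "mate \<beta> (Dn j) = Up m''"
    using s mate_sym[OF \<alpha>] mate_sym[OF \<beta>] by blast+
  have p: "Up i \<in> points n" "Dn j \<in> points n"
    using mate_moved_points[OF \<alpha> s(1)] mate_moved_points[OF \<beta> s(4)] by blast+
  have "(Up i, Mid m) \<in> (steps \<alpha> \<beta>)\<^sup>*" "(Mid m, Mid m') \<in> (steps \<alpha> \<beta>)\<^sup>*"
    "(Mid m', Mid m'') \<in> (steps \<alpha> \<beta>)\<^sup>*" "(Mid m'', Dn j) \<in> (steps \<alpha> \<beta>)\<^sup>*"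
    using steps_upper[of "Up i" \<alpha> \<beta>] steps_lower[of "Mid m" \<beta> \<alpha>]
      steps_upper[of "Mid m'" \<alpha> \<beta>] steps_lower[of "Mid m''" \<beta> \<alpha>] s by simp_all
  then have "(Up i, Dn j) \<in> (steps \<alpha> \<beta>)\<^sup>*" by (meson rtrancl_trans)
  then show ?thesis
    using p * s by (intro mate_multI[OF \<alpha> \<beta>, where X = "{Up i, Mid m, Mid m', Mid m'', Dn j}"]) auto
qed

text \<open>Relabelling by an injection serves two purposes: a map into numbered layers places the
  product graph inside a larger stack, and \<open>flip\<close> turns it upside down.\<close>

lemma map_same_block_mult:
  assumes "inj h"
  shows "map_prod h h ` same_block (part_mult n \<alpha> \<beta>) =
    Restr ((map_prod (h \<circ> lower_to_mid) (h \<circ> lower_to_mid) ` same_block \<alpha> \<union>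
      map_prod (h \<circ> upper_to_mid) (h \<circ> upper_to_mid) ` same_block \<beta>)\<^sup>*) (h ` points n)"
proof -
  have "map_prod (h \<circ> lower_to_mid) (h \<circ> lower_to_mid) ` same_block \<alpha> \<union>
      map_prod (h \<circ> upper_to_mid) (h \<circ> upper_to_mid) ` same_block \<beta> =
      map_prod h h ` product_edges \<alpha> \<beta>"
    by (simp add: product_edges_eq image_Un image_image map_prod_def split_beta comp_def)
  then show ?thesis
    unfolding same_block_part_mult
    by (auto simp: rtrancl_map_prod[OF assms] intro!: map_prod_imageI)
qed

section \<open>Associativity by stacking three diagrams\<close>

lemma same_block_points:
  "\<alpha> \<in> PBc n \<Longrightarrow> same_block \<alpha> \<subseteq> points n \<times> points n"
  by (auto simp: same_block_def PB_carrier partition_on_def)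

lemma map_prod_points_cong:
  assumes "\<alpha> \<in> PBc n" "\<And>u. u \<in> points n \<Longrightarrow> f u = g u"
  shows "map_prod f f ` same_block \<alpha> = map_prod g g ` same_block \<alpha>"
  by (rule image_cong) (use same_block_points[OF assms(1)] assms(2) in auto)

fun layer :: "nat \<Rightarrow> nat \<Rightarrow> nat \<Rightarrow> vertex \<Rightarrow> nat \<times> nat" where
  "layer a b c (Up i) = (a, i)"
| "layer a b c (Mid i) = (b, i)"
| "layer a b c (Dn i) = (c, i)"

text \<open>The middle argument of \<open>layer\<close> is a dummy, as the blocks of a diagram
  contain no middle points.\<close>

definition layered :: "nat \<Rightarrow> nat \<Rightarrow> vertex set set \<Rightarrow> ((nat \<times> nat) \<times> (nat \<times> nat)) set" where
  "layered a c \<alpha> = map_prod (layer a a c) (layer a a c) ` same_block \<alpha>"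

lemma inj_layer: "distinct [a, b, c] \<Longrightarrow> inj (layer a b c)"
proof (rule injI)
  fix x y assume "distinct [a, b, c]" "layer a b c x = layer a b c y"
  then show "x = y" by (cases x; cases y) auto
qed

lemma layer_points: "layer a b c ` points n = {a, c} \<times> {1..n}"
  unfolding points_def image_Un image_image by auto

lemma Field_layered: "\<alpha> \<in> PBc n \<Longrightarrow> Field (layered a c \<alpha>) \<subseteq> {a, c} \<times> {1..n}"
  using same_block_points[of \<alpha> n] by (fastforce simp: layered_def Field_def points_def)

lemma layered_mult:
  assumes d: "distinct [a, b, c]" and \<alpha>: "\<alpha> \<in> PBc n" and \<beta>: "\<beta> \<in> PBc n"
  shows "layered a c (\<alpha> \<otimes>\<^bsub>PB n\<^esub> \<beta>) = Restr ((layered a b \<alpha> \<union> layered b c \<beta>)\<^sup>*) ({a, c} \<times> {1..n})"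
proof -
  have "layered a c (\<alpha> \<otimes>\<^bsub>PB n\<^esub> \<beta>) = map_prod (layer a b c) (layer a b c) ` same_block (part_mult n \<alpha> \<beta>)"
    unfolding layered_def PB_mult
    by (rule map_prod_points_cong[OF part_mult_closed[OF \<alpha> \<beta>]]) (auto simp: points_def)
  moreover have "layered a b \<alpha> = map_prod (layer a b c \<circ> lower_to_mid) (layer a b c \<circ> lower_to_mid) ` same_block \<alpha>"
    unfolding layered_def by (rule map_prod_points_cong[OF \<alpha>]) (auto simp: points_def)
  moreover have "layered b c \<beta> = map_prod (layer a b c \<circ> upper_to_mid) (layer a b c \<circ> upper_to_mid) ` same_block \<beta>"
    unfolding layered_def by (rule map_prod_points_cong[OF \<beta>]) (auto simp: points_def)
  ultimately show ?thesis
    by (simp only: map_same_block_mult[OF inj_layer[OF d]] layer_points)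
qed

text \<open>Both bracketings are read off the graph on four layers in which the three factors are stacked.\<close>
lemma PB_assoc:
  assumes \<alpha>: "\<alpha> \<in> PBc n" and \<beta>: "\<beta> \<in> PBc n" and \<gamma>: "\<gamma> \<in> PBc n"
  shows "(\<alpha> \<otimes>\<^bsub>PB n\<^esub> \<beta>) \<otimes>\<^bsub>PB n\<^esub> \<gamma> = \<alpha> \<otimes>\<^bsub>PB n\<^esub> (\<beta> \<otimes>\<^bsub>PB n\<^esub> \<gamma>)"
proof -
  let ?l = "(\<alpha> \<otimes>\<^bsub>PB n\<^esub> \<beta>) \<otimes>\<^bsub>PB n\<^esub> \<gamma>" and ?r = "\<alpha> \<otimes>\<^bsub>PB n\<^esub> (\<beta> \<otimes>\<^bsub>PB n\<^esub> \<gamma>)"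
  let ?Y = "\<lambda>a c. {a, c::nat} \<times> {1..n}"
  let ?A = "layered 0 1 \<alpha>" and ?B = "layered 1 2 \<beta>" and ?C = "layered 2 3 \<gamma>"
  have A: "Field ?A \<subseteq> ?Y 0 1" and B: "Field ?B \<subseteq> ?Y 1 2" and C: "Field ?C \<subseteq> ?Y 2 3"
    using Field_layered \<alpha> \<beta> \<gamma> by blast+
  have AB: "Field (?A \<union> ?B) \<subseteq> ?Y 0 1 \<union> ?Y 1 2" and BC: "Field (?B \<union> ?C) \<subseteq> ?Y 1 2 \<union> ?Y 2 3"
    unfolding Field_Un by (intro Un_mono A B C)+
  have "layered 0 3 ?l = Restr ((layered 0 2 (\<alpha> \<otimes>\<^bsub>PB n\<^esub> \<beta>) \<union> ?C)\<^sup>*) (?Y 0 3)"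
    by (rule layered_mult) (use \<alpha> \<beta> \<gamma> in auto)
  also have "layered 0 2 (\<alpha> \<otimes>\<^bsub>PB n\<^esub> \<beta>) = Restr ((?A \<union> ?B)\<^sup>*) (?Y 0 2)"
    by (rule layered_mult) (use \<alpha> \<beta> \<gamma> in auto)
  also have "Restr ((Restr ((?A \<union> ?B)\<^sup>*) (?Y 0 2) \<union> ?C)\<^sup>*) (?Y 0 3) = Restr (((?A \<union> ?B) \<union> ?C)\<^sup>*) (?Y 0 3)"
    by (rule rtrancl_glue[OF AB C]) auto
  finally have l: "layered 0 3 ?l = Restr (((?A \<union> ?B) \<union> ?C)\<^sup>*) (?Y 0 3)" .
  have "layered 0 3 ?r = Restr ((?A \<union> layered 1 3 (\<beta> \<otimes>\<^bsub>PB n\<^esub> \<gamma>))\<^sup>*) (?Y 0 3)"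
    by (rule layered_mult) (use \<alpha> \<beta> \<gamma> in auto)
  also have "?A \<union> layered 1 3 (\<beta> \<otimes>\<^bsub>PB n\<^esub> \<gamma>) = Restr ((?B \<union> ?C)\<^sup>*) (?Y 1 3) \<union> ?A"
    by (subst layered_mult[of 1 2 3]) (use \<alpha> \<beta> \<gamma> in auto)
  also have "Restr ((Restr ((?B \<union> ?C)\<^sup>*) (?Y 1 3) \<union> ?A)\<^sup>*) (?Y 0 3) = Restr (((?B \<union> ?C) \<union> ?A)\<^sup>*) (?Y 0 3)"
    by (rule rtrancl_glue[OF BC A]) auto
  finally have r: "layered 0 3 ?r = Restr (((?A \<union> ?B) \<union> ?C)\<^sup>*) (?Y 0 3)"
    by (simp only: Un_ac)
  have inj: "inj (layer 0 1 3)" by (rule inj_layer) simp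
  have eq: "map_prod (layer 0 1 3) (layer 0 1 3) ` same_block \<delta> = layered 0 3 \<delta>" if "\<delta> \<in> PBc n" for \<delta>
    unfolding layered_def by (rule map_prod_points_cong[OF that]) (auto simp: points_def)
  have "map_prod (layer 0 1 3) (layer 0 1 3) ` same_block ?l = map_prod (layer 0 1 3) (layer 0 1 3) ` same_block ?r"
    using \<alpha> \<beta> \<gamma> by (simp only: eq mult_closed l r)
  then have "same_block ?l = same_block ?r"
    using prod.inj_map[OF inj inj] by (simp only: inj_image_eq_iff)
  moreover have "partition_on (points n) ?l" "partition_on (points n) ?r"
    by (simp_all only: PB_mult part_mult_partition)
  ultimately show ?thesis by (simp add: partition_eq_iff)
qed

section \<open>The reflection of diagrams\<close>

lemma flip_flip [simp]: "flip (flip u) = u"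
  by (cases u) auto

lemma flip_points [simp]: "flip u \<in> points n \<longleftrightarrow> u \<in> points n"
  by (cases u) auto

lemma inj_flip: "inj flip"
  by (metis flip_flip injI)

lemma flip_eq_iff [simp]: "flip u = flip v \<longleftrightarrow> u = v"
  using inj_flip by (auto dest: injD)

lemma star_star [simp]: "star (star \<alpha>) = \<alpha>"
  by (simp add: star_def image_image)

lemma flip_image_points: "flip ` points n = points n"
proof (intro equalityI subsetI)
  fix u assume "u \<in> points n"
  then have "flip (flip u) \<in> flip ` points n" by (intro imageI) simp
  then show "u \<in> flip ` points n" by simp
qed auto

lemma star_closed [simp]:
  assumes "\<alpha> \<in> PBc n"
  shows "star \<alpha> \<in> PBc n"
proof -
  have "{} \<notin> (`) flip ` \<alpha>" using assms by (auto simp: PB_carrier partition_on_def)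
  moreover have "inj_on flip (points n)" using inj_flip inj_on_subset by blast
  ultimately have "partition_on (points n) (star \<alpha>)"
    using partition_on_inj_image[of "points n" \<alpha> flip] assms
    by (simp add: star_def PB_carrier flip_image_points)
  moreover have "card (flip ` B) = card B" for B
    using inj_flip inj_on_subset by (metis card_image subset_UNIV)
  ultimately show ?thesis using assms by (auto simp: PB_carrier star_def)
qed

lemma star_PB_iff [simp]: "star \<alpha> \<in> PBc n \<longleftrightarrow> \<alpha> \<in> PBc n"
  using star_closed star_star by metis

lemma mate_star:
  assumes "\<alpha> \<in> PBc n"
  shows "mate (star \<alpha>) u = flip (mate \<alpha> (flip u))"
proof (cases "u \<in> points n")
  case True
  then have "{flip u, mate \<alpha> (flip u)} \<in> \<alpha>" using mate_block[OF assms] by simp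
  then have "flip ` {flip u, mate \<alpha> (flip u)} \<in> star \<alpha>" unfolding star_def by (rule imageI)
  then show ?thesis using mate_eqI[OF star_closed[OF assms]] by simp
next
  case False
  then show ?thesis using mate_outside assms by simp
qed

lemma same_block_star: "same_block (star \<alpha>) = map_prod flip flip ` same_block \<alpha>"
  unfolding same_block_def star_def by (auto intro!: map_prod_imageI)

text \<open>Turning the product graph upside down exchanges the roles of the two factors and fixes
  the middle row. This anti-automorphism yields the lower version of each statement proved for upper
  points.\<close>

lemma star_mult:
  assumes \<alpha>: "\<alpha> \<in> PBc n" and \<beta>: "\<beta> \<in> PBc n"
  shows "star (\<alpha> \<otimes>\<^bsub>PB n\<^esub> \<beta>) = star \<beta> \<otimes>\<^bsub>PB n\<^esub> star \<alpha>"
proof -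
  have "same_block (star (part_mult n \<alpha> \<beta>)) = map_prod flip flip ` same_block (part_mult n \<alpha> \<beta>)"
    by (rule same_block_star)
  also have "\<dots> = Restr ((map_prod (flip \<circ> lower_to_mid) (flip \<circ> lower_to_mid) ` same_block \<alpha> \<union>
      map_prod (flip \<circ> upper_to_mid) (flip \<circ> upper_to_mid) ` same_block \<beta>)\<^sup>*) (flip ` points n)"
    by (rule map_same_block_mult[OF inj_flip])
  also have "map_prod (flip \<circ> lower_to_mid) (flip \<circ> lower_to_mid) ` same_block \<alpha> =
      map_prod (upper_to_mid \<circ> flip) (upper_to_mid \<circ> flip) ` same_block \<alpha>"
    by (rule map_prod_points_cong[OF \<alpha>]) (auto simp: points_def)
  also have "map_prod (flip \<circ> upper_to_mid) (flip \<circ> upper_to_mid) ` same_block \<beta> =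
      map_prod (lower_to_mid \<circ> flip) (lower_to_mid \<circ> flip) ` same_block \<beta>"
    by (rule map_prod_points_cong[OF \<beta>]) (auto simp: points_def)
  also have "map_prod (upper_to_mid \<circ> flip) (upper_to_mid \<circ> flip) ` same_block \<alpha> \<union>
      map_prod (lower_to_mid \<circ> flip) (lower_to_mid \<circ> flip) ` same_block \<beta> = product_edges (star \<beta>) (star \<alpha>)"
    by (simp add: product_edges_eq same_block_star image_image map_prod_def split_beta comp_def Un_commute)
  finally have "same_block (star (part_mult n \<alpha> \<beta>)) = same_block (part_mult n (star \<beta>) (star \<alpha>))"
    by (simp only: same_block_part_mult flip_image_points)
  moreover have "partition_on (points n) (star (part_mult n \<alpha> \<beta>))"
    using star_closed[OF part_mult_closed[OF \<alpha> \<beta>]] by (simp add: PB_carrier)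
  ultimately show ?thesis
    using partition_eq_iff[OF _ part_mult_partition] by (simp add: PB_mult)
qed

lemma mate_mult_Dn:
  assumes "\<alpha> \<in> PBc n" "\<beta> \<in> PBc n"
  shows "mate (\<alpha> \<otimes>\<^bsub>PB n\<^esub> \<beta>) (Dn i) = flip (mate (star \<beta> \<otimes>\<^bsub>PB n\<^esub> star \<alpha>) (Up i))"
  using mate_star[of "star (\<alpha> \<otimes>\<^bsub>PB n\<^esub> \<beta>)" n "Dn i"] assms by (simp add: star_mult)

lemma mate_mult_Dn_Dn:
  assumes "\<alpha> \<in> PBc n" "\<beta> \<in> PBc n" "mate \<beta> (Dn i) = Dn j"
  shows "mate (\<alpha> \<otimes>\<^bsub>PB n\<^esub> \<beta>) (Dn i) = Dn j"
  using assms by (simp add: mate_mult_Dn mate_mult_Up_Up[where j = j] mate_star)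

lemma mate_mult_Dn_Up:
  assumes "\<alpha> \<in> PBc n" "\<beta> \<in> PBc n" "mate \<beta> (Dn i) = Up m" "mate \<alpha> (Dn m) = Up j"
  shows "mate (\<alpha> \<otimes>\<^bsub>PB n\<^esub> \<beta>) (Dn i) = Up j"
  using assms by (simp add: mate_mult_Dn mate_mult_Up_Dn[where j = j and m = m] mate_star)

lemma mate_mult_Dn_turn:
  assumes "\<alpha> \<in> PBc n" "\<beta> \<in> PBc n" "mate \<beta> (Dn i) = Up m" "mate \<alpha> (Dn m) = Dn m'" "mate \<beta> (Up m') = Dn j"
  shows "mate (\<alpha> \<otimes>\<^bsub>PB n\<^esub> \<beta>) (Dn i) = Dn j"
  using assms by (simp add: mate_mult_Dn mate_mult_Up_turn[where j = j and m = m and m' = m'] mate_star)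

lemma mate_mult_Dn_stuck:
  assumes "\<alpha> \<in> PBc n" "\<beta> \<in> PBc n" "mate \<beta> (Dn i) = Up m" "mate \<alpha> (Dn m) = Dn m'" "mate \<beta> (Up m') = Up m'"
  shows "mate (\<alpha> \<otimes>\<^bsub>PB n\<^esub> \<beta>) (Dn i) = Dn i"
  using assms by (simp add: mate_mult_Dn mate_mult_Up_stuck[where m = m and m' = m'] mate_star)

section \<open>Rank and factorization\<close>

definition pdom :: "vertex set set \<Rightarrow> nat set" where
  "pdom \<alpha> = {i. \<exists>j. mate \<alpha> (Up i) = Dn j}"

definition pcod :: "vertex set set \<Rightarrow> nat set" where
  "pcod \<alpha> = {j. \<exists>i. mate \<alpha> (Dn j) = Up i}"

text \<open>This is \<R>-relatedness in terms of diagrams: the same domain and the same upper blocks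
  that are not transversals, wherever the transversals end.\<close>

definition upper_eq :: "vertex set set \<Rightarrow> vertex set set \<Rightarrow> bool" where
  "upper_eq \<alpha> \<beta> \<longleftrightarrow> (\<forall>i. mate \<alpha> (Up i) = mate \<beta> (Up i) \<or> i \<in> pdom \<alpha> \<and> i \<in> pdom \<beta>)"

definition lower_eq :: "vertex set set \<Rightarrow> vertex set set \<Rightarrow> bool" where
  "lower_eq \<alpha> \<beta> \<longleftrightarrow> upper_eq (star \<alpha>) (star \<beta>)"

locale partial_brauer =
  fixes n :: nat
begin

abbreviation carr :: "vertex set set set" where
  "carr \<equiv> PBc n"

abbreviation mul :: "vertex set set \<Rightarrow> vertex set set \<Rightarrow> vertex set set" (infixl \<open>\<cdot>\<close> 70) where
  "\<alpha> \<cdot> \<beta> \<equiv> \<alpha> \<otimes>\<^bsub>PB n\<^esub> \<beta>"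

abbreviation e :: "nat \<Rightarrow> vertex set set" where
  "e q \<equiv> bar n q id"

lemma mul_assoc: "\<lbrakk>\<alpha> \<in> carr; \<beta> \<in> carr; \<gamma> \<in> carr\<rbrakk> \<Longrightarrow> \<alpha> \<cdot> \<beta> \<cdot> \<gamma> = \<alpha> \<cdot> (\<beta> \<cdot> \<gamma>)"
  by (rule PB_assoc)

lemma flip_eq_simps [simp]: "flip u = Up i \<longleftrightarrow> u = Dn i" "flip u = Dn i \<longleftrightarrow> u = Up i"
  by (cases u; simp)+

lemmas mate_star_n = mate_star[where n = n]

lemma pcod_star: "\<alpha> \<in> carr \<Longrightarrow> pcod \<alpha> = pdom (star \<alpha>)"
  by (simp add: pdom_def pcod_def mate_star_n)

lemma pdom_star: "\<alpha> \<in> carr \<Longrightarrow> pcod (star \<alpha>) = pdom \<alpha>"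
  by (simp add: pdom_def pcod_def mate_star_n)

lemma mate_Up_cases:
  assumes "\<alpha> \<in> carr"
  obtains j where "mate \<alpha> (Up i) = Up j" | j where "mate \<alpha> (Up i) = Dn j"
  using mate_UpDn_not_Mid[OF assms] by (metis vertex.exhaust)

lemma mate_Dn_cases:
  assumes "\<alpha> \<in> carr"
  obtains j where "mate \<alpha> (Dn i) = Up j" | j where "mate \<alpha> (Dn i) = Dn j"
  using mate_UpDn_not_Mid[OF assms] by (metis vertex.exhaust)

lemma pdom_range:
  assumes "\<alpha> \<in> carr"
  shows "pdom \<alpha> \<subseteq> {1..n}"
proof
  fix i assume "i \<in> pdom \<alpha>"
  then obtain j where "mate \<alpha> (Up i) = Dn j" by (auto simp: pdom_def)
  then show "i \<in> {1..n}" using mate_moved_points(1)[OF assms, of "Up i"] by simp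
qed

lemma finite_dom: "\<alpha> \<in> carr \<Longrightarrow> finite (pdom \<alpha>)"
  using pdom_range finite_subset by blast

lemma rank_eq_dom:
  assumes "\<alpha> \<in> carr"
  shows "rank \<alpha> = card (pdom \<alpha>)"
proof -
  have "{B \<in> \<alpha>. (\<exists>i. Up i \<in> B) \<and> (\<exists>j. Dn j \<in> B)} = (\<lambda>i. {Up i, mate \<alpha> (Up i)}) ` pdom \<alpha>"
  proof (intro equalityI subsetI)
    fix B assume "B \<in> {B \<in> \<alpha>. (\<exists>i. Up i \<in> B) \<and> (\<exists>j. Dn j \<in> B)}"
    then obtain i j where B: "B \<in> \<alpha>" "Up i \<in> B" "Dn j \<in> B" by blast
    then obtain v where "B = {Up i, v}" using block_pair assms by blast
    then have "B = {Up i, Dn j}" using B by auto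
    moreover then have "mate \<alpha> (Up i) = Dn j" using mate_eqI assms B by blast
    ultimately show "B \<in> (\<lambda>i. {Up i, mate \<alpha> (Up i)}) ` pdom \<alpha>" by (auto simp: pdom_def)
  next
    fix B assume "B \<in> (\<lambda>i. {Up i, mate \<alpha> (Up i)}) ` pdom \<alpha>"
    then obtain i j where i: "i \<in> pdom \<alpha>" "B = {Up i, mate \<alpha> (Up i)}" "mate \<alpha> (Up i) = Dn j"
      by (auto simp: pdom_def)
    then have "B \<in> \<alpha>" using pdom_range[OF assms] mate_block[OF assms, of "Up i"] by auto
    then show "B \<in> {B \<in> \<alpha>. (\<exists>i. Up i \<in> B) \<and> (\<exists>j. Dn j \<in> B)}" using i by auto
  qed
  moreover have "inj_on (\<lambda>i. {Up i, mate \<alpha> (Up i)}) (pdom \<alpha>)"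
    by (rule inj_onI) (auto simp: pdom_def doubleton_eq_iff)
  ultimately show ?thesis by (simp add: rank_def card_image)
qed

lemma rank_star [simp]: "rank (star \<alpha>) = rank \<alpha>"
proof -
  define T where "T B \<longleftrightarrow> (\<exists>i. Up i \<in> B) \<and> (\<exists>j. Dn j \<in> B)" for B
  have "Up i \<in> flip ` B \<longleftrightarrow> Dn i \<in> B" "Dn i \<in> flip ` B \<longleftrightarrow> Up i \<in> B" for i B
    by (metis flip.simps(1,2) flip_flip image_iff)+
  then have "T (flip ` B) \<longleftrightarrow> T B" for B by (auto simp: T_def)
  then have "{B \<in> star \<alpha>. T B} = (`) flip ` {B \<in> \<alpha>. T B}" by (auto simp: star_def)
  moreover have "inj ((`) flip)"
    using inj_flip by (simp add: inj_image_eq_iff inj_def)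
  ultimately show ?thesis unfolding rank_def T_def[symmetric]
    by (simp add: card_image[OF inj_on_subset[OF _ subset_UNIV]])
qed

lemma rank_eq_cod: "\<alpha> \<in> carr \<Longrightarrow> rank \<alpha> = card (pcod \<alpha>)"
  using rank_eq_dom[of "star \<alpha>"] by (simp add: pcod_star)

lemma rank_le:
  assumes "\<alpha> \<in> carr"
  shows "rank \<alpha> \<le> n"
  using card_mono[OF _ pdom_range[OF assms]] rank_eq_dom[OF assms] by simp

lemma pdom_mult:
  assumes "\<alpha> \<in> carr" "\<beta> \<in> carr"
  shows "pdom (\<alpha> \<cdot> \<beta>) \<subseteq> pdom \<alpha>"
proof
  fix i assume "i \<in> pdom (\<alpha> \<cdot> \<beta>)"
  then obtain j where "mate (\<alpha> \<cdot> \<beta>) (Up i) = Dn j" by (auto simp: pdom_def)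
  then show "i \<in> pdom \<alpha>"
    using mate_mult_Up_Up[OF assms] by (metis (mono_tags, lifting) pdom_def mate_Up_cases[OF assms(1)] mem_Collect_eq vertex.distinct(3))
qed

lemma pcod_mult:
  assumes "\<alpha> \<in> carr" "\<beta> \<in> carr"
  shows "pcod (\<alpha> \<cdot> \<beta>) \<subseteq> pcod \<beta>"
  using pdom_mult[of "star \<beta>" "star \<alpha>"] assms by (simp add: pcod_star star_mult)

lemma rank_mult_le1: "\<alpha> \<in> carr \<Longrightarrow> \<beta> \<in> carr \<Longrightarrow> rank (\<alpha> \<cdot> \<beta>) \<le> rank \<alpha>"
  by (simp add: rank_eq_dom card_mono pdom_mult finite_dom)

lemma rank_mult_le2:
  assumes "\<alpha> \<in> carr" "\<beta> \<in> carr" shows "rank (\<alpha> \<cdot> \<beta>) \<le> rank \<beta>"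
  using rank_mult_le1[of "star \<beta>" "star \<alpha>"] assms by (simp flip: star_mult)

text \<open>Partial identities with arbitrary domain. Those with domain \<open>{1..q}\<close> are
  the \<open>e q\<close>; the others serve as probes that cut selected transversals.\<close>

definition pid :: "nat set \<Rightarrow> vertex set set" where
  "pid A = pairs n (\<lambda>u. case u of Up i \<Rightarrow> if i \<in> A then Dn i else Up i
     | Dn i \<Rightarrow> if i \<in> A then Up i else Dn i | Mid i \<Rightarrow> Mid i)"

lemma pid_pairing:
  "pairing n (\<lambda>u. case u of Up i \<Rightarrow> if i \<in> A then Dn i else Up i
     | Dn i \<Rightarrow> if i \<in> A then Up i else Dn i | Mid i \<Rightarrow> Mid i)"
  by (auto simp: pairing_def points_def)

lemma pid_closed [simp]: "pid A \<in> carr"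
  unfolding pid_def by (rule pairs_PB[OF pid_pairing])

lemma mate_pid [simp]:
  "mate (pid A) (Up i) = (if i \<in> A \<inter> {1..n} then Dn i else Up i)"
  "mate (pid A) (Dn i) = (if i \<in> A \<inter> {1..n} then Up i else Dn i)"
proof -
  have "mate (pid A) (Up i) = (if i \<in> A then Dn i else Up i)" "mate (pid A) (Dn i) = (if i \<in> A then Up i else Dn i)"
    if "i \<in> {1..n}"
    using mate_pairs[OF pid_pairing[of A]] that unfolding pid_def by auto
  then show "mate (pid A) (Up i) = (if i \<in> A \<inter> {1..n} then Dn i else Up i)"
    "mate (pid A) (Dn i) = (if i \<in> A \<inter> {1..n} then Up i else Dn i)"
    using mate_outside[OF pid_closed[of A], of "Up i"] mate_outside[OF pid_closed[of A], of "Dn i"]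
    by (cases "i \<in> {1..n}"; auto)+
qed

lemma pdom_pid [simp]: "pdom (pid A) = A \<inter> {1..n}"
  by (auto simp: pdom_def)

lemma star_pid [simp]: "star (pid A) = pid A"
  by (rule PB_eqI_UpDn[of _ n]) (simp_all add: mate_star_n)

lemma pairing_bar:
  assumes "\<sigma> permutes {1..q}" "q \<le> n"
  shows "pairing n (\<lambda>u. case u of Up i \<Rightarrow> if i \<in> {1..q} then Dn (\<sigma> i) else Up i
     | Dn i \<Rightarrow> if i \<in> {1..q} then Up (inv' \<sigma> i) else Dn i | Mid i \<Rightarrow> Mid i)" (is "pairing n ?f")
  unfolding pairing_def
proof
  fix u assume "u \<in> points n"
  moreover have "\<sigma> i \<in> {1..q} \<longleftrightarrow> i \<in> {1..q}" "inv' \<sigma> i \<in> {1..q} \<longleftrightarrow> i \<in> {1..q}" for i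
    using permutes_in_image[OF assms(1)] permutes_in_image[OF permutes_inv[OF assms(1)]] by auto
  ultimately show "?f u \<in> points n \<and> ?f (?f u) = u"
    using assms(2) permutes_inverses[OF assms(1)]
    by (cases u) (simp_all, (meson le_trans)+)
qed

lemma bar_eq_pairs:
  assumes "\<sigma> permutes {1..q}" "q \<le> n"
  shows "bar n q \<sigma> = pairs n (\<lambda>u. case u of Up i \<Rightarrow> if i \<in> {1..q} then Dn (\<sigma> i) else Up i
     | Dn i \<Rightarrow> if i \<in> {1..q} then Up (inv' \<sigma> i) else Dn i | Mid i \<Rightarrow> Mid i)" (is "_ = pairs n ?f")
proof (intro equalityI subsetI)
  fix B assume "B \<in> bar n q \<sigma>"
  then consider i where "i \<in> {1..q}" "B = {Up i, Dn (\<sigma> i)}" | i where "i \<in> {q+1..n}" "B = {Up i}"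
    | i where "i \<in> {q+1..n}" "B = {Dn i}" unfolding bar_def by blast
  then show "B \<in> pairs n ?f"
  proof cases
    case 1
    then show ?thesis using assms unfolding pairs_def by (intro image_eqI[of _ _ "Up i"]) auto
  next
    case 2
    then show ?thesis using assms unfolding pairs_def by (intro image_eqI[of _ _ "Up i"]) auto
  next
    case 3
    then show ?thesis using assms unfolding pairs_def by (intro image_eqI[of _ _ "Dn i"]) auto
  qed
next
  fix B assume "B \<in> pairs n ?f"
  then obtain u where u: "u \<in> points n" "B = {u, ?f u}" by (auto simp: pairs_def)
  then consider i where "i \<in> {1..n}" "u = Up i" | i where "i \<in> {1..n}" "u = Dn i"
    by (auto simp: points_def)
  then show "B \<in> bar n q \<sigma>"
  proof cases
    case 1
    then show ?thesis using u by (auto simp: bar_def)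
  next
    case (2 i)
    show ?thesis
    proof (cases "i \<le> q")
      case True
      then have i: "inv' \<sigma> i \<in> {1..q}" "\<sigma> (inv' \<sigma> i) = i"
        using 2 permutes_in_image[OF permutes_inv[OF assms(1)]] permutes_inverses[OF assms(1)] by auto
      have "B = {Up (inv' \<sigma> i), Dn (\<sigma> (inv' \<sigma> i))}" using 2 u True i by auto
      then show ?thesis using i(1) unfolding bar_def by blast
    qed (use 2 u in \<open>auto simp: bar_def\<close>)
  qed
qed

lemma bar_closed [simp]: "\<sigma> permutes {1..q} \<Longrightarrow> q \<le> n \<Longrightarrow> bar n q \<sigma> \<in> carr"
  by (simp add: bar_eq_pairs pairs_PB[OF pairing_bar])

lemma mate_bar:
  assumes "\<sigma> permutes {1..q}" "q \<le> n"
  shows "mate (bar n q \<sigma>) (Up i) = (if i \<in> {1..q} then Dn (\<sigma> i) else Up i)"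
    "mate (bar n q \<sigma>) (Dn i) = (if i \<in> {1..q} then Up (inv' \<sigma> i) else Dn i)"
proof -
  have "mate (bar n q \<sigma>) (Up i) = (if i \<in> {1..q} then Dn (\<sigma> i) else Up i)"
    "mate (bar n q \<sigma>) (Dn i) = (if i \<in> {1..q} then Up (inv' \<sigma> i) else Dn i)" if "i \<in> {1..n}"
    using mate_pairs[OF pairing_bar[OF assms]] that bar_eq_pairs[OF assms] by auto
  then show "mate (bar n q \<sigma>) (Up i) = (if i \<in> {1..q} then Dn (\<sigma> i) else Up i)"
    "mate (bar n q \<sigma>) (Dn i) = (if i \<in> {1..q} then Up (inv' \<sigma> i) else Dn i)"
    using mate_outside[OF bar_closed[OF assms], of "Up i"] mate_outside[OF bar_closed[OF assms], of "Dn i"] assms(2)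
    by (cases "i \<in> {1..n}"; auto)+
qed

lemma e_eq_pid: "q \<le> n \<Longrightarrow> e q = pid {1..q}"
  by (rule PB_eqI_UpDn[of _ n]) (auto simp: mate_bar permutes_id)

lemma e_closed [simp]: "q \<le> n \<Longrightarrow> e q \<in> carr"
  by (simp add: permutes_id)

lemma star_e [simp]: "q \<le> n \<Longrightarrow> star (e q) = e q"
  by (simp add: e_eq_pid)

lemma mate_e [simp]:
  "q \<le> n \<Longrightarrow> mate (e q) (Up i) = (if i \<in> {1..q} then Dn i else Up i)"
  "q \<le> n \<Longrightarrow> mate (e q) (Dn i) = (if i \<in> {1..q} then Up i else Dn i)"
  by (simp_all add: mate_bar permutes_id)

text \<open>Diagrams compose from left to right and functions from right to left, so
  \<open>bar\<close> reverses products. Normal subgroups are unaffected, but the order matters in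
  every explicit computation below.\<close>

lemma bar_mult:
  assumes "\<sigma> permutes {1..q}" "\<tau> permutes {1..q}" "q \<le> n"
  shows "bar n q \<sigma> \<cdot> bar n q \<tau> = bar n q (\<tau> \<circ> \<sigma>)"
proof (rule PB_eqI_UpDn[of _ n])
  have p: "\<tau> \<circ> \<sigma> permutes {1..q}" using assms by (simp add: permutes_compose)
  show c: "bar n q \<sigma> \<cdot> bar n q \<tau> \<in> carr" "bar n q (\<tau> \<circ> \<sigma>) \<in> carr" using assms p by auto
  have b: "bar n q \<sigma> \<in> carr" "bar n q \<tau> \<in> carr" using assms by auto
  have inv: "inv' (\<tau> \<circ> \<sigma>) = inv' \<sigma> \<circ> inv' \<tau>" using assms by (meson o_inv_distrib permutes_bij)
  fix i
  show "mate (bar n q \<sigma> \<cdot> bar n q \<tau>) (Up i) = mate (bar n q (\<tau> \<circ> \<sigma>)) (Up i)"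
    using assms permutes_in_image[OF assms(1), of i]
    by (cases "i \<in> {1..q}")
      (simp_all add: mate_mult_Up_Dn[OF b, of _ "\<sigma> i"] mate_mult_Up_Up[OF b] mate_bar mate_bar[OF p])
  show "mate (bar n q \<sigma> \<cdot> bar n q \<tau>) (Dn i) = mate (bar n q (\<tau> \<circ> \<sigma>)) (Dn i)"
    using assms permutes_in_image[OF permutes_inv[OF assms(2)], of i]
    by (cases "i \<in> {1..q}")
      (simp_all add: mate_mult_Dn_Up[OF b, of _ "inv' \<tau> i"] mate_mult_Dn_Dn[OF b] mate_bar mate_bar[OF p] inv)
qed

lemma star_bar:
  assumes "\<sigma> permutes {1..q}" "q \<le> n"
  shows "star (bar n q \<sigma>) = bar n q (inv' \<sigma>)"
  by (rule PB_eqI_UpDn[of _ n])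
    (use assms permutes_inv[OF assms(1)] in \<open>auto simp: mate_star_n mate_bar permutes_inv_inv\<close>)

lemma pdom_bar: "\<sigma> permutes {1..q} \<Longrightarrow> q \<le> n \<Longrightarrow> pdom (bar n q \<sigma>) = {1..q}"
  by (auto simp: pdom_def mate_bar split: if_splits)

lemma rank_bar: "\<sigma> permutes {1..q} \<Longrightarrow> q \<le> n \<Longrightarrow> rank (bar n q \<sigma>) = q"
  by (simp add: rank_eq_dom pdom_bar)

lemma rank_e [simp]: "q \<le> n \<Longrightarrow> rank (e q) = q"
  by (simp add: rank_bar permutes_id)

lemma pdom_e [simp]: "q \<le> n \<Longrightarrow> pdom (e q) = {1..q}"
  by (simp add: pdom_bar permutes_id)

lemma pcod_e [simp]: "q \<le> n \<Longrightarrow> pcod (e q) = {1..q}"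
  by (simp add: pcod_star)

lemma pid_mult: "pid A \<cdot> pid B = pid (A \<inter> B)"
proof (rule PB_eqI_UpDn[of _ n])
  fix i
  have "mate (pid A \<cdot> pid B) (Up i) = mate (pid (A \<inter> B)) (Up i)" for A B
    by (cases "i \<in> A \<inter> {1..n}"; cases "i \<in> B")
      (auto simp: mate_mult_Up_Dn[OF pid_closed pid_closed, of _ _ i]
        mate_mult_Up_turn[OF pid_closed pid_closed, of _ _ i _ i] mate_mult_Up_Up[OF pid_closed pid_closed])
  note Up = this
  then show "mate (pid A \<cdot> pid B) (Up i) = mate (pid (A \<inter> B)) (Up i)" .
  show "mate (pid A \<cdot> pid B) (Dn i) = mate (pid (A \<inter> B)) (Dn i)"
    using Up[of B A] by (simp add: mate_mult_Dn)
qed auto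

lemma e_mult: "p \<le> n \<Longrightarrow> q \<le> n \<Longrightarrow> e p \<cdot> e q = e (min p q)"
proof -
  assume "p \<le> n" "q \<le> n"
  moreover have "{1..p} \<inter> {1..q} = {1..min p q}" by auto
  ultimately show ?thesis by (simp add: e_eq_pid pid_mult min_le_iff_disj)
qed

lemma one_mult [simp]: "\<alpha> \<in> carr \<Longrightarrow> e n \<cdot> \<alpha> = \<alpha>"
proof (rule PB_eqI_UpDn[of _ n])
  fix i assume a: "\<alpha> \<in> carr" and i: "1 \<le> i" "i \<le> n"
  have en: "e n \<in> carr" by simp
  show "mate (e n \<cdot> \<alpha>) (Up i) = mate \<alpha> (Up i)"
  proof (cases rule: mate_Up_cases[OF a, of i])
    case (1 j)
    then have "Up j \<in> points n" using i mate_points[OF a, of "Up i"] by simp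
    then show ?thesis using i 1 by (simp add: mate_mult_Up_turn[OF en a, of i i j j])
  next
    case (2 j)
    then show ?thesis using i by (simp add: mate_mult_Up_Dn[OF en a, of i i j])
  qed
  show "mate (e n \<cdot> \<alpha>) (Dn i) = mate \<alpha> (Dn i)"
  proof (cases rule: mate_Dn_cases[OF a, of i])
    case (1 j)
    then have "Up j \<in> points n" using i mate_points[OF a, of "Dn i"] by simp
    then show ?thesis using i 1 by (simp add: mate_mult_Dn_Up[OF en a, of i j j])
  next
    case (2 j)
    then show ?thesis by (simp add: mate_mult_Dn_Dn[OF en a, of i j])
  qed
qed auto

section \<open>Factorization through the idempotents \<open>e q\<close>\<close>

lemma pcod_eqI:
  assumes s: "s \<in> carr" "s \<cdot> e q = s" "rank s = q" and q: "q \<le> n"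
  shows "pcod s = {1..q}"
proof -
  have "pcod s \<subseteq> {1..q}" using pcod_mult[OF s(1) e_closed[OF q]] s(2) q by simp
  then show ?thesis using rank_eq_cod[OF s(1)] s(3)
    by (metis card_atLeastAtMost card_subset_eq diff_Suc_1 finite_atLeastAtMost)
qed

lemma mate_Dn_fixed:
  assumes s: "s \<in> carr" "s \<cdot> e q = s" and q: "q \<le> n" "i > q"
  shows "mate s (Dn i) = Dn i"
  using mate_mult_Dn_Dn[OF s(1) e_closed[OF q(1)], of i i] s(2) q by simp

text \<open>Absorbing \<open>e q\<close> and having full rank \<open>q\<close> forces the lower row
  of \<open>s\<close> to consist of transversal ends at 1, ..., q and singletons elsewhere. Such an
  \<open>s\<close> works as a coordinate chart with one-sided inverse \<open>star s\<close>.\<close>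

lemma star_cancel:
  assumes s: "s \<in> carr" "s \<cdot> e q = s" "rank s = q" and q: "q \<le> n"
  shows "star s \<cdot> s = e q"
proof (rule PB_eqI_UpDn[of _ n])
  have c: "star s \<in> carr" using s by simp
  fix i
  have "mate (star s \<cdot> s) (Up i) = mate (e q) (Up i) \<and> mate (star s \<cdot> s) (Dn i) = mate (e q) (Dn i)"
    if "1 \<le> i"
  proof (cases "i \<le> q")
    case True
    then have "i \<in> pcod s" using pcod_eqI[OF s q] that by simp
    then obtain k where k: "mate s (Dn i) = Up k" by (auto simp: pcod_def)
    then have "mate s (Up k) = Dn i" using mate_sym[OF s(1)] by blast
    then show ?thesis
      using k that True q mate_mult_Up_Dn[OF c s(1), of i k i] mate_mult_Dn_Up[OF c s(1), of i k i] s
      by (simp add: mate_star_n)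
  next
    case False
    then have "mate s (Dn i) = Dn i" using mate_Dn_fixed[OF s(1,2) q] by simp
    then show ?thesis using False q mate_mult_Up_Up[OF c s(1), of i i] mate_mult_Dn_Dn[OF c s(1), of i i] s
      by (simp add: mate_star_n)
  qed
  then show "1 \<le> i \<Longrightarrow> mate (star s \<cdot> s) (Up i) = mate (e q) (Up i)"
    "1 \<le> i \<Longrightarrow> mate (star s \<cdot> s) (Dn i) = mate (e q) (Dn i)" by auto
qed (use s q in auto)

lemma star_cancel':
  assumes t: "t \<in> carr" "e q \<cdot> t = t" "rank t = q" and q: "q \<le> n"
  shows "t \<cdot> star t = e q"
  using star_cancel[of "star t" q] t q by (metis star_closed star_e star_mult star_star rank_star e_closed)

lemma upper_eq_dom: "upper_eq \<alpha> \<beta> \<Longrightarrow> pdom \<alpha> = pdom \<beta>"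
  by (auto simp: upper_eq_def pdom_def; metis)

text \<open>The factor \<open>s\<close> depends on the upper half of \<open>\<alpha>\<close> only and maps its transversals onto \<open>1, \<dots>, q\<close>.\<close>
lemma left_factor:
  assumes \<alpha>: "\<alpha> \<in> carr" "rank \<alpha> = q"
  shows "\<exists>s\<in>carr. s \<cdot> e q = s \<and> rank s = q \<and> (\<forall>\<beta>\<in>carr. upper_eq \<alpha> \<beta> \<longrightarrow> s \<cdot> (star s \<cdot> \<beta>) = \<beta>)"
proof -
  have q: "q \<le> n" using rank_le \<alpha> by blast
  have "finite (pdom \<alpha>)" "card (pdom \<alpha>) = q" using \<alpha> rank_eq_dom finite_dom by auto
  then obtain g where g: "bij_betw g {1..q} (pdom \<alpha>)"
    using ex_bij_betw_nat_finite_1 by metis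
  define h where "h = inv_into {1..q} g"
  have h: "h i \<in> {1..q}" "g (h i) = i" if "i \<in> pdom \<alpha>" for i
    using that g inv_into_into[of i g "{1..q}"] f_inv_into_f[of i g "{1..q}"]
    unfolding h_def by (auto simp: bij_betw_def)
  have gd: "g j \<in> pdom \<alpha>" "h (g j) = j" if "j \<in> {1..q}" for j
    using that g unfolding h_def by (auto simp: bij_betw_def bij_betw_inv_into_left[OF g])
  have gn: "g j \<in> {1..n}" if "j \<in> {1..q}" for j using gd(1)[OF that] pdom_range[OF \<alpha>(1)] by blast
  have ndom: "\<exists>k. mate \<alpha> (Up i) = Up k \<and> k \<notin> pdom \<alpha>" if "i \<notin> pdom \<alpha>" for i
  proof (cases rule: mate_Up_cases[OF \<alpha>(1), of i])
    case (1 k)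
    then have "mate \<alpha> (Up k) = Up i" using mate_sym[OF \<alpha>(1)] by blast
    then show ?thesis using 1 by (auto simp: pdom_def)
  qed (use that in \<open>auto simp: pdom_def\<close>)
  define f where "f = (\<lambda>u. case u of Up i \<Rightarrow> if i \<in> pdom \<alpha> then Dn (h i) else mate \<alpha> (Up i)
     | Dn i \<Rightarrow> if i \<in> {1..q} then Up (g i) else Dn i | Mid i \<Rightarrow> Mid i)"
  have pf: "pairing n f"
    unfolding pairing_def
  proof
    fix u assume u: "u \<in> points n"
    then consider i where "u = Up i" "i \<in> pdom \<alpha>" | i where "u = Up i" "i \<notin> pdom \<alpha>"
      | i where "u = Dn i" "i \<in> {1..q}" | i where "u = Dn i" "i \<notin> {1..q}" by (auto simp: points_def)
    then show "f u \<in> points n \<and> f (f u) = u"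
    proof cases
      case 1
      then show ?thesis using h[OF 1(2)] q by (auto simp: f_def)
    next
      case 2
      then show ?thesis using ndom[OF 2(2)] u mate_points[OF \<alpha>(1), of u] mate_mate[OF \<alpha>(1), of u]
        by (auto simp: f_def)
    next
      case 3
      then show ?thesis using gd[OF 3(2)] gn[OF 3(2)] by (auto simp: f_def)
    next
      case 4
      then show ?thesis using u by (auto simp: f_def)
    qed
  qed
  define s where "s = pairs n f"
  have s: "s \<in> carr" unfolding s_def by (rule pairs_PB[OF pf])
  have sUp: "mate s (Up i) = (if i \<in> pdom \<alpha> then Dn (h i) else mate \<alpha> (Up i))" for i
    using mate_pairs[OF pf, of "Up i"] mate_outside[OF s, of "Up i"] mate_outside[OF \<alpha>(1), of "Up i"] pdom_range[OF \<alpha>(1)]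
    by (cases "Up i \<in> points n") (auto simp: s_def f_def)
  have sDn: "mate s (Dn i) = (if i \<in> {1..q} then Up (g i) else Dn i)" for i
    using mate_pairs[OF pf, of "Dn i"] mate_outside[OF s, of "Dn i"] q
    by (cases "Dn i \<in> points n") (auto simp: s_def f_def)
  have "s \<cdot> e q = s"
  proof (rule PB_eqI_UpDn[of _ n])
    fix i
    show "mate (s \<cdot> e q) (Up i) = mate s (Up i)"
    proof (cases "i \<in> pdom \<alpha>")
      case True
      then show ?thesis using mate_mult_Up_Dn[OF s e_closed[OF q], of i "h i" "h i"] h[OF True] q by (simp add: sUp)
    next
      case False
      then show ?thesis using ndom[OF False] mate_mult_Up_Up[OF s e_closed[OF q], of i] by (auto simp: sUp)
    qed
    show "mate (s \<cdot> e q) (Dn i) = mate s (Dn i)"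
      using mate_mult_Dn_Up[OF s e_closed[OF q], of i i] mate_mult_Dn_Dn[OF s e_closed[OF q], of i i] q
      by (cases "i \<in> {1..q}") (simp_all add: sDn)
  qed (use s q in auto)
  moreover have "pdom s = pdom \<alpha>"
  proof -
    have "i \<in> pdom s \<longleftrightarrow> i \<in> pdom \<alpha>" for i
      using ndom[of i] by (cases "i \<in> pdom \<alpha>") (auto simp: pdom_def[of s] sUp)
    then show ?thesis by blast
  qed
  then have "rank s = q" using \<alpha> s rank_eq_dom by simp
  moreover have "s \<cdot> (star s \<cdot> \<beta>) = \<beta>" if \<beta>: "\<beta> \<in> carr" "upper_eq \<alpha> \<beta>" for \<beta>
  proof -
    have d: "pdom \<beta> = pdom \<alpha>" using upper_eq_dom[OF \<beta>(2)] by simp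
    have ss: "star s \<in> carr" using s by simp
    define t where "t = star s \<cdot> \<beta>"
    have t: "t \<in> carr" unfolding t_def using s \<beta> by simp
    have tUp: "mate t (Up j) = mate \<beta> (Up (g j))" if j: "j \<in> {1..q}" for j
    proof -
      have "g j \<in> pdom \<beta>" using gd(1)[OF j] d by simp
      then obtain k where "mate \<beta> (Up (g j)) = Dn k" by (auto simp: pdom_def)
      then show ?thesis using mate_mult_Up_Dn[OF ss \<beta>(1), of j "g j" k] j
        by (simp add: t_def mate_star_n s sDn)
    qed
    have tDn: "mate t (Dn k) = (case mate \<beta> (Dn k) of Up i \<Rightarrow> Up (h i) | v \<Rightarrow> v)" for k
    proof (cases rule: mate_Dn_cases[OF \<beta>(1), of k])
      case (1 i)
      then have "mate \<beta> (Up i) = Dn k" using mate_sym[OF \<beta>(1)] by blast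
      then have "i \<in> pdom \<alpha>" unfolding d[symmetric] by (auto simp: pdom_def)
      then show ?thesis using 1 mate_mult_Dn_Up[OF ss \<beta>(1), of k i "h i"]
        by (simp add: t_def mate_star_n s sUp)
    next
      case (2 i)
      then show ?thesis using mate_mult_Dn_Dn[OF ss \<beta>(1), of k i] by (simp add: t_def)
    qed
    have "s \<cdot> t = \<beta>"
    proof (rule PB_eqI_UpDn[of _ n])
      fix i
      show "mate (s \<cdot> t) (Up i) = mate \<beta> (Up i)"
      proof (cases "i \<in> pdom \<alpha>")
        case True
        then obtain k where "mate \<beta> (Up i) = Dn k" unfolding d[symmetric] by (auto simp: pdom_def)
        then show ?thesis using mate_mult_Up_Dn[OF s t, of i "h i" k] h[OF True] tUp[of "h i"] True
          by (simp add: sUp)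
      next
        case False
        then have "mate \<beta> (Up i) = mate \<alpha> (Up i)" using \<beta>(2) unfolding upper_eq_def by metis
        then show ?thesis using ndom[OF False] mate_mult_Up_Up[OF s t, of i] False by (auto simp: sUp)
      qed
      show "mate (s \<cdot> t) (Dn i) = mate \<beta> (Dn i)"
      proof (cases rule: mate_Dn_cases[OF \<beta>(1), of i])
        case (1 k)
        then have "mate \<beta> (Up k) = Dn i" using mate_sym[OF \<beta>(1)] by blast
        then have "k \<in> pdom \<alpha>" unfolding d[symmetric] by (auto simp: pdom_def)
        then show ?thesis using 1 mate_mult_Dn_Up[OF s t, of i "h k" k] h[of k] by (simp add: tDn sDn)
      next
        case (2 k)
        then show ?thesis using mate_mult_Dn_Dn[OF s t, of i k] by (simp add: tDn)
      qed
    qed (use s t \<beta> in auto)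
    then show ?thesis by (simp add: t_def)
  qed
  ultimately show ?thesis using s by blast
qed

lemma right_factor:
  assumes \<alpha>: "\<alpha> \<in> carr" "rank \<alpha> = q"
  shows "\<exists>t\<in>carr. e q \<cdot> t = t \<and> rank t = q \<and> (\<forall>\<beta>\<in>carr. lower_eq \<alpha> \<beta> \<longrightarrow> (\<beta> \<cdot> star t) \<cdot> t = \<beta>)"
proof -
  have q: "q \<le> n" using rank_le \<alpha> by blast
  obtain s where s: "s \<in> carr" "s \<cdot> e q = s" "rank s = q"
    "\<And>\<beta>. \<beta> \<in> carr \<Longrightarrow> upper_eq (star \<alpha>) \<beta> \<Longrightarrow> s \<cdot> (star s \<cdot> \<beta>) = \<beta>"
    using left_factor[of "star \<alpha>" q] \<alpha> by auto
  have "e q \<cdot> star s = star s" using s(1,2) q star_mult[of s n "e q"] by simp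
  moreover have "(\<beta> \<cdot> star (star s)) \<cdot> star s = \<beta>" if \<beta>: "\<beta> \<in> carr" "lower_eq \<alpha> \<beta>" for \<beta>
  proof -
    have "s \<cdot> (star s \<cdot> star \<beta>) = star \<beta>" using s(4)[of "star \<beta>"] \<beta> by (simp add: lower_eq_def)
    then have "star (s \<cdot> (star s \<cdot> star \<beta>)) = \<beta>" by simp
    then show ?thesis using s(1) \<beta>(1) by (simp add: star_mult)
  qed
  ultimately show ?thesis using s by (intro bexI[of _ "star s"]) auto
qed

lemma upper_eq_refl [simp]: "upper_eq \<alpha> \<alpha>" and lower_eq_refl [simp]: "lower_eq \<alpha> \<alpha>"
  by (auto simp: upper_eq_def lower_eq_def)

text \<open>Absorbing \<open>e q\<close> on both sides confines all transversals to 1, ..., q above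
  and below, and full rank leaves no room there for hooks or singletons. So the group of units of
  the local monoid at \<open>e q\<close> is the symmetric group.\<close>

lemma group_elem:
  assumes g: "g \<in> carr" "e q \<cdot> g = g" "g \<cdot> e q = g" "rank g = q" and q: "q \<le> n"
  shows "\<exists>\<sigma>. \<sigma> permutes {1..q} \<and> g = bar n q \<sigma>"
proof -
  have "e q \<cdot> star (star g) = star (star g)" using g by simp
  then have pcod: "pcod g = {1..q}" using pcod_eqI[OF g(1,3,4) q] by simp
  have "star g \<cdot> e q = star g" using g(1,2) q star_mult[of "e q" n g] by simp
  then have pdom: "pdom g = {1..q}"
    using pcod_eqI[of "star g" q] g q pdom_star[of g] by simp
  define \<sigma> where "\<sigma> i = (case mate g (Up i) of Dn j \<Rightarrow> j | _ \<Rightarrow> i)" for i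
  have \<sigma>: "mate g (Up i) = Dn (\<sigma> i)" "\<sigma> i \<in> {1..q}" if i: "i \<in> {1..q}" for i
  proof -
    have "i \<in> pdom g" using i pdom by simp
    then obtain j where j: "mate g (Up i) = Dn j" by (auto simp: pdom_def)
    then have "mate g (Dn j) = Up i" using mate_sym[OF g(1)] by blast
    then have "j \<in> pcod g" by (auto simp: pcod_def)
    then show "mate g (Up i) = Dn (\<sigma> i)" "\<sigma> i \<in> {1..q}" using j pcod by (auto simp: \<sigma>_def)
  qed
  have out: "mate g (Up i) = Up i" "mate g (Dn i) = Dn i" if "i \<notin> {1..q}" for i
  proof -
    have "mate (star g) (Dn i) = Dn i" if "i > q"
      using mate_Dn_fixed[of "star g" q i] \<open>star g \<cdot> e q = star g\<close> g q that by simp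
    moreover have "mate g (Dn i) = Dn i" if "i > q"
      using mate_Dn_fixed[of g q i] g q that by simp
    moreover have "mate g (Up 0) = Up 0" "mate g (Dn 0) = Dn 0" using mate_outside[OF g(1)] by auto
    ultimately show "mate g (Up i) = Up i" "mate g (Dn i) = Dn i"
      using that g(1) by (cases "i = 0"; force simp: mate_star_n)+
  qed
  have "inj_on \<sigma> {1..q}" by (rule inj_onI) (metis \<sigma>(1) mate_mate[OF g(1)] vertex.inject(1))
  then have "bij_betw \<sigma> {1..q} {1..q}"
    using \<sigma>(2) by (metis bij_betw_def card_image card_subset_eq finite_atLeastAtMost image_subsetI)
  moreover have "\<sigma> i = i" if "i \<notin> {1..q}" for i using out[OF that] by (simp add: \<sigma>_def)
  ultimately have p: "\<sigma> permutes {1..q}" by (rule bij_imp_permutes)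
  have "mate g (Dn i) = Up (inv' \<sigma> i)" if "i \<in> {1..q}" for i
  proof -
    have "inv' \<sigma> i \<in> {1..q}" "\<sigma> (inv' \<sigma> i) = i"
      using permutes_in_image[OF permutes_inv[OF p], of i] that permutes_inverses[OF p] by auto
    then show ?thesis using \<sigma>(1)[of "inv' \<sigma> i"] mate_sym[OF g(1)] by simp
  qed
  then have "g = bar n q \<sigma>"
    by (intro PB_eqI_UpDn[of _ n]) (use g p q \<sigma> out in \<open>auto simp: mate_bar\<close>)
  then show ?thesis using p by blast
qed

end

section \<open>Green's relations and ideals\<close>

context partial_brauer
begin

abbreviation zero :: "vertex set set" (\<open>\<omega>\<close>) where
  "\<omega> \<equiv> e 0"

lemma I_rank_iff: "\<alpha> \<in> I_rank n q \<longleftrightarrow> \<alpha> \<in> carr \<and> rank \<alpha> \<le> q"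
  by (simp add: I_rank_def)

section \<open>Elements of rank at most one and their halves\<close>

lemma rank0_mate:
  assumes "x \<in> carr" "rank x = 0"
  shows "\<exists>j. mate x (Up i) = Up j" "\<exists>j. mate x (Dn i) = Dn j"
proof -
  have "pdom x = {}" using rank_eq_dom assms finite_dom by simp
  moreover have "pcod x = {}"
    using rank_eq_cod assms finite_dom[of "star x"] by (simp add: pcod_star)
  ultimately have "mate x (Up i) \<noteq> Dn j" "mate x (Dn i) \<noteq> Up j" for j
    by (auto simp: pdom_def pcod_def)
  then show "\<exists>j. mate x (Up i) = Up j" "\<exists>j. mate x (Dn i) = Dn j"
    by (metis mate_Up_cases[OF assms(1)], metis mate_Dn_cases[OF assms(1)])
qed

lemma rank0_mult_Up:
  "\<lbrakk>x \<in> carr; rank x = 0; y \<in> carr\<rbrakk> \<Longrightarrow> mate (x \<cdot> y) (Up i) = mate x (Up i)"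
  using rank0_mate(1) mate_mult_Up_Up by metis

lemma rank0_mult_Dn:
  "\<lbrakk>x \<in> carr; y \<in> carr; rank y = 0\<rbrakk> \<Longrightarrow> mate (x \<cdot> y) (Dn i) = mate y (Dn i)"
  using rank0_mate(2) mate_mult_Dn_Dn by metis

lemma rank0_mult: "x \<in> carr \<Longrightarrow> y \<in> carr \<Longrightarrow> rank x = 0 \<or> rank y = 0 \<Longrightarrow> rank (x \<cdot> y) = 0"
  using rank_mult_le1 rank_mult_le2 by (metis le_zero_eq)

lemma zero_closed [simp]: "\<omega> \<in> carr" and rank_zero [simp]: "rank \<omega> = 0" and star_zero [simp]: "star \<omega> = \<omega>"
  by simp_all

lemma mate_zero [simp]: "mate \<omega> (Up i) = Up i" "mate \<omega> (Dn i) = Dn i"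
  by simp_all

text \<open>A rank-zero left factor fixes the upper half of a product and a rank-zero right factor
  the lower half, so the minimal ideal is a rectangular band.\<close>

lemma rank0_sandwich:
  assumes "x \<in> carr" "rank x = 0" "y \<in> carr"
  shows "x \<cdot> y \<cdot> x = x"
  by (rule PB_eqI_UpDn[of _ n])
    (use assms rank0_mult in \<open>simp_all add: rank0_mult_Up rank0_mult_Dn\<close>)

lemma zero_e [simp]: "q \<le> n \<Longrightarrow> \<omega> \<cdot> e q = \<omega>" "q \<le> n \<Longrightarrow> e q \<cdot> \<omega> = \<omega>"
  by (simp_all add: e_mult)

text \<open>The right factor cuts the transversal of \<open>x\<close>. Its upper end could only be
  joined to the upper end of another transversal, and there is none, so it becomes a singleton
  whatever \<open>m\<close> is. This independence of \<open>m\<close> fails for rank 2.\<close>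

lemma rank1_mult_Up:
  assumes x: "x \<in> carr" "rank x \<le> 1" and m: "m \<in> carr" "rank m = 0"
  shows "mate (x \<cdot> m) (Up i) = (if i \<in> pdom x then Up i else mate x (Up i))"
proof (cases "i \<in> pdom x")
  case True
  have "rank (x \<cdot> m) = 0" using x m by (simp add: rank0_mult)
  then obtain j where j: "mate (x \<cdot> m) (Up i) = Up j" using rank0_mate(1)[of "x \<cdot> m" i] x m by auto
  then have j': "mate (x \<cdot> m) (Up j) = Up i" using mate_sym[of "x \<cdot> m" n] x m by auto
  have "j \<in> pdom x"
  proof (rule ccontr)
    assume "j \<notin> pdom x"
    then obtain k where k: "mate x (Up j) = Up k"
      using mate_Up_cases[OF x(1), of j] by (auto simp: pdom_def)
    then have "k = i" using mate_mult_Up_Up[OF x(1) m(1) k] j' by simp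
    then have "mate x (Up i) = Up j" using k mate_sym[OF x(1)] by blast
    then show False using True by (auto simp: pdom_def)
  qed
  moreover have "card (pdom x) \<le> Suc 0" using x rank_eq_dom by simp
  ultimately have "i = j" using True finite_dom[OF x(1)] by (simp add: card_le_Suc0_iff_eq)
  then show ?thesis using j True by simp
next
  case False
  then obtain k where "mate x (Up i) = Up k"
    using mate_Up_cases[OF x(1), of i] by (auto simp: pdom_def)
  then show ?thesis using False mate_mult_Up_Up[OF x(1) m(1)] by simp
qed

lemma rank1_mult_Dn:
  assumes x: "x \<in> carr" "rank x \<le> 1" and m: "m \<in> carr" "rank m = 0"
  shows "mate (m \<cdot> x) (Dn i) = (if i \<in> pcod x then Dn i else mate x (Dn i))"
  using rank1_mult_Up[of "star x" "star m" i] x m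
  by (simp add: mate_mult_Dn pcod_star mate_star_n)

lemma rank1_sandwich:
  assumes x: "x \<in> carr" "rank x \<le> 1" and m: "m \<in> carr" "rank m = 0"
  shows "x \<cdot> m \<cdot> x = x \<cdot> \<omega> \<cdot> x"
proof (rule PB_eqI_UpDn[of _ n])
  fix i
  have z: "\<omega> \<in> carr" "rank \<omega> = 0" by simp_all
  show "mate (x \<cdot> m \<cdot> x) (Up i) = mate (x \<cdot> \<omega> \<cdot> x) (Up i)"
    using x m rank0_mult by (simp add: rank0_mult_Up rank1_mult_Up[OF x m] rank1_mult_Up[OF x z])
  have "mate (x \<cdot> (m \<cdot> x)) (Dn i) = mate (x \<cdot> (\<omega> \<cdot> x)) (Dn i)"
    using x m rank0_mult by (simp add: rank0_mult_Dn rank1_mult_Dn[OF x m] rank1_mult_Dn[OF x z])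
  then show "mate (x \<cdot> m \<cdot> x) (Dn i) = mate (x \<cdot> \<omega> \<cdot> x) (Dn i)"
    using x m by (simp add: mul_assoc)
qed (use x m in auto)

lemma zero_sandwich: "y \<in> carr \<Longrightarrow> \<omega> \<cdot> y \<cdot> \<omega> = \<omega>"
  by (rule rank0_sandwich) auto

text \<open>The lower half of an element \<open>x\<close> of rank at most 1 is \<open>\<omega> x\<close>, its upper half is \<open>x \<omega>\<close>.\<close>
lemma lower_half_mult:
  assumes x: "x \<in> carr" "rank x \<le> 1" and z: "z \<in> carr"
  shows "\<omega> \<cdot> (z \<cdot> x) = \<omega> \<cdot> x"
proof -
  \<comment> \<open>Expanding \<omega> by the rectangular band law puts the rank-zero element
    \<open>\<omega> \<cdot> z\<close> between two copies of \<open>x\<close>, where it may be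
    exchanged for \<omega>.\<close>
  have "\<omega> \<cdot> (z \<cdot> x) = \<omega> \<cdot> (z \<cdot> x) \<cdot> \<omega> \<cdot> (z \<cdot> x)" using x z by (simp add: zero_sandwich)
  also have "\<dots> = \<omega> \<cdot> z \<cdot> (x \<cdot> (\<omega> \<cdot> z) \<cdot> x)" using x z by (simp add: mul_assoc)
  also have "x \<cdot> (\<omega> \<cdot> z) \<cdot> x = x \<cdot> \<omega> \<cdot> x"
    by (rule rank1_sandwich) (use x z rank0_mult in auto)
  also have "\<omega> \<cdot> z \<cdot> (x \<cdot> \<omega> \<cdot> x) = \<omega> \<cdot> (z \<cdot> x) \<cdot> \<omega> \<cdot> x" using x z by (simp add: mul_assoc)
  also have "\<dots> = \<omega> \<cdot> x" using x z by (simp add: zero_sandwich)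
  finally show ?thesis .
qed

lemma upper_half_mult:
  assumes x: "x \<in> carr" "rank x \<le> 1" and z: "z \<in> carr"
  shows "(x \<cdot> z) \<cdot> \<omega> = x \<cdot> \<omega>"
proof -
  have "star ((x \<cdot> z) \<cdot> \<omega>) = star (x \<cdot> \<omega>)"
    using lower_half_mult[of "star x" "star z"] x z by (simp add: star_mult[where n = n])
  then show ?thesis by (metis star_star)
qed

lemma rank0_eqI:
  assumes "x \<in> carr" "rank x = 0" "y \<in> carr" "rank y = 0" "\<omega> \<cdot> x = \<omega> \<cdot> y" "x \<cdot> \<omega> = y \<cdot> \<omega>"
  shows "x = y"
proof -
  have "x = x \<cdot> \<omega> \<cdot> x" by (rule rank0_sandwich[symmetric]) (use assms in auto)
  also have "\<dots> = y \<cdot> (\<omega> \<cdot> x)" using assms(1,3) by (simp add: assms(6) mul_assoc)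
  also have "\<dots> = y \<cdot> \<omega> \<cdot> y" using assms(1,3) by (simp add: assms(5) mul_assoc)
  also have "\<dots> = y" using assms by (simp add: rank0_sandwich)
  finally show ?thesis .
qed

text \<open>For \<open>q = 2\<close> the product with \<open>e q\<close> leaves on the lower points
  1 and 2 either a hook or two singletons, since every block of \<open>m\<close> that leaves {1, 2}
  is cut. Both patterns are symmetric under the transposition. With three points a hook and a
  singleton could be interchanged, hence the bound on \<open>q\<close>.\<close>

lemma rank0_mult_bar:
  assumes m: "m \<in> carr" "rank m = 0" and q: "q \<le> 2" "q \<le> n" and \<sigma>: "\<sigma> permutes {1..q}"
  shows "m \<cdot> bar n q \<sigma> = m \<cdot> e q"
proof (cases "\<sigma> = id")
  case False
  have q2: "q = 2"
  proof (rule ccontr)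
    assume "q \<noteq> 2"
    then have "{1..q} \<subseteq> {1}" using q by auto
    then have "\<sigma> permutes {1}" using \<sigma> permutes_subset by blast
    then show False using False by (simp add: permutes_sing)
  qed
  have \<sigma>12: "\<sigma> = transpose 1 2"
  proof -
    have "{1..2::nat} = {1, 2}" by auto
    then show ?thesis using \<sigma> q2 False by (simp add: permutes_doubleton_iff)
  qed
  have b: "bar n q \<sigma> \<in> carr" using \<sigma> q by simp
  note mb = mate_bar[OF \<sigma> q(2)]
  show ?thesis
  proof (rule PB_eqI_UpDn[of _ n])
    fix i
    show "mate (m \<cdot> bar n q \<sigma>) (Up i) = mate (m \<cdot> e q) (Up i)"
      using m b q by (simp add: rank0_mult_Up)
    show "mate (m \<cdot> bar n q \<sigma>) (Dn i) = mate (m \<cdot> e q) (Dn i)"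
    proof (cases "i \<in> {1, 2}")
      case False
      then have "i \<notin> {1..q}" using q2 by auto
      then have *: "mate (bar n q \<sigma>) (Dn i) = Dn i" "mate (e q) (Dn i) = Dn i" using q(2) by (auto simp: mb)
      show ?thesis
        using mate_mult_Dn_Dn[OF m(1) b *(1)] mate_mult_Dn_Dn[OF m(1) e_closed[OF q(2)] *(2)] by simp
    next
      case True
      define i' where "i' = 3 - i"
      have i': "i = 1 \<and> i' = 2 \<or> i = 2 \<and> i' = 1" "i \<noteq> i'" using True by (auto simp: i'_def)
      have inv: "inv' \<sigma> = \<sigma>" by (simp add: \<sigma>12)
      have \<sigma>i: "\<sigma> i = i'" "\<sigma> i' = i" using i' by (auto simp: \<sigma>12)
      have range: "i \<in> {1..q}" "i' \<in> {1..q}" using i' q2 by auto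
      have out: "k \<notin> {1..q}" if "k \<noteq> i" "k \<noteq> i'" for k using i' q2 that by auto
      have bi: "mate (bar n q \<sigma>) (Dn i) = Up i'" "mate (e q) (Dn i) = Up i"
        using range q(2) by (auto simp: mb inv \<sigma>i)
      obtain k where k: "mate m (Dn i) = Dn k" using rank0_mate[OF m] by blast
      obtain k' where k': "mate m (Dn i') = Dn k'" using rank0_mate[OF m] by blast
      have kk: "mate m (Dn k) = Dn i" "mate m (Dn k') = Dn i'" using k k' mate_sym[OF m(1)] by blast+
      have "mate (m \<cdot> e q) (Dn i) = (if k \<in> {1..q} then Dn k else Dn i)"
        using mate_mult_Dn_turn[OF m(1) e_closed[OF q(2)] bi(2) k, of k]
          mate_mult_Dn_stuck[OF m(1) e_closed[OF q(2)] bi(2) k] q(2) by auto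
      moreover have "mate (m \<cdot> bar n q \<sigma>) (Dn i) = (if k' \<in> {1..q} then Dn (\<sigma> k') else Dn i)"
        using mate_mult_Dn_turn[OF m(1) b bi(1) k', of "\<sigma> k'"]
          mate_mult_Dn_stuck[OF m(1) b bi(1) k'] by (auto simp: mb)
      moreover have "(if k \<in> {1..q} then Dn k else Dn i) = (if k' \<in> {1..q} then Dn (\<sigma> k') else Dn i)"
      proof -
        consider "k' = i'" | "k' = i" | "k' \<noteq> i" "k' \<noteq> i'" by blast
        then show ?thesis
        proof cases
          case 1
          then have "k \<noteq> i'" using k kk i'(2) by auto
          then show ?thesis using 1 \<sigma>i range out[of k] by auto
        next
          case 2
          then have "k = i'" using k kk by auto
          then show ?thesis using 2 \<sigma>i range by auto
        next
          case 3
          have "k \<noteq> i'" using 3(1) k' kk(1) by auto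
          then show ?thesis using out[of k] out[OF 3] by auto
        qed
      qed
      ultimately show ?thesis by simp
    qed
  qed (use m b q in auto)
qed simp

lemma bar_mult_rank0:
  assumes m: "m \<in> carr" "rank m = 0" and q: "q \<le> 2" "q \<le> n" and \<sigma>: "\<sigma> permutes {1..q}"
  shows "bar n q \<sigma> \<cdot> m = e q \<cdot> m"
proof -
  have "star m \<cdot> bar n q (inv' \<sigma>) = star m \<cdot> e q"
    by (rule rank0_mult_bar) (use m q permutes_inv[OF \<sigma>] in auto)
  then have "star (bar n q \<sigma> \<cdot> m) = star (e q \<cdot> m)"
    using m q \<sigma> by (simp add: star_mult[where n = n] star_bar)
  then show ?thesis by (metis star_star)
qed

section \<open>Principal ideals, Green's relations and ideals\<close>

lemma factor:
  assumes "\<alpha> \<in> carr" "rank \<alpha> = q"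
  obtains s t where "s \<in> carr" "t \<in> carr" "s \<cdot> e q = s" "e q \<cdot> t = t" "rank s = q" "rank t = q" "\<alpha> = s \<cdot> t"
proof -
  have q: "q \<le> n" using rank_le assms by blast
  obtain s where s: "s \<in> carr" "s \<cdot> e q = s" "rank s = q" "s \<cdot> (star s \<cdot> \<alpha>) = \<alpha>"
    using left_factor[OF assms] assms(1) by auto
  define t where "t = star s \<cdot> \<alpha>"
  have t: "t \<in> carr" using s assms by (simp add: t_def)
  have "e q \<cdot> star s = star s" using s(1,2) q star_mult[of s n "e q"] by simp
  then have "e q \<cdot> t = t" using s(1) q assms(1) unfolding t_def by (simp flip: mul_assoc)
  moreover have "rank t = q"
    using rank_mult_le2[OF s(1) t] rank_mult_le1[of "star s" \<alpha>] s assms by (simp add: t_def)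
  ultimately show ?thesis using that s t by (simp add: t_def)
qed

lemma factor_le:
  assumes "\<alpha> \<in> carr" "rank \<alpha> \<le> q" "q \<le> n"
  obtains s t where "s \<in> carr" "t \<in> carr" "s \<cdot> e q = s" "\<alpha> = s \<cdot> e q \<cdot> t"
proof -
  obtain s t where st: "s \<in> carr" "t \<in> carr" "s \<cdot> e (rank \<alpha>) = s" "\<alpha> = s \<cdot> t"
    using factor[OF assms(1)] by metis
  have r: "rank \<alpha> \<le> n" using assms by simp
  have "s \<cdot> e q = s \<cdot> e (rank \<alpha>) \<cdot> e q" by (simp only: st(3))
  also have "\<dots> = s \<cdot> e (rank \<alpha>)" using st(1) assms r by (simp add: mul_assoc e_mult min_absorb1 del: st(3))
  also have "\<dots> = s" by (rule st(3))
  finally have "s \<cdot> e q = s" .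
  then show ?thesis using that st by simp
qed

lemma e_from_rank:
  assumes "\<alpha> \<in> carr" "rank \<alpha> = q"
  obtains u v where "u \<in> carr" "v \<in> carr" "u \<cdot> \<alpha> \<cdot> v = e q" "e q \<cdot> u = u" "v \<cdot> e q = v"
proof -
  have q: "q \<le> n" using rank_le assms by blast
  obtain s t where st: "s \<in> carr" "t \<in> carr" "s \<cdot> e q = s" "e q \<cdot> t = t" "rank s = q" "rank t = q" "\<alpha> = s \<cdot> t"
    using factor[OF assms] by metis
  have "star s \<cdot> \<alpha> \<cdot> star t = (star s \<cdot> s) \<cdot> (t \<cdot> star t)" using st by (simp add: mul_assoc)
  then have "star s \<cdot> \<alpha> \<cdot> star t = e q" using st q by (simp add: star_cancel star_cancel' e_mult)
  moreover have "e q \<cdot> star s = star s" "star t \<cdot> e q = star t"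
    using st(1-4) q star_mult[of s n "e q"] star_mult[of "e q" n t] by simp_all
  ultimately show ?thesis using that star_closed[OF st(1)] star_closed[OF st(2)] by blast
qed

lemma principal_PB:
  assumes "x \<in> carr"
  shows "principal (PB n) x = I_rank n (rank x)"
proof (intro equalityI subsetI)
  fix y assume "y \<in> principal (PB n) x"
  then obtain s t where "y = s \<cdot> x \<cdot> t" "s \<in> carr" "t \<in> carr" by (auto simp: principal_def)
  then show "y \<in> I_rank n (rank x)"
    using assms rank_mult_le1[of "s \<cdot> x" t] rank_mult_le2[of s x] by (simp add: I_rank_iff)
next
  fix y assume "y \<in> I_rank n (rank x)"
  then have y: "y \<in> carr" "rank y \<le> rank x" by (auto simp: I_rank_iff)
  obtain s t where st: "s \<in> carr" "t \<in> carr" "y = s \<cdot> e (rank x) \<cdot> t"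
    using factor_le[OF y rank_le[OF assms]] by metis
  obtain u v where uv: "u \<in> carr" "v \<in> carr" "u \<cdot> x \<cdot> v = e (rank x)"
    using e_from_rank[OF assms] by metis
  have "y = (s \<cdot> u) \<cdot> x \<cdot> (v \<cdot> t)" using st uv(1,2) assms by (simp add: mul_assoc flip: uv(3))
  then show "y \<in> principal (PB n) x"
    unfolding principal_def using st uv by (intro CollectI exI[of _ "s \<cdot> u"] exI[of _ "v \<cdot> t"]) simp
qed

lemma I_rank_inj: "\<lbrakk>I_rank n p = I_rank n q; p \<le> n; q \<le> n\<rbrakk> \<Longrightarrow> p = q"
  by (metis I_rank_iff e_closed le_antisym order_refl rank_e)

lemma GreenJ_PB: "GreenJ (PB n) = {(x, y). x \<in> carr \<and> y \<in> carr \<and> rank x = rank y}"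
  unfolding GreenJ_def using principal_PB I_rank_inj rank_le by fastforce

text \<open>A retraction takes values in the minimal ideal, so this and its mirror image are all
  that is needed about \<L> and \<R>. From equal lower halves one gets
  \<open>a = (a \<cdot> \<omega>) \<cdot> b\<close>, an explicit left multiplier.\<close>

lemma left_principal_zero:
  assumes "x \<in> carr" "rank x = 0" "y \<in> carr" "rank y = 0"
  shows "(x, y) \<in> GreenL (PB n) \<longleftrightarrow> \<omega> \<cdot> x = \<omega> \<cdot> y"
proof
  assume "(x, y) \<in> GreenL (PB n)"
  then have "left_principal (PB n) x = left_principal (PB n) y" by (auto simp: GreenL_def)
  moreover have "x \<in> left_principal (PB n) x"
    unfolding left_principal_def using assms by (intro CollectI exI[of _ "e n"]) simp
  ultimately obtain s where "s \<in> carr" "x = s \<cdot> y" by (auto simp: left_principal_def)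
  then show "\<omega> \<cdot> x = \<omega> \<cdot> y" using lower_half_mult[of y s] assms by simp
next
  assume eq: "\<omega> \<cdot> x = \<omega> \<cdot> y"
  have sub: "left_principal (PB n) a \<subseteq> left_principal (PB n) b"
    if "a \<in> carr" "rank a = 0" "b \<in> carr" "\<omega> \<cdot> a = \<omega> \<cdot> b" for a b
  proof
    fix z assume "z \<in> left_principal (PB n) a"
    then obtain s where s: "s \<in> carr" "z = s \<cdot> a" by (auto simp: left_principal_def)
    have "a = a \<cdot> (\<omega> \<cdot> a)" using that(1,2) rank0_sandwich[of a \<omega>] by (simp add: mul_assoc)
    also have "\<dots> = (a \<cdot> \<omega>) \<cdot> b" unfolding that(4) using that(1,3) by (simp add: mul_assoc)
    finally have "z = s \<cdot> ((a \<cdot> \<omega>) \<cdot> b)" using s(2) by argo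
    then have "z = (s \<cdot> (a \<cdot> \<omega>)) \<cdot> b" using s(1) that(1,3) by (simp add: mul_assoc)
    then show "z \<in> left_principal (PB n) b"
      unfolding left_principal_def using s that by (intro CollectI exI[of _ "s \<cdot> (a \<cdot> \<omega>)"]) simp
  qed
  show "(x, y) \<in> GreenL (PB n)"
    unfolding GreenL_def using sub[of x y] sub[of y x] assms eq by auto
qed

lemma right_principal_star:
  assumes "x \<in> carr"
  shows "right_principal (PB n) x = star ` left_principal (PB n) (star x)"
proof (intro equalityI subsetI)
  fix z assume "z \<in> right_principal (PB n) x"
  then obtain t where t: "t \<in> carr" "z = x \<cdot> t" by (auto simp: right_principal_def)
  then have "z = star (star t \<cdot> star x)" using assms by (simp add: star_mult[where n = n])
  then show "z \<in> star ` left_principal (PB n) (star x)"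
    unfolding left_principal_def using t by (intro image_eqI CollectI exI[of _ "star t"]) auto
next
  fix z assume "z \<in> star ` left_principal (PB n) (star x)"
  then obtain s where s: "s \<in> carr" "z = star (s \<cdot> star x)" by (auto simp: left_principal_def)
  then have "z = x \<cdot> star s" using assms by (simp add: star_mult[where n = n])
  then show "z \<in> right_principal (PB n) x"
    unfolding right_principal_def using s by auto
qed

lemma right_principal_zero:
  assumes "x \<in> carr" "rank x = 0" "y \<in> carr" "rank y = 0"
  shows "(x, y) \<in> GreenR (PB n) \<longleftrightarrow> x \<cdot> \<omega> = y \<cdot> \<omega>"
proof -
  have "inj star" by (metis injI star_star)
  then have "(x, y) \<in> GreenR (PB n) \<longleftrightarrow> (star x, star y) \<in> GreenL (PB n)"
    using assms by (simp add: GreenR_def GreenL_def right_principal_star inj_image_eq_iff)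
  also have "\<dots> \<longleftrightarrow> \<omega> \<cdot> star x = \<omega> \<cdot> star y"
    using assms by (intro left_principal_zero) auto
  also have "\<dots> \<longleftrightarrow> star (x \<cdot> \<omega>) = star (y \<cdot> \<omega>)"
    using assms by (simp add: star_mult[where n = n])
  also have "\<dots> \<longleftrightarrow> x \<cdot> \<omega> = y \<cdot> \<omega>" by (metis star_star)
  finally show ?thesis .
qed

lemma sgp_ideal_I_rank: "q \<le> n \<Longrightarrow> sgp_ideal (PB n) (I_rank n q)"
  unfolding sgp_ideal_def
proof (intro conjI ballI)
  show "I_rank n q \<noteq> {}" using zero_closed rank_zero I_rank_iff by (metis empty_iff le0)
  show "I_rank n q \<subseteq> carr" by (auto simp: I_rank_iff)
  fix x s assume "x \<in> I_rank n q" "s \<in> carr"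
  then show "s \<cdot> x \<in> I_rank n q" "x \<cdot> s \<in> I_rank n q"
    using rank_mult_le1[of x s] rank_mult_le2[of s x] by (auto simp: I_rank_iff)
qed

lemma sgp_ideals: "{I. sgp_ideal (PB n) I} = {I_rank n q | q. q \<le> n}"
proof (intro equalityI subsetI)
  fix I assume "I \<in> {I. sgp_ideal (PB n) I}"
  then have I: "I \<noteq> {}" "I \<subseteq> carr" "\<And>x s. x \<in> I \<Longrightarrow> s \<in> carr \<Longrightarrow> s \<cdot> x \<in> I \<and> x \<cdot> s \<in> I"
    by (auto simp: sgp_ideal_def)
  define q where "q = Max (rank ` I)"
  have "rank ` I \<subseteq> {..n}" using I(2) rank_le by auto
  then have fin: "finite (rank ` I)" using finite_subset by blast
  then have "q \<in> rank ` I" unfolding q_def using I(1) by (intro Max_in) auto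
  then obtain x where x: "x \<in> I" "rank x = q" by auto
  have "I = I_rank n q"
  proof
    show "I \<subseteq> I_rank n q" using fin I(2) by (auto simp: q_def I_rank_iff)
    show "I_rank n q \<subseteq> I"
    proof
      fix y assume "y \<in> I_rank n q"
      then have "y \<in> principal (PB n) x" using principal_PB x I(2) by auto
      then obtain s t where "y = s \<cdot> x \<cdot> t" "s \<in> carr" "t \<in> carr" by (auto simp: principal_def)
      then show "y \<in> I" using I(3) x by blast
    qed
  qed
  moreover have "q \<le> n" using x I(2) rank_le by blast
  ultimately show "I \<in> {I_rank n q | q. q \<le> n}" by blast
qed (use sgp_ideal_I_rank in auto)

lemma min_ideal_PB: "min_ideal (PB n) = I_rank n 0"
  unfolding min_ideal_def sgp_ideals by (auto simp: I_rank_iff)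

end

section \<open>A uniform family of congruences\<close>

lemma normal_sym_group:
  assumes "N \<lhd> sym_group q"
  shows "\<sigma> \<in> N \<Longrightarrow> \<sigma> permutes {1..q}" "id \<in> N"
    "\<lbrakk>\<sigma> \<in> N; \<tau> \<in> N\<rbrakk> \<Longrightarrow> \<sigma> \<circ> \<tau> \<in> N" "\<sigma> \<in> N \<Longrightarrow> inv' \<sigma> \<in> N"
    "\<lbrakk>\<sigma> \<in> N; \<tau> permutes {1..q}\<rbrakk> \<Longrightarrow> \<tau> \<circ> \<sigma> \<circ> inv' \<tau> \<in> N"
proof -
  interpret normal N "sym_group q" by (rule assms)
  note sg = normal_imp_subgroup[OF assms]
  show "\<sigma> \<in> N \<Longrightarrow> \<sigma> permutes {1..q}"
    using subgroup.mem_carrier[OF sg] by (simp add: sym_group_carrier)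
  show "id \<in> N" using subgroup.one_closed[OF sg] by (simp add: sym_group_one)
  show "\<lbrakk>\<sigma> \<in> N; \<tau> \<in> N\<rbrakk> \<Longrightarrow> \<sigma> \<circ> \<tau> \<in> N"
    using subgroup.m_closed[OF sg] by (simp add: sym_group_mult)
  show "\<sigma> \<in> N \<Longrightarrow> inv' \<sigma> \<in> N"
    using subgroup.m_inv_closed[OF sg, of \<sigma>] subgroup.mem_carrier[OF sg, of \<sigma>] by simp
  show "\<lbrakk>\<sigma> \<in> N; \<tau> permutes {1..q}\<rbrakk> \<Longrightarrow> \<tau> \<circ> \<sigma> \<circ> inv' \<tau> \<in> N"
    using inv_op_closed2[of \<tau> \<sigma>] by (simp add: sym_group_carrier sym_group_mult)
qed

lemma normal_sym_groupI:
  assumes "\<And>\<sigma>. \<sigma> \<in> N \<Longrightarrow> \<sigma> permutes {1..q}" "id \<in> N"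
    "\<And>\<sigma> \<tau>. \<lbrakk>\<sigma> \<in> N; \<tau> \<in> N\<rbrakk> \<Longrightarrow> \<sigma> \<circ> \<tau> \<in> N" "\<And>\<sigma>. \<sigma> \<in> N \<Longrightarrow> inv' \<sigma> \<in> N"
    "\<And>\<sigma> \<tau>. \<lbrakk>\<sigma> \<in> N; \<tau> permutes {1..q}\<rbrakk> \<Longrightarrow> \<tau> \<circ> \<sigma> \<circ> inv' \<tau> \<in> N"
  shows "N \<lhd> sym_group q"
proof -
  interpret group "sym_group q" by (rule sym_group_is_group)
  have "subgroup N (sym_group q)"
  proof (rule subgroupI)
    show "N \<subseteq> carrier (sym_group q)" using assms(1) by (auto simp: sym_group_carrier)
    show "N \<noteq> {}" using assms(2) by auto
    fix \<sigma> assume "\<sigma> \<in> N"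
    then show "inv\<^bsub>sym_group q\<^esub> \<sigma> \<in> N" using assms(1,4) by (simp add: sym_group_carrier)
    fix \<tau> assume "\<tau> \<in> N"
    then show "\<sigma> \<otimes>\<^bsub>sym_group q\<^esub> \<tau> \<in> N" using assms(3) \<open>\<sigma> \<in> N\<close> by (simp add: sym_group_mult)
  qed
  then show ?thesis
    unfolding normal_inv_iff using assms(5) by (auto simp: sym_group_carrier sym_group_mult)
qed

lemma trivial_normal: "{id} \<lhd> sym_group q"
  by (rule normal_sym_groupI) (auto simp: permutes_id permutes_inv_o)

lemma sym_normal: "carrier (sym_group q) \<lhd> sym_group q"
  by (rule normal_sym_groupI) (auto simp: sym_group_carrier permutes_id permutes_compose permutes_inv)

context partial_brauer
begin

lemma bar_inj: 
  assumes "\<sigma> permutes {1..q}" "\<tau> permutes {1..q}" "q \<le> n" "bar n q \<sigma> = bar n q \<tau>"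
  shows "\<sigma> = \<tau>"
proof
  fix i
  show "\<sigma> i = \<tau> i"
  proof (cases "i \<in> {1..q}")
    case True
    have "mate (bar n q \<sigma>) (Up i) = mate (bar n q \<tau>) (Up i)" using assms(4) by simp
    then show ?thesis using True mate_bar(1)[OF assms(1,3)] mate_bar(1)[OF assms(2,3)] by auto
  next
    case False
    then show ?thesis using assms(1,2) by (simp add: permutes_not_in)
  qed
qed

lemma GreenJ_bar:
  assumes "N \<lhd> sym_group q" "q \<le> n"
  shows "GreenJ (PB n) `` (bar n q ` N) = {\<alpha> \<in> carr. rank \<alpha> = q}"
proof -
  have "rank (bar n q \<sigma>) = q \<and> bar n q \<sigma> \<in> carr" if "\<sigma> \<in> N" for \<sigma>
    using normal_sym_group(1)[OF assms(1) that] assms(2) rank_bar by simp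
  moreover have "bar n q id \<in> bar n q ` N" using normal_sym_group(2)[OF assms(1)] by blast
  ultimately show ?thesis unfolding GreenJ_PB by fastforce
qed

text \<open>A normal form of \<open>nu\<close>: both outer factors are charts of full rank and the
  first permutation is the identity. Elements of \<open>N\<close> then measure the difference of two
  related diagrams.\<close>

definition nu_rel :: "nat \<Rightarrow> (nat \<Rightarrow> nat) set \<Rightarrow> pb_rel" where
  "nu_rel q N = {(s \<cdot> t, s \<cdot> bar n q \<sigma> \<cdot> t) | s t \<sigma>. s \<in> carr \<and> t \<in> carr \<and>
     s \<cdot> e q = s \<and> e q \<cdot> t = t \<and> rank s = q \<and> rank t = q \<and> \<sigma> \<in> N}"

lemma e_bar [simp]: "\<sigma> permutes {1..q} \<Longrightarrow> q \<le> n \<Longrightarrow> e q \<cdot> bar n q \<sigma> = bar n q \<sigma>"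
  "\<sigma> permutes {1..q} \<Longrightarrow> q \<le> n \<Longrightarrow> bar n q \<sigma> \<cdot> e q = bar n q \<sigma>"
  by (simp_all add: bar_mult permutes_id)

lemma bar_inverse:
  assumes "\<sigma> permutes {1..q}" "q \<le> n"
  shows "bar n q \<sigma> \<cdot> bar n q (inv' \<sigma>) = e q" "bar n q (inv' \<sigma>) \<cdot> bar n q \<sigma> = e q"
  using assms by (simp_all add: bar_mult permutes_inv permutes_inv_o)

lemma star_cancel_e:
  assumes "s \<in> carr" "s \<cdot> e q = s" "q \<le> n"
  shows "e q \<cdot> star s = star s"
  using assms star_mult[of s n "e q"] by simp

lemma star_cancel_e':
  assumes "t \<in> carr" "e q \<cdot> t = t" "q \<le> n"
  shows "star t \<cdot> e q = star t"
  using assms star_mult[of "e q" n t] by simp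

lemma rank_sandwich:
  assumes s: "s \<in> carr" "s \<cdot> e q = s" "rank s = q" and t: "t \<in> carr" "e q \<cdot> t = t" "rank t = q"
    and \<sigma>: "\<sigma> permutes {1..q}" and q: "q \<le> n"
  shows "star s \<cdot> (s \<cdot> bar n q \<sigma> \<cdot> t) \<cdot> star t = bar n q \<sigma>" "rank (s \<cdot> bar n q \<sigma> \<cdot> t) = q"
proof -
  have b: "bar n q \<sigma> \<in> carr" using \<sigma> q by simp
  have "star s \<cdot> (s \<cdot> bar n q \<sigma> \<cdot> t) \<cdot> star t = (star s \<cdot> s) \<cdot> bar n q \<sigma> \<cdot> (t \<cdot> star t)"
    using s t b by (simp add: mul_assoc)
  then show *: "star s \<cdot> (s \<cdot> bar n q \<sigma> \<cdot> t) \<cdot> star t = bar n q \<sigma>"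
    using s t q \<sigma> by (simp add: star_cancel star_cancel')
  have "q \<le> rank (s \<cdot> bar n q \<sigma> \<cdot> t)"
    using rank_mult_le1[of "star s \<cdot> (s \<cdot> bar n q \<sigma> \<cdot> t)" "star t"]
      rank_mult_le2[of "star s" "s \<cdot> bar n q \<sigma> \<cdot> t"] s t b * rank_bar[OF \<sigma> q] by simp
  moreover have "rank (s \<cdot> bar n q \<sigma> \<cdot> t) \<le> q"
    using rank_mult_le2[of "s \<cdot> bar n q \<sigma>" t] s t b by simp
  ultimately show "rank (s \<cdot> bar n q \<sigma> \<cdot> t) = q" by simp
qed

lemma rank_product:
  assumes "s \<in> carr" "s \<cdot> e q = s" "rank s = q" "t \<in> carr" "e q \<cdot> t = t" "rank t = q" "q \<le> n"
  shows "rank (s \<cdot> t) = q"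
  using rank_sandwich(2)[of s q t id] assms by (simp add: permutes_id)

lemma nu_relI:
  "\<lbrakk>s \<in> carr; t \<in> carr; s \<cdot> e q = s; e q \<cdot> t = t; rank s = q; rank t = q; \<sigma> \<in> N\<rbrakk>
    \<Longrightarrow> (s \<cdot> t, s \<cdot> bar n q \<sigma> \<cdot> t) \<in> nu_rel q N"
  unfolding nu_rel_def by blast

lemma nu_relE:
  assumes "(\<alpha>, \<beta>) \<in> nu_rel q N"
  obtains s t \<sigma> where "s \<in> carr" "t \<in> carr" "s \<cdot> e q = s" "e q \<cdot> t = t" "rank s = q" "rank t = q" "\<sigma> \<in> N"
    "\<alpha> = s \<cdot> t" "\<beta> = s \<cdot> bar n q \<sigma> \<cdot> t"
  using assms unfolding nu_rel_def by blast

lemma nu_rel_rank: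
  assumes "N \<lhd> sym_group q" "q \<le> n" "(\<alpha>, \<beta>) \<in> nu_rel q N"
  shows "\<alpha> \<in> carr" "\<beta> \<in> carr" "rank \<alpha> = q" "rank \<beta> = q"
proof -
  obtain s t \<sigma> where st: "s \<in> carr" "t \<in> carr" "s \<cdot> e q = s" "e q \<cdot> t = t" "rank s = q" "rank t = q" "\<sigma> \<in> N"
    "\<alpha> = s \<cdot> t" "\<beta> = s \<cdot> bar n q \<sigma> \<cdot> t" using assms(3) by (rule nu_relE)
  have \<sigma>: "\<sigma> permutes {1..q}" using normal_sym_group(1)[OF assms(1)] st(7) .
  show "\<alpha> \<in> carr" "\<beta> \<in> carr" using st \<sigma> assms(2) by auto
  show "rank \<alpha> = q" unfolding st(8) by (rule rank_product) (use st assms in auto)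
  show "rank \<beta> = q" unfolding st(9) by (rule rank_sandwich) (use st assms \<sigma> in auto)
qed

lemma nu_rel_sandwich:
  assumes N: "N \<lhd> sym_group q" and q: "q \<le> n" and xy: "\<sigma> \<in> N" "\<tau> \<in> N" and st: "s \<in> carr" "t \<in> carr"
    and r: "rank (s \<cdot> bar n q \<sigma> \<cdot> t) = q"
  shows "(s \<cdot> bar n q \<sigma> \<cdot> t, s \<cdot> bar n q \<tau> \<cdot> t) \<in> nu_rel q N"
proof -
  have p: "\<sigma> permutes {1..q}" "\<tau> permutes {1..q}" using normal_sym_group(1)[OF N] xy by auto
  have b: "bar n q \<sigma> \<in> carr" "bar n q \<tau> \<in> carr" "bar n q (inv' \<sigma>) \<in> carr" using p q permutes_inv[OF p(1)] by auto
  \<comment> \<open>The first permutation is absorbed into the left chart. What remains is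
    \<open>?\<rho>\<close>, in this order because \<open>bar\<close> reverses composition; the rank
    assumption makes both new outer factors charts.\<close>
  let ?s = "s \<cdot> bar n q \<sigma>" and ?t = "e q \<cdot> t" and ?\<rho> = "\<tau> \<circ> inv' \<sigma>"
  have \<rho>: "?\<rho> \<in> N" using normal_sym_group(3,4)[OF N] xy by blast
  have t: "?t \<in> carr" "e q \<cdot> ?t = ?t" using st q by (simp_all add: e_mult flip: mul_assoc)
  have s: "?s \<in> carr" "?s \<cdot> e q = ?s" using st b p q by (simp_all add: mul_assoc)
  have eq: "?s \<cdot> ?t = s \<cdot> bar n q \<sigma> \<cdot> t"
  proof -
    have "?s \<cdot> ?t = (?s \<cdot> e q) \<cdot> t" using s(1) st q by (simp add: mul_assoc)
    then show ?thesis by (simp only: s(2))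
  qed
  have "bar n q \<sigma> \<cdot> bar n q ?\<rho> = bar n q \<tau>"
  proof -
    have "?\<rho> \<circ> \<sigma> = \<tau>" using p(1) by (simp add: comp_assoc permutes_inv_o)
    then show ?thesis using bar_mult[OF p(1) normal_sym_group(1)[OF N \<rho>] q] by simp
  qed
  moreover have "bar n q ?\<rho> \<in> carr" using normal_sym_group(1)[OF N \<rho>] q by simp
  ultimately have eq2: "?s \<cdot> bar n q ?\<rho> \<cdot> ?t = s \<cdot> bar n q \<tau> \<cdot> t"
  proof -
    assume a: "bar n q \<sigma> \<cdot> bar n q ?\<rho> = bar n q \<tau>" "bar n q ?\<rho> \<in> carr"
    have "?s \<cdot> bar n q ?\<rho> \<cdot> ?t = s \<cdot> (bar n q \<sigma> \<cdot> bar n q ?\<rho>) \<cdot> ?t" using st b a(2) q by (simp add: mul_assoc)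
    also have "\<dots> = s \<cdot> (bar n q \<tau> \<cdot> e q) \<cdot> t" unfolding a(1) using st b q by (simp add: mul_assoc)
    finally show ?thesis using p q by simp
  qed
  have "q \<le> rank ?s" "q \<le> rank ?t"
    using rank_mult_le1[OF s(1) t(1)] rank_mult_le2[OF s(1) t(1)] r eq by simp_all
  moreover have "rank ?s \<le> q" "rank ?t \<le> q"
    using rank_mult_le2[OF st(1) b(1)] rank_mult_le1[OF e_closed[OF q] st(2)] rank_bar[OF p(1) q] q by simp_all
  ultimately have "rank ?s = q" "rank ?t = q" by simp_all
  then show ?thesis using nu_relI[OF s(1) t(1) s(2) t(2) _ _ \<rho>] unfolding eq eq2 by simp
qed

lemma nu_eq_nu_rel:
  assumes N: "N \<lhd> sym_group q" and q: "q \<le> n"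
  shows "nu (PB n) (bar n q ` N) = nu_rel q N"
proof (intro equalityI subrelI)
  fix \<alpha> \<beta> assume ab: "(\<alpha>, \<beta>) \<in> nu (PB n) (bar n q ` N)"
  then have "\<exists>s t x y. (\<alpha>, \<beta>) = (s \<cdot> x \<cdot> t, s \<cdot> y \<cdot> t) \<and>
      x \<in> bar n q ` N \<and> y \<in> bar n q ` N \<and> s \<in> carr \<and> t \<in> carr"
    unfolding nu_def by (elim IntE CollectE)
  then obtain s t x y where ab': "\<alpha> = s \<cdot> x \<cdot> t" "\<beta> = s \<cdot> y \<cdot> t" "s \<in> carr" "t \<in> carr"
    and xy: "x \<in> bar n q ` N" "y \<in> bar n q ` N" by blast
  obtain \<sigma> where \<sigma>: "x = bar n q \<sigma>" "\<sigma> \<in> N" using xy(1) by blast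
  obtain \<tau> where \<tau>: "y = bar n q \<tau>" "\<tau> \<in> N" using xy(2) by blast
  have "rank \<alpha> = q" using ab unfolding nu_def GreenJ_bar[OF N q] by auto
  then show "(\<alpha>, \<beta>) \<in> nu_rel q N" using nu_rel_sandwich[OF N q \<sigma>(2) \<tau>(2) ab'(3,4)] ab' \<sigma> \<tau> by simp
next
  fix \<alpha> \<beta> assume ab: "(\<alpha>, \<beta>) \<in> nu_rel q N"
  then obtain s t \<sigma> where st: "s \<in> carr" "t \<in> carr" "s \<cdot> e q = s" "\<sigma> \<in> N" "\<alpha> = s \<cdot> t" "\<beta> = s \<cdot> bar n q \<sigma> \<cdot> t"
    by (rule nu_relE)
  then have "\<alpha> = s \<cdot> bar n q id \<cdot> t" by simp
  moreover have "bar n q id \<in> bar n q ` N" "bar n q \<sigma> \<in> bar n q ` N"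
    using normal_sym_group(2)[OF N] st(4) by blast+
  ultimately show "(\<alpha>, \<beta>) \<in> nu (PB n) (bar n q ` N)"
    unfolding nu_def GreenJ_bar[OF N q] using nu_rel_rank[OF N q ab] st(1,2,6) by blast
qed

lemma nu_rel_sym:
  assumes N: "N \<lhd> sym_group q" and q: "q \<le> n" and ab: "(\<alpha>, \<beta>) \<in> nu_rel q N"
  shows "(\<beta>, \<alpha>) \<in> nu_rel q N"
proof -
  obtain s t \<sigma> where st: "s \<in> carr" "t \<in> carr" "s \<cdot> e q = s" "\<sigma> \<in> N" "\<alpha> = s \<cdot> t" "\<beta> = s \<cdot> bar n q \<sigma> \<cdot> t"
    using ab by (rule nu_relE)
  have "(s \<cdot> bar n q \<sigma> \<cdot> t, s \<cdot> bar n q id \<cdot> t) \<in> nu_rel q N"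
    by (rule nu_rel_sandwich[OF N q]) (use st normal_sym_group(2)[OF N] nu_rel_rank(4)[OF N q ab] in auto)
  then show ?thesis using st by simp
qed

text \<open>The middle element has two chart decompositions. The changes of charts \<open>g\<close>
  and \<open>h\<close> are permutations \<open>a\<close> and \<open>c\<close> with composite
  \<sigma>, and in the first charts the total permutation is c \<tau> a, the conjugate of \<tau> by
  \<open>c\<close> followed by \<sigma>. Normality of \<open>N\<close> enters here.\<close>

lemma nu_rel_trans:
  assumes N: "N \<lhd> sym_group q" and q: "q \<le> n" and ab: "(\<alpha>, \<beta>) \<in> nu_rel q N" and bc: "(\<beta>, \<gamma>) \<in> nu_rel q N"
  shows "(\<alpha>, \<gamma>) \<in> nu_rel q N"
proof -
  obtain s t \<sigma> where s: "s \<in> carr" "s \<cdot> e q = s" "rank s = q" and t: "t \<in> carr" "e q \<cdot> t = t" "rank t = q"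
    and \<sigma>: "\<sigma> \<in> N" and a: "\<alpha> = s \<cdot> t" and b: "\<beta> = s \<cdot> bar n q \<sigma> \<cdot> t"
    using ab by (rule nu_relE) blast
  obtain s' t' \<tau> where s': "s' \<in> carr" "s' \<cdot> e q = s'" "rank s' = q" and t': "t' \<in> carr" "e q \<cdot> t' = t'" "rank t' = q"
    and \<tau>: "\<tau> \<in> N" and b': "\<beta> = s' \<cdot> t'" and c: "\<gamma> = s' \<cdot> bar n q \<tau> \<cdot> t'"
    using bc by (rule nu_relE) blast
  have p: "\<sigma> permutes {1..q}" "\<tau> permutes {1..q}" using normal_sym_group(1)[OF N] \<sigma> \<tau> by auto
  have bar: "bar n q \<sigma> \<in> carr" "bar n q \<tau> \<in> carr" using p q by auto
  have st: "star s \<in> carr" "star t \<in> carr" "star s' \<in> carr" "star t' \<in> carr" using s t s' t' by auto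
  define g where "g = star s \<cdot> s'"
  define h where "h = t' \<cdot> star t"
  have gh: "g \<in> carr" "h \<in> carr" unfolding g_def h_def using st s' t' by auto
  have "g \<cdot> h = star s \<cdot> (s' \<cdot> t') \<cdot> star t" unfolding g_def h_def using st s' t' by (simp add: mul_assoc)
  then have gh\<sigma>: "g \<cdot> h = bar n q \<sigma>"
    using rank_sandwich(1)[OF s t p(1) q] by (simp flip: b b')
  have ge: "e q \<cdot> g = g" "g \<cdot> e q = g" "e q \<cdot> h = h" "h \<cdot> e q = h"
    unfolding g_def h_def using star_cancel_e[OF s(1,2) q] star_cancel_e'[OF t(1,2) q] s' t' st q
    by (simp_all add: mul_assoc flip: mul_assoc[of "e q"])
  have "q \<le> rank g" "q \<le> rank h"
    using rank_mult_le1[OF gh] rank_mult_le2[OF gh] gh\<sigma> rank_bar[OF p(1) q] by auto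
  moreover have "rank g \<le> q" "rank h \<le> q"
    using rank_mult_le2[OF st(1) s'(1)] rank_mult_le1[OF t'(1) st(2)] s' t' by (auto simp: g_def h_def)
  ultimately have "rank g = q" "rank h = q" by auto
  then obtain a c where ac: "a permutes {1..q}" "g = bar n q a" "c permutes {1..q}" "h = bar n q c"
    using group_elem[OF gh(1) ge(1,2) _ q] group_elem[OF gh(2) ge(3,4) _ q] by blast
  have ca: "c \<circ> a = \<sigma>"
    by (rule bar_inj[of _ q]) (use bar_mult[OF ac(1,3) q] gh\<sigma> ac p q in \<open>auto intro: permutes_compose\<close>)
  have sg: "s \<cdot> g = s'"
  proof -
    have "s' = s' \<cdot> (t' \<cdot> star t')" using star_cancel'[OF t' q] s'(2) by simp
    also have "\<dots> = s \<cdot> bar n q \<sigma> \<cdot> t \<cdot> star t'" using s' t' st b b' by (simp flip: mul_assoc)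
    finally have s'eq: "s' = s \<cdot> bar n q \<sigma> \<cdot> t \<cdot> star t'" .
    have "s \<cdot> g = s \<cdot> (star s \<cdot> (s \<cdot> bar n q \<sigma> \<cdot> t \<cdot> star t'))" unfolding g_def s'eq[symmetric] ..
    also have "\<dots> = s \<cdot> (star s \<cdot> s) \<cdot> (bar n q \<sigma> \<cdot> t \<cdot> star t')" using s t st bar by (simp add: mul_assoc)
    also have "\<dots> = s \<cdot> (bar n q \<sigma> \<cdot> t \<cdot> star t')" using star_cancel[OF s q] s(2) by simp
    also have "\<dots> = s'" using s t st bar by (simp add: s'eq mul_assoc)
    finally show ?thesis .
  qed
  have ht: "h \<cdot> t = t'"
  proof -
    have "t' = (star s' \<cdot> s') \<cdot> t'" using star_cancel[OF s' q] t'(2) by simp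
    also have "\<dots> = star s' \<cdot> (s \<cdot> bar n q \<sigma> \<cdot> t)" using s' t' st b b' by (simp add: mul_assoc)
    finally have t'eq: "t' = star s' \<cdot> (s \<cdot> bar n q \<sigma> \<cdot> t)" .
    have "h \<cdot> t = star s' \<cdot> (s \<cdot> bar n q \<sigma> \<cdot> t) \<cdot> star t \<cdot> t" unfolding h_def t'eq[symmetric] ..
    also have "\<dots> = star s' \<cdot> (s \<cdot> bar n q \<sigma> \<cdot> ((t \<cdot> star t) \<cdot> t))" using s t st bar by (simp add: mul_assoc)
    also have "\<dots> = t'" using star_cancel'[OF t q] t(2) by (simp flip: t'eq)
    finally show ?thesis .
  qed
  let ?\<rho> = "(c \<circ> \<tau> \<circ> inv' c) \<circ> \<sigma>"
  have \<rho>: "?\<rho> \<in> N" using normal_sym_group(3,5)[OF N] \<sigma> \<tau> ac(3) by blast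
  have "\<gamma> = (s \<cdot> g) \<cdot> bar n q \<tau> \<cdot> (h \<cdot> t)" using c sg ht by simp
  also have "\<dots> = s \<cdot> ((g \<cdot> bar n q \<tau>) \<cdot> h) \<cdot> t" using s t gh bar by (simp add: mul_assoc)
  also have "(g \<cdot> bar n q \<tau>) \<cdot> h = bar n q (c \<circ> (\<tau> \<circ> a))"
    using ac p q by (simp add: bar_mult permutes_compose)
  also have "c \<circ> (\<tau> \<circ> a) = ?\<rho>" unfolding ca[symmetric] using ac(3)
    by (simp add: fun_eq_iff permutes_inverses)
  finally have "\<gamma> = s \<cdot> bar n q ?\<rho> \<cdot> t" .
  then show ?thesis using nu_relI[OF s(1) t(1) s(2) t(2) s(3) t(3) \<rho>] a by simp
qed

definition kap :: "nat \<Rightarrow> bool \<Rightarrow> bool \<Rightarrow> pb_rel" where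
  "kap p P Q = {(x, y) \<in> I_rank n p \<times> I_rank n p.
     (P \<longrightarrow> \<omega> \<cdot> x = \<omega> \<cdot> y) \<and> (Q \<longrightarrow> x \<cdot> \<omega> = y \<cdot> \<omega>)}"

text \<open>
  All congruences other than \<open>\<nabla>\<close> are of this form with \<open>1 \<le> q \<le> n\<close>, \<open>N \<lhd> \<S>\<^sub>q\<close> and
  \<open>q \<le> 2\<close> unless both flags are false. The flag pairs (True, True), (True, False), (False, True)
  and (False, False) give \<open>\<mu>\<close>, \<open>\<lambda>\<close>, \<open>\<rho>\<close> and \<open>R\<close>.
\<close>
definition con :: "nat \<Rightarrow> (nat \<Rightarrow> nat) set \<Rightarrow> bool \<Rightarrow> bool \<Rightarrow> pb_rel" where
  "con q N P Q = Delta (PB n) \<union> nu_rel q N \<union> kap (q - 1) P Q"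

text \<open>This is where the two layers of \<open>con\<close> meet: when a multiplication lowers
  the rank of a chart, a pair from \<open>nu_rel\<close> must land in \<open>kap\<close>. For
  \<open>q \<le> 2\<close> its halves agree because rank-zero elements do not see the permutation;
  otherwise no halves are compared.\<close>

lemma nu_rel_link:
  assumes q: "1 \<le> q" "q \<le> n" "q \<le> 2 \<or> \<not> P \<and> \<not> Q" and \<sigma>: "\<sigma> permutes {1..q}"
    and w: "w \<in> carr" "w \<cdot> e q = w" "rank w < q" and t: "t \<in> carr" "e q \<cdot> t = t"
  shows "(w \<cdot> t, w \<cdot> bar n q \<sigma> \<cdot> t) \<in> kap (q - 1) P Q"
proof -
  have b: "bar n q \<sigma> \<in> carr" using \<sigma> q by simp
  have r: "rank (w \<cdot> t) \<le> q - 1" "rank (w \<cdot> bar n q \<sigma> \<cdot> t) \<le> q - 1"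
    using rank_mult_le1[OF w(1) t(1)] rank_mult_le1[of "w \<cdot> bar n q \<sigma>" t] rank_mult_le1[OF w(1) b] w t b by auto
  have "\<omega> \<cdot> (w \<cdot> t) = \<omega> \<cdot> (w \<cdot> bar n q \<sigma> \<cdot> t)" if "q \<le> 2"
  proof -
    have "(\<omega> \<cdot> w) \<cdot> bar n q \<sigma> = (\<omega> \<cdot> w) \<cdot> e q"
      by (rule rank0_mult_bar) (use that q \<sigma> w rank0_mult in auto)
    then have *: "\<omega> \<cdot> w \<cdot> bar n q \<sigma> = \<omega> \<cdot> w" using w q by (simp add: mul_assoc)
    have "\<omega> \<cdot> (w \<cdot> bar n q \<sigma> \<cdot> t) = (\<omega> \<cdot> w \<cdot> bar n q \<sigma>) \<cdot> t" using w t b by (simp add: mul_assoc)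
    then show ?thesis unfolding * using w t by (simp add: mul_assoc)
  qed
  moreover have "w \<cdot> t \<cdot> \<omega> = w \<cdot> bar n q \<sigma> \<cdot> t \<cdot> \<omega>" if "q \<le> 2"
  proof -
    have "bar n q \<sigma> \<cdot> (t \<cdot> \<omega>) = e q \<cdot> (t \<cdot> \<omega>)"
      by (rule bar_mult_rank0) (use that q \<sigma> t rank0_mult in auto)
    moreover have "e q \<cdot> (t \<cdot> \<omega>) = t \<cdot> \<omega>" using t q by (simp flip: mul_assoc)
    ultimately have *: "bar n q \<sigma> \<cdot> (t \<cdot> \<omega>) = t \<cdot> \<omega>" by simp
    have "w \<cdot> bar n q \<sigma> \<cdot> t \<cdot> \<omega> = w \<cdot> (bar n q \<sigma> \<cdot> (t \<cdot> \<omega>))" using w t b by (simp add: mul_assoc)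
    then show ?thesis unfolding * using w t by (simp add: mul_assoc)
  qed
  ultimately show ?thesis using r w t b q(3) by (auto simp: kap_def I_rank_iff)
qed

lemma star_kap: "(\<alpha>, \<beta>) \<in> kap p P Q \<longleftrightarrow> \<alpha> \<in> carr \<and> \<beta> \<in> carr \<and> (star \<alpha>, star \<beta>) \<in> kap p Q P"
proof -
  have "\<omega> \<cdot> star \<alpha> = \<omega> \<cdot> star \<beta> \<longleftrightarrow> \<alpha> \<cdot> \<omega> = \<beta> \<cdot> \<omega>" "star \<alpha> \<cdot> \<omega> = star \<beta> \<cdot> \<omega> \<longleftrightarrow> \<omega> \<cdot> \<alpha> = \<omega> \<cdot> \<beta>"
    if "\<alpha> \<in> carr" "\<beta> \<in> carr"
  proof -
    have inj: "star a = star b \<longleftrightarrow> a = b" for a b by (metis star_star)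
    have "\<omega> \<cdot> star \<alpha> = star (\<alpha> \<cdot> \<omega>)" "\<omega> \<cdot> star \<beta> = star (\<beta> \<cdot> \<omega>)" "star \<alpha> \<cdot> \<omega> = star (\<omega> \<cdot> \<alpha>)" "star \<beta> \<cdot> \<omega> = star (\<omega> \<cdot> \<beta>)"
      using that by (simp_all add: star_mult[where n = n])
    then show "\<omega> \<cdot> star \<alpha> = \<omega> \<cdot> star \<beta> \<longleftrightarrow> \<alpha> \<cdot> \<omega> = \<beta> \<cdot> \<omega>" "star \<alpha> \<cdot> \<omega> = star \<beta> \<cdot> \<omega> \<longleftrightarrow> \<omega> \<cdot> \<alpha> = \<omega> \<cdot> \<beta>"
      by (simp_all only: inj)
  qed
  then show ?thesis unfolding kap_def by (auto simp: I_rank_iff)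
qed

lemma star_nu_rel:
  assumes N: "N \<lhd> sym_group q" and q: "q \<le> n" and ab: "(\<alpha>, \<beta>) \<in> nu_rel q N"
  shows "(star \<alpha>, star \<beta>) \<in> nu_rel q N"
proof -
  obtain s t \<sigma> where s: "s \<in> carr" "s \<cdot> e q = s" "rank s = q" and t: "t \<in> carr" "e q \<cdot> t = t" "rank t = q"
    and \<sigma>: "\<sigma> \<in> N" and a: "\<alpha> = s \<cdot> t" and b: "\<beta> = s \<cdot> bar n q \<sigma> \<cdot> t"
    using ab by (rule nu_relE) blast
  have p: "\<sigma> permutes {1..q}" using normal_sym_group(1)[OF N \<sigma>] .
  have "star \<alpha> = star t \<cdot> star s" unfolding a using s t by (simp add: star_mult[where n = n])
  moreover have "star \<beta> = star t \<cdot> bar n q (inv' \<sigma>) \<cdot> star s"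
    unfolding b using s t p q permutes_inv[OF p] by (simp add: star_mult[where n = n] star_bar mul_assoc)
  ultimately show ?thesis
    using nu_relI[of "star t" "star s" q "inv' \<sigma>" N] s t star_cancel_e[OF s(1,2) q] star_cancel_e'[OF t(1,2) q]
      normal_sym_group(4)[OF N \<sigma>] by simp
qed

lemma con_cases:
  assumes "(\<alpha>, \<beta>) \<in> con q N P Q"
  obtains "\<alpha> = \<beta>" "\<alpha> \<in> carr" | "(\<alpha>, \<beta>) \<in> nu_rel q N" | "(\<alpha>, \<beta>) \<in> kap (q - 1) P Q"
  using assms by (auto simp: con_def Delta_def)

text \<open>Reflection exchanges upper and lower halves, hence the flags. This reduces right
  compatibility to left compatibility and later decides which congruences respect the
  involution.\<close>

lemma star_con:
  assumes N: "N \<lhd> sym_group q" and q: "q \<le> n" and ab: "(\<alpha>, \<beta>) \<in> con q N P Q"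
  shows "(star \<alpha>, star \<beta>) \<in> con q N Q P"
  using ab
proof (cases rule: con_cases)
  case 1
  then show ?thesis by (auto simp: con_def Delta_def intro: Id_onI)
next
  case 2
  then show ?thesis using star_nu_rel[OF N q] by (simp add: con_def)
next
  case 3
  then have "(star \<alpha>, star \<beta>) \<in> kap (q - 1) Q P" using star_kap by blast
  then show ?thesis by (simp add: con_def)
qed

lemma con_mult_left:
  assumes N: "N \<lhd> sym_group q" and q: "1 \<le> q" "q \<le> n" "q \<le> 2 \<or> \<not> P \<and> \<not> Q"
    and ab: "(\<alpha>, \<beta>) \<in> con q N P Q" and z: "z \<in> carr"
  shows "(z \<cdot> \<alpha>, z \<cdot> \<beta>) \<in> con q N P Q"
  using ab
proof (cases rule: con_cases)
  case 1
  then show ?thesis using z by (auto simp: con_def Delta_def intro: Id_onI)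
next
  case 2
  then obtain s t \<sigma> where s: "s \<in> carr" "s \<cdot> e q = s" "rank s = q" and t: "t \<in> carr" "e q \<cdot> t = t" "rank t = q"
    and \<sigma>: "\<sigma> \<in> N" and a: "\<alpha> = s \<cdot> t" and b: "\<beta> = s \<cdot> bar n q \<sigma> \<cdot> t"
    by (rule nu_relE) blast
  have p: "\<sigma> permutes {1..q}" using normal_sym_group(1)[OF N \<sigma>] .
  have bar: "bar n q \<sigma> \<in> carr" using p q by simp
  have w: "z \<cdot> s \<in> carr" "z \<cdot> s \<cdot> e q = z \<cdot> s" using z s q by (simp_all add: mul_assoc)
  have za: "z \<cdot> \<alpha> = (z \<cdot> s) \<cdot> t" "z \<cdot> \<beta> = (z \<cdot> s) \<cdot> bar n q \<sigma> \<cdot> t"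
    unfolding a b using z s t bar by (simp_all add: mul_assoc)
  show ?thesis
  proof (cases "rank (z \<cdot> s) = q")
    case True
    then show ?thesis unfolding za con_def using nu_relI[OF w(1) t(1) w(2) t(2) _ t(3) \<sigma>] by blast
  next
    case False
    then have "rank (z \<cdot> s) < q" using rank_mult_le2[OF z s(1)] s(3) by simp
    then show ?thesis unfolding za con_def using nu_rel_link[OF q p w _ t(1,2)] by blast
  qed
next
  case 3
  then have ab: "\<alpha> \<in> carr" "rank \<alpha> \<le> q - 1" "\<beta> \<in> carr" "rank \<beta> \<le> q - 1"
    and eq: "P \<Longrightarrow> \<omega> \<cdot> \<alpha> = \<omega> \<cdot> \<beta>" "Q \<Longrightarrow> \<alpha> \<cdot> \<omega> = \<beta> \<cdot> \<omega>" by (auto simp: kap_def I_rank_iff)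
  have "rank (z \<cdot> \<alpha>) \<le> q - 1" "rank (z \<cdot> \<beta>) \<le> q - 1"
    using rank_mult_le2[OF z ab(1)] rank_mult_le2[OF z ab(3)] ab by auto
  moreover have "\<omega> \<cdot> (z \<cdot> \<alpha>) = \<omega> \<cdot> (z \<cdot> \<beta>)" if P
    using eq(1)[OF that] lower_half_mult[OF ab(1) _ z] lower_half_mult[OF ab(3) _ z] ab q(3) that by simp
  moreover have "z \<cdot> \<alpha> \<cdot> \<omega> = z \<cdot> \<beta> \<cdot> \<omega>" if Q
    using eq(2)[OF that] z ab by (simp add: mul_assoc)
  ultimately have "(z \<cdot> \<alpha>, z \<cdot> \<beta>) \<in> kap (q - 1) P Q" using z ab by (auto simp: kap_def I_rank_iff)
  then show ?thesis by (simp add: con_def)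
qed

lemma con_mult_right:
  assumes N: "N \<lhd> sym_group q" and q: "1 \<le> q" "q \<le> n" "q \<le> 2 \<or> \<not> P \<and> \<not> Q"
    and ab: "(\<alpha>, \<beta>) \<in> con q N P Q" and z: "z \<in> carr"
  shows "(\<alpha> \<cdot> z, \<beta> \<cdot> z) \<in> con q N P Q"
proof -
  have c: "\<alpha> \<in> carr" "\<beta> \<in> carr"
    using ab by (cases rule: con_cases; use nu_rel_rank[OF N q(2)] in \<open>auto simp: kap_def I_rank_iff\<close>)+
  have "(star z \<cdot> star \<alpha>, star z \<cdot> star \<beta>) \<in> con q N Q P"
    by (rule con_mult_left[OF N q(1,2)]) (use q z star_con[OF N q(2) ab] in auto)
  then have "(star (\<alpha> \<cdot> z), star (\<beta> \<cdot> z)) \<in> con q N Q P"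
    using c z by (simp add: star_mult[where n = n])
  then show ?thesis using star_con[OF N q(2)] by (metis star_star)
qed

lemma congruence_con:
  assumes N: "N \<lhd> sym_group q" and q: "1 \<le> q" "q \<le> n" "q \<le> 2 \<or> \<not> P \<and> \<not> Q"
  shows "congruence (PB n) (con q N P Q)"
  unfolding congruence_def
proof (intro conjI)
  have rk: "(\<alpha>, \<beta>) \<in> kap (q - 1) P Q \<Longrightarrow> \<alpha> \<in> carr \<and> \<beta> \<in> carr \<and> rank \<alpha> < q \<and> rank \<beta> < q" for \<alpha> \<beta>
    using q(1) by (auto simp: kap_def I_rank_iff)
  note nr = nu_rel_rank[OF N q(2)]
  show "equiv carr (con q N P Q)"
  proof (rule equivI)
    show "con q N P Q \<subseteq> carr \<times> carr" using rk nr by (auto simp: con_def Delta_def)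
    show "refl_on carr (con q N P Q)" by (auto simp: refl_on_def con_def Delta_def)
    show "sym (con q N P Q)"
    proof (rule symI)
      fix \<alpha> \<beta> assume "(\<alpha>, \<beta>) \<in> con q N P Q"
      then show "(\<beta>, \<alpha>) \<in> con q N P Q"
      proof (cases rule: con_cases)
        case 2
        then show ?thesis using nu_rel_sym[OF N q(2)] by (simp add: con_def)
      qed (auto simp: con_def Delta_def kap_def)
    qed
    show "trans (con q N P Q)"
    \<comment> \<open>The mixed cases are contradictory: \<open>nu_rel\<close> relates elements of
      rank exactly \<open>q\<close>, while \<open>kap\<close> relates elements of smaller
      rank.\<close>
    proof (rule transI)
      fix \<alpha> \<beta> \<gamma> assume ab: "(\<alpha>, \<beta>) \<in> con q N P Q" and bc: "(\<beta>, \<gamma>) \<in> con q N P Q"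
      from ab show "(\<alpha>, \<gamma>) \<in> con q N P Q"
      proof (cases rule: con_cases)
        case 1
        then show ?thesis using bc by simp
      next
        case 2
        from bc show ?thesis
        proof (cases rule: con_cases)
          case 1
          then show ?thesis using ab by simp
        next
          case bc: 2
          show ?thesis using nu_rel_trans[OF N q(2) 2 bc] by (simp add: con_def)
        next
          case 3
          then show ?thesis using rk nr(4)[OF 2] by fastforce
        qed
      next
        case 3
        from bc show ?thesis
        proof (cases rule: con_cases)
          case 1
          then show ?thesis using ab by simp
        next
          case 2
          then show ?thesis using rk[OF 3] nr(3)[OF 2] by simp
        next
          case bc: 3
          have "(\<alpha>, \<gamma>) \<in> kap (q - 1) P Q" using 3 bc by (auto simp: kap_def)
          then show ?thesis by (simp add: con_def)
        qed
      qed
    qed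
  qed
  show "\<forall>(x, y)\<in>con q N P Q. \<forall>z\<in>carr. (z \<cdot> x, z \<cdot> y) \<in> con q N P Q \<and> (x \<cdot> z, y \<cdot> z) \<in> con q N P Q"
    using con_mult_left[OF N q] con_mult_right[OF N q] by auto
qed

end

section \<open>Consequences of a single related pair\<close>

context partial_brauer
begin

lemma congruenceD:
  assumes "congruence (PB n) \<theta>"
  shows "(x, y) \<in> \<theta> \<Longrightarrow> x \<in> carr \<and> y \<in> carr"
    and "x \<in> carr \<Longrightarrow> (x, x) \<in> \<theta>"
    and "(x, y) \<in> \<theta> \<Longrightarrow> (y, x) \<in> \<theta>"
    and "\<lbrakk>(x, y) \<in> \<theta>; (y, z) \<in> \<theta>\<rbrakk> \<Longrightarrow> (x, z) \<in> \<theta>"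
    and "\<lbrakk>(x, y) \<in> \<theta>; z \<in> carr\<rbrakk> \<Longrightarrow> (z \<cdot> x, z \<cdot> y) \<in> \<theta>"
    and "\<lbrakk>(x, y) \<in> \<theta>; z \<in> carr\<rbrakk> \<Longrightarrow> (x \<cdot> z, y \<cdot> z) \<in> \<theta>"
  using assms unfolding congruence_def equiv_def refl_on_def
  by (auto dest: symD transD)

lemma congruence_mult:
  assumes "congruence (PB n) \<theta>" "(x, y) \<in> \<theta>" "(x', y') \<in> \<theta>"
  shows "(x \<cdot> x', y \<cdot> y') \<in> \<theta>"
  using congruenceD[OF assms(1)] assms(2,3) by meson

lemma congruence_sandwich:
  assumes "congruence (PB n) \<theta>" "(x, y) \<in> \<theta>" "s \<in> carr" "t \<in> carr"
  shows "(s \<cdot> x \<cdot> t, s \<cdot> y \<cdot> t) \<in> \<theta>"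
  using congruenceD[OF assms(1)] assms(2-4) by meson

text \<open>The mirror image of a congruence. Applying a statement about upper halves to it gives
  the statement about lower halves.\<close>

definition star_rel :: "pb_rel \<Rightarrow> pb_rel" where
  "star_rel \<theta> = {(x, y). (star x, star y) \<in> \<theta>}"

lemma star_rel_iff: "(x, y) \<in> star_rel \<theta> \<longleftrightarrow> (star x, star y) \<in> \<theta>"
  by (simp add: star_rel_def)

lemma congruence_star_rel:
  assumes "congruence (PB n) \<theta>"
  shows "congruence (PB n) (star_rel \<theta>)"
proof -
  note c = congruenceD[OF assms]
  have "equiv carr (star_rel \<theta>)"
  proof (rule equivI)
    show "star_rel \<theta> \<subseteq> carr \<times> carr" using c(1) by (fastforce simp: star_rel_iff)
    show "refl_on carr (star_rel \<theta>)" using c(2) by (simp add: refl_on_def star_rel_iff)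
    show "sym (star_rel \<theta>)" using c(3) by (simp add: sym_def star_rel_iff)
    show "trans (star_rel \<theta>)" unfolding trans_def star_rel_iff using c(4) by blast
  qed
  moreover have "(z \<cdot> x, z \<cdot> y) \<in> star_rel \<theta> \<and> (x \<cdot> z, y \<cdot> z) \<in> star_rel \<theta>"
    if "(x, y) \<in> star_rel \<theta>" "z \<in> carr" for x y z
  proof -
    have xy: "(star x, star y) \<in> \<theta>" "x \<in> carr" "y \<in> carr"
      using that(1) c(1)[of "star x" "star y"] by (auto simp: star_rel_iff)
    then show ?thesis
      using c(5)[OF xy(1), of "star z"] c(6)[OF xy(1), of "star z"] that(2)
      by (simp add: star_rel_iff star_mult[where n = n])
  qed
  ultimately show ?thesis unfolding congruence_def by blast
qed

text \<open>The rank-zero diagram with hooks {1, 2} and {1', 2'} and singletons elsewhere. Its two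
  halves \<open>hook \<cdot> \<omega>\<close> and \<open>\<omega> \<cdot> hook\<close> each differ
  from \<omega> on one side only, so they test the two flags separately.\<close>

definition hook :: "vertex set set" where
  "hook = pairs n (\<lambda>u. case u of Up i \<Rightarrow> Up (transpose 1 2 i) | Dn i \<Rightarrow> Dn (transpose 1 2 i) | Mid i \<Rightarrow> Mid i)"

lemma pairing_hook:
  assumes "2 \<le> n"
  shows "pairing n (\<lambda>u. case u of Up i \<Rightarrow> Up (transpose 1 2 i) | Dn i \<Rightarrow> Dn (transpose 1 2 i) | Mid i \<Rightarrow> Mid i)"
  unfolding pairing_def
proof
  fix u assume "u \<in> points n"
  moreover have "1 \<le> transpose 1 2 i \<and> transpose 1 2 i \<le> n" if "1 \<le> i" "i \<le> n" for i
    using that assms by (auto simp: transpose_def)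
  ultimately show "(case u of Up i \<Rightarrow> Up (transpose 1 2 i) | Mid i \<Rightarrow> Mid i | Dn i \<Rightarrow> Dn (transpose 1 2 i)) \<in> points n \<and>
    (case case u of Up i \<Rightarrow> Up (transpose 1 2 i) | Mid i \<Rightarrow> Mid i | Dn i \<Rightarrow> Dn (transpose 1 2 i) of
      Up i \<Rightarrow> Up (transpose 1 2 i) | Mid i \<Rightarrow> Mid i | Dn i \<Rightarrow> Dn (transpose 1 2 i)) = u"
    by (cases u) auto
qed

lemma hook_closed [simp]: "2 \<le> n \<Longrightarrow> hook \<in> carr"
  unfolding hook_def by (rule pairs_PB[OF pairing_hook])

lemma mate_hook [simp]:
  assumes "2 \<le> n"
  shows "mate hook (Up i) = Up (transpose 1 2 i)" "mate hook (Dn i) = Dn (transpose 1 2 i)"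
proof -
  have "mate hook (Up i) = Up (transpose 1 2 i) \<and> mate hook (Dn i) = Dn (transpose 1 2 i)"
  proof (cases "1 \<le> i \<and> i \<le> n")
    case True
    then show ?thesis
      using mate_pairs[OF pairing_hook[OF assms], of "Up i"] mate_pairs[OF pairing_hook[OF assms], of "Dn i"]
      unfolding hook_def by simp
  next
    case False
    then have "transpose 1 2 i = i" using assms by (auto simp: transpose_def)
    then show ?thesis
      using False mate_outside[OF hook_closed[OF assms], of "Up i"] mate_outside[OF hook_closed[OF assms], of "Dn i"]
      by auto
  qed
  then show "mate hook (Up i) = Up (transpose 1 2 i)" "mate hook (Dn i) = Dn (transpose 1 2 i)" by auto
qed

lemma rank_hook [simp]: "2 \<le> n \<Longrightarrow> rank hook = 0"
  by (simp add: rank_eq_dom pdom_def)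

lemma star_hook [simp]: "2 \<le> n \<Longrightarrow> star hook = hook"
  by (rule PB_eqI_UpDn[of _ n]) (simp_all add: mate_star_n)

lemma hook_zero_neq: "2 \<le> n \<Longrightarrow> hook \<cdot> \<omega> \<noteq> \<omega>" "2 \<le> n \<Longrightarrow> \<omega> \<cdot> hook \<noteq> \<omega>"
proof -
  assume n: "2 \<le> n"
  have "mate (hook \<cdot> \<omega>) (Up 1) = Up 2" "mate (\<omega> \<cdot> hook) (Dn 1) = Dn 2"
    using n by (simp_all add: rank0_mult_Up rank0_mult_Dn)
  then show "hook \<cdot> \<omega> \<noteq> \<omega>" "\<omega> \<cdot> hook \<noteq> \<omega>" by auto
qed

lemma hook_e:
  assumes n: "2 \<le> n" and q: "2 \<le> q" "q \<le> n"
  shows "hook \<cdot> e q = hook" "e q \<cdot> hook = hook"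
proof -
  have h: "hook \<in> carr" and eq: "e q \<in> carr" using n q by auto
  show *: "hook \<cdot> e q = hook"
  proof (rule PB_eqI_UpDn[of _ n])
    fix i
    show "mate (hook \<cdot> e q) (Up i) = mate hook (Up i)" using n h eq by (simp add: rank0_mult_Up)
    show "mate (hook \<cdot> e q) (Dn i) = mate hook (Dn i)"
    proof (cases "i \<in> {1..q}")
      case True
      then have "transpose 1 2 i \<in> {1..q}" using q by (auto simp: transpose_def)
      then show ?thesis
        using mate_mult_Dn_turn[OF h eq, of i i "transpose 1 2 i" "transpose 1 2 i"] True n q by simp
    next
      case False
      then have "transpose 1 2 i = i" using q by (auto simp: transpose_def)
      then show ?thesis using mate_mult_Dn_Dn[OF h eq, of i i] False n q by simp
    qed
  qed (use h eq in auto)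
  have "star (e q \<cdot> hook) = star hook" using * h eq n q by (simp add: star_mult[where n = n])
  then show "e q \<cdot> hook = hook" by (metis star_star)
qed

text \<open>The two transversals \<open>{a, i'}\<close>, \<open>{b, j'}\<close> replace the upper hook \<open>{a, b}\<close> of \<open>r\<close>.\<close>
lemma two_arms:
  assumes r: "r \<in> carr" "rank r = 0" "mate r (Up a) = Up b" "a \<noteq> b"
    and ij: "i \<noteq> j" "i \<in> {1..n}" "j \<in> {1..n}"
  obtains s where "s \<in> carr" "mate s (Up a) = Dn i" "mate s (Up b) = Dn j"
    "mate s (Dn i) = Up a" "mate s (Dn j) = Up b"
    "\<And>c. c \<noteq> a \<Longrightarrow> c \<noteq> b \<Longrightarrow> mate s (Up c) = mate r (Up c)"
    "\<And>c. c \<noteq> i \<Longrightarrow> c \<noteq> j \<Longrightarrow> mate s (Dn c) = Dn c"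
proof -
  define f where "f = (\<lambda>u. case u of Up c \<Rightarrow> if c = a then Dn i else if c = b then Dn j else mate r (Up c)
    | Dn c \<Rightarrow> if c = i then Up a else if c = j then Up b else Dn c | Mid c \<Rightarrow> Mid c)"
  have ba: "mate r (Up b) = Up a" using r(3) mate_sym[OF r(1)] by blast
  have abn: "a \<in> {1..n}" "b \<in> {1..n}"
    using mate_moved_points[OF r(1,3)] r(4) by auto
  have other: "\<exists>d. mate r (Up c) = Up d \<and> d \<noteq> a \<and> d \<noteq> b \<and> mate r (Up d) = Up c" if "c \<noteq> a" "c \<noteq> b" for c
  proof -
    obtain d where d: "mate r (Up c) = Up d" using rank0_mate[OF r(1,2)] by blast
    then have "mate r (Up d) = Up c" using mate_sym[OF r(1)] by blast
    then show ?thesis using d that r(3) ba by auto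
  qed
  have f: "pairing n f"
    unfolding pairing_def
  proof
    fix u assume u: "u \<in> points n"
    then consider "u = Up a" | "u = Up b" | "u = Dn i" | "u = Dn j"
      | c where "u = Up c" "c \<noteq> a" "c \<noteq> b" | c where "u = Dn c" "c \<noteq> i" "c \<noteq> j"
      by (auto simp: points_def)
    then show "f u \<in> points n \<and> f (f u) = u"
    proof cases
      case 5
      obtain d where "mate r (Up c) = Up d" "d \<noteq> a" "d \<noteq> b" "mate r (Up d) = Up c" using other[OF 5(2,3)] by blast
      then show ?thesis using 5 u mate_points[OF r(1), of "Up c"] by (simp add: f_def)
    qed (use u abn ij r(4) in \<open>auto simp: f_def\<close>)
  qed
  define s where "s = pairs n f"
  have s: "s \<in> carr" unfolding s_def by (rule pairs_PB[OF f])
  have ms: "mate s u = f u" if "u \<in> points n" for u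
    unfolding s_def by (rule mate_pairs[OF f that])
  show ?thesis
  proof (rule that[OF s])
    show "mate s (Up a) = Dn i" "mate s (Up b) = Dn j" "mate s (Dn i) = Up a" "mate s (Dn j) = Up b"
      using ms abn ij r(4) by (auto simp: f_def)
    show "mate s (Up c) = mate r (Up c)" if "c \<noteq> a" "c \<noteq> b" for c
      using ms[of "Up c"] that mate_outside[OF s, of "Up c"] mate_outside[OF r(1), of "Up c"]
      by (cases "Up c \<in> points n") (auto simp: f_def)
    show "mate s (Dn c) = Dn c" if "c \<noteq> i" "c \<noteq> j" for c
      using ms[of "Dn c"] that mate_outside[OF s, of "Dn c"]
      by (cases "Dn c \<in> points n") (auto simp: f_def)
  qed
qed

section \<open>Halves of rank-zero elements under a congruence\<close>

lemma upper_zero_eqI: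
  assumes "x \<in> carr" "y \<in> carr" "rank y = 0" "\<And>i. mate x (Up i) = mate y (Up i)"
  shows "x \<cdot> \<omega> = y \<cdot> \<omega>"
proof (rule PB_eqI_UpDn[of _ n])
  fix i
  obtain j where "mate y (Up i) = Up j" using rank0_mate assms by blast
  then show "mate (x \<cdot> \<omega>) (Up i) = mate (y \<cdot> \<omega>) (Up i)"
    using assms mate_mult_Up_Up[of x n \<omega> i j] mate_mult_Up_Up[of y n \<omega> i j] by simp
qed (use assms in \<open>auto simp: rank0_mult_Dn\<close>)

text \<open>The multiplier \<open>s\<close> sends transversals from 1 and 2 to the ends
  \<open>i\<close> and \<open>j\<close> of the hook of \<open>x\<close> and has singletons
  elsewhere. Through \<open>x\<close> they join to the hook {1, 2}; through \<open>y\<close> they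
  end in a singleton or return to their own start.\<close>

lemma upper_hook_from_pair:
  assumes c: "congruence (PB n) \<theta>" and n: "2 \<le> n" and xy: "(x, y) \<in> \<theta>" "rank x = 0" "rank y = 0"
    and ij: "mate x (Up i) = Up j" "i \<noteq> j" "mate y (Up i) \<noteq> Up j"
  shows "(hook \<cdot> \<omega>, \<omega>) \<in> \<theta>"
proof -
  have X: "x \<in> carr" "y \<in> carr" using congruenceD(1)[OF c xy(1)] by auto
  have ijn: "i \<in> {1..n}" "j \<in> {1..n}" using mate_moved_points[OF X(1) ij(1)] ij(2) by auto
  have h12: "mate hook (Up 1) = Up 2" "(1::nat) \<noteq> 2" using n by auto
  obtain s where s: "s \<in> carr" "mate s (Up 1) = Dn i" "mate s (Up 2) = Dn j"
    "mate s (Dn i) = Up 1" "mate s (Dn j) = Up 2"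
    "\<And>c. c \<noteq> 1 \<Longrightarrow> c \<noteq> 2 \<Longrightarrow> mate s (Up c) = mate hook (Up c)"
    "\<And>c. c \<noteq> i \<Longrightarrow> c \<noteq> j \<Longrightarrow> mate s (Dn c) = Dn c"
    using two_arms[OF hook_closed[OF n] rank_hook[OF n] h12 ij(2) ijn] by metis
  have other: "mate s (Up c) = Up c" if "c \<noteq> 1" "c \<noteq> 2" for c :: nat
    using s(6)[OF that] that n by simp
  have xji: "mate x (Up j) = Up i" using ij(1) mate_sym[OF X(1)] by blast
  have "s \<cdot> x \<cdot> \<omega> = hook \<cdot> \<omega>"
  proof (rule upper_zero_eqI)
    fix c :: nat
    consider "c = 1" | "c = 2" | "c \<noteq> 1" "c \<noteq> 2" by blast
    then show "mate (s \<cdot> x) (Up c) = mate hook (Up c)"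
    proof cases
      case 1
      then show ?thesis using mate_mult_Up_turn[OF s(1) X(1) s(2) ij(1) s(5)] n by simp
    next
      case 2
      then show ?thesis using mate_mult_Up_turn[OF s(1) X(1) s(3) xji s(4)] n by simp
    next
      case 3
      then show ?thesis using mate_mult_Up_Up[OF s(1) X(1) other[OF 3]] n by simp
    qed
  qed (use s X n in auto)
  moreover have "s \<cdot> y \<cdot> \<omega> = \<omega> \<cdot> \<omega>"
  proof (rule upper_zero_eqI)
    fix c :: nat
    obtain k where k: "mate y (Up i) = Up k" using rank0_mate[OF X(2) xy(3)] by blast
    obtain l where l: "mate y (Up j) = Up l" using rank0_mate[OF X(2) xy(3)] by blast
    have kj: "k \<noteq> j" using k ij(3) by auto
    have li: "l \<noteq> i" using l mate_sym[OF X(2)] ij(3) by blast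
    consider "c = 1" | "c = 2" | "c \<noteq> 1" "c \<noteq> 2" by blast
    then show "mate (s \<cdot> y) (Up c) = mate \<omega> (Up c)"
    proof cases
      case 1
      then show ?thesis
        using mate_mult_Up_turn[OF s(1) X(2) s(2) k, of 1] mate_mult_Up_stuck[OF s(1) X(2) s(2) k] s(4) s(7)[OF _ kj]
        by (cases "k = i") auto
    next
      case 2
      then show ?thesis
        using mate_mult_Up_turn[OF s(1) X(2) s(3) l, of 2] mate_mult_Up_stuck[OF s(1) X(2) s(3) l] s(5) s(7)[OF li]
        by (cases "l = j") auto
    next
      case 3
      then show ?thesis using mate_mult_Up_Up[OF s(1) X(2) other[OF 3]] by simp
    qed
  qed (use s X in auto)
  ultimately show ?thesis
    using congruence_sandwich[OF c xy(1) s(1) zero_closed] by (simp add: e_mult)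
qed

text \<open>Hooks are removed one at a time. Replacing a hook {a, b} of \<open>r\<close> by
  transversals into 1 and 2 gives \<open>s\<close> such that \<open>s \<cdot> hook\<close> has the
  upper half of \<open>r\<close> and \<open>s \<cdot> \<omega>\<close> that half with {a, b} cut.
  The induction counts the upper points that are not singletons.\<close>

lemma upper_spread:
  assumes c: "congruence (PB n) \<theta>" and n: "2 \<le> n" and h: "(hook \<cdot> \<omega>, \<omega>) \<in> \<theta>"
    and r: "r \<in> carr" "rank r = 0"
  shows "(r \<cdot> \<omega>, \<omega>) \<in> \<theta>"
  using r
proof (induction "card {i \<in> {1..n}. mate r (Up i) \<noteq> Up i}" arbitrary: r rule: less_induct)
  case less
  note r = less.prems
  show ?case
  proof (cases "\<exists>a b. mate r (Up a) = Up b \<and> a \<noteq> b")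
    case False
    then have "mate r (Up i) = mate \<omega> (Up i)" for i using rank0_mate(1)[OF r, of i] by auto
    then have "r \<cdot> \<omega> = \<omega> \<cdot> \<omega>" by (intro upper_zero_eqI) (use r in auto)
    then show ?thesis using congruenceD(2)[OF c zero_closed] by (simp add: e_mult)
  next
    case True
    then obtain a b where ab: "mate r (Up a) = Up b" "a \<noteq> b" by blast
    have ba: "mate r (Up b) = Up a" using ab mate_sym[OF r(1)] by blast
    have an: "a \<in> {1..n}" using mate_moved_points[OF r(1) ab(1)] ab(2) by auto
    have one: "(1::nat) \<noteq> 2" "1 \<in> {1..n}" "2 \<in> {1..n}" using n by auto
    obtain s where s: "s \<in> carr" "mate s (Up a) = Dn 1" "mate s (Up b) = Dn 2"
      "mate s (Dn 1) = Up a" "mate s (Dn 2) = Up b"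
      "\<And>c. c \<noteq> a \<Longrightarrow> c \<noteq> b \<Longrightarrow> mate s (Up c) = mate r (Up c)"
      using two_arms[OF r ab one] by metis
    have H: "hook \<in> carr" using n by simp
    have h12: "mate hook (Up 1) = Up 2" "mate hook (Up 2) = Up 1" using n by auto
    have other: "\<exists>d. mate s (Up c) = Up d \<and> mate r (Up c) = Up d" if "c \<noteq> a" "c \<noteq> b" for c
      using s(6)[OF that] rank0_mate(1)[OF r, of c] by auto
    have "s \<cdot> hook \<cdot> \<omega> = r \<cdot> \<omega>"
    proof (rule upper_zero_eqI)
      fix c :: nat
      consider "c = a" | "c = b" | "c \<noteq> a" "c \<noteq> b" by blast
      then show "mate (s \<cdot> hook) (Up c) = mate r (Up c)"
      proof cases
        case 1
        then show ?thesis using mate_mult_Up_turn[OF s(1) H s(2) h12(1) s(5)] ab by simp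
      next
        case 2
        then show ?thesis using mate_mult_Up_turn[OF s(1) H s(3) h12(2) s(4)] ba by simp
      next
        case 3
        then show ?thesis using other[OF 3] mate_mult_Up_Up[OF s(1) H] by auto
      qed
    qed (use s r H in auto)
    then have 1: "(r \<cdot> \<omega>, s \<cdot> \<omega>) \<in> \<theta>"
      using congruenceD(5)[OF c h s(1)] s(1) H by (simp add: mul_assoc)
    have sw: "s \<cdot> \<omega> \<in> carr" "rank (s \<cdot> \<omega>) = 0" using s rank0_mult by auto
    have sUp: "mate (s \<cdot> \<omega>) (Up c) = (if c = a \<or> c = b then Up c else mate r (Up c))" for c
      using mate_mult_Up_turn[OF s(1) zero_closed s(2) _ s(4)] mate_mult_Up_turn[OF s(1) zero_closed s(3) _ s(5)]
        other[of c] mate_mult_Up_Up[OF s(1) zero_closed, of c] by auto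
    let ?H = "\<lambda>x. {i \<in> {1..n}. mate x (Up i) \<noteq> Up i}"
    have "?H (s \<cdot> \<omega>) \<subseteq> ?H r" by (auto simp: sUp split: if_splits)
    moreover have "a \<in> ?H r" "a \<notin> ?H (s \<cdot> \<omega>)" using ab an by (simp_all add: sUp)
    ultimately have "?H (s \<cdot> \<omega>) \<subset> ?H r" by blast
    then have "card {i \<in> {1..n}. mate (s \<cdot> \<omega>) (Up i) \<noteq> Up i} < card {i \<in> {1..n}. mate r (Up i) \<noteq> Up i}"
      by (intro psubset_card_mono) auto
    then have "(s \<cdot> \<omega> \<cdot> \<omega>, \<omega>) \<in> \<theta>" using less.hyps sw by blast
    moreover have "s \<cdot> \<omega> \<cdot> \<omega> = s \<cdot> \<omega>" using s by (simp add: mul_assoc e_mult)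
    ultimately show ?thesis using congruenceD(4)[OF c 1] by simp
  qed
qed

lemma upper_hook_collapse:
  assumes c: "congruence (PB n) \<theta>" and n: "2 \<le> n" and xy: "(x, y) \<in> \<theta>" "rank x = 0" "rank y = 0"
    and ne: "x \<cdot> \<omega> \<noteq> y \<cdot> \<omega>"
  shows "(hook \<cdot> \<omega>, \<omega>) \<in> \<theta>"
proof -
  have X: "x \<in> carr" "y \<in> carr" using congruenceD(1)[OF c xy(1)] by auto
  obtain i where i: "mate x (Up i) \<noteq> mate y (Up i)" using ne upper_zero_eqI X xy(3) by metis
  obtain j where j: "mate x (Up i) = Up j" using rank0_mate[OF X(1) xy(2)] by blast
  obtain k where k: "mate y (Up i) = Up k" using rank0_mate[OF X(2) xy(3)] by blast
  show ?thesis
  proof (cases "i = j")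
    case False
    \<comment> \<open>If \<open>i\<close> is not single in \<open>x\<close>, the required hook is
      taken from \<open>x\<close>. Otherwise, in the next case, \<open>i\<close> is single in
      \<open>x\<close> and so belongs to a hook of \<open>y\<close>, and the pair is
      reversed.\<close>
    then show ?thesis using upper_hook_from_pair[OF c n xy j] i j by simp
  next
    case True
    then have "i \<noteq> k" using i j k by auto
    then show ?thesis using upper_hook_from_pair[OF c n congruenceD(3)[OF c xy(1)] xy(3,2) k] i k by simp
  qed
qed

lemma lower_spread:
  assumes c: "congruence (PB n) \<theta>" and n: "2 \<le> n" and h: "(\<omega> \<cdot> hook, \<omega>) \<in> \<theta>"
    and r: "r \<in> carr" "rank r = 0"
  shows "(\<omega> \<cdot> r, \<omega>) \<in> \<theta>"
proof -
  have "(hook \<cdot> \<omega>, \<omega>) \<in> star_rel \<theta>" using h n by (simp add: star_rel_iff star_mult[where n = n])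
  then have "(star r \<cdot> \<omega>, \<omega>) \<in> star_rel \<theta>"
    using upper_spread[OF congruence_star_rel[OF c] n, of "star r"] r by simp
  then show ?thesis using r by (simp add: star_rel_iff star_mult[where n = n])
qed

lemma lower_hook_collapse:
  assumes c: "congruence (PB n) \<theta>" and n: "2 \<le> n" and xy: "(x, y) \<in> \<theta>" "rank x = 0" "rank y = 0"
    and ne: "\<omega> \<cdot> x \<noteq> \<omega> \<cdot> y"
  shows "(\<omega> \<cdot> hook, \<omega>) \<in> \<theta>"
proof -
  have X: "x \<in> carr" "y \<in> carr" using congruenceD(1)[OF c xy(1)] by auto
  have "star (\<omega> \<cdot> x) \<noteq> star (\<omega> \<cdot> y)" using ne by (metis star_star)
  then have "(hook \<cdot> \<omega>, \<omega>) \<in> star_rel \<theta>"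
    by (intro upper_hook_collapse[OF congruence_star_rel[OF c] n, of "star x" "star y"])
      (use X xy in \<open>simp_all add: star_rel_iff star_mult[where n = n]\<close>)
  then show ?thesis using n by (simp add: star_rel_iff star_mult[where n = n])
qed

text \<open>A left factor can open new domain points only through its lower hooks, as in the zigzag
  rule. A partial identity has no hooks.\<close>

lemma pdom_pid_mult:
  assumes "\<gamma> \<in> carr"
  shows "pdom (pid A \<cdot> \<gamma>) \<subseteq> A \<inter> pdom \<gamma>"
proof
  fix i assume i: "i \<in> pdom (pid A \<cdot> \<gamma>)"
  then have A: "i \<in> A \<inter> {1..n}" using pdom_mult[OF pid_closed assms, of A] by auto
  moreover have "i \<in> pdom \<gamma>"
  proof (rule ccontr)
    assume "i \<notin> pdom \<gamma>"
    then obtain k where k: "mate \<gamma> (Up i) = Up k" using mate_Up_cases[OF assms, of i] by (auto simp: pdom_def)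
    have pi: "mate (pid A) (Up i) = Dn i" using A by simp
    have "\<exists>j. mate (pid A \<cdot> \<gamma>) (Up i) = Up j"
      using mate_mult_Up_turn[OF pid_closed assms pi k, of k] mate_mult_Up_stuck[OF pid_closed assms pi k]
      by (cases "k \<in> A \<inter> {1..n}") auto
    then show False using i by (auto simp: pdom_def)
  qed
  ultimately show "i \<in> A \<inter> pdom \<gamma>" by blast
qed

text \<open>
  Once \<open>e\<^sub>q\<close> is related to an element of smaller rank, the induction hypothesis for \<open>q - 1\<close> relates it
  to some \<open>\<gamma>\<close> of rank 0, and then \<open>\<omega> = \<omega> e\<^sub>q\<close>, \<open>\<omega> \<gamma>\<close>, \<open>\<gamma> \<omega>\<close> and \<open>\<gamma> = \<gamma> \<omega> \<gamma>\<close> are all related.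
\<close>
lemma rank_drop_collapse:
  assumes c: "congruence (PB n) \<theta>" and "(\<alpha>, \<beta>) \<in> \<theta>" "rank \<alpha> = q" "rank \<beta> < q"
  shows "(e q, \<omega>) \<in> \<theta>"
  using assms(2-)
proof (induction q arbitrary: \<alpha> \<beta> rule: less_induct)
  case (less q)
  have ab: "\<alpha> \<in> carr" "\<beta> \<in> carr" using congruenceD(1)[OF c less.prems(1)] by auto
  have q: "q \<le> n" using rank_le[OF ab(1)] less.prems by simp
  obtain u v where uv: "u \<in> carr" "v \<in> carr" "u \<cdot> \<alpha> \<cdot> v = e q" "e q \<cdot> u = u" "v \<cdot> e q = v"
    using e_from_rank[OF ab(1) less.prems(2)] by metis
  define \<gamma> where "\<gamma> = u \<cdot> \<beta> \<cdot> v"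
  have \<gamma>: "\<gamma> \<in> carr" using ab uv by (simp add: \<gamma>_def)
  have eg: "(e q, \<gamma>) \<in> \<theta>"
    using congruence_sandwich[OF c less.prems(1) uv(1,2)] uv(3) by (simp add: \<gamma>_def)
  have "e q \<cdot> \<gamma> = e q \<cdot> u \<cdot> \<beta> \<cdot> v" unfolding \<gamma>_def using uv(1,2) ab q by (simp add: mul_assoc)
  then have e\<gamma>: "e q \<cdot> \<gamma> = \<gamma>" by (simp add: uv(4) \<gamma>_def)
  have rg: "rank \<gamma> < q"
    using rank_mult_le1[of "u \<cdot> \<beta>" v] rank_mult_le2[of u \<beta>] uv ab less.prems(3) by (simp add: \<gamma>_def)
  have "\<exists>\<gamma>0. (e q, \<gamma>0) \<in> \<theta> \<and> rank \<gamma>0 = 0"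
  proof (cases "q = 1")
    case True
    then show ?thesis using eg rg by auto
  next
    case False
    then have q2: "2 \<le> q" using rg by simp
    have dg: "pdom \<gamma> \<subseteq> {1..q}" using pdom_mult[OF e_closed[OF q] \<gamma>] e\<gamma> q by simp
    \<comment> \<open>Cutting the transversal at \<open>i\<close> costs \<open>e q\<close> exactly
      one rank. If \<gamma> has rank \<open>q - 1\<close> it must lose one too, so \<open>i\<close>
      is then taken from its domain; this keeps the ranks strictly apart for the induction
      hypothesis.\<close>
    obtain i where i: "i \<in> {1..q}" "rank \<gamma> = q - 1 \<Longrightarrow> i \<in> pdom \<gamma>"
    proof (cases "pdom \<gamma> = {}")
      case True
      then have "rank \<gamma> = 0" using rank_eq_dom[OF \<gamma>] by simp
      then show ?thesis using that[of 1] q2 by simp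
    next
      case False
      then show ?thesis using that dg by blast
    qed
    let ?f = "pid ({1..q} - {i})"
    have A: "({1..q} - {i}) \<inter> {1..n} = {1..q} - {i}" using q by auto
    have "?f \<cdot> e q = pid (({1..q} - {i}) \<inter> {1..q})" using q by (simp add: e_eq_pid pid_mult)
    also have "({1..q} - {i}) \<inter> {1..q} = {1..q} - {i}" by blast
    finally have f: "?f \<cdot> e q = ?f" .
    have rf: "rank ?f = q - 1" unfolding rank_eq_dom[OF pid_closed] pdom_pid A using i(1) by simp
    have "rank (?f \<cdot> \<gamma>) < q - 1"
    proof (cases "rank \<gamma> = q - 1")
      case True
      have "pdom (?f \<cdot> \<gamma>) \<subseteq> pdom \<gamma> - {i}" using pdom_pid_mult[OF \<gamma>, of "{1..q} - {i}"] by blast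
      then have "card (pdom (?f \<cdot> \<gamma>)) \<le> card (pdom \<gamma> - {i})" using finite_dom[OF \<gamma>] by (intro card_mono) auto
      also have "\<dots> < card (pdom \<gamma>)" using i(2)[OF True] finite_dom[OF \<gamma>] by (intro card_Diff1_less) auto
      finally show ?thesis using True \<gamma> by (simp add: rank_eq_dom)
    next
      case False
      then show ?thesis using rank_mult_le2[OF pid_closed \<gamma>, of "{1..q} - {i}"] rg by simp
    qed
    moreover have "(?f, ?f \<cdot> \<gamma>) \<in> \<theta>"
      using congruenceD(5)[OF c eg pid_closed[of "{1..q} - {i}"]] unfolding f .
    moreover have "q - 1 < q" using q2 by simp
    ultimately have e': "(e (q - 1), \<omega>) \<in> \<theta>" using less.IH rf by blast
    have "rank \<gamma> \<le> q - 1" "q - 1 \<le> n" using rg q by auto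
    then obtain s t where st: "s \<in> carr" "t \<in> carr" "\<gamma> = s \<cdot> e (q - 1) \<cdot> t"
      using factor_le[OF \<gamma>] by metis
    have "(\<gamma>, s \<cdot> \<omega> \<cdot> t) \<in> \<theta>" using congruence_sandwich[OF c e' st(1,2)] st(3) by simp
    moreover have "rank (s \<cdot> \<omega> \<cdot> t) = 0" using st rank0_mult by auto
    ultimately show ?thesis using congruenceD(4)[OF c eg] by blast
  qed
  then obtain \<gamma>0 where g0: "(e q, \<gamma>0) \<in> \<theta>" "rank \<gamma>0 = 0" by blast
  have G: "\<gamma>0 \<in> carr" using congruenceD(1)[OF c g0(1)] by simp
  have 1: "(\<omega>, \<omega> \<cdot> \<gamma>0) \<in> \<theta>" "(\<omega>, \<gamma>0 \<cdot> \<omega>) \<in> \<theta>"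
    using congruenceD(5,6)[OF c g0(1) zero_closed] q by simp_all
  have "(\<omega> \<cdot> \<gamma>0, \<gamma>0 \<cdot> \<omega> \<cdot> \<gamma>0) \<in> \<theta>" using congruenceD(6)[OF c 1(2) G] .
  then have "(\<omega>, \<gamma>0) \<in> \<theta>" using congruenceD(4)[OF c 1(1)] rank0_sandwich[OF G g0(2) zero_closed] by simp
  then show ?case using congruenceD(3,4)[OF c] g0(1) by blast
qed

text \<open>
  Left multiplication by this element passes from \<open>k\<close> through a hook \<open>{k, l}\<close> to \<open>i\<close>;
  it takes the place of the transversal at \<open>i\<close>.
\<close>
lemma hook_detector:
  assumes D: "D \<subseteq> {1..n}" "i \<in> D" "k \<notin> D" "l \<notin> D" "k \<noteq> l" "k \<in> {1..n}" "l \<in> {1..n}"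
  obtains s where "s \<in> carr" "pdom s = insert k (D - {i})"
    "\<And>c. c \<in> insert k (D - {i}) \<Longrightarrow> mate s (Up c) = Dn c" "mate s (Dn k) = Up k" "mate s (Dn l) = Dn i"
    "\<And>c. c \<notin> D \<Longrightarrow> c \<noteq> k \<Longrightarrow> c \<noteq> l \<Longrightarrow> mate s (Dn c) = Dn c"
proof -
  let ?E = "insert k (D - {i})"
  define f where "f = (\<lambda>u. case u of Up c \<Rightarrow> if c \<in> ?E then Dn c else Up c
    | Dn c \<Rightarrow> if c \<in> ?E then Up c else if c = l then Dn i else if c = i then Dn l else Dn c | Mid c \<Rightarrow> Mid c)"
  have f: "pairing n f"
    unfolding pairing_def
  proof
    fix u assume "u \<in> points n"
    then show "f u \<in> points n \<and> f (f u) = u" using D by (cases u) (auto simp: f_def)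
  qed
  define s where "s = pairs n f"
  have s: "s \<in> carr" unfolding s_def by (rule pairs_PB[OF f])
  have ms: "mate s u = f u" if "u \<in> points n" for u
    unfolding s_def by (rule mate_pairs[OF f that])
  have E: "?E \<subseteq> {1..n}" using D by blast
  have Up: "mate s (Up c) = (if c \<in> ?E then Dn c else Up c)" for c
    using ms[of "Up c"] mate_outside[OF s, of "Up c"] E by (cases "Up c \<in> points n") (auto simp: f_def)
  show ?thesis
  proof (rule that[OF s])
    show "pdom s = ?E" by (auto simp: pdom_def Up)
    show "\<And>c. c \<in> ?E \<Longrightarrow> mate s (Up c) = Dn c" by (simp add: Up)
    show "mate s (Dn k) = Up k" "mate s (Dn l) = Dn i" using ms D by (auto simp: f_def)
    show "mate s (Dn c) = Dn c" if "c \<notin> D" "c \<noteq> k" "c \<noteq> l" for c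
      using ms[of "Dn c"] mate_outside[OF s, of "Dn c"] that D(2) by (cases "Dn c \<in> points n") (auto simp: f_def)
  qed
qed

text \<open>With a hook {k, l} of \<alpha> that \<beta> lacks, one transversal of \<alpha>, at
  \<open>i\<close>, is made to start at \<open>k\<close> and to run through the hook. Multiplication
  by the detector then preserves the rank of \<alpha>. In \<beta> the path from \<open>k\<close>
  dies, and at most the other \<open>q - 1\<close> domain points survive.\<close>

lemma upper_separation:
  assumes ab: "\<alpha> \<in> carr" "\<beta> \<in> carr" "rank \<alpha> = q" "rank \<beta> = q" "1 \<le> q" and d: "pdom \<alpha> = pdom \<beta>"
    and k: "mate \<alpha> (Up k) = Up l" "k \<noteq> l" "mate \<beta> (Up k) \<noteq> Up l" "k \<notin> pdom \<beta>"
  shows "\<exists>s\<in>carr. rank (s \<cdot> \<alpha>) = q \<and> rank (s \<cdot> \<beta>) < q"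
proof -
  have kn: "k \<in> {1..n}" "l \<in> {1..n}" using mate_moved_points[OF ab(1) k(1)] k(2) by auto
  have lk: "mate \<alpha> (Up l) = Up k" using k(1) mate_sym[OF ab(1)] by blast
  have nd: "k \<notin> pdom \<alpha>" "l \<notin> pdom \<alpha>" using k(1) lk by (auto simp: pdom_def)
  have cd: "card (pdom \<alpha>) = q" using ab rank_eq_dom by simp
  then have "pdom \<alpha> \<noteq> {}" using ab(5) by auto
  then obtain i where i: "i \<in> pdom \<alpha>" by blast
  obtain s where s: "s \<in> carr" "pdom s = insert k (pdom \<alpha> - {i})"
    "\<And>c. c \<in> insert k (pdom \<alpha> - {i}) \<Longrightarrow> mate s (Up c) = Dn c" "mate s (Dn k) = Up k" "mate s (Dn l) = Dn i"
    "\<And>c. c \<notin> pdom \<alpha> \<Longrightarrow> c \<noteq> k \<Longrightarrow> c \<noteq> l \<Longrightarrow> mate s (Dn c) = Dn c"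
    using hook_detector[OF pdom_range[OF ab(1)] i nd k(2) kn] by metis
  have ki: "k \<notin> pdom \<alpha> - {i}" using nd by blast
  have cE: "card (insert k (pdom \<alpha> - {i})) = q"
    using cd i ki finite_dom[OF ab(1)] ab(5) by simp
  have "insert k (pdom \<alpha> - {i}) \<subseteq> pdom (s \<cdot> \<alpha>)"
  proof
    fix c assume c: "c \<in> insert k (pdom \<alpha> - {i})"
    show "c \<in> pdom (s \<cdot> \<alpha>)"
    proof (cases "c = k")
      case True
      obtain j where j: "mate \<alpha> (Up i) = Dn j" using i by (auto simp: pdom_def)
      have "mate (s \<cdot> \<alpha>) (Up k) = Dn j"
        by (rule mate_mult_Up_zigzag[OF s(1) ab(1) s(3) k(1) s(5) j]) simp
      then show ?thesis using True by (auto simp: pdom_def)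
    next
      case False
      then obtain j where j: "mate \<alpha> (Up c) = Dn j" using c by (auto simp: pdom_def)
      have "mate (s \<cdot> \<alpha>) (Up c) = Dn j" using mate_mult_Up_Dn[OF s(1) ab(1) s(3)[OF c] j] .
      then show ?thesis by (auto simp: pdom_def)
    qed
  qed
  then have "q \<le> rank (s \<cdot> \<alpha>)"
    using card_mono[OF finite_dom[of "s \<cdot> \<alpha>"]] s(1) ab(1) cE rank_eq_dom[of "s \<cdot> \<alpha>"] by fastforce
  then have 1: "rank (s \<cdot> \<alpha>) = q" using rank_mult_le2[OF s(1) ab(1)] ab(3) by simp
  have "k \<notin> pdom (s \<cdot> \<beta>)"
  proof -
    obtain m where m: "mate \<beta> (Up k) = Up m" using k(4) mate_Up_cases[OF ab(2), of k] by (auto simp: pdom_def)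
    then have "mate \<beta> (Up m) = Up k" using mate_sym[OF ab(2)] by blast
    then have "m \<notin> pdom \<alpha>" unfolding d by (auto simp: pdom_def)
    moreover have "m \<noteq> l" using m k(3) by auto
    ultimately have "mate (s \<cdot> \<beta>) (Up k) = Up k"
      using mate_mult_Up_turn[OF s(1) ab(2) s(3)[of k] m, of k] mate_mult_Up_stuck[OF s(1) ab(2) s(3)[of k] m] s(4) s(6)[of m]
      by (cases "m = k") auto
    then show ?thesis by (auto simp: pdom_def)
  qed
  then have "pdom (s \<cdot> \<beta>) \<subseteq> pdom \<alpha> - {i}" using pdom_mult[OF s(1) ab(2)] unfolding s(2) by blast
  then have "card (pdom (s \<cdot> \<beta>)) \<le> card (pdom \<alpha> - {i})" using finite_dom[OF ab(1)] by (intro card_mono) auto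
  also have "\<dots> < q" using card_Diff1_less[OF finite_dom[OF ab(1)] i] cd by simp
  finally show ?thesis using 1 s(1) ab(2) rank_eq_dom[of "s \<cdot> \<beta>"] by auto
qed

text \<open>Two upper halves of equal rank differ in their domains or in their hooks. A partial
  identity detects the first difference and a hook detector the second, both by lowering the rank of
  only one element.\<close>

lemma upper_collapse:
  assumes c: "congruence (PB n) \<theta>" and ab: "(\<alpha>, \<beta>) \<in> \<theta>" "rank \<alpha> = q" "rank \<beta> = q" "1 \<le> q"
    and ne: "\<not> upper_eq \<alpha> \<beta>"
  shows "(e q, \<omega>) \<in> \<theta>"
proof -
  have X: "\<alpha> \<in> carr" "\<beta> \<in> carr" using congruenceD(1)[OF c ab(1)] by auto
  have ba: "(\<beta>, \<alpha>) \<in> \<theta>" using congruenceD(3)[OF c ab(1)] .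
  show ?thesis
  proof (cases "pdom \<alpha> = pdom \<beta>")
    case False
    have "\<not> pdom \<alpha> \<subseteq> pdom \<beta>"
      using False ab(2,3) X finite_dom rank_eq_dom by (metis card_subset_eq)
    then have "pdom \<alpha> \<inter> pdom \<beta> \<subset> pdom \<alpha>" by blast
    then have lt: "card (pdom \<alpha> \<inter> pdom \<beta>) < q"
      using psubset_card_mono[OF finite_dom[OF X(1)]] ab(2) rank_eq_dom[OF X(1)] by simp
    let ?s = "pid (pdom \<alpha>)"
    have "pdom \<alpha> \<subseteq> pdom (?s \<cdot> \<alpha>)"
    proof
      fix i assume i: "i \<in> pdom \<alpha>"
      then obtain j where j: "mate \<alpha> (Up i) = Dn j" by (auto simp: pdom_def)
      have "mate ?s (Up i) = Dn i" using i pdom_range[OF X(1)] by auto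
      then show "i \<in> pdom (?s \<cdot> \<alpha>)" using mate_mult_Up_Dn[OF pid_closed X(1) _ j] by (auto simp: pdom_def)
    qed
    then have "card (pdom \<alpha>) \<le> card (pdom (?s \<cdot> \<alpha>))" using X by (intro card_mono finite_dom) auto
    then have "q \<le> rank (?s \<cdot> \<alpha>)" using X ab(2) by (simp add: rank_eq_dom)
    then have 1: "rank (?s \<cdot> \<alpha>) = q" using rank_mult_le2[OF pid_closed X(1)] ab(2) by (simp add: le_antisym)
    have "card (pdom (?s \<cdot> \<beta>)) \<le> card (pdom \<alpha> \<inter> pdom \<beta>)"
      by (intro card_mono pdom_pid_mult X) (use finite_dom[OF X(1)] in auto)
    then have "rank (?s \<cdot> \<beta>) < q" using lt X rank_eq_dom[of "?s \<cdot> \<beta>"] by simp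
    then show ?thesis using rank_drop_collapse[OF c congruenceD(5)[OF c ab(1) pid_closed] 1] by blast
  next
    case True
    obtain k where k: "mate \<alpha> (Up k) \<noteq> mate \<beta> (Up k)" "k \<notin> pdom \<alpha>" "k \<notin> pdom \<beta>"
      using ne True unfolding upper_eq_def by blast
    obtain l where l: "mate \<alpha> (Up k) = Up l" using k(2) mate_Up_cases[OF X(1), of k] by (auto simp: pdom_def)
    obtain m where m: "mate \<beta> (Up k) = Up m" using k(3) mate_Up_cases[OF X(2), of k] by (auto simp: pdom_def)
    show ?thesis
    proof (cases "k = l")
      case False
      obtain s where "s \<in> carr" "rank (s \<cdot> \<alpha>) = q" "rank (s \<cdot> \<beta>) < q"
        using upper_separation[OF X ab(2-4) True l False _ k(3)] k l by auto
      then show ?thesis using rank_drop_collapse[OF c congruenceD(5)[OF c ab(1)]] by blast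
    next
      \<comment> \<open>Here \<open>k\<close> is single in \<alpha>, so the distinguishing hook lies
        in \<beta> and the roles are exchanged.\<close>
      case kl: True
      then have "k \<noteq> m" using k l m by auto
      then obtain s where "s \<in> carr" "rank (s \<cdot> \<beta>) = q" "rank (s \<cdot> \<alpha>) < q"
        using upper_separation[OF X(2,1) ab(3,2,4) True[symmetric] m _ _ k(2)] k m by auto
      then show ?thesis using rank_drop_collapse[OF c congruenceD(5)[OF c ba]] by blast
    qed
  qed
qed

lemma collapse:
  assumes c: "congruence (PB n) \<theta>" and ab: "(\<alpha>, \<beta>) \<in> \<theta>" "rank \<alpha> = q" "rank \<beta> \<le> q" "1 \<le> q"
    and ne: "\<not> (rank \<beta> = q \<and> upper_eq \<alpha> \<beta> \<and> lower_eq \<alpha> \<beta>)"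
  shows "(e q, \<omega>) \<in> \<theta>"
proof -
  consider "rank \<beta> < q" | "rank \<beta> = q" "\<not> upper_eq \<alpha> \<beta>" | "rank \<beta> = q" "\<not> lower_eq \<alpha> \<beta>"
    using ab(3) ne by linarith
  then show ?thesis
  proof cases
    case 1
    then show ?thesis using rank_drop_collapse[OF c ab(1,2)] by blast
  next
    case 2
    then show ?thesis using upper_collapse[OF c ab(1,2)] ab(4) by blast
  next
    case 3
    have q: "q \<le> n" using congruenceD(1)[OF c ab(1)] ab(2) rank_le by blast
    have "(e q, \<omega>) \<in> star_rel \<theta>"
      by (rule upper_collapse[OF congruence_star_rel[OF c], of "star \<alpha>" "star \<beta>"])
        (use 3 ab in \<open>simp_all add: star_rel_iff lower_eq_def\<close>)
    then show ?thesis using q by (simp add: star_rel_iff)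
  qed
qed

end

section \<open>All congruences\<close>

context partial_brauer
begin

lemma zero_idem: "x \<in> carr \<Longrightarrow> \<omega> \<cdot> (\<omega> \<cdot> x) = \<omega> \<cdot> x" "x \<in> carr \<Longrightarrow> (x \<cdot> \<omega>) \<cdot> \<omega> = x \<cdot> \<omega>"
  using mul_assoc[of \<omega> \<omega> x] mul_assoc[of x \<omega> \<omega>] by simp_all

lemma halves_mult: "x \<in> carr \<Longrightarrow> (x \<cdot> \<omega>) \<cdot> (\<omega> \<cdot> x) = x \<cdot> \<omega> \<cdot> x"
  using zero_idem(1)[of x] by (simp add: mul_assoc)

text \<open>Replacing \<open>e 1\<close> by \<omega> in a factorization relates \<open>x\<close> to
  some \<open>y\<close> of rank zero. Sandwiching \<omega> between both members of the pair shows
  that \<open>y\<close> is related to \<open>x \<cdot> \<omega> \<cdot> x\<close>, which depends on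
  \<open>x\<close> alone and is the value of the retraction.\<close>

lemma rank1_collapse:
  assumes c: "congruence (PB n) \<theta>" and e1: "(e 1, \<omega>) \<in> \<theta>" and n: "1 \<le> n" and x: "x \<in> carr" "rank x \<le> 1"
  shows "(x, x \<cdot> \<omega> \<cdot> x) \<in> \<theta>"
proof -
  obtain s t where st: "s \<in> carr" "t \<in> carr" "x = s \<cdot> e 1 \<cdot> t" using factor_le[OF x n] by metis
  let ?y = "s \<cdot> \<omega> \<cdot> t"
  have y: "?y \<in> carr" "rank ?y = 0" using st rank0_mult by auto
  have xy: "(x, ?y) \<in> \<theta>" using congruence_sandwich[OF c e1 st(1,2)] st(3) by simp
  have "(x \<cdot> \<omega> \<cdot> x, ?y \<cdot> \<omega> \<cdot> ?y) \<in> \<theta>"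
    using congruence_mult[OF c congruenceD(6)[OF c xy zero_closed] xy] .
  then have "(?y, x \<cdot> \<omega> \<cdot> x) \<in> \<theta>"
    using rank0_sandwich[OF y zero_closed] congruenceD(3)[OF c] by simp
  then show ?thesis using congruenceD(4)[OF c xy] by blast
qed

lemma rank2_collapse:
  assumes c: "congruence (PB n) \<theta>" and eq: "(e q, \<omega>) \<in> \<theta>" and q: "2 \<le> q" "q \<le> n"
  shows "I_rank n q \<times> I_rank n q \<subseteq> \<theta>"
proof -
  have n: "2 \<le> n" using q by simp
  have H: "hook \<in> carr" "rank hook = 0" using n by auto
  \<comment> \<open>The hook absorbs \<open>e q\<close> on either side, so it is related to each of
    its halves. Multiplying by \<omega> from the other side relates both halves to \<omega>.\<close>
  have 1: "(hook, hook \<cdot> \<omega>) \<in> \<theta>" "(hook, \<omega> \<cdot> hook) \<in> \<theta>"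
    using congruenceD(5,6)[OF c eq H(1)] hook_e[OF n q] by simp_all
  have "\<omega> \<cdot> (hook \<cdot> \<omega>) = \<omega>" "(\<omega> \<cdot> hook) \<cdot> \<omega> = \<omega>" using zero_sandwich[OF H(1)] H by (simp_all add: mul_assoc)
  then have "(\<omega> \<cdot> hook, \<omega>) \<in> \<theta>" "(hook \<cdot> \<omega>, \<omega>) \<in> \<theta>"
    using congruenceD(5)[OF c 1(1) zero_closed] congruenceD(6)[OF c 1(2) zero_closed] by simp_all
  note spread = lower_spread[OF c n this(1)] upper_spread[OF c n this(2)]
  have zero: "(x, \<omega>) \<in> \<theta>" if x: "x \<in> carr" "rank x = 0" for x
  proof -
    have "((x \<cdot> \<omega>) \<cdot> (\<omega> \<cdot> x), \<omega> \<cdot> \<omega>) \<in> \<theta>" using congruence_mult[OF c spread(2)[OF x] spread(1)[OF x]] .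
    then show ?thesis using halves_mult[OF x(1)] rank0_sandwich[OF x zero_closed] by simp
  qed
  have "(x, \<omega>) \<in> \<theta>" if "x \<in> I_rank n q" for x
  proof -
    have x: "x \<in> carr" "rank x \<le> q" using that by (auto simp: I_rank_iff)
    obtain s t where st: "s \<in> carr" "t \<in> carr" "x = s \<cdot> e q \<cdot> t" using factor_le[OF x q(2)] by metis
    have "(x, s \<cdot> \<omega> \<cdot> t) \<in> \<theta>" using congruence_sandwich[OF c eq st(1,2)] st(3) by simp
    moreover have "(s \<cdot> \<omega> \<cdot> t, \<omega>) \<in> \<theta>" by (rule zero) (use st rank0_mult in auto)
    ultimately show ?thesis using congruenceD(4)[OF c] by blast
  qed
  then show ?thesis using congruenceD(3,4)[OF c] by blast
qed

text \<open>The charts of \<alpha> depend on its halves only, so the same pair of charts serves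
  \<beta>. Two \<H>-related diagrams thus differ by permutations between common charts.\<close>

lemma H_related_factor:
  assumes ab: "\<alpha> \<in> carr" "\<beta> \<in> carr" "rank \<alpha> = p" "rank \<beta> = p" "upper_eq \<alpha> \<beta>" "lower_eq \<alpha> \<beta>"
  obtains s t \<sigma> \<tau> where "s \<in> carr" "t \<in> carr" "s \<cdot> e p = s" "e p \<cdot> t = t" "rank s = p" "rank t = p"
    "\<sigma> permutes {1..p}" "\<tau> permutes {1..p}" "\<alpha> = s \<cdot> bar n p \<sigma> \<cdot> t" "\<beta> = s \<cdot> bar n p \<tau> \<cdot> t"
proof -
  have p: "p \<le> n" using rank_le ab by blast
  obtain s where s: "s \<in> carr" "s \<cdot> e p = s" "rank s = p"
    "\<And>\<gamma>. \<gamma> \<in> carr \<Longrightarrow> upper_eq \<alpha> \<gamma> \<Longrightarrow> s \<cdot> (star s \<cdot> \<gamma>) = \<gamma>"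
    using left_factor[OF ab(1,3)] by blast
  obtain t where t: "t \<in> carr" "e p \<cdot> t = t" "rank t = p"
    "\<And>\<gamma>. \<gamma> \<in> carr \<Longrightarrow> lower_eq \<alpha> \<gamma> \<Longrightarrow> (\<gamma> \<cdot> star t) \<cdot> t = \<gamma>"
    using right_factor[OF ab(1,3)] by blast
  have st: "star s \<in> carr" "star t \<in> carr" using s t by auto
  have *: "\<exists>\<sigma>. \<sigma> permutes {1..p} \<and> \<gamma> = s \<cdot> bar n p \<sigma> \<cdot> t"
    if \<gamma>: "\<gamma> \<in> carr" "rank \<gamma> = p" "upper_eq \<alpha> \<gamma>" "lower_eq \<alpha> \<gamma>" for \<gamma>
  proof -
    define g where "g = star s \<cdot> \<gamma> \<cdot> star t"
    have g: "g \<in> carr" using st \<gamma> by (simp add: g_def)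
    have "s \<cdot> g \<cdot> t = s \<cdot> (star s \<cdot> ((\<gamma> \<cdot> star t) \<cdot> t))" unfolding g_def using s(1) t(1) st \<gamma> by (simp add: mul_assoc)
    then have \<gamma>eq: "\<gamma> = s \<cdot> g \<cdot> t" using s(4)[OF \<gamma>(1,3)] t(4)[OF \<gamma>(1,4)] by simp
    have "e p \<cdot> g = (e p \<cdot> star s) \<cdot> \<gamma> \<cdot> star t" "g \<cdot> e p = star s \<cdot> \<gamma> \<cdot> (star t \<cdot> e p)"
      unfolding g_def using st \<gamma> p by (simp_all add: mul_assoc)
    then have ge: "e p \<cdot> g = g" "g \<cdot> e p = g"
      using star_cancel_e[OF s(1,2) p] star_cancel_e'[OF t(1,2) p] by (simp_all add: g_def)
    have "rank \<gamma> \<le> rank g" unfolding \<gamma>eq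
      using rank_mult_le1[of "s \<cdot> g" t] rank_mult_le2[OF s(1) g] s(1) t(1) g by simp
    moreover have "rank g \<le> rank \<gamma>" unfolding g_def
      using rank_mult_le1[of "star s \<cdot> \<gamma>" "star t"] rank_mult_le2[OF st(1) \<gamma>(1)] st \<gamma> by simp
    ultimately have "rank g = p" using \<gamma>(2) by simp
    then obtain \<sigma> where "\<sigma> permutes {1..p}" "g = bar n p \<sigma>" using group_elem[OF g ge _ p] by blast
    then show ?thesis using \<gamma>eq by blast
  qed
  obtain \<sigma> where "\<sigma> permutes {1..p}" "\<alpha> = s \<cdot> bar n p \<sigma> \<cdot> t" using *[OF ab(1,3)] by auto
  moreover obtain \<tau> where "\<tau> permutes {1..p}" "\<beta> = s \<cdot> bar n p \<tau> \<cdot> t" using *[OF ab(2,4-6)] by auto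
  ultimately show ?thesis using that s(1-3) t(1-3) by blast
qed

text \<open>Cut the transversal at a point \<open>i\<close> moved by \<rho>. The two restrictions
  have rank \<open>p - 1\<close>, but their codomains omit \<open>i\<close> and
  \<open>\<rho> i\<close> respectively, so their lower halves differ and \<open>collapse\<close>
  applies one rank lower.\<close>

lemma permutation_collapse:
  assumes c: "congruence (PB n) \<theta>" and p: "1 \<le> p" "p \<le> n" and \<rho>: "\<rho> permutes {1..p}" "\<rho> \<noteq> id"
    and er: "(e p, bar n p \<rho>) \<in> \<theta>"
  shows "2 \<le> p" "(e (p - 1), \<omega>) \<in> \<theta>"
proof -
  obtain i where i: "\<rho> i \<noteq> i" using \<rho>(2) by (auto simp: fun_eq_iff)
  then have ip: "i \<in> {1..p}" using \<rho>(1) by (meson permutes_not_in)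
  then have rip: "\<rho> i \<in> {1..p}" using permutes_in_image[OF \<rho>(1)] by blast
  show p2: "2 \<le> p" using i ip rip by auto
  let ?A = "{1..p} - {i}"
  have b: "bar n p \<rho> \<in> carr" using \<rho> p by simp
  have An: "?A \<inter> {1..n} = ?A" using p by auto
  have "pid ?A \<cdot> e p = pid (?A \<inter> {1..p})" using p by (simp add: e_eq_pid pid_mult)
  moreover have "?A \<inter> {1..p} = ?A" by blast
  ultimately have "pid ?A \<cdot> e p = pid ?A" by simp
  then have rel: "(pid ?A, pid ?A \<cdot> bar n p \<rho>) \<in> \<theta>"
    using congruenceD(5)[OF c er pid_closed[of ?A]] by simp
  have rA: "rank (pid ?A) = p - 1" unfolding rank_eq_dom[OF pid_closed] pdom_pid An using ip by simp
  have bd: "mate (bar n p \<rho>) (Dn (\<rho> i)) = Up i" "mate (bar n p \<rho>) (Up i) = Dn (\<rho> i)"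
    using rip ip permutes_inverses[OF \<rho>(1)] mate_bar[OF \<rho>(1) p(2)] by auto
  have "mate (pid ?A) (Dn i) = Dn i" by simp
  then have "mate (pid ?A \<cdot> bar n p \<rho>) (Dn (\<rho> i)) = Dn (\<rho> i)"
    using mate_mult_Dn_turn[OF pid_closed b bd(1) _ bd(2)] by blast
  then have "\<rho> i \<notin> pcod (pid ?A \<cdot> bar n p \<rho>)" by (auto simp: pcod_def)
  moreover have "\<rho> i \<in> pcod (pid ?A)" using rip i p unfolding pcod_star[OF pid_closed] star_pid pdom_pid by auto
  ultimately have "pcod (pid ?A) \<noteq> pcod (pid ?A \<cdot> bar n p \<rho>)" by blast
  then have "\<not> lower_eq (pid ?A) (pid ?A \<cdot> bar n p \<rho>)"
    using upper_eq_dom[of "star (pid ?A)"] b unfolding lower_eq_def by (auto simp: pcod_star)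
  moreover have "rank (pid ?A \<cdot> bar n p \<rho>) \<le> p - 1" using rank_mult_le1[OF pid_closed[of ?A] b] rA by simp
  ultimately show "(e (p - 1), \<omega>) \<in> \<theta>" using collapse[OF c rel rA] p2 by auto
qed

definition perm_kernel :: "nat \<Rightarrow> pb_rel \<Rightarrow> (nat \<Rightarrow> nat) set" where
  "perm_kernel q \<theta> = {\<sigma>. \<sigma> permutes {1..q} \<and> (e q, bar n q \<sigma>) \<in> \<theta>}"

lemma bar_related:
  assumes c: "congruence (PB n) \<theta>" and q: "q \<le> n" and p: "\<sigma> permutes {1..q}" "\<tau> permutes {1..q}"
    and "(bar n q \<sigma>, bar n q \<tau>) \<in> \<theta>"
  shows "\<tau> \<circ> inv' \<sigma> \<in> perm_kernel q \<theta>"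
proof -
  have i: "inv' \<sigma> permutes {1..q}" using permutes_inv[OF p(1)] .
  have "(bar n q (inv' \<sigma>) \<cdot> bar n q \<sigma>, bar n q (inv' \<sigma>) \<cdot> bar n q \<tau>) \<in> \<theta>"
    using congruenceD(5)[OF c assms(5)] i q by simp
  then have "(e q, bar n q (\<tau> \<circ> inv' \<sigma>)) \<in> \<theta>" using bar_inverse[OF p(1) q] bar_mult[OF i p(2) q] by simp
  then show ?thesis using i p(2) by (simp add: perm_kernel_def permutes_compose)
qed

lemma perm_kernel_normal:
  assumes c: "congruence (PB n) \<theta>" and q: "q \<le> n"
  shows "perm_kernel q \<theta> \<lhd> sym_group q"
proof (rule normal_sym_groupI)
  note K = perm_kernel_def
  show "\<sigma> permutes {1..q}" if "\<sigma> \<in> perm_kernel q \<theta>" for \<sigma> using that by (simp add: K)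
  show "id \<in> perm_kernel q \<theta>" using congruenceD(2)[OF c e_closed[OF q]] by (simp add: K permutes_id)
  show "\<sigma> \<circ> \<tau> \<in> perm_kernel q \<theta>" if "\<sigma> \<in> perm_kernel q \<theta>" "\<tau> \<in> perm_kernel q \<theta>" for \<sigma> \<tau>
  proof -
    have p: "\<sigma> permutes {1..q}" "\<tau> permutes {1..q}" and r: "(e q, bar n q \<sigma>) \<in> \<theta>" "(e q, bar n q \<tau>) \<in> \<theta>"
      using that by (auto simp: K)
    have "(e q \<cdot> e q, bar n q \<tau> \<cdot> bar n q \<sigma>) \<in> \<theta>" using congruence_mult[OF c r(2,1)] .
    then show ?thesis using p q bar_mult[OF p(2,1) q] by (simp add: K permutes_compose e_mult)
  qed
  show "inv' \<sigma> \<in> perm_kernel q \<theta>" if "\<sigma> \<in> perm_kernel q \<theta>" for \<sigma>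
  proof -
    have p: "\<sigma> permutes {1..q}" and r: "(bar n q \<sigma>, bar n q id) \<in> \<theta>"
      using that congruenceD(3)[OF c] by (auto simp: K)
    show ?thesis using bar_related[OF c q p permutes_id r] by simp
  qed
  show "\<tau> \<circ> \<sigma> \<circ> inv' \<tau> \<in> perm_kernel q \<theta>" if "\<sigma> \<in> perm_kernel q \<theta>" "\<tau> permutes {1..q}" for \<sigma> \<tau>
  proof -
    have p: "\<sigma> permutes {1..q}" and r: "(e q, bar n q \<sigma>) \<in> \<theta>" using that by (auto simp: K)
    have b: "bar n q \<tau> \<in> carr" using that(2) q by simp
    have "(e q \<cdot> bar n q \<tau>, bar n q \<sigma> \<cdot> bar n q \<tau>) \<in> \<theta>" using congruenceD(6)[OF c r b] .
    then have "(bar n q \<tau>, bar n q (\<tau> \<circ> \<sigma>)) \<in> \<theta>" using bar_mult[OF p that(2) q] that(2) q by simp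
    then show ?thesis using bar_related[OF c q that(2) permutes_compose[OF p that(2)]] by simp
  qed
qed

lemma hook_zero_rank: "2 \<le> n \<Longrightarrow> rank (hook \<cdot> \<omega>) = 0" "2 \<le> n \<Longrightarrow> rank (\<omega> \<cdot> hook) = 0"
  by (simp_all add: rank0_mult)

lemma Nabla_eq: "I_rank n n \<times> I_rank n n = Nabla (PB n)"
  unfolding Nabla_def using rank_le by (auto simp: I_rank_iff)

text \<open>The parameters are read off from \<theta>: \<open>r\<close> is the largest rank with
  \<open>e r\<close> related to \<omega>, the level is \<open>q = r + 1\<close>, the group consists
  of the permutations related to \<open>e q\<close>, and a flag is on when the corresponding half of
  \<open>hook\<close> is not related to \<omega>. The rest shows that these data determine
  \<theta>.\<close>

theorem congruence_classification:
  assumes n: "2 \<le> n" and c: "congruence (PB n) \<theta>"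
  shows "\<theta> = Nabla (PB n) \<or>
    (\<exists>q N P Q. 1 \<le> q \<and> q \<le> n \<and> N \<lhd> sym_group q \<and> (q \<le> 2 \<or> \<not> P \<and> \<not> Q) \<and> \<theta> = con q N P Q)"
proof -
  define r where "r = Max {p. p \<le> n \<and> (e p, \<omega>) \<in> \<theta>}"
  have fin: "finite {p. p \<le> n \<and> (e p, \<omega>) \<in> \<theta>}" by simp
  have "0 \<in> {p. p \<le> n \<and> (e p, \<omega>) \<in> \<theta>}" using congruenceD(2)[OF c zero_closed] by simp
  then have "r \<in> {p. p \<le> n \<and> (e p, \<omega>) \<in> \<theta>}" unfolding r_def using fin by (intro Max_in) auto
  then have r: "r \<le> n" "(e r, \<omega>) \<in> \<theta>" by auto
  have max: "p \<le> r" if "p \<le> n" "(e p, \<omega>) \<in> \<theta>" for p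
    unfolding r_def using fin that by (intro Max_ge) auto
  show ?thesis
  proof (cases "r = n")
    case True
    have "Nabla (PB n) \<subseteq> \<theta>" using rank2_collapse[OF c, of n] r True n Nabla_eq by simp
    moreover have "\<theta> \<subseteq> Nabla (PB n)" using congruenceD(1)[OF c] by (auto simp: Nabla_def)
    ultimately show ?thesis by blast
  next
    case False
    define q where "q = r + 1"
    have q: "1 \<le> q" "q \<le> n" "q - 1 = r" using False r by (auto simp: q_def)
    define N where "N = perm_kernel q \<theta>"
    define P where "P \<longleftrightarrow> (\<omega> \<cdot> hook, \<omega>) \<notin> \<theta>"
    define Q where "Q \<longleftrightarrow> (hook \<cdot> \<omega>, \<omega>) \<notin> \<theta>"
    have N: "N \<lhd> sym_group q" unfolding N_def by (rule perm_kernel_normal[OF c q(2)])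
    have H: "hook \<in> carr" using n by simp
    have PQ: "q \<le> 2 \<or> \<not> P \<and> \<not> Q"
    proof (cases "q \<le> 2")
      case False
      then have "I_rank n r \<times> I_rank n r \<subseteq> \<theta>" using rank2_collapse[OF c r(2)] q r by simp
      moreover have "\<omega> \<cdot> hook \<in> I_rank n r" "hook \<cdot> \<omega> \<in> I_rank n r" "\<omega> \<in> I_rank n r"
        using H hook_zero_rank[OF n] by (auto simp: I_rank_iff)
      ultimately show ?thesis unfolding P_def Q_def by blast
    qed simp
    have cc: "congruence (PB n) (con q N P Q)" by (rule congruence_con[OF N q(1,2) PQ])
    have nu: "nu_rel q N \<subseteq> \<theta>"
    proof (rule subrelI)
      fix \<alpha> \<beta> assume "(\<alpha>, \<beta>) \<in> nu_rel q N"
      then obtain s t \<sigma> where st: "s \<in> carr" "t \<in> carr" "s \<cdot> e q = s" "\<sigma> \<in> N" "\<alpha> = s \<cdot> t" "\<beta> = s \<cdot> bar n q \<sigma> \<cdot> t"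
        by (rule nu_relE)
      have "(e q, bar n q \<sigma>) \<in> \<theta>" using st(4) by (simp add: N_def perm_kernel_def)
      then have "(s \<cdot> e q \<cdot> t, s \<cdot> bar n q \<sigma> \<cdot> t) \<in> \<theta>" using congruence_sandwich[OF c _ st(1,2)] by blast
      then show "(\<alpha>, \<beta>) \<in> \<theta>" by (simp only: st(3,5,6))
    qed
    have kap: "kap r P Q \<subseteq> \<theta>"
    proof (cases "r \<le> 1")
      case False
      then have "I_rank n r \<times> I_rank n r \<subseteq> \<theta>" using rank2_collapse[OF c r(2)] r by simp
      then show ?thesis by (auto simp: kap_def)
    next
      case True
      show ?thesis
      proof (rule subrelI)
        fix x y assume "(x, y) \<in> kap r P Q"
        then have x: "x \<in> carr" "rank x \<le> r" and y: "y \<in> carr" "rank y \<le> r"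
          and eqs: "P \<Longrightarrow> \<omega> \<cdot> x = \<omega> \<cdot> y" "Q \<Longrightarrow> x \<cdot> \<omega> = y \<cdot> \<omega>" by (auto simp: kap_def I_rank_iff)
        \<comment> \<open>Each element is related to a product of its upper and its lower half, so
          the two halves can be treated separately.\<close>
        have red: "(z, z \<cdot> \<omega> \<cdot> z) \<in> \<theta>" if z: "z \<in> carr" "rank z \<le> r" for z
        proof (cases "r = 0")
          case True
          then have "z \<cdot> \<omega> \<cdot> z = z" using z by (intro rank0_sandwich) auto
          then show ?thesis using congruenceD(2)[OF c z(1)] by simp
        next
          case False
          then have "r = 1" using \<open>r \<le> 1\<close> by simp
          then show ?thesis using rank1_collapse[OF c _ _ z(1)] r z n by simp
        qed
        have low: "(\<omega> \<cdot> x, \<omega> \<cdot> y) \<in> \<theta>"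
        proof (cases P)
          case True
          then show ?thesis using eqs(1) congruenceD(2)[OF c] x y by simp
        next
          case False
          then have h: "(\<omega> \<cdot> hook, \<omega>) \<in> \<theta>" by (simp add: P_def)
          have "(\<omega> \<cdot> z, \<omega>) \<in> \<theta>" if "z \<in> carr" for z
            using lower_spread[OF c n h, of "\<omega> \<cdot> z"] that rank0_mult zero_idem(1)[OF that] by simp
          then show ?thesis using x y congruenceD(3,4)[OF c] by meson
        qed
        have up: "(x \<cdot> \<omega>, y \<cdot> \<omega>) \<in> \<theta>"
        proof (cases Q)
          case True
          then show ?thesis using eqs(2) congruenceD(2)[OF c] x y by simp
        next
          case False
          then have h: "(hook \<cdot> \<omega>, \<omega>) \<in> \<theta>" by (simp add: Q_def)
          have "(z \<cdot> \<omega>, \<omega>) \<in> \<theta>" if "z \<in> carr" for z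
            using upper_spread[OF c n h, of "z \<cdot> \<omega>"] that rank0_mult zero_idem(2)[OF that] by simp
          then show ?thesis using x y congruenceD(3,4)[OF c] by meson
        qed
        have "(x \<cdot> \<omega> \<cdot> x, y \<cdot> \<omega> \<cdot> y) \<in> \<theta>"
          using congruence_mult[OF c up low] halves_mult x(1) y(1) by simp
        then show "(x, y) \<in> \<theta>" using red[OF x] red[OF y] congruenceD(3,4)[OF c] by meson
      qed
    qed
    have "con q N P Q \<subseteq> \<theta>"
      using nu kap congruenceD(2)[OF c] unfolding con_def Delta_def q(3) by auto
    moreover have main: "(\<alpha>, \<beta>) \<in> con q N P Q" if ab: "(\<alpha>, \<beta>) \<in> \<theta>" and le: "rank \<beta> \<le> rank \<alpha>" for \<alpha> \<beta>
    proof (cases "\<alpha> = \<beta>")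
      case True
      then show ?thesis using congruenceD(2)[OF cc] congruenceD(1)[OF c ab] by blast
    next
      case neq: False
      have X: "\<alpha> \<in> carr" "\<beta> \<in> carr" using congruenceD(1)[OF c ab] by auto
      define p where "p = rank \<alpha>"
      have p: "p \<le> n" using rank_le[OF X(1)] by (simp add: p_def)
      show ?thesis
      proof (cases "p \<le> r")
        case True
        have I: "\<alpha> \<in> I_rank n r" "\<beta> \<in> I_rank n r" using True X le by (auto simp: p_def I_rank_iff)
        have "\<omega> \<cdot> \<alpha> = \<omega> \<cdot> \<beta>" if P
          using lower_hook_collapse[OF c n congruenceD(5)[OF c ab zero_closed]] that X rank0_mult
            mul_assoc[of \<omega> \<omega>] by (auto simp: P_def)
        moreover have "\<alpha> \<cdot> \<omega> = \<beta> \<cdot> \<omega>" if Q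
          using upper_hook_collapse[OF c n congruenceD(6)[OF c ab zero_closed]] that X rank0_mult
            mul_assoc[of _ \<omega> \<omega>] by (auto simp: Q_def)
        ultimately have "(\<alpha>, \<beta>) \<in> kap r P Q" using I by (auto simp: kap_def)
        then show ?thesis unfolding con_def q(3) by blast
      next
        case False
        then have p1: "1 \<le> p" by simp
        have "(e p, \<omega>) \<notin> \<theta>" using max[OF p] False by blast
        then have H: "rank \<beta> = p" "upper_eq \<alpha> \<beta>" "lower_eq \<alpha> \<beta>"
          using collapse[OF c ab p_def[symmetric] _ p1] le by (auto simp: p_def)
        obtain s t \<sigma> \<tau> where st: "s \<in> carr" "t \<in> carr" "s \<cdot> e p = s" "e p \<cdot> t = t" "rank s = p" "rank t = p"
          and perm: "\<sigma> permutes {1..p}" "\<tau> permutes {1..p}" and eqs: "\<alpha> = s \<cdot> bar n p \<sigma> \<cdot> t" "\<beta> = s \<cdot> bar n p \<tau> \<cdot> t"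
          using H_related_factor[OF X p_def[symmetric] H] by metis
        have "(star s \<cdot> \<alpha> \<cdot> star t, star s \<cdot> \<beta> \<cdot> star t) \<in> \<theta>" using congruence_sandwich[OF c ab] st by simp
        then have "(bar n p \<sigma>, bar n p \<tau>) \<in> \<theta>"
          unfolding eqs using rank_sandwich(1)[OF st(1,3,5,2,4,6) perm(1) p] rank_sandwich(1)[OF st(1,3,5,2,4,6) perm(2) p]
          by simp
        then have K: "\<tau> \<circ> inv' \<sigma> \<in> perm_kernel p \<theta>" by (rule bar_related[OF c p perm])
        have "\<tau> \<circ> inv' \<sigma> \<noteq> id"
        proof
          assume "\<tau> \<circ> inv' \<sigma> = id"
          then have "\<tau> \<circ> inv' \<sigma> \<circ> \<sigma> = \<sigma>" by simp
          then have "\<tau> = \<sigma>" using permutes_inv_o(2)[OF perm(1)] by (simp add: comp_assoc)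
          then show False using neq eqs by simp
        qed
        \<comment> \<open>A nontrivial permutation in rank \<open>p\<close> collapses rank
          \<open>p - 1\<close>. Since \<open>r\<close> is the largest collapsed rank and
          \<open>p\<close> exceeds it, \<open>p\<close> equals \<open>q\<close>; above level
          \<open>q\<close> the congruence is the identity.\<close>
        then have "(e (p - 1), \<omega>) \<in> \<theta>"
          using permutation_collapse(2)[OF c p1 p] K by (auto simp: perm_kernel_def)
        then have "p - 1 \<le> r" using max p by simp
        then have pq: "p = q" using False by (simp add: q_def)
        have s\<sigma>: "s \<cdot> bar n q \<sigma> \<in> carr" "(s \<cdot> bar n q \<sigma>) \<cdot> e q = s \<cdot> bar n q \<sigma>"
          using st perm q pq by (simp_all add: mul_assoc)
        have nu': "(\<alpha>, s \<cdot> bar n q \<sigma> \<cdot> bar n q \<rho> \<cdot> t) \<in> nu_rel q N" if "\<rho> \<in> N" for \<rho>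
        proof -
          have "(s \<cdot> bar n q \<sigma> \<cdot> bar n q id \<cdot> t, s \<cdot> bar n q \<sigma> \<cdot> bar n q \<rho> \<cdot> t) \<in> nu_rel q N"
            by (rule nu_rel_sandwich[OF N q(2) normal_sym_group(2)[OF N] that s\<sigma>(1) st(2)])
              (use s\<sigma>(2) eqs(1) pq p_def in simp)
          then show ?thesis using s\<sigma>(2) eqs(1) pq by simp
        qed
        have \<rho>: "\<tau> \<circ> inv' \<sigma> \<in> N" using K pq by (simp add: N_def)
        have "bar n q \<sigma> \<cdot> bar n q (\<tau> \<circ> inv' \<sigma>) = bar n q \<tau>"
        proof -
          have "\<tau> \<circ> inv' \<sigma> \<circ> \<sigma> = \<tau>" using permutes_inv_o(2)[OF perm(1)] by (simp add: comp_assoc)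
          then show ?thesis using bar_mult[of \<sigma> q "\<tau> \<circ> inv' \<sigma>"] perm pq q normal_sym_group(1)[OF N \<rho>] by simp
        qed
        moreover have "bar n q \<sigma> \<in> carr" "bar n q (\<tau> \<circ> inv' \<sigma>) \<in> carr"
          using perm pq q normal_sym_group(1)[OF N \<rho>] by auto
        ultimately have "(\<alpha>, \<beta>) \<in> nu_rel q N" using nu'[OF \<rho>] eqs(2) pq st(1,2) by (simp add: mul_assoc)
        then show ?thesis by (simp add: con_def)
      qed
    qed
    have "\<theta> \<subseteq> con q N P Q"
    proof (rule subrelI)
      fix \<alpha> \<beta> assume ab: "(\<alpha>, \<beta>) \<in> \<theta>"
      show "(\<alpha>, \<beta>) \<in> con q N P Q"
      proof (cases "rank \<beta> \<le> rank \<alpha>")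
        case True
        then show ?thesis using main ab by blast
      next
        case False
        then have "(\<beta>, \<alpha>) \<in> con q N P Q" using main[OF congruenceD(3)[OF c ab]] by simp
        then show ?thesis by (rule congruenceD(3)[OF cc])
      qed
    qed
    ultimately show ?thesis using q(1,2) N PQ by blast
  qed
qed

end

section \<open>Normal subgroups of symmetric groups\<close>

text \<open>Multiple transitivity by induction on the lists: the transposition that brings
  \<open>p x\<close> to \<open>y\<close> leaves the earlier images alone, because neither of these
  two points occurs among them.\<close>

lemma ex_permutes_map:
  assumes "distinct xs" "distinct ys" "length xs = length ys" "set xs \<subseteq> A" "set ys \<subseteq> A"
  shows "\<exists>p. p permutes A \<and> map p xs = ys"
  using assms(3,1,2,4,5)
proof (induction xs ys rule: list_induct2)
  case Nil
  then show ?case by (intro exI[of _ id] conjI permutes_id) simp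
next
  case (Cons x xs y ys)
  then obtain p where p: "p permutes A" "map p xs = ys" by auto
  let ?t = "transpose (p x) y"
  have "p x \<in> A" using permutes_in_image[OF p(1)] Cons.prems by auto
  then have "?t permutes A" using Cons.prems by (intro permutes_swap_id) auto
  then have "?t \<circ> p permutes A" using p(1) by (rule permutes_compose[rotated])
  moreover have "p x \<notin> set ys"
  proof -
    have "set ys = p ` set xs" unfolding p(2)[symmetric] by simp
    then show ?thesis using Cons.prems(1) permutes_inj[OF p(1)] by (simp add: inj_image_mem_iff)
  qed
  then have *: "map ?t ys = ys"
    using Cons.prems(2) by (intro map_idI transpose_apply_other) auto
  have "map (?t \<circ> p) xs = ys" unfolding map_map[symmetric] p(2) by (rule *)
  then have "map (?t \<circ> p) (x # xs) = y # ys" by simp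
  ultimately show ?case by (intro exI[of _ "?t \<circ> p"] conjI)
qed

lemma bij_apply_transpose: "bij p \<Longrightarrow> p (transpose a b x) = transpose (p a) (p b) (p x)"
  using bij_is_inj[of p] by (auto simp: transpose_def inj_eq)

lemma conj_double_transpose:
  assumes "p permutes A"
  shows "p \<circ> (transpose a b \<circ> transpose c d) \<circ> inv' p = transpose (p a) (p b) \<circ> transpose (p c) (p d)"
  using permutes_inverses[OF assms] by (simp add: fun_eq_iff bij_apply_transpose[OF permutes_bij[OF assms]])

locale normal_symmetric =
  fixes N :: "(nat \<Rightarrow> nat) set" and q :: nat
  assumes N: "N \<lhd> sym_group q"
begin

lemmas perm = normal_sym_group(1)[OF N] and id_mem = normal_sym_group(2)[OF N]
  and comp_mem = normal_sym_group(3)[OF N] and inv_mem = normal_sym_group(4)[OF N]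
  and conj_mem = normal_sym_group(5)[OF N]

text \<open>All 3-cycles are conjugate in the symmetric group, and they generate the alternating
  group.\<close>

lemma alt_subset:
  assumes "cycle_of_list [a, b, c] \<in> N" "distinct [a, b, c]" "{a, b, c} \<subseteq> {1..q}"
  shows "carrier (alt_group q) \<subseteq> N"
proof
  have three: "three_cycles q \<subseteq> N"
  proof
    fix \<sigma> assume "\<sigma> \<in> three_cycles q"
    then obtain cs where cs: "\<sigma> = cycle_of_list cs" "distinct cs" "length cs = 3" "set cs \<subseteq> {1..q}" by blast
    obtain p where p: "p permutes {1..q}" "map p [a, b, c] = cs"
      using ex_permutes_map[of "[a, b, c]" cs "{1..q}"] assms(2,3) cs by auto
    have "p \<circ> cycle_of_list [a, b, c] \<circ> inv' p = \<sigma>"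
      unfolding cs(1) p(2)[symmetric] by (rule conjugation_of_cycle[OF assms(2) permutes_bij[OF p(1)]])
    then show "\<sigma> \<in> N" using conj_mem[OF assms(1) p(1)] by simp
  qed
  fix \<sigma> assume "\<sigma> \<in> carrier (alt_group q)"
  then have "\<sigma> \<in> generate (alt_group q) (three_cycles q)"
    by (simp only: alt_group_carrier_as_three_cycles)
  then show "\<sigma> \<in> N"
  proof induction
    case one
    then show ?case unfolding alt_group_one by (rule id_mem)
  next
    case (incl h)
    then show ?case using three by blast
  next
    case (inv h)
    then have "h \<in> carrier (alt_group q)" "h \<in> N" using three_cycles_incl three by blast+
    then show ?case using inv_mem by (simp add: alt_group_inv_equality)
  next
    case (eng h1 h2)
    then show ?case unfolding alt_group_mult using comp_mem by blast
  qed
qed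

text \<open>The alternating group has index two: one odd element of \<open>N\<close> turns every odd
  permutation into an even one.\<close>

lemma alt_or_sym:
  assumes "carrier (alt_group q) \<subseteq> N"
  shows "N = carrier (alt_group q) \<or> N = carrier (sym_group q)"
proof (cases "N \<subseteq> carrier (alt_group q)")
  case False
  then obtain \<tau> where \<tau>: "\<tau> \<in> N" "\<tau> \<notin> carrier (alt_group q)" by blast
  have pt: "\<tau> permutes {1..q}" using perm[OF \<tau>(1)] .
  then have odd: "\<not> evenperm \<tau>" using \<tau>(2) alt_group_carrier by blast
  have P: "permutation \<sigma>" if "\<sigma> permutes {1..q}" for \<sigma>
    using that permutation_permutes by blast
  have "\<sigma> \<in> N" if \<sigma>: "\<sigma> permutes {1..q}" for \<sigma>
  proof (cases "evenperm \<sigma>")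
    case True
    then show ?thesis using assms \<sigma> by (auto simp: alt_group_carrier)
  next
    case False
    have "evenperm (\<sigma> \<circ> inv' \<tau>)"
      using evenperm_comp[OF P[OF \<sigma>] P[OF permutes_inv[OF pt]]] evenperm_inv[OF P[OF pt]] False odd by simp
    then have "\<sigma> \<circ> inv' \<tau> \<in> N"
      using assms permutes_compose[OF permutes_inv[OF pt] \<sigma>] by (auto simp: alt_group_carrier)
    then have "\<sigma> \<circ> inv' \<tau> \<circ> \<tau> \<in> N" using comp_mem \<tau>(1) by blast
    then show ?thesis using permutes_inv_o(2)[OF pt] by (simp add: comp_assoc)
  qed
  then show ?thesis using perm by (auto simp: sym_group_carrier)
qed (use assms in blast)

text \<open>The commutator of \<sigma> with a transposition lies in \<open>N\<close> and is a
  product of two transpositions, so it moves at most four points. The later arguments choose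
  \<open>a\<close> and \<open>c\<close> to control how the two overlap.\<close>

lemma commutator_mem:
  assumes \<sigma>: "\<sigma> \<in> N" and ac: "a \<in> {1..q}" "c \<in> {1..q}"
  shows "transpose (\<sigma> a) (\<sigma> c) \<circ> transpose a c \<in> N"
proof -
  let ?t = "transpose a c"
  have t: "?t permutes {1..q}" using ac by (rule permutes_swap_id)
  have "?t \<circ> inv' \<sigma> \<circ> inv' ?t \<in> N" using conj_mem[OF inv_mem[OF \<sigma>] t] .
  then have "\<sigma> \<circ> (?t \<circ> inv' \<sigma> \<circ> inv' ?t) \<in> N" using comp_mem[OF \<sigma>] by blast
  moreover have "\<sigma> \<circ> (?t \<circ> inv' \<sigma> \<circ> inv' ?t) = transpose (\<sigma> a) (\<sigma> c) \<circ> ?t"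
    using permutes_inverses[OF perm[OF \<sigma>]]
    by (simp add: fun_eq_iff bij_apply_transpose[OF permutes_bij[OF perm[OF \<sigma>]]])
  ultimately show ?thesis by simp
qed

text \<open>In both cases for \<open>\<sigma> c\<close> the two transpositions of the commutator
  share exactly one point, so their product is a 3-cycle.\<close>

lemma alt_subset_of_near_cycle:
  assumes \<sigma>: "\<sigma> \<in> N" and ac: "a \<in> {1..q}" "c \<in> {1..q}" "\<sigma> a \<noteq> a" "c \<noteq> a" "c \<noteq> \<sigma> a" "\<sigma> c = a \<or> \<sigma> c = c"
  shows "carrier (alt_group q) \<subseteq> N"
proof -
  let ?b = "\<sigma> a"
  have b: "?b \<in> {1..q}" using permutes_in_image[OF perm[OF \<sigma>]] ac(1) by simp
  note m = commutator_mem[OF \<sigma> ac(1,2)]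
  from ac(6) show ?thesis
  proof
    assume "\<sigma> c = a"
    then have "cycle_of_list [a, c, ?b] = transpose ?b (\<sigma> c) \<circ> transpose a c"
      using ac by (auto simp: fun_eq_iff transpose_def)
    then show ?thesis using m ac b by (intro alt_subset[of a c ?b]) auto
  next
    assume "\<sigma> c = c"
    then have "cycle_of_list [a, ?b, c] = transpose ?b (\<sigma> c) \<circ> transpose a c"
      using ac by (auto simp: fun_eq_iff transpose_def)
    then show ?thesis using m ac b by (intro alt_subset[of a ?b c]) auto
  qed
qed

text \<open>If \<open>N\<close> has no such 3-cycle, then for a moved point \<open>a\<close> and any
  third point \<open>c\<close> the points \<open>a\<close>, \<open>\<sigma> a\<close>,
  \<open>c\<close>, \<open>\<sigma> c\<close> are distinct. The commutator is then a product of
  disjoint transpositions.\<close>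

lemma double_transpose_mem:
  assumes "N \<noteq> {id}" "3 \<le> q" "\<not> carrier (alt_group q) \<subseteq> N"
  obtains a b c d where "distinct [a, b, c, d]" "{a, b, c, d} \<subseteq> {1..q}" "transpose a b \<circ> transpose c d \<in> N"
proof -
  obtain \<sigma> where \<sigma>: "\<sigma> \<in> N" "\<sigma> \<noteq> id" using assms(1) id_mem by blast
  then obtain a where a: "\<sigma> a \<noteq> a" by (auto simp: fun_eq_iff)
  then have aq: "a \<in> {1..q}" using perm[OF \<sigma>(1)] by (meson permutes_not_in)
  have bq: "\<sigma> a \<in> {1..q}" using permutes_in_image[OF perm[OF \<sigma>(1)]] aq by simp
  have "card ({1..q} - {a, \<sigma> a}) = q - 2" using a aq bq by (simp add: card_Diff_subset)
  then have "card ({1..q} - {a, \<sigma> a}) \<noteq> 0" using assms(2) by linarith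
  then have "{1..q} - {a, \<sigma> a} \<noteq> {}" by (metis card.empty)
  then obtain c where c: "c \<in> {1..q}" "c \<noteq> a" "c \<noteq> \<sigma> a" by blast
  have cq: "\<sigma> c \<in> {1..q}" using permutes_in_image[OF perm[OF \<sigma>(1)]] c by simp
  have "\<sigma> c \<noteq> a" "\<sigma> c \<noteq> c" using alt_subset_of_near_cycle[OF \<sigma>(1) aq c(1) a c(2,3)] assms(3) by auto
  moreover have "\<sigma> c \<noteq> \<sigma> a" using permutes_inj[OF perm[OF \<sigma>(1)]] c(2) by (auto dest: injD)
  ultimately show ?thesis
    using that[of "\<sigma> a" "\<sigma> c" a c] commutator_mem[OF \<sigma>(1) aq c(1)] a c aq bq cq by auto
qed

text \<open>A fifth point \<open>f\<close> allows conjugation of (a b)(c d) into (a b)(c f); the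
  product of the two is a 3-cycle on \<open>c\<close>, \<open>f\<close>, \<open>d\<close>.\<close>

lemma alt_subset_of_large:
  assumes "N \<noteq> {id}" "5 \<le> q"
  shows "carrier (alt_group q) \<subseteq> N"
proof (rule ccontr)
  assume not: "\<not> carrier (alt_group q) \<subseteq> N"
  have "3 \<le> q" using assms(2) by simp
  then obtain a b c d where abcd: "distinct [a, b, c, d]" "{a, b, c, d} \<subseteq> {1..q}" "transpose a b \<circ> transpose c d \<in> N"
    using double_transpose_mem[OF assms(1) _ not] by blast
  have "card ({1..q} - {a, b, c, d}) = q - 4" using abcd by (subst card_Diff_subset) auto
  then have "card ({1..q} - {a, b, c, d}) \<noteq> 0" using assms(2) by linarith
  then have "{1..q} - {a, b, c, d} \<noteq> {}" by (metis card.empty)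
  then obtain f where f: "f \<in> {1..q}" "f \<notin> {a, b, c, d}" by blast
  have t: "transpose d f permutes {1..q}" using abcd f by (intro permutes_swap_id) auto
  have "transpose d f \<circ> (transpose a b \<circ> transpose c d) \<circ> inv' (transpose d f) \<in> N"
    using conj_mem[OF abcd(3) t] .
  moreover have "transpose d f a = a" "transpose d f b = b" "transpose d f c = c"
    by (rule transpose_apply_other; use abcd(1) f in auto)+
  ultimately have "transpose a b \<circ> transpose c f \<in> N" unfolding conj_double_transpose[OF t] by simp
  then have "(transpose a b \<circ> transpose c d) \<circ> (transpose a b \<circ> transpose c f) \<in> N"
    using comp_mem abcd(3) by blast
  moreover have "(transpose a b \<circ> transpose c d) \<circ> (transpose a b \<circ> transpose c f) = cycle_of_list [c, f, d]"
    using abcd(1) f by (auto simp: fun_eq_iff transpose_def)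
  ultimately show False using alt_subset[of c f d] abcd f not by auto
qed

text \<open>Double transpositions are conjugate, so one of them brings in the three that are
  supported on 1, ..., 4.\<close>

lemma klein4_subset:
  assumes "distinct [a, b, c, d]" "{a, b, c, d} \<subseteq> {1..q}" "transpose a b \<circ> transpose c d \<in> N" "4 \<le> q"
  shows "klein4 \<subseteq> N"
proof -
  have "transpose a' b' \<circ> transpose c' d' \<in> N" if d': "distinct [a', b', c', d']" "{a', b', c', d'} \<subseteq> {1..4}" for a' b' c' d'
  proof -
    have "{a', b', c', d'} \<subseteq> {1..q}" using d'(2) assms(4) by auto
    then obtain p where p: "p permutes {1..q}" "map p [a, b, c, d] = [a', b', c', d']"
      using ex_permutes_map[of "[a, b, c, d]" "[a', b', c', d']" "{1..q}"] assms(1,2) d'(1) by auto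
    then show ?thesis using conj_mem[OF assms(3) p(1)] conj_double_transpose[OF p(1), of a b c d] by simp
  qed
  then show ?thesis using id_mem by (auto simp: klein4_def)
qed

text \<open>The Klein group is transitive on 1, ..., 4, so each \<sigma> can be corrected to an
  element \<rho> of \<open>N\<close> fixing 4. On the three remaining points a nontrivial
  permutation satisfies the near-cycle condition, which would put the alternating group into
  \<open>N\<close>.\<close>

lemma klein4_case:
  assumes "q = 4" "klein4 \<subseteq> N" "\<not> carrier (alt_group q) \<subseteq> N"
  shows "N = klein4"
proof
  show "N \<subseteq> klein4"
  proof
    fix \<sigma> assume \<sigma>: "\<sigma> \<in> N"
    have k: "\<sigma> 4 \<in> {1, 2, 3, 4}" using permutes_in_image[OF perm[OF \<sigma>], of 4] assms(1) by auto
    obtain v where v: "v \<in> klein4" "v (\<sigma> 4) = 4" "v \<circ> v = id"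
    proof -
      consider "\<sigma> 4 = 4" | "\<sigma> 4 = 1" | "\<sigma> 4 = 2" | "\<sigma> 4 = 3" using k by blast
      then show ?thesis
      proof cases
        case 1
        then show ?thesis using that[of id] by (auto simp: klein4_def)
      next
        case 2
        then show ?thesis using that[of "transpose 1 4 \<circ> transpose 2 3"] by (auto simp: klein4_def fun_eq_iff transpose_def)
      next
        case 3
        then show ?thesis using that[of "transpose 1 3 \<circ> transpose 2 4"] by (auto simp: klein4_def fun_eq_iff transpose_def)
      next
        case 4
        then show ?thesis using that[of "transpose 1 2 \<circ> transpose 3 4"] by (auto simp: klein4_def fun_eq_iff transpose_def)
      qed
    qed
    let ?\<rho> = "v \<circ> \<sigma>"
    have \<rho>: "?\<rho> \<in> N" "?\<rho> 4 = 4" using comp_mem v assms(2) \<sigma> by auto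
    have in3: "?\<rho> i \<in> {1, 2, 3}" if "i \<in> {1, 2, 3}" for i
    proof -
      have "?\<rho> i \<in> {1..4}" using permutes_in_image[OF perm[OF \<rho>(1)], of i] that assms(1) by auto
      moreover have "?\<rho> i \<noteq> 4"
      proof
        assume "?\<rho> i = 4"
        then have "i = 4" using permutes_inj[OF perm[OF \<rho>(1)]] \<rho>(2) by (metis injD)
        then show False using that by simp
      qed
      ultimately show ?thesis by auto
    qed
    have "?\<rho> = id"
    proof (rule ccontr)
      assume "?\<rho> \<noteq> id"
      then obtain a where a: "?\<rho> a \<noteq> a" by (auto simp: fun_eq_iff)
      then have "a \<in> {1..4}" using perm[OF \<rho>(1)] assms(1) by (meson permutes_not_in)
      then have a3: "a \<in> {1, 2, 3}" using a \<rho>(2) by (cases "a = 4") auto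
      define b where "b = ?\<rho> a"
      have b: "b \<in> {1, 2, 3}" "b \<noteq> a" unfolding b_def by (rule in3[OF a3], rule a)
      \<comment> \<open>The third element of {1, 2, 3}, whose sum is 6. As \<open>?\<rho> c\<close>
        differs from \<open>?\<rho> a = b\<close>, it must be \<open>a\<close> or
        \<open>c\<close>.\<close>
      define c where "c = 6 - (a + b)"
      have c: "c \<in> {1, 2, 3}" "c \<noteq> a" "c \<noteq> b" "\<And>x. x \<in> {1, 2, 3} \<Longrightarrow> x = a \<or> x = b \<or> x = c"
        using a3 b by (auto simp: c_def)
      have "?\<rho> c \<noteq> b"
      proof
        assume "?\<rho> c = b"
        then have "c = a" unfolding b_def using permutes_inj[OF perm[OF \<rho>(1)]] by (metis injD)
        then show False using c(2) by simp
      qed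
      then have "?\<rho> c = a \<or> ?\<rho> c = c" using c(4)[OF in3[OF c(1)]] by argo
      moreover have "a \<in> {1..q}" "c \<in> {1..q}" using a3 c(1) assms(1) by auto
      ultimately show False
        using alt_subset_of_near_cycle[OF \<rho>(1) _ _ a c(2) c(3)[unfolded b_def]] assms(3) by blast
    qed
    then have "\<sigma> = v" using v(3) by (metis comp_assoc comp_id id_comp)
    then show "\<sigma> \<in> klein4" using v(1) by simp
  qed
qed (rule assms(2))

theorem normal_classification:
  assumes "N \<noteq> {id}" "3 \<le> q"
  shows "N = carrier (alt_group q) \<or> N = carrier (sym_group q) \<or> q = 4 \<and> N = klein4"
proof (cases "carrier (alt_group q) \<subseteq> N")
  case True
  then show ?thesis using alt_or_sym by blast
next
  case False
  then have "q < 5" using alt_subset_of_large assms(1) by force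
  obtain a b c d where abcd: "distinct [a, b, c, d]" "{a, b, c, d} \<subseteq> {1..q}" "transpose a b \<circ> transpose c d \<in> N"
    using double_transpose_mem[OF assms False] by blast
  have "card {a, b, c, d} \<le> card {1..q}" using abcd(2) by (intro card_mono) auto
  then have "4 \<le> q" using abcd(1) by simp
  then show ?thesis using klein4_case klein4_subset[OF abcd] False \<open>q < 5\<close> by simp
qed

end

text \<open>The nontrivial elements are exactly the fixed-point-free involutions of four points.
  This description is invariant under conjugation, and normality follows from it.\<close>

lemma klein4_memI:
  assumes \<sigma>: "\<sigma> permutes {1..4}" "\<And>i. \<sigma> (\<sigma> i) = i" "\<And>i. i \<in> {1..4} \<Longrightarrow> \<sigma> i \<noteq> i"
  shows "\<sigma> \<in> klein4"
proof -
  have r: "\<sigma> i \<in> {1, 2, 3, 4}" if "i \<in> {1, 2, 3, 4}" for i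
    using permutes_in_image[OF \<sigma>(1), of i] that by auto
  have out: "\<sigma> i = i" if "i \<notin> {1, 2, 3, 4}" for i
    using permutes_not_in[OF \<sigma>(1), of i] that by auto
  have s: "\<sigma> 1 \<noteq> 1" "\<sigma> 2 \<noteq> 2" "\<sigma> 3 \<noteq> 3" "\<sigma> 4 \<noteq> 4" using \<sigma>(3) by auto
  have inj: "\<sigma> i = \<sigma> j \<longleftrightarrow> i = j" for i j using permutes_inj[OF \<sigma>(1)] by (auto dest: injD)
  have eqI: "\<sigma> = \<tau>" if "\<And>i. i \<in> {1, 2, 3, 4} \<Longrightarrow> \<sigma> i = \<tau> i" "\<And>i. i \<notin> {1, 2, 3, 4} \<Longrightarrow> \<tau> i = i" for \<tau>
    using that out by (metis ext)
  have "\<sigma> 1 \<in> {2, 3, 4}" using r[of 1] s by auto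
  then consider "\<sigma> 1 = 2" | "\<sigma> 1 = 3" | "\<sigma> 1 = 4" by blast
  then show ?thesis
  proof cases
    case 1
    then have 2: "\<sigma> 2 = 1" using \<sigma>(2)[of 1] by simp
    have 3: "\<sigma> 3 = 4" using r[of 3] s(3) inj[of 3 1] inj[of 3 2] 1 2 by auto
    then have 4: "\<sigma> 4 = 3" using \<sigma>(2)[of 3] by simp
    have "\<sigma> = transpose 1 2 \<circ> transpose 3 4"
      by (rule eqI) (use 1 2 3 4 in \<open>auto simp: transpose_def\<close>)
    then show ?thesis by (simp add: klein4_def)
  next
    case 2
    then have 3: "\<sigma> 3 = 1" using \<sigma>(2)[of 1] by simp
    have 4: "\<sigma> 2 = 4" using r[of 2] s(2) inj[of 2 1] inj[of 2 3] 2 3 by auto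
    then have 5: "\<sigma> 4 = 2" using \<sigma>(2)[of 2] by simp
    have "\<sigma> = transpose 1 3 \<circ> transpose 2 4"
      by (rule eqI) (use 2 3 4 5 in \<open>auto simp: transpose_def\<close>)
    then show ?thesis by (simp add: klein4_def)
  next
    case 3
    then have 4: "\<sigma> 4 = 1" using \<sigma>(2)[of 1] by simp
    have 5: "\<sigma> 2 = 3" using r[of 2] s(2) inj[of 2 1] inj[of 2 4] 3 4 by auto
    then have 6: "\<sigma> 3 = 2" using \<sigma>(2)[of 2] by simp
    have "\<sigma> = transpose 1 4 \<circ> transpose 2 3"
      by (rule eqI) (use 3 4 5 6 in \<open>auto simp: transpose_def\<close>)
    then show ?thesis by (simp add: klein4_def)
  qed
qed

lemma klein4_memD:
  assumes "\<sigma> \<in> klein4"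
  shows "\<sigma> permutes {1..4}" "\<sigma> (\<sigma> i) = i" "\<sigma> \<noteq> id \<Longrightarrow> i \<in> {1..4} \<Longrightarrow> \<sigma> i \<noteq> i" "evenperm \<sigma>"
proof -
  have cases: "\<sigma> = id \<or> \<sigma> = transpose 1 2 \<circ> transpose 3 4 \<or> \<sigma> = transpose 1 3 \<circ> transpose 2 4 \<or> \<sigma> = transpose 1 4 \<circ> transpose 2 3"
    using assms by (auto simp: klein4_def)
  have "transpose 1 2 \<circ> transpose 3 4 permutes {1..4::nat}" "transpose 1 3 \<circ> transpose 2 4 permutes {1..4::nat}"
    "transpose 1 4 \<circ> transpose 2 3 permutes {1..4::nat}"
    by (intro permutes_compose permutes_swap_id; simp)+
  then show "\<sigma> permutes {1..4}" using cases permutes_id by metis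
  show "\<sigma> (\<sigma> i) = i" using cases by (elim disjE) (auto simp: transpose_def)
  show "\<sigma> i \<noteq> i" if "\<sigma> \<noteq> id" "i \<in> {1..4}"
  proof -
    have "i = 1 \<or> i = 2 \<or> i = 3 \<or> i = 4" using that(2) by auto
    then show ?thesis using cases that(1) by (elim disjE) (auto simp: transpose_def)
  qed
  show "evenperm \<sigma>"
    using cases by (elim disjE) (auto simp: evenperm_comp permutation_swap_id evenperm_swap)
qed

lemma klein4_normal: "klein4 \<lhd> sym_group 4"
proof (rule normal_sym_groupI)
  show "\<sigma> permutes {1..4}" if "\<sigma> \<in> klein4" for \<sigma> using klein4_memD(1)[OF that] .
  show "id \<in> klein4" by (simp add: klein4_def)
  show "inv' \<sigma> \<in> klein4" if "\<sigma> \<in> klein4" for \<sigma>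
  proof -
    have "inv' \<sigma> = \<sigma>"
      using klein4_memD(2)[OF that] by (intro inv_unique_comp) (auto simp: fun_eq_iff)
    then show ?thesis using that by simp
  qed
  show "\<tau> \<circ> \<sigma> \<circ> inv' \<tau> \<in> klein4" if "\<sigma> \<in> klein4" "\<tau> permutes {1..4}" for \<sigma> \<tau>
  proof (cases "\<sigma> = id")
    case True
    then show ?thesis using permutes_inv_o[OF that(2)] by (simp add: klein4_def)
  next
    case False
    have i: "inv' \<tau> permutes {1..4}" using permutes_inv[OF that(2)] .
    note D = klein4_memD[OF that(1)]
    show ?thesis
    proof (rule klein4_memI)
      show "\<tau> \<circ> \<sigma> \<circ> inv' \<tau> permutes {1..4}"
        using D(1) i that(2) by (auto intro!: permutes_compose)
      show "(\<tau> \<circ> \<sigma> \<circ> inv' \<tau>) ((\<tau> \<circ> \<sigma> \<circ> inv' \<tau>) x) = x" for x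
        using D(2) permutes_inverses[OF that(2)] by simp
      show "(\<tau> \<circ> \<sigma> \<circ> inv' \<tau>) x \<noteq> x" if x: "x \<in> {1..4}" for x
      proof -
        have "inv' \<tau> x \<in> {1..4}" using permutes_in_image[OF i] x by blast
        then have "\<sigma> (inv' \<tau> x) \<noteq> inv' \<tau> x" using D(3) False by blast
        then show ?thesis using permutes_inverses[OF \<open>\<tau> permutes {1..4}\<close>] by (metis comp_apply)
      qed
    qed
  qed
  show "\<sigma> \<circ> \<tau> \<in> klein4" if "\<sigma> \<in> klein4" "\<tau> \<in> klein4" for \<sigma> \<tau>
  proof -
    define A B C :: "nat \<Rightarrow> nat" where defs: "A = transpose 1 2 \<circ> transpose 3 4"
      "B = transpose 1 3 \<circ> transpose 2 4" "C = transpose 1 4 \<circ> transpose 2 3"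
    have k: "klein4 = {id, A, B, C}" by (simp only: klein4_def defs)
    have "A \<circ> A = id" "B \<circ> B = id" "C \<circ> C = id" "A \<circ> B = C" "B \<circ> A = C"
      "A \<circ> C = B" "C \<circ> A = B" "B \<circ> C = A" "C \<circ> B = A"
      by (auto simp: defs fun_eq_iff transpose_def)
    then show ?thesis using that unfolding k
      by (elim insertE emptyE) (simp_all only: comp_id id_comp insert_iff simp_thms)
  qed
qed

section \<open>Alternating groups and symmetric groups of small degree\<close>

lemma alt_normal: "carrier (alt_group q) \<lhd> sym_group q"
  using group_hom.normal_kernel[OF sign_group_hom] alt_group_is_sign_kernel by metis

lemma alt_psubset_sym:
  assumes "2 \<le> q"
  shows "carrier (alt_group q) \<subset> carrier (sym_group q)"
proof -
  have "transpose 1 2 permutes {1..q}" using assms by (intro permutes_swap_id) auto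
  then have "transpose 1 2 \<in> carrier (sym_group q)" by (simp add: sym_group_carrier)
  moreover have "transpose 1 2 \<notin> carrier (alt_group q)" by (simp add: alt_group_carrier evenperm_swap)
  moreover have "carrier (alt_group q) \<subseteq> carrier (sym_group q)" by (auto simp: alt_group_carrier sym_group_carrier)
  ultimately show ?thesis by blast
qed

lemma cycle3_alt: "3 \<le> q \<Longrightarrow> cycle_of_list [1, 2, 3] \<in> carrier (alt_group q)"
  using three_cycles_incl[of q] by (intro subsetD[OF three_cycles_incl] CollectI exI[of _ "[1, 2, 3]"]) auto

lemma alt_nontrivial: "3 \<le> q \<Longrightarrow> carrier (alt_group q) \<noteq> {id}"
proof
  assume "3 \<le> q" "carrier (alt_group q) = {id}"
  then have "cycle_of_list [1, 2, 3::nat] = id" using cycle3_alt by blast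
  then have "cycle_of_list [1, 2, 3::nat] 1 = id 1" by (rule fun_cong)
  then show False by (simp add: transpose_def)
qed

lemma klein4_psubset_alt: "klein4 \<subset> carrier (alt_group 4)"
proof -
  let ?c = "cycle_of_list [1, 2, 3::nat]"
  have c: "?c 4 = 4" "?c 1 = 2" by (simp_all add: transpose_def)
  have ne: "?c \<noteq> id"
  proof
    assume "?c = id"
    then have "?c 1 = id 1" by (rule fun_cong)
    then show False unfolding c(2) by simp
  qed
  have "?c \<notin> klein4"
  proof
    assume "?c \<in> klein4"
    from klein4_memD(3)[OF this ne, of 4] show False unfolding c(1) by simp
  qed
  moreover have "klein4 \<subseteq> carrier (alt_group 4)" using klein4_memD by (auto simp: alt_group_carrier)
  ultimately show ?thesis using cycle3_alt[of 4] by auto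
qed

lemma klein4_nontrivial: "klein4 \<noteq> {id}"
proof
  assume "klein4 = {id}"
  then have "transpose 1 2 \<circ> transpose 3 4 = (id :: nat \<Rightarrow> nat)" by (auto simp: klein4_def)
  then have "(transpose 1 2 \<circ> transpose 3 4) 1 = id (1::nat)" by (rule fun_cong)
  then show False by (simp add: transpose_def)
qed

lemma permutes_le_1:
  fixes q :: nat
  assumes "\<sigma> permutes {1..q}" "q \<le> 1"
  shows "\<sigma> = id"
proof -
  have "{1..q} \<subseteq> {1}" using assms(2) by auto
  then have "\<sigma> permutes {1}" using permutes_subset[OF assms(1)] by blast
  then show "\<sigma> = id" by (simp add: permutes_sing)
qed

lemma permutes_2: "\<sigma> permutes {1..2::nat} \<longleftrightarrow> \<sigma> = id \<or> \<sigma> = transpose 1 2"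
proof -
  have "{1..2::nat} = {1, 2}" by auto
  then show ?thesis by (simp add: permutes_doubleton_iff)
qed

lemma sym_group_2: "carrier (sym_group 2) = {id, transpose 1 2}"
  unfolding set_eq_iff sym_group_carrier using permutes_2 by auto

lemma normal_sym_group_2:
  assumes "N \<lhd> sym_group 2"
  shows "N = {id} \<or> N = carrier (sym_group 2)"
proof -
  have sub: "\<sigma> = id \<or> \<sigma> = transpose 1 2" if "\<sigma> \<in> N" for \<sigma>
    using normal_sym_group(1)[OF assms that] permutes_2 by blast
  have id: "id \<in> N" by (rule normal_sym_group(2)[OF assms])
  show ?thesis
  proof (cases "transpose 1 2 \<in> N")
    case True
    then have "N = {id, transpose 1 2}" using sub id by (intro equalityI subsetI) auto
    then show ?thesis unfolding sym_group_2 by (rule disjI2)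
  next
    case False
    then have "\<sigma> = id" if "\<sigma> \<in> N" for \<sigma> using sub[OF that] that False by (elim disjE) simp_all
    then have "N = {id}" using id by (intro equalityI subsetI) simp_all
    then show ?thesis by (rule disjI1)
  qed
qed

lemma normal_sym_group_le_1:
  assumes "N \<lhd> sym_group q" "q \<le> 1"
  shows "N = {id}"
proof -
  have "\<sigma> = id" if "\<sigma> \<in> N" for \<sigma>
    using permutes_le_1[OF normal_sym_group(1)[OF assms(1) that] assms(2)] .
  then show ?thesis using normal_sym_group(2)[OF assms(1)] by blast
qed

section \<open>Inclusions between the congruences\<close>

context partial_brauer
begin

text \<open>The element \<open>x \<cdot> \<omega> \<cdot> x\<close> is fixed by \<open>f\<close>,
  while the homomorphism property evaluates it to a sandwich of \<omega> between two copies of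
  \<open>f x\<close>, which is \<open>f x\<close>. So a retraction is unique and has an explicit
  formula.\<close>

lemma retraction_value:
  assumes f: "is_retraction (PB n) (I_rank n q) f" and x: "x \<in> I_rank n q"
  shows "f x = x \<cdot> \<omega> \<cdot> x"
proof -
  have hom: "f a \<in> I_rank n 0" "f (a \<cdot> b) = f a \<cdot> f b" if "a \<in> I_rank n q" "b \<in> I_rank n q" for a b
    using f that by (auto simp: is_retraction_def hom_def min_ideal_PB)
  have fix0: "f a = a" if "a \<in> I_rank n 0" for a
    using f that by (simp add: is_retraction_def min_ideal_PB)
  have X: "x \<in> carr" using x by (simp add: I_rank_iff)
  have zero: "\<omega> \<in> I_rank n 0" "\<omega> \<in> I_rank n q" by (auto simp: I_rank_iff)
  have r0: "x \<cdot> \<omega> \<in> I_rank n 0" "x \<cdot> \<omega> \<in> I_rank n q" "x \<cdot> \<omega> \<cdot> x \<in> I_rank n 0"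
    using X rank0_mult by (auto simp: I_rank_iff)
  have fx: "f x \<in> carr" "rank (f x) = 0" using hom(1)[OF x x] by (auto simp: I_rank_iff)
  have "x \<cdot> \<omega> \<cdot> x = f (x \<cdot> \<omega> \<cdot> x)" using fix0 r0 by simp
  also have "\<dots> = f x \<cdot> f \<omega> \<cdot> f x" using hom(2) x zero(2) r0(2) by simp
  also have "\<dots> = f x" using fix0[OF zero(1)] rank0_sandwich[OF fx zero_closed] by simp
  finally show ?thesis by simp
qed

lemma sandwich_halves:
  assumes "x \<in> carr"
  shows "\<omega> \<cdot> (x \<cdot> \<omega> \<cdot> x) = \<omega> \<cdot> x" "(x \<cdot> \<omega> \<cdot> x) \<cdot> \<omega> = x \<cdot> \<omega>"
proof -
  have "\<omega> \<cdot> (x \<cdot> \<omega> \<cdot> x) = (\<omega> \<cdot> x \<cdot> \<omega>) \<cdot> x" "(x \<cdot> \<omega> \<cdot> x) \<cdot> \<omega> = x \<cdot> (\<omega> \<cdot> x \<cdot> \<omega>)"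
    using assms by (simp_all add: mul_assoc)
  then show "\<omega> \<cdot> (x \<cdot> \<omega> \<cdot> x) = \<omega> \<cdot> x" "(x \<cdot> \<omega> \<cdot> x) \<cdot> \<omega> = x \<cdot> \<omega>"
    using zero_sandwich[OF assms] by simp_all
qed

text \<open>Both sides of the homomorphism equation have rank zero, the upper half of
  \<open>x\<close> and the lower half of \<open>y\<close>. That halves survive multiplication within
  the ideal is the content of \<open>upper_half_mult\<close> and
  \<open>lower_half_mult\<close>.\<close>

lemma retraction_exists:
  assumes "q \<le> 1"
  shows "is_retraction (PB n) (I_rank n q) (\<lambda>x. x \<cdot> \<omega> \<cdot> x)"
proof -
  have r0: "x \<cdot> \<omega> \<cdot> x \<in> carr" "rank (x \<cdot> \<omega> \<cdot> x) = 0" if "x \<in> carr" for x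
    using that rank0_mult by auto
  have "(x \<cdot> y) \<cdot> \<omega> \<cdot> (x \<cdot> y) = (x \<cdot> \<omega> \<cdot> x) \<cdot> (y \<cdot> \<omega> \<cdot> y)"
    if x: "x \<in> carr" "rank x \<le> 1" and y: "y \<in> carr" "rank y \<le> 1" for x y
  proof (rule rank0_eqI)
    show "rank (x \<cdot> \<omega> \<cdot> x \<cdot> (y \<cdot> \<omega> \<cdot> y)) = 0" using x y r0 rank0_mult by simp
    have "\<omega> \<cdot> ((x \<cdot> \<omega> \<cdot> x) \<cdot> (y \<cdot> \<omega> \<cdot> y)) = \<omega> \<cdot> (y \<cdot> \<omega> \<cdot> y)"
      using lower_half_mult[of "y \<cdot> \<omega> \<cdot> y" "x \<cdot> \<omega> \<cdot> x"] r0 x y by simp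
    then show "\<omega> \<cdot> ((x \<cdot> y) \<cdot> \<omega> \<cdot> (x \<cdot> y)) = \<omega> \<cdot> (x \<cdot> \<omega> \<cdot> x \<cdot> (y \<cdot> \<omega> \<cdot> y))"
      using x y lower_half_mult[OF y x(1)] by (simp add: sandwich_halves)
    have "((x \<cdot> y) \<cdot> \<omega> \<cdot> (x \<cdot> y)) \<cdot> \<omega> = (x \<cdot> y) \<cdot> \<omega>"
      by (rule sandwich_halves(2)) (use x y in simp)
    also have "\<dots> = x \<cdot> \<omega>" by (rule upper_half_mult[OF x y(1)])
    also have "\<dots> = (x \<cdot> \<omega> \<cdot> x) \<cdot> \<omega>" using x by (simp add: sandwich_halves)
    also have "\<dots> = ((x \<cdot> \<omega> \<cdot> x) \<cdot> (y \<cdot> \<omega> \<cdot> y)) \<cdot> \<omega>"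
      using upper_half_mult[of "x \<cdot> \<omega> \<cdot> x" "y \<cdot> \<omega> \<cdot> y"] r0 x y by simp
    finally show "((x \<cdot> y) \<cdot> \<omega> \<cdot> (x \<cdot> y)) \<cdot> \<omega> = x \<cdot> \<omega> \<cdot> x \<cdot> (y \<cdot> \<omega> \<cdot> y) \<cdot> \<omega>" .
  qed (use x y r0 in auto)
  moreover have "x \<cdot> \<omega> \<cdot> x = x" if "x \<in> carr" "rank x = 0" for x
    using that by (intro rank0_sandwich) auto
  ultimately show ?thesis
    using assms r0 by (auto simp: is_retraction_def hom_def min_ideal_PB I_rank_iff)
qed

lemma retraction_PB:
  assumes "q \<le> 1" "x \<in> I_rank n q"
  shows "retraction (PB n) (I_rank n q) x = x \<cdot> \<omega> \<cdot> x"
proof (rule retraction_value[OF _ assms(2)])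
  show "is_retraction (PB n) (I_rank n q) (retraction (PB n) (I_rank n q))"
    unfolding retraction_def by (rule someI[of "is_retraction (PB n) (I_rank n q)", OF retraction_exists[OF assms(1)]])
qed

text \<open>From \<open>q = 2\<close> on the ideal contains \<open>e 2\<close>, and the formula
  sends it to \<omega> but fixes \<open>hook\<close>. As \<open>hook\<close> absorbs
  \<open>e 2\<close> on both sides, a homomorphism would force \<open>hook\<close> to equal
  \<omega>.\<close>

lemma retractable_iff:
  assumes "q \<le> n"
  shows "retractable_ideal (PB n) (I_rank n q) \<longleftrightarrow> q \<le> 1"
proof
  assume "retractable_ideal (PB n) (I_rank n q)"
  then obtain f where f: "is_retraction (PB n) (I_rank n q) f" by (auto simp: retractable_ideal_def)
  show "q \<le> 1"
  proof (rule ccontr)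
    assume "\<not> q \<le> 1"
    then have q: "2 \<le> q" and n: "2 \<le> n" using assms by auto
    have I: "e 2 \<in> I_rank n q" "hook \<in> I_rank n q" using q n by (auto simp: I_rank_iff)
    have "e 2 \<cdot> \<omega> \<cdot> e 2 = \<omega>" "hook \<cdot> \<omega> \<cdot> hook = hook" using n rank0_sandwich[of hook \<omega>] by simp_all
    then have fv: "f (e 2) = \<omega>" "f hook = hook" using retraction_value[OF f] I by simp_all
    have "f (e 2 \<cdot> hook) = f (e 2) \<cdot> f hook"
      using f I by (auto simp: is_retraction_def hom_def)
    then have "hook = \<omega> \<cdot> hook" using hook_e(2)[OF n, of 2] n fv by simp
    moreover have "f (hook \<cdot> e 2) = f hook \<cdot> f (e 2)"
      using f I by (auto simp: is_retraction_def hom_def)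
    then have "hook = hook \<cdot> \<omega>" using hook_e(1)[OF n, of 2] n fv by simp
    ultimately have "\<omega> \<cdot> hook \<cdot> \<omega> = hook" by simp
    then show False using zero_sandwich[of hook] hook_zero_neq(1)[OF n] n \<open>hook = hook \<cdot> \<omega>\<close> by simp
  qed
next
  assume "q \<le> 1"
  then show "retractable_ideal (PB n) (I_rank n q)"
    unfolding retractable_ideal_def using sgp_ideal_I_rank[OF assms] retraction_exists by blast
qed

lemma R_IN_con:
  assumes "N \<lhd> sym_group q" "q \<le> n"
  shows "R_IN (PB n) (I_rank n (q - 1)) (bar n q ` N) = con q N False False"
  unfolding R_IN_def con_def nu_eq_nu_rel[OF assms] by (auto simp: kap_def)

lemma retraction_Green:
  assumes "q \<le> 1" "x \<in> I_rank n q" "y \<in> I_rank n q"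
  shows "(retraction (PB n) (I_rank n q) x, retraction (PB n) (I_rank n q) y) \<in> GreenL (PB n) \<longleftrightarrow> \<omega> \<cdot> x = \<omega> \<cdot> y"
    "(retraction (PB n) (I_rank n q) x, retraction (PB n) (I_rank n q) y) \<in> GreenR (PB n) \<longleftrightarrow> x \<cdot> \<omega> = y \<cdot> \<omega>"
proof -
  have X: "x \<in> carr" "y \<in> carr" using assms by (auto simp: I_rank_iff)
  have r: "rank (x \<cdot> \<omega> \<cdot> x) = 0" "rank (y \<cdot> \<omega> \<cdot> y) = 0" using X rank0_mult by auto
  show "(retraction (PB n) (I_rank n q) x, retraction (PB n) (I_rank n q) y) \<in> GreenL (PB n) \<longleftrightarrow> \<omega> \<cdot> x = \<omega> \<cdot> y"
    using assms X r left_principal_zero[of "x \<cdot> \<omega> \<cdot> x" "y \<cdot> \<omega> \<cdot> y"] by (simp add: retraction_PB sandwich_halves)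
  show "(retraction (PB n) (I_rank n q) x, retraction (PB n) (I_rank n q) y) \<in> GreenR (PB n) \<longleftrightarrow> x \<cdot> \<omega> = y \<cdot> \<omega>"
    using assms X r right_principal_zero[of "x \<cdot> \<omega> \<cdot> x" "y \<cdot> \<omega> \<cdot> y"] by (simp add: retraction_PB sandwich_halves)
qed

lemma lambda_rho_mu_con:
  assumes N: "N \<lhd> sym_group q" and q: "q \<le> n" "q \<le> 2"
  shows "lambda_IN (PB n) (I_rank n (q - 1)) (bar n q ` N) = con q N True False"
    "rho_IN (PB n) (I_rank n (q - 1)) (bar n q ` N) = con q N False True"
    "mu_IN (PB n) (I_rank n (q - 1)) (bar n q ` N) = con q N True True"
proof -
  have q1: "q - 1 \<le> 1" using q by simp
  note defs = con_def nu_eq_nu_rel[OF N q(1)] kap_def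
  show "lambda_IN (PB n) (I_rank n (q - 1)) (bar n q ` N) = con q N True False"
    unfolding lambda_IN_def defs using retraction_Green[OF q1] by auto
  show "rho_IN (PB n) (I_rank n (q - 1)) (bar n q ` N) = con q N False True"
    unfolding rho_IN_def defs using retraction_Green[OF q1] by auto
  show "mu_IN (PB n) (I_rank n (q - 1)) (bar n q ` N) = con q N True True"
    unfolding mu_IN_def defs GreenH_def using retraction_Green[OF q1] by auto
qed

lemma nu_rel_trivial:
  assumes "q \<le> n" "(\<alpha>, \<beta>) \<in> nu_rel q {id}"
  shows "\<alpha> = \<beta>"
  using assms(2) by (auto elim!: nu_relE)

text \<open>The Rees congruence of rank \<open>q\<close> sits at level \<open>q + 1\<close> with the
  trivial group, whose part of \<open>nu_rel\<close> lies on the diagonal.\<close>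

lemma Rees_con:
  assumes "q < n"
  shows "Rees (PB n) (I_rank n q) = con (q + 1) {id} False False"
proof -
  have "nu_rel (q + 1) {id} \<subseteq> Delta (PB n)"
  proof (rule subrelI)
    fix \<alpha> \<beta> assume ab: "(\<alpha>, \<beta>) \<in> nu_rel (q + 1) {id}"
    have q: "q + 1 \<le> n" using assms by simp
    show "(\<alpha>, \<beta>) \<in> Delta (PB n)"
      using nu_rel_trivial[OF q ab] nu_rel_rank(1)[OF trivial_normal q ab] by (auto simp: Delta_def)
  qed
  then show ?thesis unfolding Rees_def con_def by (auto simp: kap_def)
qed

lemma Rees_Nabla: "Rees (PB n) (I_rank n n) = Nabla (PB n)"
  unfolding Rees_def Nabla_eq by (auto simp: Nabla_def Delta_def)

lemma congruence_Nabla: "congruence (PB n) (Nabla (PB n))"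
  unfolding congruence_def Nabla_def
  by (auto intro!: equivI simp: refl_on_def sym_def trans_def)

text \<open>The first of three kinds of test pairs. This one recovers the level,
  \<open>bar_con\<close> the group and \<open>hook_con\<close> the flags, so the parameters can be
  read off from the relation.\<close>

lemma e_zero_con:
  assumes "1 \<le> q" "q \<le> n" "p \<le> n" and N: "N \<lhd> sym_group q"
  shows "(e p, \<omega>) \<in> con q N P Q \<longleftrightarrow> p < q"
proof
  assume "(e p, \<omega>) \<in> con q N P Q"
  then show "p < q"
  proof (cases rule: con_cases)
    case 1
    have "p = 0" using arg_cong[OF 1(1), of rank] assms(3) by simp
    then show ?thesis using assms by simp
  next
    case 2
    then show ?thesis using nu_rel_rank(4)[OF N assms(2) 2] assms(1) by simp
  next
    case 3
    then have "rank (e p) \<le> q - 1" by (simp add: kap_def I_rank_iff)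
    then show ?thesis using assms by simp
  qed
next
  assume "p < q"
  then have "(e p, \<omega>) \<in> kap (q - 1) P Q" using assms by (auto simp: kap_def I_rank_iff)
  then show "(e p, \<omega>) \<in> con q N P Q" by (simp add: con_def)
qed

text \<open>If a pair in normal form starts with \<open>e q\<close>, both charts lie in the group
  and are inverse to each other. Then \<sigma> is a conjugate of an element of \<open>N\<close>,
  which normality puts back into \<open>N\<close>.\<close>

lemma bar_con:
  assumes q: "1 \<le> q" "q \<le> n" and N: "N \<lhd> sym_group q" and \<sigma>: "\<sigma> permutes {1..q}"
  shows "(e q, bar n q \<sigma>) \<in> con q N P Q \<longleftrightarrow> \<sigma> \<in> N"
proof
  assume "(e q, bar n q \<sigma>) \<in> con q N P Q"
  then show "\<sigma> \<in> N"
  proof (cases rule: con_cases)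
    case 1
    then have "\<sigma> = id" using bar_inj[OF \<sigma> permutes_id q(2)] by simp
    then show ?thesis using normal_sym_group(2)[OF N] by simp
  next
    case 2
    then obtain s t \<tau> where s: "s \<in> carr" "s \<cdot> e q = s" "rank s = q" and t: "t \<in> carr" "e q \<cdot> t = t" "rank t = q"
      and \<tau>: "\<tau> \<in> N" and eqs: "e q = s \<cdot> t" "bar n q \<sigma> = s \<cdot> bar n q \<tau> \<cdot> t"
      by (rule nu_relE) blast
    have "e q \<cdot> star t = s \<cdot> (t \<cdot> star t)" unfolding eqs(1) using s t by (simp add: mul_assoc)
    then have "e q \<cdot> star t = s" using star_cancel'[OF t q(2)] s(2) by simp
    then have "e q \<cdot> s = e q \<cdot> (e q \<cdot> star t)" by simp
    also have "\<dots> = (e q \<cdot> e q) \<cdot> star t"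
      by (rule mul_assoc[symmetric]) (use t(1) q in auto)
    also have "\<dots> = s" using q \<open>e q \<cdot> star t = s\<close> by (simp add: e_mult)
    finally obtain a where a: "a permutes {1..q}" "s = bar n q a"
      using group_elem[OF s(1) _ s(2,3) q(2)] by blast
    have "star s \<cdot> e q = (star s \<cdot> s) \<cdot> t" unfolding eqs(1) using s t by (simp add: mul_assoc)
    then have st: "star s \<cdot> e q = t" using star_cancel[OF s q(2)] t(2) by simp
    have "t = bar n q (inv' a)" using st star_bar[OF a(1) q(2)] a q permutes_inv[OF a(1)] by simp
    then have "bar n q \<sigma> = bar n q (inv' a \<circ> \<tau> \<circ> a)"
      using eqs(2) a q normal_sym_group(1)[OF N \<tau>] permutes_inv[OF a(1)]
      by (simp add: bar_mult permutes_compose comp_assoc)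
    then have "\<sigma> = inv' a \<circ> \<tau> \<circ> a"
      using bar_inj[OF \<sigma> _ q(2)] normal_sym_group(1)[OF N \<tau>] a(1) permutes_inv[OF a(1)] by (auto intro!: permutes_compose)
    moreover have "inv' a \<circ> \<tau> \<circ> inv' (inv' a) \<in> N"
      using normal_sym_group(5)[OF N \<tau> permutes_inv[OF a(1)]] .
    ultimately show ?thesis using permutes_inv_inv[OF a(1)] by simp
  next
    case 3
    then have "rank (e q) \<le> q - 1" by (simp add: kap_def I_rank_iff)
    then show ?thesis using q by simp
  qed
next
  assume "\<sigma> \<in> N"
  then have "(e q \<cdot> e q, e q \<cdot> bar n q \<sigma> \<cdot> e q) \<in> nu_rel q N"
    using q by (intro nu_relI) (auto simp: e_mult)
  then show "(e q, bar n q \<sigma>) \<in> con q N P Q" using \<sigma> q by (simp add: con_def e_mult)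
qed

lemma hook_con:
  assumes q: "1 \<le> q" "q \<le> n" and n: "2 \<le> n" and N: "N \<lhd> sym_group q"
  shows "(\<omega> \<cdot> hook, \<omega>) \<in> con q N P Q \<longleftrightarrow> \<not> P" "(hook \<cdot> \<omega>, \<omega>) \<in> con q N P Q \<longleftrightarrow> \<not> Q"
proof -
  have H: "hook \<in> carr" using n by simp
  have nu: "(x, \<omega>) \<notin> nu_rel q N" for x using nu_rel_rank(4)[OF N q(2)] q(1) by fastforce
  have *: "\<omega> \<cdot> (hook \<cdot> \<omega>) = \<omega>" "(\<omega> \<cdot> hook) \<cdot> \<omega> = \<omega>" using zero_sandwich[OF H] H by (simp_all add: mul_assoc)
  show "(\<omega> \<cdot> hook, \<omega>) \<in> con q N P Q \<longleftrightarrow> \<not> P"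
    using nu hook_zero_neq(2)[OF n] hook_zero_rank[OF n] H * zero_idem[OF H]
    by (auto simp: con_def Delta_def kap_def I_rank_iff)
  show "(hook \<cdot> \<omega>, \<omega>) \<in> con q N P Q \<longleftrightarrow> \<not> Q"
    using nu hook_zero_neq(1)[OF n] hook_zero_rank[OF n] H * zero_idem[OF H]
    by (auto simp: con_def Delta_def kap_def I_rank_iff)
qed

definition con_params :: "(nat \<times> (nat \<Rightarrow> nat) set \<times> bool \<times> bool) set" where
  "con_params = {(q, N, P, Q). 1 \<le> q \<and> q \<le> n \<and> N \<lhd> sym_group q \<and> (q \<le> 2 \<or> \<not> P \<and> \<not> Q)}"

text \<open>Test pairs give the necessary conditions. Conversely, at a strictly lower level the
  permutation part of the smaller congruence either is trivial or disappears in a fully collapsed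
  ideal. Flags are compared in reverse, since remembering more halves makes a congruence
  smaller.\<close>

lemma con_subset_iff:
  assumes n: "2 \<le> n" and v: "(q, N, P, Q) \<in> con_params" "(q', N', P', Q') \<in> con_params"
  shows "con q N P Q \<subseteq> con q' N' P' Q' \<longleftrightarrow>
    (P' \<longrightarrow> P) \<and> (Q' \<longrightarrow> Q) \<and> (q < q' \<or> q = q' \<and> N \<subseteq> N')"
proof
  have V: "1 \<le> q" "q \<le> n" "N \<lhd> sym_group q" "1 \<le> q'" "q' \<le> n" "N' \<lhd> sym_group q'"
    "q' \<le> 2 \<or> \<not> P' \<and> \<not> Q'" using v by (auto simp: con_params_def)
  show "(P' \<longrightarrow> P) \<and> (Q' \<longrightarrow> Q) \<and> (q < q' \<or> q = q' \<and> N \<subseteq> N')" if sub: "con q N P Q \<subseteq> con q' N' P' Q'"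
  proof (intro conjI)
    show "P' \<longrightarrow> P" "Q' \<longrightarrow> Q"
      using sub hook_con[OF V(1,2) n V(3)] hook_con[OF V(4,5) n V(6)] by blast+
    have "(e (q - 1), \<omega>) \<in> con q N P Q" using e_zero_con[OF V(1,2) _ V(3)] V by simp
    then have "q - 1 < q'" using sub e_zero_con[OF V(4,5) _ V(6)] V by auto
    moreover have "N \<subseteq> N'" if "q = q'"
    proof
      fix \<sigma> assume \<sigma>: "\<sigma> \<in> N"
      note p = normal_sym_group(1)[OF V(3) \<sigma>]
      have "(e q, bar n q \<sigma>) \<in> con q' N' P' Q'" using sub bar_con[OF V(1-3) p] \<sigma> by blast
      then show "\<sigma> \<in> N'" using bar_con[OF V(4-6)] p that by simp
    qed
    ultimately show "q < q' \<or> q = q' \<and> N \<subseteq> N'" by linarith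
  qed
  show "con q N P Q \<subseteq> con q' N' P' Q'" if a: "(P' \<longrightarrow> P) \<and> (Q' \<longrightarrow> Q) \<and> (q < q' \<or> q = q' \<and> N \<subseteq> N')"
  proof -
    have kap: "kap (q - 1) P Q \<subseteq> kap (q' - 1) P' Q'" using a by (auto simp: kap_def I_rank_iff)
    have "nu_rel q N \<subseteq> con q' N' P' Q'"
    proof (cases "q = q'")
      case True
      then have "nu_rel q N \<subseteq> nu_rel q' N'" using a unfolding nu_rel_def by blast
      then show ?thesis by (auto simp: con_def)
    next
      case False
      then have lt: "q < q'" using a by simp
      show ?thesis
      proof (rule subrelI)
        fix \<alpha> \<beta> assume ab: "(\<alpha>, \<beta>) \<in> nu_rel q N"
        note r = nu_rel_rank[OF V(3,2) ab]
        show "(\<alpha>, \<beta>) \<in> con q' N' P' Q'"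
        proof (cases "q = 1")
          case True
          then have "N = {id}" using normal_sym_group_le_1[OF V(3)] by simp
          then have "\<alpha> = \<beta>" using nu_rel_trivial[OF V(2)] ab by simp
          then show ?thesis using r by (auto simp: con_def Delta_def)
        next
          case False
          \<comment> \<open>Here 1 < q < q', so \<open>q'\<close> is at least 3 and no halves are
            remembered there.\<close>
          then have "\<not> P'" "\<not> Q'" using V(1,7) lt by auto
          then have "(\<alpha>, \<beta>) \<in> kap (q' - 1) P' Q'" using r lt by (auto simp: kap_def I_rank_iff)
          then show ?thesis by (simp add: con_def)
        qed
      qed
    qed
    then show ?thesis using kap by (auto simp: con_def)
  qed
qed

lemma con_inj:
  assumes "2 \<le> n" "(q, N, P, Q) \<in> con_params" "(q', N', P', Q') \<in> con_params" "con q N P Q = con q' N' P' Q'"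
  shows "(q, N, P, Q) = (q', N', P', Q')"
  using con_subset_iff[OF assms(1-3)] con_subset_iff[OF assms(1,3,2)] assms(4) by auto

lemma con_psubset_Nabla:
  assumes "(q, N, P, Q) \<in> con_params"
  shows "con q N P Q \<subset> Nabla (PB n)"
proof -
  have V: "1 \<le> q" "q \<le> n" "N \<lhd> sym_group q" "q \<le> 2 \<or> \<not> P \<and> \<not> Q" using assms by (auto simp: con_params_def)
  have "con q N P Q \<subseteq> Nabla (PB n)"
    using congruenceD(1)[OF congruence_con[OF V(3,1,2,4)]] by (auto simp: Nabla_def)
  moreover have "(e q, \<omega>) \<notin> con q N P Q" using e_zero_con[OF V(1,2,2,3)] by simp
  moreover have "(e q, \<omega>) \<in> Nabla (PB n)" using V by (simp add: Nabla_def)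
  ultimately show ?thesis by blast
qed

lemma Cong_PB:
  assumes "2 \<le> n"
  shows "Cong (PB n) = insert (Nabla (PB n)) ((\<lambda>(q, N, P, Q). con q N P Q) ` con_params)"
proof (intro equalityI subsetI)
  fix \<theta> assume "\<theta> \<in> Cong (PB n)"
  then show "\<theta> \<in> insert (Nabla (PB n)) ((\<lambda>(q, N, P, Q). con q N P Q) ` con_params)"
    using congruence_classification[OF assms, of \<theta>] unfolding Cong_def con_params_def by fastforce
next
  fix \<theta> assume "\<theta> \<in> insert (Nabla (PB n)) ((\<lambda>(q, N, P, Q). con q N P Q) ` con_params)"
  then show "\<theta> \<in> Cong (PB n)"
    using congruence_Nabla congruence_con by (auto simp: Cong_def con_params_def)
qed

definition star_closed_rel :: "pb_rel \<Rightarrow> bool" where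
  "star_closed_rel \<theta> \<longleftrightarrow> (\<forall>(\<alpha>, \<beta>)\<in>\<theta>. (star \<alpha>, star \<beta>) \<in> \<theta>)"

lemma star_closed_con:
  assumes n: "2 \<le> n" and v: "(q, N, P, Q) \<in> con_params"
  shows "star_closed_rel (con q N P Q) \<longleftrightarrow> P = Q"
proof
  have V: "1 \<le> q" "q \<le> n" "N \<lhd> sym_group q" using v by (auto simp: con_params_def)
  have H: "hook \<in> carr" using n by simp
  have s: "star (hook \<cdot> \<omega>) = \<omega> \<cdot> hook" "star (\<omega> \<cdot> hook) = hook \<cdot> \<omega>"
    using H n by (simp_all add: star_mult[where n = n])
  show "P = Q" if "star_closed_rel (con q N P Q)"
  proof -
    have "(hook \<cdot> \<omega>, \<omega>) \<in> con q N P Q \<Longrightarrow> (\<omega> \<cdot> hook, \<omega>) \<in> con q N P Q"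
      "(\<omega> \<cdot> hook, \<omega>) \<in> con q N P Q \<Longrightarrow> (hook \<cdot> \<omega>, \<omega>) \<in> con q N P Q"
      using that s star_zero unfolding star_closed_rel_def by fastforce+
    then show ?thesis using hook_con[OF V(1,2) n V(3)] by blast
  qed
  show "star_closed_rel (con q N P Q)" if "P = Q"
    using star_con[OF V(3,2)] that by (auto simp: star_closed_rel_def)
qed

lemma star_closed_Nabla: "star_closed_rel (Nabla (PB n))"
  by (auto simp: star_closed_rel_def Nabla_def)

lemma Cong_star_PB: "Cong_star n = {\<theta> \<in> Cong (PB n). star_closed_rel \<theta>}"
  by (simp add: Cong_star_def star_closed_rel_def)

end

section \<open>IN-pairs\<close>

context partial_brauer
begin

abbreviation bars :: "nat \<Rightarrow> vertex set set set" where
  "bars q \<equiv> bar n q ` carrier (sym_group q)"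

lemma bars_iff:
  assumes "q \<le> n"
  shows "g \<in> bars q \<longleftrightarrow> g \<in> carr \<and> e q \<cdot> g = g \<and> g \<cdot> e q = g \<and> rank g = q"
proof
  assume "g \<in> bars q"
  then obtain \<sigma> where "\<sigma> permutes {1..q}" "g = bar n q \<sigma>" by (auto simp: sym_group_carrier)
  then show "g \<in> carr \<and> e q \<cdot> g = g \<and> g \<cdot> e q = g \<and> rank g = q" using assms rank_bar by simp
next
  assume "g \<in> carr \<and> e q \<cdot> g = g \<and> g \<cdot> e q = g \<and> rank g = q"
  then obtain \<sigma> where "\<sigma> permutes {1..q}" "g = bar n q \<sigma>" using group_elem[of g q] assms by blast
  then show "g \<in> bars q" by (auto simp: sym_group_carrier)
qed

lemma group_at_simps [simp]:
  "carrier (group_at (PB n) G u) = G" "one (group_at (PB n) G u) = u" "mult (group_at (PB n) G u) = mult (PB n)"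
  by (simp_all add: group_at_def)

lemma bar_sym_group:
  assumes "q \<le> n"
  shows "group (bar_sym n q)"
  unfolding bar_sym_def
proof (rule groupI, goal_cases)
  case (1 x y)
  then obtain \<sigma> \<tau> where s: "\<sigma> permutes {1..q}" "\<tau> permutes {1..q}" "x = bar n q \<sigma>" "y = bar n q \<tau>"
    by (auto simp: sym_group_carrier)
  then have "x \<cdot> y = bar n q (\<tau> \<circ> \<sigma>)" using bar_mult assms by simp
  then show ?case using s by (simp add: sym_group_carrier permutes_compose)
next
  case 2
  then show ?case using permutes_id by (auto simp: sym_group_carrier)
next
  case (3 x y z)
  then have "x \<in> carr" "y \<in> carr" "z \<in> carr" unfolding group_at_simps bars_iff[OF assms] by blast+
  then show ?case by (simp add: mul_assoc)
next
  case (4 x)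
  then show ?case by (simp only: group_at_simps bars_iff[OF assms])
next
  case (5 x)
  then obtain \<sigma> where s: "\<sigma> permutes {1..q}" "x = bar n q \<sigma>" by (auto simp: sym_group_carrier)
  then have "bar n q (inv' \<sigma>) \<cdot> x = e q" using bar_inverse assms by simp
  moreover have "bar n q (inv' \<sigma>) \<in> bars q" using permutes_inv[OF s(1)] by (simp add: sym_group_carrier)
  ultimately show ?case by (intro bexI[of _ "bar n q (inv' \<sigma>)"]) simp_all
qed

lemma bar_sym_inv:
  assumes "q \<le> n" "\<sigma> permutes {1..q}"
  shows "inv\<^bsub>bar_sym n q\<^esub> (bar n q \<sigma>) = bar n q (inv' \<sigma>)"
proof (rule group.inv_equality[OF bar_sym_group[OF assms(1)]])
  show "bar n q (inv' \<sigma>) \<otimes>\<^bsub>bar_sym n q\<^esub> bar n q \<sigma> = \<one>\<^bsub>bar_sym n q\<^esub>"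
    unfolding bar_sym_def using bar_inverse(2)[OF assms(2,1)] by simp
qed (use assms permutes_inv[OF assms(2)] in \<open>auto simp: bar_sym_def sym_group_carrier intro!: imageI\<close>)

text \<open>Since \<open>bar\<close> is an anti-isomorphism, conjugation by
  \<open>bar n q \<tau>\<close> corresponds to conjugation by the inverse of \<tau>; normality is
  transferred all the same.\<close>

lemma normal_bar_image:
  assumes q: "q \<le> n" and N: "N \<lhd> sym_group q"
  shows "bar n q ` N \<lhd> bar_sym n q"
proof -
  note p = normal_sym_group(1)[OF N]
  have "subgroup (bar n q ` N) (bar_sym n q)"
  proof (rule group.subgroupI[OF bar_sym_group[OF q]])
    show "bar n q ` N \<subseteq> carrier (bar_sym n q)" using p by (auto simp: bar_sym_def sym_group_carrier)
    show "bar n q ` N \<noteq> {}" using normal_sym_group(2)[OF N] by blast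
    fix x assume "x \<in> bar n q ` N"
    then obtain \<sigma> where s: "\<sigma> \<in> N" "x = bar n q \<sigma>" by blast
    then show "inv\<^bsub>bar_sym n q\<^esub> x \<in> bar n q ` N"
      using bar_sym_inv[OF q p] normal_sym_group(4)[OF N] by simp
    fix y assume "y \<in> bar n q ` N"
    then obtain \<tau> where t: "\<tau> \<in> N" "y = bar n q \<tau>" by blast
    have "x \<cdot> y = bar n q (\<tau> \<circ> \<sigma>)" using bar_mult p s t q by simp
    then show "x \<otimes>\<^bsub>bar_sym n q\<^esub> y \<in> bar n q ` N"
      using normal_sym_group(3)[OF N t(1) s(1)] by (simp add: bar_sym_def)
  qed
  moreover have "g \<otimes>\<^bsub>bar_sym n q\<^esub> x \<otimes>\<^bsub>bar_sym n q\<^esub> inv\<^bsub>bar_sym n q\<^esub> g \<in> bar n q ` N"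
    if g: "g \<in> carrier (bar_sym n q)" and x: "x \<in> bar n q ` N" for g x
  proof -
    obtain \<tau> where t: "\<tau> permutes {1..q}" "g = bar n q \<tau>" using g by (auto simp: bar_sym_def sym_group_carrier)
    obtain \<sigma> where s: "\<sigma> \<in> N" "x = bar n q \<sigma>" using x by blast
    have i: "inv' \<tau> permutes {1..q}" using permutes_inv[OF t(1)] .
    have "g \<cdot> x \<cdot> bar n q (inv' \<tau>) = bar n q (inv' \<tau> \<circ> (\<sigma> \<circ> \<tau>))"
      using t i p[OF s(1)] s(2) q by (simp add: bar_mult permutes_compose)
    moreover have "inv' \<tau> \<circ> \<sigma> \<circ> inv' (inv' \<tau>) \<in> N" using normal_sym_group(5)[OF N s(1) i] .
    ultimately have "g \<cdot> x \<cdot> bar n q (inv' \<tau>) \<in> bar n q ` N"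
      using permutes_inv_inv[OF t(1)] by (simp only: comp_assoc) blast
    then show ?thesis unfolding t(2) bar_sym_inv[OF q t(1)] by (simp add: bar_sym_def t(2))
  qed
  ultimately show ?thesis by (simp add: group.normal_inv_iff[OF bar_sym_group[OF q]])
qed

lemma normal_bar_preimage:
  assumes q: "q \<le> n" and M: "M \<lhd> bar_sym n q"
  obtains N where "N \<lhd> sym_group q" "M = bar n q ` N"
proof
  define N where "N = {\<sigma>. \<sigma> permutes {1..q} \<and> bar n q \<sigma> \<in> M}"
  have sg: "subgroup M (bar_sym n q)" and nm: "\<And>g x. g \<in> carrier (bar_sym n q) \<Longrightarrow> x \<in> M \<Longrightarrow>
      g \<otimes>\<^bsub>bar_sym n q\<^esub> x \<otimes>\<^bsub>bar_sym n q\<^esub> inv\<^bsub>bar_sym n q\<^esub> g \<in> M"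
    using M by (auto simp: group.normal_inv_iff[OF bar_sym_group[OF q]])
  have mult: "mult (bar_sym n q) = mult (PB n)" by (simp add: bar_sym_def)
  have "M \<subseteq> bars q" using subgroup.subset[OF sg] by (simp add: bar_sym_def)
  then show "M = bar n q ` N" unfolding N_def by (fastforce simp: sym_group_carrier)
  show "N \<lhd> sym_group q"
  proof (rule normal_sym_groupI)
    show "\<sigma> permutes {1..q}" if "\<sigma> \<in> N" for \<sigma> using that by (simp add: N_def)
    show "id \<in> N" using subgroup.one_closed[OF sg] permutes_id by (simp add: N_def bar_sym_def)
    show "inv' \<sigma> \<in> N" if "\<sigma> \<in> N" for \<sigma>
      using subgroup.m_inv_closed[OF sg, of "bar n q \<sigma>"] bar_sym_inv[OF q] that permutes_inv[of \<sigma> "{1..q}"]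
      by (simp add: N_def)
    show "\<sigma> \<circ> \<tau> \<in> N" if "\<sigma> \<in> N" "\<tau> \<in> N" for \<sigma> \<tau>
    proof -
      have p: "\<sigma> permutes {1..q}" "\<tau> permutes {1..q}" using that by (auto simp: N_def)
      have "bar n q \<tau> \<cdot> bar n q \<sigma> \<in> M"
        using subgroup.m_closed[OF sg, of "bar n q \<tau>" "bar n q \<sigma>"] that by (simp add: N_def mult)
      then show ?thesis using bar_mult[OF p(2,1) q] permutes_compose[OF p(2,1)] by (simp add: N_def)
    qed
    show "\<tau> \<circ> \<sigma> \<circ> inv' \<tau> \<in> N" if "\<sigma> \<in> N" "\<tau> permutes {1..q}" for \<sigma> \<tau>
    proof -
      have p: "\<sigma> permutes {1..q}" and i: "inv' \<tau> permutes {1..q}" using that permutes_inv by (auto simp: N_def)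
      have "bar n q (inv' \<tau>) \<in> carrier (bar_sym n q)" using i by (simp add: bar_sym_def sym_group_carrier)
      from nm[OF this] have "bar n q (inv' \<tau>) \<cdot> bar n q \<sigma> \<cdot> bar n q \<tau> \<in> M"
        using that bar_sym_inv[OF q i] permutes_inv_inv[OF that(2)] by (simp add: mult N_def)
      moreover have "bar n q (inv' \<tau>) \<cdot> bar n q \<sigma> \<cdot> bar n q \<tau> = bar n q (\<tau> \<circ> (\<sigma> \<circ> inv' \<tau>))"
        using p i that(2) q by (simp add: bar_mult permutes_compose)
      moreover have "\<tau> \<circ> \<sigma> \<circ> inv' \<tau> permutes {1..q}" using p i that(2) by (intro permutes_compose)
      ultimately show ?thesis by (simp add: N_def comp_assoc)
    qed
  qed
qed

text \<open>A group has one idempotent, so \<open>e q\<close> must be the identity of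
  \<open>H\<close>. Invertibility then forces rank \<open>q\<close>, and \<open>bars_iff\<close>
  identifies the elements as permutations.\<close>

lemma subgroup_bars:
  assumes q: "q \<le> n" and H: "group (group_at (PB n) H u)" "H \<subseteq> carr" "e q \<in> H"
  shows "u = e q" "H \<subseteq> bars q"
proof -
  interpret group "group_at (PB n) H u" by (rule H(1))
  have "e q \<cdot> e q = e q" using q by (simp add: e_mult)
  then show u: "u = e q"
    using l_cancel_one[of "e q" "e q"] H(3) by simp
  show "H \<subseteq> bars q"
  proof
    fix g assume g: "g \<in> H"
    then have gc: "g \<in> carr" using H(2) by blast
    have eg: "e q \<cdot> g = g" "g \<cdot> e q = g" using l_one[of g] r_one[of g] g u by simp_all
    obtain h where h: "h \<in> H" "h \<cdot> g = e q" using l_inv_ex[of g] g u by auto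
    have "q \<le> rank g" using rank_mult_le2[of h g] h gc H(2) q by auto
    moreover have "rank g \<le> q" using rank_mult_le1[of "e q" g] eg gc q by simp
    ultimately show "g \<in> bars q" unfolding bars_iff[OF q] using gc eg by simp
  qed
qed

lemma maximal_subgroup_bars:
  assumes "q \<le> n"
  shows "maximal_subgroup (PB n) (bars q)"
  unfolding maximal_subgroup_def
proof (intro conjI allI impI)
  have sub: "bars q \<subseteq> carr" using bars_iff[OF assms] by blast
  show "subgroup_of_sgp (PB n) (bars q)"
    unfolding subgroup_of_sgp_def using sub bar_sym_group[OF assms] by (auto simp: bar_sym_def)
  fix H assume H: "subgroup_of_sgp (PB n) H \<and> bars q \<subseteq> H"
  then obtain u where Hg: "group (group_at (PB n) H u)" and Hc: "H \<subseteq> carr" by (auto simp: subgroup_of_sgp_def)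
  have "e q \<in> bars q" using bars_iff[OF assms] assms by (simp add: e_mult)
  then have "e q \<in> H" using H by (rule subsetD[OF conjunct2, rotated])
  then show "H = bars q"
    by (rule subset_antisym[OF subgroup_bars(2)[OF assms Hg Hc] conjunct2[OF H]])
qed

definition rank_class :: "nat \<Rightarrow> vertex set set set" where
  "rank_class q = {\<alpha> \<in> carr. rank \<alpha> = q}"

lemma J_classes_PB: "J_classes (PB n) = rank_class ` {..n}"
proof (intro equalityI subsetI)
  fix J assume "J \<in> J_classes (PB n)"
  then obtain x where "x \<in> carr" "J = GreenJ (PB n) `` {x}" by (auto simp: J_classes_def quotient_def)
  then have "J = rank_class (rank x)" "rank x \<le> n" using rank_le by (auto simp: GreenJ_PB rank_class_def)
  then show "J \<in> rank_class ` {..n}" by blast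
next
  fix J assume "J \<in> rank_class ` {..n}"
  then obtain q where q: "q \<le> n" "J = rank_class q" by blast
  then have "J = GreenJ (PB n) `` {e q}" by (auto simp: GreenJ_PB rank_class_def)
  then show "J \<in> J_classes (PB n)" unfolding J_classes_def using q by (auto intro: quotientI)
qed

lemma e_rank_class: "q \<le> n \<Longrightarrow> e q \<in> rank_class q"
  by (simp add: rank_class_def)

lemma rank_class_inj: "\<lbrakk>rank_class p = rank_class q; p \<le> n\<rbrakk> \<Longrightarrow> p = q"
  using e_rank_class[of p] by (simp add: rank_class_def[of q])

lemma J_le_PB:
  assumes "p \<le> n" "q \<le> n"
  shows "J_le (PB n) (rank_class p) (rank_class q) \<longleftrightarrow> p \<le> q"
proof
  assume "J_le (PB n) (rank_class p) (rank_class q)"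
  then obtain a b where "a \<in> rank_class p" "b \<in> rank_class q" "a \<in> principal (PB n) b" by (auto simp: J_le_def)
  then show "p \<le> q" using principal_PB[of b] by (simp add: rank_class_def I_rank_iff)
next
  assume "p \<le> q"
  then have "e p \<in> principal (PB n) (e q)" using principal_PB[of "e q"] assms by (simp add: I_rank_iff)
  then show "J_le (PB n) (rank_class p) (rank_class q)"
    unfolding J_le_def using e_rank_class[OF assms(1)] e_rank_class[OF assms(2)] by (intro bexI)
qed

lemma regular_PB: "regular_class (PB n) (rank_class q)"
  unfolding regular_class_def
proof
  fix x assume "x \<in> rank_class q"
  then have x: "x \<in> carr" "rank x = q" by (auto simp: rank_class_def)
  then have q: "q \<le> n" using rank_le by blast
  obtain s t where st: "s \<in> carr" "t \<in> carr" "s \<cdot> e q = s" "e q \<cdot> t = t" "rank s = q" "rank t = q" "x = s \<cdot> t"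
    using factor[OF x] by metis
  have "x \<cdot> (star t \<cdot> star s) \<cdot> x = s \<cdot> (t \<cdot> star t) \<cdot> (star s \<cdot> s) \<cdot> t"
    unfolding st(7) using st(1,2) by (simp add: mul_assoc)
  also have "\<dots> = x" using st q by (simp add: star_cancel star_cancel')
  finally show "\<exists>y\<in>carr. x \<cdot> y \<cdot> x = x" using st by (intro bexI[of _ "star t \<cdot> star s"]) auto
qed

lemma minimal_J_outside_PB:
  assumes "r \<le> n" "q \<le> n"
  shows "minimal_J_outside (PB n) (I_rank n r) (rank_class q) \<longleftrightarrow> q = r + 1"
proof -
  have out: "rank_class p \<subseteq> carr - I_rank n r \<longleftrightarrow> r < p" if "p \<le> n" for p
    using e_rank_class[OF that] by (auto simp: rank_class_def I_rank_iff)
  show ?thesis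
  proof
    assume m: "minimal_J_outside (PB n) (I_rank n r) (rank_class q)"
    then have rq: "r < q" using out[OF assms(2)] by (simp add: minimal_J_outside_def)
    then have r1: "r + 1 \<le> n" using assms by simp
    then have "rank_class (r + 1) = rank_class q"
      using m out[OF r1] J_le_PB[OF r1 assms(2)] rq by (auto simp: minimal_J_outside_def J_classes_PB)
    then show "q = r + 1" using rank_class_inj r1 by metis
  next
    assume q: "q = r + 1"
    show "minimal_J_outside (PB n) (I_rank n r) (rank_class q)"
      unfolding minimal_J_outside_def
    proof (intro conjI ballI impI)
      show "rank_class q \<in> J_classes (PB n)" using assms by (simp add: J_classes_PB)
      show "rank_class q \<subseteq> carr - I_rank n r" using out[OF assms(2)] q by simp
      fix J assume J: "J \<in> J_classes (PB n)" "J \<subseteq> carr - I_rank n r \<and> J_le (PB n) J (rank_class q)"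
      then obtain p where p: "p \<le> n" "J = rank_class p" by (auto simp: J_classes_PB)
      then have "r < p" "p \<le> q" using J(2) out[OF p(1)] J_le_PB[OF p(1) assms(2)] by auto
      then have "p = q" using q by simp
      then show "J = rank_class q" using p by simp
    qed
  qed
qed

text \<open>As a subgroup of \<open>bars q\<close>, \<open>M\<close> contains \<open>e q\<close>.
  This determines the maximal subgroup around it and places its \<J>-class in rank \<open>q\<close>;
  minimality outside the ideal then says that the ideal is \<open>I_rank n (q - 1)\<close>. Level 0
  does not occur because ideals are non-empty.\<close>

lemma IN_pair_iff:
  "IN_pair (PB n) I M \<and> (\<exists>q\<le>n. subgroup M (bar_sym n q)) \<longleftrightarrow>
    (\<exists>q N. 1 \<le> q \<and> q \<le> n \<and> N \<lhd> sym_group q \<and> I = I_rank n (q - 1) \<and> M = bar n q ` N)"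
proof
  assume a: "IN_pair (PB n) I M \<and> (\<exists>q\<le>n. subgroup M (bar_sym n q))"
  then obtain q where q: "q \<le> n" and sM: "subgroup M (bar_sym n q)" by blast
  obtain J G u where I: "sgp_ideal (PB n) I" and J: "minimal_J_outside (PB n) I J"
    and G: "maximal_subgroup (PB n) G" "G \<subseteq> J" and M: "M \<lhd> group_at (PB n) G u"
    using a unfolding IN_pair_def by blast
  have eM: "e q \<in> M" using subgroup.one_closed[OF sM] by (simp add: bar_sym_def)
  have gG: "group (group_at (PB n) G u)" using M by (simp add: normal_def)
  have MG: "M \<subseteq> G" using subgroup.subset[OF normal_imp_subgroup[OF M]] by simp
  have Gc: "G \<subseteq> carr" using G(1) by (simp add: maximal_subgroup_def subgroup_of_sgp_def)
  have u: "u = e q" and "G \<subseteq> bars q" using subgroup_bars[OF q gG Gc] eM MG by blast+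
  moreover have "subgroup_of_sgp (PB n) (bars q)" using maximal_subgroup_bars[OF q] by (simp add: maximal_subgroup_def)
  ultimately have "G = bars q" using G(1) unfolding maximal_subgroup_def by blast
  then have "M \<lhd> bar_sym n q" using M u by (simp add: bar_sym_def)
  then obtain N where N: "N \<lhd> sym_group q" "M = bar n q ` N" using normal_bar_preimage[OF q] by blast
  obtain r where r: "r \<le> n" "I = I_rank n r" using I sgp_ideals by blast
  obtain p where p: "p \<le> n" "J = rank_class p" using J by (auto simp: minimal_J_outside_def J_classes_PB)
  have "e q \<in> J" using eM MG G(2) by blast
  then have "p = q" using p q by (simp add: rank_class_def)
  then have "q = r + 1" using J minimal_J_outside_PB[OF r(1) q] p r by simp
  then show "\<exists>q N. 1 \<le> q \<and> q \<le> n \<and> N \<lhd> sym_group q \<and> I = I_rank n (q - 1) \<and> M = bar n q ` N"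
    using q N r by (intro exI[of _ q] exI[of _ N]) simp
next
  assume "\<exists>q N. 1 \<le> q \<and> q \<le> n \<and> N \<lhd> sym_group q \<and> I = I_rank n (q - 1) \<and> M = bar n q ` N"
  then obtain q N where q: "1 \<le> q" "q \<le> n" and N: "N \<lhd> sym_group q" and I: "I = I_rank n (q - 1)" and M: "M = bar n q ` N"
    by blast
  have nM: "M \<lhd> bar_sym n q" unfolding M by (rule normal_bar_image[OF q(2) N])
  have "minimal_J_outside (PB n) I (rank_class q)"
    unfolding I using minimal_J_outside_PB[of "q - 1" q] q by simp
  moreover have "bars q \<subseteq> rank_class q" using bars_iff[OF q(2)] by (auto simp: rank_class_def)
  moreover have "sgp_ideal (PB n) I" unfolding I using q by (intro sgp_ideal_I_rank) simp
  moreover have "M \<lhd> group_at (PB n) (bars q) (e q)" using nM by (simp add: bar_sym_def)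
  ultimately have "IN_pair (PB n) I M"
    unfolding IN_pair_def using regular_PB[of q] maximal_subgroup_bars[OF q(2)] by blast
  then show "IN_pair (PB n) I M \<and> (\<exists>q\<le>n. subgroup M (bar_sym n q))"
    using normal_imp_subgroup[OF nM] q(2) by blast
qed

lemma proper_iff:
  assumes "q \<le> n" "N \<lhd> sym_group q"
  shows "2 \<le> card (bar n q ` N) \<longleftrightarrow> N \<noteq> {id}"
proof -
  note p = normal_sym_group(1)[OF assms(2)]
  have "inj_on (bar n q) N" using bar_inj[OF p p assms(1)] by (intro inj_onI)
  then have c: "card (bar n q ` N) = card N" by (rule card_image)
  have "N \<subseteq> {\<sigma>. \<sigma> permutes {1..q}}" using p by blast
  then have fin: "finite N" using finite_permutations[of "{1..q}"] finite_subset by blast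
  have id: "id \<in> N" by (rule normal_sym_group(2)[OF assms(2)])
  then have "card N \<noteq> 0" using fin by auto
  moreover have "card N = 1 \<longleftrightarrow> N = {id}" using id by (auto simp: card_1_singleton_iff)
  ultimately show ?thesis unfolding c by linarith
qed

lemma nontrivial_normal_degree:
  assumes "N \<lhd> sym_group q" "N \<noteq> {id}"
  shows "2 \<le> q"
  using normal_sym_group_le_1[OF assms(1)] assms(2) by linarith

lemma proper_IN_pairs:
  "{(I, M). proper_IN_pair (PB n) I M \<and> (\<exists>q\<le>n. subgroup M (bar_sym n q))} =
    {(I_rank n (q - 1), bar n q ` N) | q N. 2 \<le> q \<and> q \<le> n \<and> N \<lhd> sym_group q \<and> N \<noteq> {id}}"
    (is "?L = ?R")
proof (intro equalityI subrelI)
  fix I M assume "(I, M) \<in> ?L"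
  then have a: "IN_pair (PB n) I M \<and> (\<exists>q\<le>n. subgroup M (bar_sym n q))" "2 \<le> card M"
    by (auto simp: proper_IN_pair_def)
  obtain q N where qN: "1 \<le> q" "q \<le> n" "N \<lhd> sym_group q" "I = I_rank n (q - 1)" "M = bar n q ` N"
    using a(1) unfolding IN_pair_iff by blast
  have "N \<noteq> {id}" using proper_iff[OF qN(2,3)] a(2) qN(5) by simp
  then show "(I, M) \<in> ?R" using qN nontrivial_normal_degree[OF qN(3)] by blast
next
  fix I M assume "(I, M) \<in> ?R"
  then obtain q N where qN: "2 \<le> q" "q \<le> n" "N \<lhd> sym_group q" "N \<noteq> {id}" "I = I_rank n (q - 1)" "M = bar n q ` N"
    by blast
  have "IN_pair (PB n) I M \<and> (\<exists>q\<le>n. subgroup M (bar_sym n q))"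
    unfolding IN_pair_iff using qN by (intro exI[of _ q] exI[of _ N]) simp
  moreover have "2 \<le> card M" using proper_iff[OF qN(2,3)] qN by simp
  ultimately show "(I, M) \<in> ?L" by (simp add: proper_IN_pair_def)
qed

lemma coset_card:
  assumes q: "q \<le> 2" "q \<le> n" and N: "N \<lhd> sym_group q" and x: "x \<in> min_ideal (PB n)"
  shows "card (x <#\<^bsub>PB n\<^esub> (bar n q ` N)) = 1 \<and> card ((bar n q ` N) #>\<^bsub>PB n\<^esub> x) = 1"
proof -
  have x: "x \<in> carr" "rank x = 0" using x by (auto simp: min_ideal_PB I_rank_iff)
  have ne: "N \<noteq> {}" using normal_sym_group(2)[OF N] by auto
  note p = normal_sym_group(1)[OF N]
  have "x <#\<^bsub>PB n\<^esub> (bar n q ` N) = (\<Union>\<sigma>\<in>N. {x \<cdot> bar n q \<sigma>})" by (simp add: l_coset_def)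
  also have "\<dots> = (\<Union>\<sigma>\<in>N. {x \<cdot> e q})" using rank0_mult_bar[OF x q p] by (intro SUP_cong) simp_all
  finally have "x <#\<^bsub>PB n\<^esub> (bar n q ` N) = {x \<cdot> e q}" using ne by simp
  moreover have "(bar n q ` N) #>\<^bsub>PB n\<^esub> x = (\<Union>\<sigma>\<in>N. {bar n q \<sigma> \<cdot> x})" by (simp add: r_coset_def)
  moreover have "\<dots> = (\<Union>\<sigma>\<in>N. {e q \<cdot> x})" using bar_mult_rank0[OF x q p] by (intro SUP_cong) simp_all
  moreover have "\<dots> = {e q \<cdot> x}" using ne by simp
  ultimately show ?thesis by simp
qed

text \<open>Retractability of the ideal bounds \<open>q - 1\<close> by 1. For
  \<open>q \<le> 2\<close> the coset condition holds since permutations of degree at most 2 act on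
  rank-zero elements like \<open>e q\<close>.\<close>

lemma retractable_IN_pairs:
  "retractable_IN_pair (PB n) I M \<and> (\<exists>q\<le>n. subgroup M (bar_sym n q)) \<longleftrightarrow>
    (\<exists>q N. 1 \<le> q \<and> q \<le> n \<and> q \<le> 2 \<and> N \<lhd> sym_group q \<and> I = I_rank n (q - 1) \<and> M = bar n q ` N)"
    (is "?L \<longleftrightarrow> ?R")
proof
  assume a: ?L
  then have "IN_pair (PB n) I M \<and> (\<exists>q\<le>n. subgroup M (bar_sym n q))" by (auto simp: retractable_IN_pair_def)
  then obtain q N where qN: "1 \<le> q" "q \<le> n" "N \<lhd> sym_group q" "I = I_rank n (q - 1)" "M = bar n q ` N"
    unfolding IN_pair_iff by blast
  then have "q - 1 \<le> 1" using a retractable_iff[of "q - 1"] by (simp add: retractable_IN_pair_def)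
  then have "q \<le> 2" by simp
  then show ?R using qN by blast
next
  assume ?R
  then obtain q N where qN: "1 \<le> q" "q \<le> n" "q \<le> 2" "N \<lhd> sym_group q" "I = I_rank n (q - 1)" "M = bar n q ` N"
    by blast
  have "IN_pair (PB n) I M \<and> (\<exists>q\<le>n. subgroup M (bar_sym n q))"
    unfolding IN_pair_iff using qN(1,2,4-6) by blast
  moreover have "retractable_ideal (PB n) I" unfolding qN(5) using qN by (subst retractable_iff) auto
  ultimately show ?L unfolding retractable_IN_pair_def using coset_card[OF qN(3,2,4)] qN(6) by blast
qed

end

section \<open>The lattice of congruences\<close>

text \<open>With \<open>grp\<close>, the level and the normal subgroup belonging to each index of
  the chain. The level exceeds the rank of the ideal by one.\<close>

fun deg :: "idx \<Rightarrow> nat" where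
  "deg Zero = 1" | "deg One = 2" | "deg STwo = 2"

fun grp :: "idx \<Rightarrow> (nat \<Rightarrow> nat) set" where
  "grp Zero = {id}" | "grp One = {id}" | "grp STwo = carrier (sym_group 2)"

text \<open>With \<open>upper_flag\<close>, the parameters \<open>P\<close> and \<open>Q\<close> of
  a member of the diamond. A flag records a half that is remembered, so going up in the diamond
  switches flags off.\<close>

definition lower_flag :: "diamond \<Rightarrow> bool" where
  "lower_flag d \<longleftrightarrow> d = DMu \<or> d = DLam"

definition upper_flag :: "diamond \<Rightarrow> bool" where
  "upper_flag d \<longleftrightarrow> d = DMu \<or> d = DRho"

lemma sym_group_2_nontrivial: "carrier (sym_group 2) \<noteq> {id}"
proof
  assume "carrier (sym_group 2) = {id}"
  then have "transpose 1 2 = (id :: nat \<Rightarrow> nat)" unfolding sym_group_2 by (metis insertI1 insert_commute singletonD)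
  then show False by (simp add: transpose_eq_id_iff)
qed

lemma grp_normal: "grp i \<lhd> sym_group (deg i)"
  by (cases i) (simp_all only: grp.simps deg.simps trivial_normal sym_normal)

lemma deg_bounds: "1 \<le> deg i" "deg i \<le> 2"
  by (cases i; simp)+

lemma idx_le_iff: "idx_le i j \<longleftrightarrow> deg i < deg j \<or> deg i = deg j \<and> grp i \<subseteq> grp j"
proof -
  have sub: "\<not> carrier (sym_group 2) \<subseteq> {id}" "id \<in> carrier (sym_group 2)"
    using sym_group_2_nontrivial unfolding sym_group_2 by blast+
  show ?thesis by (cases i; cases j) (simp_all add: idx_le_def sub)
qed

lemma diamond_le_iff:
  "diamond_le d d' \<longleftrightarrow> (lower_flag d' \<longrightarrow> lower_flag d) \<and> (upper_flag d' \<longrightarrow> upper_flag d)"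
  by (cases d; cases d') (simp_all add: diamond_le_def lower_flag_def upper_flag_def)

lemma flags_surj: "\<exists>d. lower_flag d = P \<and> upper_flag d = Q"
proof (cases P; cases Q)
  assume "P" "Q"
  then show ?thesis by (intro exI[of _ DMu]) (simp add: lower_flag_def upper_flag_def)
next
  assume "P" "\<not> Q"
  then show ?thesis by (intro exI[of _ DLam]) (simp add: lower_flag_def upper_flag_def)
next
  assume "\<not> P" "Q"
  then show ?thesis by (intro exI[of _ DRho]) (simp add: lower_flag_def upper_flag_def)
next
  assume "\<not> P" "\<not> Q"
  then show ?thesis by (intro exI[of _ DR]) (simp add: lower_flag_def upper_flag_def)
qed

lemma range_idx: "range f = {f Zero, f One, f STwo}"
proof (intro equalityI subsetI)
  fix x assume "x \<in> range f"
  then obtain i where "x = f i" by blast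
  then show "x \<in> {f Zero, f One, f STwo}" by (cases i) simp_all
qed auto

locale partial_brauer_ge_2 = partial_brauer +
  assumes n: "2 \<le> n"
begin

lemma C_pair_eq: "C_pair n i = (I_rank n (deg i - 1), bar n (deg i) ` grp i)"
  by (cases i) simp_all

lemma grp_params: "(deg i, grp i, P, Q) \<in> con_params"
  using deg_bounds[of i] grp_normal[of i] n by (simp add: con_params_def)

lemma low_params:
  assumes "(q, N, P, Q) \<in> con_params" "q \<le> 2"
  obtains i where "q = deg i" "N = grp i"
proof -
  have N: "N \<lhd> sym_group q" "1 \<le> q" using assms by (auto simp: con_params_def)
  consider "q = 1" | "q = 2" using N assms(2) by linarith
  then show ?thesis
  proof cases
    case 1
    then show ?thesis using that[of Zero] normal_sym_group_le_1[OF N(1)] by simp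
  next
    case 2
    then have "N = {id} \<or> N = carrier (sym_group 2)" using normal_sym_group_2 N by blast
    then show ?thesis using that[of One] that[of STwo] 2 by auto
  qed
qed

lemma lam_con: "lam n i = con (deg i) (grp i) True False"
  and rho_con: "rho n i = con (deg i) (grp i) False True"
  and mu_con: "mu n i = con (deg i) (grp i) True True"
  using lambda_rho_mu_con[OF grp_normal, of i] deg_bounds[of i] n
  by (simp_all add: lam_def rho_def mu_def C_pair_eq)

lemma RN_con: "N \<lhd> sym_group q \<Longrightarrow> q \<le> n \<Longrightarrow> RN n q N = con q N False False"
  unfolding RN_def by (rule R_IN_con)

lemma Rq_con: "q < n \<Longrightarrow> Rq n q = con (q + 1) {id} False False"
  unfolding Rq_def by (rule Rees_con)

lemma Rq_Nabla: "Rq n n = Nabla (PB n)"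
  unfolding Rq_def by (rule Rees_Nabla)

lemma xi_con: "xi n d i = con (deg i) (grp i) (lower_flag d) (upper_flag d)"
proof (cases d)
  case DR
  then show ?thesis using n RN_con[OF sym_normal, of 2] Rq_con[of 0] Rq_con[of 1]
    by (cases i) (simp_all add: lower_flag_def upper_flag_def numeral_2_eq_2)
qed (simp_all add: lam_con rho_con mu_con lower_flag_def upper_flag_def)

lemma xi_subset_iff: "xi n d i \<subseteq> xi n d' j \<longleftrightarrow> diamond_le d d' \<and> idx_le i j"
  unfolding xi_con con_subset_iff[OF n grp_params grp_params] diamond_le_iff idx_le_iff by blast

lemma xi_set: "{xi n d i | d i. True} = {con q N P Q | q N P Q. (q, N, P, Q) \<in> con_params \<and> q \<le> 2}"
proof (intro equalityI subsetI)
  fix \<theta> assume "\<theta> \<in> {xi n d i | d i. True}"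
  then obtain d i where "\<theta> = xi n d i" by blast
  then show "\<theta> \<in> {con q N P Q | q N P Q. (q, N, P, Q) \<in> con_params \<and> q \<le> 2}"
    unfolding xi_con using grp_params[of i] deg_bounds(2)[of i] by blast
next
  fix \<theta> assume "\<theta> \<in> {con q N P Q | q N P Q. (q, N, P, Q) \<in> con_params \<and> q \<le> 2}"
  then obtain q N P Q where t: "\<theta> = con q N P Q" "(q, N, P, Q) \<in> con_params" "q \<le> 2" by blast
  obtain i where i: "q = deg i" "N = grp i" using low_params[OF t(2,3)] .
  obtain d where "lower_flag d = P" "upper_flag d = Q" using flags_surj by blast
  then have "\<theta> = xi n d i" using t i xi_con by simp
  then show "\<theta> \<in> {xi n d i | d i. True}" by blast
qed

text \<open>The value \<^const>\<open>None\<close> stands for \<open>\<nabla>\<close>.\<close>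
fun code :: "cong_label \<Rightarrow> (nat \<times> (nat \<Rightarrow> nat) set \<times> bool \<times> bool) option" where
  "code (LRq q) = (if q = n then None else Some (q + 1, {id}, False, False))"
| "code (LRN q N) = Some (q, N, False, False)"
| "code (LLam i) = Some (deg i, grp i, True, False)"
| "code (LRho i) = Some (deg i, grp i, False, True)"
| "code (LMu i) = Some (deg i, grp i, True, True)"

fun decode :: "(nat \<times> (nat \<Rightarrow> nat) set \<times> bool \<times> bool) option \<Rightarrow> pb_rel" where
  "decode None = Nabla (PB n)"
| "decode (Some (q, N, P, Q)) = con q N P Q"

lemma cong_labels_cases:
  assumes "l \<in> cong_labels n"
  obtains q where "l = LRq q" "q \<le> n"
  | q N where "l = LRN q N" "2 \<le> q" "q \<le> n" "N \<lhd> sym_group q" "N \<noteq> {id}"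
  | i where "l = LLam i" | i where "l = LRho i" | i where "l = LMu i"
  using assms unfolding cong_labels_def by blast

lemma cong_of_decode:
  assumes "l \<in> cong_labels n"
  shows "cong_of n l = decode (code l)"
  using assms
proof (cases rule: cong_labels_cases)
  case (1 q)
  then show ?thesis using Rq_con Rq_Nabla by (cases "q = n") simp_all
next
  case (2 q N)
  then show ?thesis using RN_con by simp
qed (simp_all add: lam_con rho_con mu_con)

lemma deg_grp_inj: "deg i = deg j \<Longrightarrow> grp i = grp j \<Longrightarrow> i = j"
  using sym_group_2_nontrivial by (cases i; cases j) auto

lemma inj_on_code: "inj_on code (cong_labels n)"
proof (rule inj_onI)
  fix l l' assume l: "l \<in> cong_labels n" and l': "l' \<in> cong_labels n" and eq: "code l = code l'"
  from l show "l = l'"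
  proof (cases rule: cong_labels_cases)
    case (1 q)
    from l' show ?thesis
      by (cases rule: cong_labels_cases) (use 1 eq in \<open>auto split: if_splits\<close>)
  next
    case (2 q N)
    from l' show ?thesis
      by (cases rule: cong_labels_cases) (use 2 eq in \<open>auto split: if_splits\<close>)
  next
    case (3 i)
    from l' show ?thesis
      by (cases rule: cong_labels_cases) (use 3 eq deg_grp_inj in \<open>auto split: if_splits\<close>)
  next
    case (4 i)
    from l' show ?thesis
      by (cases rule: cong_labels_cases) (use 4 eq deg_grp_inj in \<open>auto split: if_splits\<close>)
  next
    case (5 i)
    from l' show ?thesis
      by (cases rule: cong_labels_cases) (use 5 eq deg_grp_inj in \<open>auto split: if_splits\<close>)
  qed
qed

lemma code_image: "code ` cong_labels n = insert None (Some ` con_params)"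
proof (intro equalityI subsetI)
  fix p assume "p \<in> code ` cong_labels n"
  then obtain l where l: "l \<in> cong_labels n" "p = code l" by blast
  from l(1) show "p \<in> insert None (Some ` con_params)"
  proof (cases rule: cong_labels_cases)
    case (1 q)
    then have "q \<noteq> n \<Longrightarrow> (q + 1, {id}, False, False) \<in> con_params"
      using trivial_normal[of "q + 1"] by (auto simp: con_params_def)
    then show ?thesis using 1 l(2) by auto
  next
    case (2 q N)
    then have "(q, N, False, False) \<in> con_params" by (auto simp: con_params_def)
    then show ?thesis using 2 l(2) by auto
  qed (use l(2) grp_params in auto)
next
  fix p assume "p \<in> insert None (Some ` con_params)"
  then consider "p = None" | q N P Q where "p = Some (q, N, P, Q)" "(q, N, P, Q) \<in> con_params" by auto
  then show "p \<in> code ` cong_labels n"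
  proof cases
    case 1
    then show ?thesis by (intro image_eqI[of _ _ "LRq n"]) (auto simp: cong_labels_def)
  next
    case (2 q N P Q)
    then have v: "1 \<le> q" "q \<le> n" "N \<lhd> sym_group q" "q \<le> 2 \<or> \<not> P \<and> \<not> Q" by (auto simp: con_params_def)
    show ?thesis
    proof (cases "P \<or> Q")
      case True
      then have "q \<le> 2" using v(4) by blast
      then obtain i where i: "q = deg i" "N = grp i" using low_params[OF 2(2)] by blast
      have "LLam i \<in> cong_labels n" "LRho i \<in> cong_labels n" "LMu i \<in> cong_labels n"
        by (auto simp: cong_labels_def)
      then show ?thesis using 2(1) i True
        by (cases P; cases Q) (auto intro: image_eqI[of _ _ "LLam i"] image_eqI[of _ _ "LRho i"] image_eqI[of _ _ "LMu i"])
    next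
      case False
      show ?thesis
      \<comment> \<open>At level \<open>q\<close> the trivial group stands for the Rees congruence
        of rank \<open>q - 1\<close>; a nontrivial group can occur only for
        \<open>q \<ge> 2\<close>, as the label requires.\<close>
      proof (cases "N = {id}")
        case True
        then show ?thesis using 2(1) v False
          by (intro image_eqI[of _ _ "LRq (q - 1)"]) (auto simp: cong_labels_def)
      next
        case nontrivial: False
        then show ?thesis using 2(1) v False nontrivial_normal_degree[OF v(3)]
          by (intro image_eqI[of _ _ "LRN q N"]) (auto simp: cong_labels_def)
      qed
    qed
  qed
qed

lemma inj_on_decode: "inj_on decode (insert None (Some ` con_params))"
proof (rule inj_onI)
  fix p p' assume a: "p \<in> insert None (Some ` con_params)" "p' \<in> insert None (Some ` con_params)" "decode p = decode p'"
  show "p = p'"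
  proof (cases p)
    case None
    then show ?thesis using a con_psubset_Nabla by (cases p') fastforce+
  next
    case (Some x)
    obtain q N P Q where x: "x = (q, N, P, Q)" by (metis prod.collapse)
    then have v: "(q, N, P, Q) \<in> con_params" using a Some by auto
    show ?thesis
    proof (cases p')
      case None
      then show ?thesis using a con_psubset_Nabla[OF v] Some x by auto
    next
      case (Some x')
      obtain q' N' P' Q' where x': "x' = (q', N', P', Q')" by (metis prod.collapse)
      then have v': "(q', N', P', Q') \<in> con_params" using a Some by auto
      show ?thesis using con_inj[OF n v v'] a(3) Some \<open>p = Some x\<close> x x' by simp
    qed
  qed
qed

lemma Cong_labels: "inj_on (cong_of n) (cong_labels n)" "Cong (PB n) = cong_of n ` cong_labels n"
proof -
  have "inj_on (decode \<circ> code) (cong_labels n)"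
    using inj_on_code inj_on_decode by (intro comp_inj_on) (simp_all add: code_image)
  then show "inj_on (cong_of n) (cong_labels n)"
    using cong_of_decode by (simp cong: inj_on_cong)
  have "cong_of n ` cong_labels n = decode ` (code ` cong_labels n)"
    unfolding image_image using cong_of_decode by (intro image_cong) simp_all
  also have "\<dots> = insert (Nabla (PB n)) ((\<lambda>(q, N, P, Q). con q N P Q) ` con_params)"
  proof -
    have "decode (Some x) = (case x of (q, N, P, Q) \<Rightarrow> con q N P Q)" for x by (cases x) simp
    then show ?thesis by (simp only: code_image image_insert image_image decode.simps(1))
  qed
  finally show "Cong (PB n) = cong_of n ` cong_labels n" using Cong_PB[OF n] by simp
qed

lemma CongE:
  assumes "\<theta> \<in> Cong (PB n)"
  obtains "\<theta> = Nabla (PB n)" | q N P Q where "\<theta> = con q N P Q" "(q, N, P, Q) \<in> con_params"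
  using assms unfolding Cong_PB[OF n] by auto

lemma con_Cong: "(q, N, P, Q) \<in> con_params \<Longrightarrow> con q N P Q \<in> Cong (PB n)"
  unfolding Cong_PB[OF n] by force

lemma Nabla_Cong: "Nabla (PB n) \<in> Cong (PB n)"
  unfolding Cong_PB[OF n] by blast

text \<open>Invariance under the involution means equal flags. Unequal flags occur only at levels 1
  and 2, and they give exactly the \<lambda> and \<rho> congruences.\<close>

lemma Cong_star_eq:
  "Cong_star n = Cong (PB n) - {lam n Zero, lam n One, lam n STwo, rho n Zero, rho n One, rho n STwo}"
proof -
  have set: "{lam n Zero, lam n One, lam n STwo, rho n Zero, rho n One, rho n STwo} = range (lam n) \<union> range (rho n)"
    by (simp only: range_idx Un_insert_left Un_empty_left)
  have "star_closed_rel \<theta> \<longleftrightarrow> \<theta> \<notin> range (lam n) \<union> range (rho n)" if "\<theta> \<in> Cong (PB n)" for \<theta>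
    using that
  proof (cases rule: CongE)
    case 1
    have "lam n i \<noteq> Nabla (PB n)" "rho n i \<noteq> Nabla (PB n)" for i
      using con_psubset_Nabla[OF grp_params[of i True False]] con_psubset_Nabla[OF grp_params[of i False True]]
      unfolding lam_con rho_con psubset_eq by simp_all
    then have "Nabla (PB n) \<notin> range (lam n) \<union> range (rho n)" by (metis UnE imageE)
    then show ?thesis using star_closed_Nabla 1 by simp
  next
    case (2 q N P Q)
    show ?thesis
    proof (cases "P = Q")
      case True
      have "\<theta> \<noteq> lam n i \<and> \<theta> \<noteq> rho n i" for i
        using con_inj[OF n 2(2) grp_params] 2(1) True by (auto simp: lam_con rho_con)
      then show ?thesis using star_closed_con[OF n 2(2)] 2(1) True by auto
    next
      case False
      then have "q \<le> 2" using 2(2) by (auto simp: con_params_def)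
      then obtain i where "q = deg i" "N = grp i" using low_params[OF 2(2)] by blast
      then have "\<theta> = lam n i \<or> \<theta> = rho n i" using False 2(1) by (cases P; cases Q) (simp_all add: lam_con rho_con)
      then show ?thesis using star_closed_con[OF n 2(2)] 2(1) False by auto
    qed
  qed
  then show ?thesis unfolding set Cong_star_PB by blast
qed

text \<open>The block lists what the classification of normal subgroups allows in degree
  \<open>q\<close>, followed by the Rees congruence that contains them all.\<close>

lemma chain_block_set:
  assumes q: "3 \<le> q"
  shows "set (chain_block n q) = insert (Rq n q) {RN n q N | N. N \<lhd> sym_group q \<and> N \<noteq> {id}}"
proof -
  let ?A = "carrier (alt_group q)" and ?S = "carrier (sym_group q)"
  have "?S \<noteq> {id}"
  proof
    assume "?S = {id}"
    then have "?A \<subset> {id}" using alt_psubset_sym[of q] q by simp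
    then show False using normal_sym_group(2)[OF alt_normal, of q] by blast
  qed
  then have conv: "N \<lhd> sym_group q \<and> N \<noteq> {id}" if "N = ?A \<or> N = ?S \<or> q = 4 \<and> N = klein4" for N
    using that alt_nontrivial[OF q] alt_normal[of q] sym_normal[of q] klein4_normal klein4_nontrivial
    by (elim disjE conjE) simp_all
  have iff: "N \<lhd> sym_group q \<and> N \<noteq> {id} \<longleftrightarrow> N = ?A \<or> N = ?S \<or> q = 4 \<and> N = klein4" for N
    using conv normal_symmetric.normal_classification[OF normal_symmetric.intro _ q] by metis
  have "{RN n q N | N. N \<lhd> sym_group q \<and> N \<noteq> {id}} = RN n q ` {N. N = ?A \<or> N = ?S \<or> q = 4 \<and> N = klein4}"
    by (simp only: iff setcompr_eq_image)
  also have "{N. N = ?A \<or> N = ?S \<or> q = 4 \<and> N = klein4} = {?A, ?S} \<union> (if q = 4 then {klein4} else {})"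
    by (rule Set.set_eqI, cases "q = 4")
      (simp_all only: mem_Collect_eq Un_iff insert_iff empty_iff if_True if_False simp_thms disj_assoc)
  finally have eq: "{RN n q N | N. N \<lhd> sym_group q \<and> N \<noteq> {id}} =
      RN n q ` ({?A, ?S} \<union> (if q = 4 then {klein4} else {}))" .
  show ?thesis unfolding eq chain_block_def by (cases "q = 4") (simp_all add: insert_commute)
qed

text \<open>The chain consists of all levels from 3 on, in shifted form: the Rees congruence closing
  the block of \<open>q\<close> belongs to level \<open>q + 1\<close>. Thus the leading
  \<open>Rq n 2\<close> is level 3 with the trivial group, and the final \<open>Rq n n\<close> is
  the total congruence.\<close>

lemma upper_chain_set:
  "set (upper_chain n) = insert (Nabla (PB n)) {con q N False False | q N. 3 \<le> q \<and> q \<le> n \<and> N \<lhd> sym_group q}"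
    (is "_ = ?R")
proof -
  have "set (upper_chain n) = insert (Rq n 2) (\<Union>q\<in>{3..n}. set (chain_block n q))"
  proof -
    have "set [3..<n+1] = {3..n}" by auto
    then show ?thesis unfolding upper_chain_def list.set set_concat set_map image_image by (simp only:)
  qed
  also have "\<dots> = insert (Rq n 2) (\<Union>q\<in>{3..n}. insert (Rq n q) {RN n q N | N. N \<lhd> sym_group q \<and> N \<noteq> {id}})"
    using chain_block_set by simp
  also have "\<dots> = {Rq n q | q. 2 \<le> q \<and> q \<le> n} \<union> {RN n q N | q N. 3 \<le> q \<and> q \<le> n \<and> N \<lhd> sym_group q \<and> N \<noteq> {id}}"
  proof -
    have "insert (Rq n 2) (Rq n ` {3..n}) = {Rq n q | q. 2 \<le> q \<and> q \<le> n}"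
    proof -
      have "insert 2 {3..n} = {2..n}" using n by auto
      then have "insert (Rq n 2) (Rq n ` {3..n}) = Rq n ` {2..n}" by (metis image_insert)
      then show ?thesis by auto
    qed
    moreover have "insert (Rq n 2) (\<Union>q\<in>{3..n}. insert (Rq n q) (X q)) =
      insert (Rq n 2) (Rq n ` {3..n}) \<union> (\<Union>q\<in>{3..n}. X q)" for X by blast
    moreover have "(\<Union>q\<in>{3..n}. {RN n q N | N. N \<lhd> sym_group q \<and> N \<noteq> {id}}) =
      {RN n q N | q N. 3 \<le> q \<and> q \<le> n \<and> N \<lhd> sym_group q \<and> N \<noteq> {id}}"
    proof (intro equalityI subsetI)
      fix \<theta> assume "\<theta> \<in> (\<Union>q\<in>{3..n}. {RN n q N | N. N \<lhd> sym_group q \<and> N \<noteq> {id}})"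
      then obtain q where q: "q \<in> {3..n}" and \<theta>: "\<theta> \<in> {RN n q N | N. N \<lhd> sym_group q \<and> N \<noteq> {id}}"
        by (rule UN_E)
      from \<theta> obtain N where "\<theta> = RN n q N" "N \<lhd> sym_group q \<and> N \<noteq> {id}" by (elim CollectE exE conjE) (rule that; simp)
      then show "\<theta> \<in> {RN n q N | q N. 3 \<le> q \<and> q \<le> n \<and> N \<lhd> sym_group q \<and> N \<noteq> {id}}"
        using q by (intro CollectI exI[of _ q] exI[of _ N]) simp
    next
      fix \<theta> assume "\<theta> \<in> {RN n q N | q N. 3 \<le> q \<and> q \<le> n \<and> N \<lhd> sym_group q \<and> N \<noteq> {id}}"
      then obtain q N where q: "\<theta> = RN n q N" "3 \<le> q" "q \<le> n" "N \<lhd> sym_group q \<and> N \<noteq> {id}"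
        by (elim CollectE exE conjE) (rule that; simp)
      show "\<theta> \<in> (\<Union>q\<in>{3..n}. {RN n q N | N. N \<lhd> sym_group q \<and> N \<noteq> {id}})"
        by (rule UN_I[of q]) (use q in \<open>auto simp: atLeastAtMost_iff\<close>)
    qed
    ultimately show ?thesis by (simp only:)
  qed
  also have "\<dots> = ?R"
  proof (intro equalityI subsetI)
    fix \<theta> assume "\<theta> \<in> {Rq n q | q. 2 \<le> q \<and> q \<le> n} \<union> {RN n q N | q N. 3 \<le> q \<and> q \<le> n \<and> N \<lhd> sym_group q \<and> N \<noteq> {id}}"
    then consider q where "\<theta> = Rq n q" "2 \<le> q" "q \<le> n" | q N where "\<theta> = RN n q N" "3 \<le> q" "q \<le> n" "N \<lhd> sym_group q"
      by blast
    then show "\<theta> \<in> ?R"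
    proof cases
      case (1 q)
      show ?thesis
      proof (cases "q = n")
        case False
        then have "\<theta> = con (q + 1) {id} False False" using Rq_con 1 by simp
        moreover have "3 \<le> q + 1" "q + 1 \<le> n" using 1 False by auto
        ultimately show ?thesis using trivial_normal by blast
      qed (use 1 Rq_Nabla in simp)
    next
      case (2 q N)
      then show ?thesis using RN_con by blast
    qed
  next
    fix \<theta> assume "\<theta> \<in> ?R"
    then consider "\<theta> = Nabla (PB n)" | q N where "\<theta> = con q N False False" "3 \<le> q" "q \<le> n" "N \<lhd> sym_group q" by blast
    then show "\<theta> \<in> {Rq n q | q. 2 \<le> q \<and> q \<le> n} \<union> {RN n q N | q N. 3 \<le> q \<and> q \<le> n \<and> N \<lhd> sym_group q \<and> N \<noteq> {id}}"
    proof cases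
      case 1
      then show ?thesis using Rq_Nabla n by auto
    next
      case (2 q N)
      show ?thesis
      proof (cases "N = {id}")
        case True
        then have "\<theta> = Rq n (q - 1)" using Rq_con[of "q - 1"] 2 by simp
        then show ?thesis using 2 by auto
      next
        case False
        then show ?thesis using 2 RN_con by blast
      qed
    qed
  qed
  finally show ?thesis .
qed

text \<open>The level separates the two families: at most 2 for the product of diamond and chain, at
  least 3 or the total congruence for the rest. Injectivity of the parameters makes them
  disjoint.\<close>

lemma Cong_minus_xi: "Cong (PB n) - {xi n d i | d i. True} = set (upper_chain n)"
proof -
  have "\<theta> \<in> set (upper_chain n) \<longleftrightarrow> \<theta> \<notin> {xi n d i | d i. True}" if "\<theta> \<in> Cong (PB n)" for \<theta>
    using that
  proof (cases rule: CongE)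
    case 1
    have "Nabla (PB n) \<noteq> con q N P Q" if "(q, N, P, Q) \<in> con_params" for q N P Q
      using con_psubset_Nabla[OF that] by blast
    then show ?thesis unfolding 1 xi_set upper_chain_set by blast
  next
    case (2 q N P Q)
    show ?thesis
    proof (cases "q \<le> 2")
      case True
      then have "\<theta> \<in> {xi n d i | d i. True}" unfolding xi_set using 2 by blast
      moreover have "\<theta> \<notin> set (upper_chain n)"
      proof
        assume "\<theta> \<in> set (upper_chain n)"
        then consider "\<theta> = Nabla (PB n)" | q' N' where "\<theta> = con q' N' False False" "3 \<le> q'" "q' \<le> n" "N' \<lhd> sym_group q'"
          unfolding upper_chain_set by blast
        then show False
        proof cases
          case 1
          then show ?thesis using con_psubset_Nabla[OF 2(2)] 2(1) by blast
        next
          case (2 q' N')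
          then have "(q', N', False, False) \<in> con_params" by (simp add: con_params_def)
          moreover have "con q N P Q = con q' N' False False" using \<open>\<theta> = con q N P Q\<close> 2(1) by simp
          ultimately have "(q, N, P, Q) = (q', N', False, False)"
            using con_inj[OF n \<open>(q, N, P, Q) \<in> con_params\<close>] by blast
          then show ?thesis using 2(2) True by simp
        qed
      qed
      ultimately show ?thesis by blast
    next
      case False
      then have "3 \<le> q" "q \<le> n" "N \<lhd> sym_group q" "\<not> P" "\<not> Q" using 2(2) by (auto simp: con_params_def)
      then have "\<theta> \<in> set (upper_chain n)" unfolding upper_chain_set using 2(1) by auto
      moreover have "\<theta> \<notin> {xi n d i | d i. True}"
      proof
        assume "\<theta> \<in> {xi n d i | d i. True}"
        then obtain q' N' P' Q' where "\<theta> = con q' N' P' Q'" "(q', N', P', Q') \<in> con_params" "q' \<le> 2"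
          unfolding xi_set by blast
        then show False using con_inj[OF n 2(2)] 2(1) False by auto
      qed
      ultimately show ?thesis by blast
    qed
  qed
  moreover have "set (upper_chain n) \<subseteq> Cong (PB n)"
    unfolding upper_chain_set using Nabla_Cong con_Cong by (auto simp: con_params_def)
  ultimately show ?thesis by blast
qed

section \<open>Strict inclusions along the chain\<close>

lemma Rq_psubset_RN:
  assumes "1 \<le> q" "q \<le> n" "N \<lhd> sym_group q" "N \<noteq> {id}"
  shows "Rq n (q - 1) \<subset> RN n q N"
proof -
  have v: "(q, {id}, False, False) \<in> con_params" "(q, N, False, False) \<in> con_params"
    using assms trivial_normal by (auto simp: con_params_def)
  have "{id} \<subset> N" using normal_sym_group(2)[OF assms(3)] assms(4) by blast
  then have "con q {id} False False \<subset> con q N False False"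
    unfolding psubset_eq using con_subset_iff[OF n v] con_inj[OF n v] by auto
  then show ?thesis using Rq_con[of "q - 1"] RN_con[OF assms(3,2)] assms(1,2) by simp
qed

lemma RN_psubset_RN:
  assumes "1 \<le> q" "q \<le> n" "N \<lhd> sym_group q" "N' \<lhd> sym_group q" "N \<subset> N'"
  shows "RN n q N \<subset> RN n q N'"
proof -
  have v: "(q, N, False, False) \<in> con_params" "(q, N', False, False) \<in> con_params"
    using assms by (auto simp: con_params_def)
  have "con q N False False \<subset> con q N' False False"
    unfolding psubset_eq using con_subset_iff[OF n v] con_inj[OF n v] assms(5) by auto
  then show ?thesis using RN_con assms by simp
qed

lemma RN_psubset_Rq:
  assumes "1 \<le> q" "q \<le> n" "N \<lhd> sym_group q"
  shows "RN n q N \<subset> Rq n q"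
proof (cases "q = n")
  case True
  have "(q, N, False, False) \<in> con_params" using assms by (simp add: con_params_def)
  then show ?thesis using con_psubset_Nabla RN_con[OF assms(3,2)] Rq_Nabla True by simp
next
  case False
  have v: "(q, N, False, False) \<in> con_params" "(q + 1, {id}, False, False) \<in> con_params"
    using assms trivial_normal[of "q + 1"] False by (auto simp: con_params_def)
  have "con q N False False \<subset> con (q + 1) {id} False False"
    unfolding psubset_eq using con_subset_iff[OF n v] con_inj[OF n v] by auto
  then show ?thesis using RN_con[OF assms(3,2)] Rq_con[of q] assms False by simp
qed

lemma chain_block_sorted:
  assumes q: "3 \<le> q" "q \<le> n"
  shows "sorted_wrt (\<subset>) (chain_block n q)" "\<And>\<theta>. \<theta> \<in> set (chain_block n q) \<Longrightarrow> Rq n (q - 1) \<subset> \<theta>"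
    "\<And>\<theta>. \<theta> \<in> set (chain_block n q) \<Longrightarrow> \<theta> \<subseteq> Rq n q"
proof -
  have q1: "1 \<le> q" using q by simp
  have AS: "RN n q (carrier (alt_group q)) \<subset> RN n q (carrier (sym_group q))"
    using RN_psubset_RN[OF q1 q(2) alt_normal sym_normal] alt_psubset_sym q by simp
  have SR: "RN n q (carrier (sym_group q)) \<subset> Rq n q" by (rule RN_psubset_Rq[OF q1 q(2) sym_normal])
  have KA: "RN n 4 klein4 \<subset> RN n q (carrier (alt_group q))" if "q = 4"
    using RN_psubset_RN[of 4 klein4 "carrier (alt_group 4)"] klein4_normal alt_normal klein4_psubset_alt q that by simp
  show "sorted_wrt (\<subset>) (chain_block n q)"
    unfolding chain_block_def using AS SR KA by (auto intro: psubset_trans)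
  have RR: "Rq n (q - 1) \<subset> Rq n q"
    using Rq_psubset_RN[OF q1 q(2) alt_normal alt_nontrivial[OF q(1)]] AS SR by blast
  show "Rq n (q - 1) \<subset> \<theta>" if "\<theta> \<in> set (chain_block n q)" for \<theta>
    using that RR Rq_psubset_RN[OF q1 q(2)] unfolding chain_block_set[OF q(1)] by auto
  show "\<theta> \<subseteq> Rq n q" if "\<theta> \<in> set (chain_block n q)" for \<theta>
    using that RN_psubset_Rq[OF q1 q(2)] unfolding chain_block_set[OF q(1)] by blast
qed

text \<open>The statement is strengthened for the induction: every member lies below
  \<open>Rq n m\<close>, and each element of the next block lies strictly above it, so appending
  that block preserves sortedness.\<close>

lemma chain_sorted_upto:
  assumes "2 \<le> m" "m \<le> n"
  shows "sorted_wrt (\<subset>) (RN n 2 (carrier (sym_group 2)) # Rq n 2 # concat (map (chain_block n) [3..<m+1])) \<and>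
    (\<forall>\<theta>\<in>set (RN n 2 (carrier (sym_group 2)) # Rq n 2 # concat (map (chain_block n) [3..<m+1])). \<theta> \<subseteq> Rq n m) \<and>
    last (Rq n 2 # concat (map (chain_block n) [3..<m+1])) = Rq n m"
  using assms
proof (induction m rule: dec_induct)
  case base
  have "RN n 2 (carrier (sym_group 2)) \<subset> Rq n 2" by (rule RN_psubset_Rq) (use n sym_normal in auto)
  then show ?case by auto
next
  case (step m)
  let ?L = "\<lambda>m. Rq n 2 # concat (map (chain_block n) [3..<m+1])"
  let ?S = "RN n 2 (carrier (sym_group 2))"
  have m: "3 \<le> Suc m" "Suc m \<le> n" "m \<le> n" using step by auto
  have IH: "sorted_wrt (\<subset>) (?S # ?L m)" "\<And>\<theta>. \<theta> \<in> set (?S # ?L m) \<Longrightarrow> \<theta> \<subseteq> Rq n m" "last (?L m) = Rq n m"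
    using step.IH m(3) by blast+
  have L: "?L (Suc m) = ?L m @ chain_block n (Suc m)" using step.hyps by simp
  note B = chain_block_sorted[OF m(1,2), unfolded diff_Suc_1]
  have eq: "(?S # ?L m) @ chain_block n (Suc m) = ?S # ?L (Suc m)" unfolding L by simp
  have 1: "sorted_wrt (\<subset>) ((?S # ?L m) @ chain_block n (Suc m))"
    unfolding sorted_wrt_append
    by (intro conjI ballI IH(1) B(1)) (rule subset_psubset_trans[OF IH(2) B(2)])
  have "Rq n m \<subset> Rq n (Suc m)" using B(2)[of "Rq n (Suc m)"] by (simp add: chain_block_def)
  then have RR: "Rq n m \<subseteq> Rq n (Suc m)" by (rule psubset_imp_subset)
  have 2: "\<theta> \<subseteq> Rq n (Suc m)" if "\<theta> \<in> set ((?S # ?L m) @ chain_block n (Suc m))" for \<theta>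
    using that unfolding set_append
  proof (rule UnE)
    assume "\<theta> \<in> set (?S # ?L m)"
    then show ?thesis by (rule subset_trans[OF IH(2) RR])
  qed (rule B(3))
  have 3: "last (?L m @ chain_block n (Suc m)) = Rq n (Suc m)" by (simp add: chain_block_def)
  show ?case
    by (intro conjI ballI 1[unfolded eq] 3[folded L]) (rule 2[unfolded eq])
qed

lemma upper_chain_sorted:
  "sorted_wrt (\<subset>) (RN n 2 (carrier (sym_group 2)) # upper_chain n)" "last (upper_chain n) = Rq n n"
  unfolding upper_chain_def
  by (rule conjunct1[OF chain_sorted_upto[OF n order_refl]],
      rule conjunct2[OF conjunct2[OF chain_sorted_upto[OF n order_refl]]])

lemma mu_Zero_Delta: "mu n Zero = Delta (PB n)"
proof -
  have n1: "1 \<le> n" using n by simp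
  have "nu_rel 1 {id} \<subseteq> Delta (PB n)"
  proof (rule subrelI)
    fix \<alpha> \<beta> assume ab: "(\<alpha>, \<beta>) \<in> nu_rel 1 {id}"
    show "(\<alpha>, \<beta>) \<in> Delta (PB n)"
      using nu_rel_trivial[OF n1 ab] nu_rel_rank(1)[OF trivial_normal n1 ab] by (auto simp: Delta_def)
  qed
  moreover have "kap 0 True True \<subseteq> Delta (PB n)"
  proof (rule subrelI)
    fix x y assume "(x, y) \<in> kap 0 True True"
    then have "x \<in> carr" "x = y" using rank0_eqI[of x y] by (auto simp: kap_def I_rank_iff)
    then show "(x, y) \<in> Delta (PB n)" by (auto simp: Delta_def)
  qed
  ultimately show ?thesis unfolding mu_con by (auto simp: con_def)
qed

lemma Cong_star_xi: "Cong_star n = {xi n d i | d i. d \<in> {DMu, DR}} \<union> set (upper_chain n)"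
proof -
  have flags: "lower_flag d = upper_flag d \<longleftrightarrow> d \<in> {DMu, DR}" for d
    by (cases d) (simp_all add: lower_flag_def upper_flag_def)
  have xiC: "xi n d i \<in> Cong (PB n)" for d i unfolding xi_con by (rule con_Cong[OF grp_params])
  have xi: "star_closed_rel (xi n d i) \<longleftrightarrow> d \<in> {DMu, DR}" for d i
    unfolding xi_con star_closed_con[OF n grp_params] flags ..
  have upper: "star_closed_rel \<theta>" "\<theta> \<in> Cong (PB n)" if "\<theta> \<in> set (upper_chain n)" for \<theta>
  proof -
    show "\<theta> \<in> Cong (PB n)" using that Cong_minus_xi by blast
    from that consider "\<theta> = Nabla (PB n)" | q N where "\<theta> = con q N False False" "(q, N, False, False) \<in> con_params"
      unfolding upper_chain_set con_params_def by force
    then show "star_closed_rel \<theta>"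
      using star_closed_Nabla star_closed_con[OF n] by cases auto
  qed
  show ?thesis
  proof (intro equalityI subsetI)
    fix \<theta> assume "\<theta> \<in> Cong_star n"
    then have \<theta>: "\<theta> \<in> Cong (PB n)" "star_closed_rel \<theta>" by (auto simp: Cong_star_PB)
    show "\<theta> \<in> {xi n d i | d i. d \<in> {DMu, DR}} \<union> set (upper_chain n)"
    proof (cases "\<theta> \<in> set (upper_chain n)")
      case False
      then obtain d i where "\<theta> = xi n d i" using \<theta>(1) Cong_minus_xi by blast
      then show ?thesis using xi \<theta>(2) by blast
    qed blast
  next
    fix \<theta> assume "\<theta> \<in> {xi n d i | d i. d \<in> {DMu, DR}} \<union> set (upper_chain n)"
    then show "\<theta> \<in> Cong_star n" using xi xiC upper unfolding Cong_star_PB by blast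
  qed
qed

lemma retractable_set:
  "{(I, M). retractable_IN_pair (PB n) I M \<and> (\<exists>q\<le>n. subgroup M (bar_sym n q))} =
    {C_pair n Zero, C_pair n One, C_pair n STwo}"
proof -
  have "retractable_IN_pair (PB n) I M \<and> (\<exists>q\<le>n. subgroup M (bar_sym n q)) \<longleftrightarrow> (\<exists>i. (I, M) = C_pair n i)" for I M
    unfolding retractable_IN_pairs
  proof
    assume "\<exists>q N. 1 \<le> q \<and> q \<le> n \<and> q \<le> 2 \<and> N \<lhd> sym_group q \<and> I = I_rank n (q - 1) \<and> M = bar n q ` N"
    then obtain q N where q: "1 \<le> q" "q \<le> n" "q \<le> 2" "N \<lhd> sym_group q" "I = I_rank n (q - 1)" "M = bar n q ` N"
      by blast
    then have "(q, N, True, True) \<in> con_params" by (simp add: con_params_def)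
    then obtain i where "q = deg i" "N = grp i" using low_params q(3) by blast
    then show "\<exists>i. (I, M) = C_pair n i" using q C_pair_eq by auto
  next
    assume "\<exists>i. (I, M) = C_pair n i"
    then obtain i where "I = I_rank n (deg i - 1)" "M = bar n (deg i) ` grp i" unfolding C_pair_eq by blast
    then show "\<exists>q N. 1 \<le> q \<and> q \<le> n \<and> q \<le> 2 \<and> N \<lhd> sym_group q \<and> I = I_rank n (q - 1) \<and> M = bar n q ` N"
      using deg_bounds[of i] grp_normal[of i] n by (intro exI[of _ "deg i"] exI[of _ "grp i"]) simp
  qed
  then have "{(I, M). retractable_IN_pair (PB n) I M \<and> (\<exists>q\<le>n. subgroup M (bar_sym n q))} = range (C_pair n)"
    by (auto simp del: C_pair.simps)
  then show ?thesis by (simp only: range_idx)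
qed

lemma Rq_congruence: "q \<le> n \<Longrightarrow> congruence (PB n) (Rq n q)"
proof (cases "q = n")
  case True
  then show ?thesis using Rq_Nabla congruence_Nabla by simp
next
  case False
  assume "q \<le> n"
  then show ?thesis using False Rq_con[of q] congruence_con[OF trivial_normal, of "q + 1" False False] by simp
qed

lemma xi_congruence: "congruence (PB n) (con (deg i) (grp i) P Q)"
  using con_Cong[OF grp_params] by (simp add: Cong_def)

end

theorem theorem6p1:
  fixes n :: nat
  assumes "n \<ge> 2"
  shows "
    \<comment> \<open>(i)\<close>
    ({I. sgp_ideal (PB n) I} = {I_rank n q | q. q \<le> n} \<and>
     (\<forall>q\<le>n. congruence (PB n) (Rq n q))) \<and>
    \<comment> \<open>(ii)\<close>
    ({(I, M). proper_IN_pair (PB n) I M \<and> (\<exists>q\<le>n. subgroup M (bar_sym n q))} =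
       {(I_rank n (q - 1), bar n q ` N) | q N.
          2 \<le> q \<and> q \<le> n \<and> N \<lhd> sym_group q \<and> N \<noteq> {id}} \<and>
     (\<forall>q N. 2 \<le> q \<and> q \<le> n \<and> N \<lhd> sym_group q \<and> N \<noteq> {id} \<longrightarrow>
        congruence (PB n) (RN n q N))) \<and>
    \<comment> \<open>(iii)\<close>
    ({(I, M). retractable_IN_pair (PB n) I M \<and> (\<exists>q\<le>n. subgroup M (bar_sym n q))} =
       {C_pair n Zero, C_pair n One, C_pair n STwo} \<and>
     (\<forall>i. congruence (PB n) (lam n i) \<and> congruence (PB n) (rho n i) \<and>
          congruence (PB n) (mu n i))) \<and>
    \<comment> \<open>(iv)\<close>
    (inj_on (cong_of n) (cong_labels n) \<and> Cong (PB n) = cong_of n ` cong_labels n) \<and>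
    \<comment> \<open>(v)\<close>
    Cong_star n = cong_of n ` cong_labels n -
      {lam n Zero, lam n One, lam n STwo, rho n Zero, rho n One, rho n STwo} \<and>
    \<comment> \<open>(vi): the order on all congruences\<close>
    ((\<forall>d e i j. xi n d i \<subseteq> xi n e j \<longleftrightarrow> diamond_le d e \<and> idx_le i j) \<and>
     mu n Zero = Delta (PB n) \<and>
     (\<forall>d i. mu n Zero \<subseteq> xi n d i \<and> xi n d i \<subseteq> RN n 2 (carrier (sym_group 2))) \<and>
     Cong (PB n) - {xi n d i | d i. True} = set (upper_chain n) \<and>
     sorted_wrt (\<subset>) (RN n 2 (carrier (sym_group 2)) # upper_chain n) \<and>
     last (upper_chain n) = Rq n n \<and> Rq n n = Nabla (PB n)) \<and>
    \<comment> \<open>(vi): the order on the *-congruences\<close>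
    (Cong_star n = {xi n d i | d i. d \<in> {DMu, DR}} \<union> set (upper_chain n) \<and>
     (\<forall>d\<in>{DMu, DR}. \<forall>e\<in>{DMu, DR}. \<forall>i j.
        xi n d i \<subseteq> xi n e j \<longleftrightarrow> (d = DMu \<or> e = DR) \<and> idx_le i j))"
proof -
  interpret partial_brauer_ge_2 n by unfold_locales (rule assms)
  have RN: "congruence (PB n) (RN n q N)" if "2 \<le> q" "q \<le> n" "N \<lhd> sym_group q" for q N
    using congruence_con[OF that(3), of False False] RN_con[OF that(3,2)] that by simp
  have between: "mu n Zero \<subseteq> xi n d i \<and> xi n d i \<subseteq> RN n 2 (carrier (sym_group 2))" for d i
    using xi_subset_iff[of DMu Zero d i] xi_subset_iff[of d i DR STwo]
    by (simp add: diamond_le_def idx_le_def)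
  have ends: "xi n d i \<subseteq> xi n d' j \<longleftrightarrow> (d = DMu \<or> d' = DR) \<and> idx_le i j"
    if "d \<in> {DMu, DR}" "d' \<in> {DMu, DR}" for d d' i j
  proof -
    have "diamond_le d d' \<longleftrightarrow> d = DMu \<or> d' = DR"
      using that by (elim insertE emptyE) (simp_all add: diamond_le_def)
    then show ?thesis by (simp only: xi_subset_iff)
  qed
  show ?thesis
  proof (intro conjI)
    show "\<forall>q\<le>n. congruence (PB n) (Rq n q)" using Rq_congruence by simp
    show "\<forall>q N. 2 \<le> q \<and> q \<le> n \<and> N \<lhd> sym_group q \<and> N \<noteq> {id} \<longrightarrow> congruence (PB n) (RN n q N)"
      using RN by simp
    show "\<forall>i. congruence (PB n) (lam n i) \<and> congruence (PB n) (rho n i) \<and> congruence (PB n) (mu n i)"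
      by (simp add: lam_con rho_con mu_con xi_congruence)
    show "\<forall>d e i j. xi n d i \<subseteq> xi n e j \<longleftrightarrow> diamond_le d e \<and> idx_le i j" by (simp only: xi_subset_iff simp_thms)
    show "\<forall>d i. mu n Zero \<subseteq> xi n d i \<and> xi n d i \<subseteq> RN n 2 (carrier (sym_group 2))"
      by (intro allI between)
    show "\<forall>d\<in>{DMu, DR}. \<forall>e\<in>{DMu, DR}. \<forall>i j.
        xi n d i \<subseteq> xi n e j \<longleftrightarrow> (d = DMu \<or> e = DR) \<and> idx_le i j"
      by (intro ballI allI ends)
  qed (rule sgp_ideals proper_IN_pairs retractable_set Cong_labels Cong_star_eq[unfolded Cong_labels(2)]
      mu_Zero_Delta Cong_minus_xi upper_chain_sorted Rq_Nabla Cong_star_xi)+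
qed

end
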